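(* Let $S$ be a countable right LCM semigroup and $N$ be a nontrivial scale on $S$ such that the partially ordered set $(\ker N)/(\ker N)^*$ is directed. Assume the abscissa of convergence $\beta_c$ of the series $\sum_{[s] \in S/{\sim_N}} N(s)^{-\beta}$ is finite. Then there exists an affine homeomorphism between the $\sigma^N$-KMS$_\infty$-states on $C^*(S)$ and the tracial states on $C^*(\ker N)$. Namely, the KMS$_\infty$-state $\varphi_{\tau,\infty}$ corresponding to a tracial state $\tau$ on $C^*(\ker N)$ is given by $$\varphi_{\tau,\infty}(v_sv_t^* )=\begin{cases}\tau(v_sv_t^* ),&\text{if } s,t\in \ker N,\\ 0,&\text{otherwise}.\end{cases}$$
   Context: A right LCM semigroup is a left cancellative semigroup $S$ with identity element $e$ such that for all $s,t\in S$ either $sS\cap tS=\emptyset$ or $sS\cap tS=rS$ for some $r\in S$. A scale on $S$ is a semigroup homomorphism $N\colon S\to([1,+\infty),\cdot)$; it is nontrivial if not identically $1$; $\ker N:=N^{-1}(1)$. For a right LCM semigroup $S$, $C^*(S)$ is the (universal) C$^*$-algebra generated by isometries $v_s$, $s\in S$, with relations $v_e=1$, $v_sv_t=v_{st}$, and $v_sv_s^*v_tv_t^*=v_rv_r^*$ if $sS\cap tS=rS$, $v_sv_s^*v_tv_t^*=0$ if $sS\cap tS=\emptyset$. The dynamics $\sigma^N$ is given by $\sigma^N_t(v_s)=N(s)^{it}v_s$. A $\sigma^N$-KMS$_\beta$-state is a state $\varphi$ on $C^*(S)$ such that $\varphi(ab)=\varphi(b\,\sigma^N_{i\beta}(a))$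 for all $a,b$ in a dense subspace of $\sigma^N$-analytic elements. A $\sigma^N$-KMS$_\infty$-state is a weak$^*$ limit of $\sigma^N$-KMS$_{\beta_i}$-states $\varphi_i$ with $\beta_i\to+\infty$. State spaces carry the weak$^*$ topology. $(\ker N)^*$ is the group of invertible elements of $\ker N$. Directedness of $(\ker N)/(\ker N)^*$ (ordered by: $t_1(\ker N)^*$ is larger than $t_2(\ker N)^*$ iff $t_1\ker N\subset t_2\ker N$) means $t_1(\ker N)\cap t_2(\ker N)\neq\emptyset$ for all $t_1,t_2\in\ker N$. Then $s\sim_N t$ iff $sa=tb$ for some $a,b\in\ker N$ is an equivalence relation on $S$, $[s]$ is the class of $s$, and $N$ is constant on classes. Under the hypotheses, $\ker N$ is itself a right LCM semigroup, so $C^*(\ker N)$ is defined as the (universal) C$^*$-algebra generated by isometries $v_s$, $s\in\ker N$, with relations $v_e=1$, $v_sv_t=v_{st}$, and $v_sv_s^*v_tv_t^*=v_rv_r^*$ if $s(\ker N)\cap t(\ker N)=r(\ker N)$ (the intersection is never empty, by directedness). *)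

theory Defs
  imports
    "HOL-Analysis.Analysis"
    "HOL-Algebra.Module"
    "HOL-Algebra.Coset"
    "HOL-Library.Poly_Mapping"
begin

section \<open>Right LCM semigroups and scales\<close>

locale right_lcm_semigroup = monoid S for S (structure) +
  assumes left_cancel:
      "\<lbrakk>a \<in> carrier S; x \<in> carrier S; y \<in> carrier S; a \<otimes> x = a \<otimes> y\<rbrakk> \<Longrightarrow> x = y"
    and right_lcm:
      "\<lbrakk>s \<in> carrier S; t \<in> carrier S\<rbrakk> \<Longrightarrow>
        (s <# carrier S) \<inter> (t <# carrier S) = {} \<or>
        (\<exists>r\<in>carrier S. (s <# carrier S) \<inter> (t <# carrier S) = r <# carrier S)"

definition scale :: "'s monoid \<Rightarrow> ('s \<Rightarrow> real) \<Rightarrow> bool" where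
  "scale S N \<longleftrightarrow>
     (\<forall>s\<in>carrier S. 1 \<le> N s) \<and>
     (\<forall>s\<in>carrier S. \<forall>t\<in>carrier S. N (s \<otimes>\<^bsub>S\<^esub> t) = N s * N t)"

definition nontrivial_scale :: "'s monoid \<Rightarrow> ('s \<Rightarrow> real) \<Rightarrow> bool" where
  "nontrivial_scale S N \<longleftrightarrow> scale S N \<and> (\<exists>s\<in>carrier S. N s \<noteq> 1)"

definition ker_scale :: "'s monoid \<Rightarrow> ('s \<Rightarrow> real) \<Rightarrow> 's monoid" where
  "ker_scale S N = S\<lparr>carrier := {s \<in> carrier S. N s = 1}\<rparr>"

text \<open>Directedness of the poset of classes \<open>t (ker N)\<^sup>*\<close>, where \<open>t\<^sub>1 (ker N)\<^sup>*\<close> is larger than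
  \<open>t\<^sub>2 (ker N)\<^sup>*\<close> iff \<open>t\<^sub>1 ker N \<subseteq> t\<^sub>2 ker N\<close>: an upper bound of the classes of \<open>t\<^sub>1\<close> and \<open>t\<^sub>2\<close> is
  the class of an element of \<open>t\<^sub>1 ker N \<inter> t\<^sub>2 ker N\<close>.\<close>

definition directed_kernel :: "'s monoid \<Rightarrow> ('s \<Rightarrow> real) \<Rightarrow> bool" where
  "directed_kernel S N \<longleftrightarrow>
     (let K = ker_scale S N in
      \<forall>t\<^sub>1\<in>carrier K. \<forall>t\<^sub>2\<in>carrier K.
        (t\<^sub>1 <#\<^bsub>K\<^esub> carrier K) \<inter> (t\<^sub>2 <#\<^bsub>K\<^esub> carrier K) \<noteq> {})"

definition scale_rel :: "'s monoid \<Rightarrow> ('s \<Rightarrow> real) \<Rightarrow> ('s \<times> 's) set" where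
  "scale_rel S N =
     {(s, t). s \<in> carrier S \<and> t \<in> carrier S \<and>
        (\<exists>a\<in>carrier (ker_scale S N). \<exists>b\<in>carrier (ker_scale S N). s \<otimes>\<^bsub>S\<^esub> a = t \<otimes>\<^bsub>S\<^esub> b)}"

text \<open>\<open>N\<close> is constant on each class \<open>C\<close>, so \<open>the_elem (N ` C)\<close> is its value there.\<close>

definition abscissa :: "'s monoid \<Rightarrow> ('s \<Rightarrow> real) \<Rightarrow> ereal" where
  "abscissa S N =
     Inf (ereal ` {\<beta>. (\<lambda>C. the_elem (N ` C) powr (-\<beta>)) summable_on (carrier S // scale_rel S N)})"


section \<open>The universal C*-algebra of a semigroup\<close>

text \<open>The free unital complex *-algebra on letters \<open>v\<^sub>s\<close>: finitely supported complex functions on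
  words in \<open>v\<^sub>s\<close> (\<open>Gen s\<close>) and \<open>v\<^sub>s\<^sup>*\<close> (\<open>Adj s\<close>). Making words an additive monoid under
  concatenation lets \<open>poly_mapping\<close> supply the convolution product.\<close>

datatype 's letter = Gen 's | Adj 's

instantiation list :: (type) monoid_add
begin
definition zero_list_def: "0 = []"
definition plus_list_def: "xs + ys = xs @ ys"
instance by standard (simp_all add: zero_list_def plus_list_def)
end

type_synonym 's free_alg = "'s letter list \<Rightarrow>\<^sub>0 complex"

fun letter_base :: "'s letter \<Rightarrow> 's" where
  "letter_base (Gen s) = s"
| "letter_base (Adj s) = s"

fun letter_adj :: "'s letter \<Rightarrow> 's letter" where
  "letter_adj (Gen s) = Adj s"
| "letter_adj (Adj s) = Gen s"

definition free_carrier :: "'s monoid \<Rightarrow> 's free_alg set" where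
  "free_carrier S = {p. \<forall>w\<in>Poly_Mapping.keys p. \<forall>l\<in>set w. letter_base l \<in> carrier S}"

definition free_scale :: "complex \<Rightarrow> 's free_alg \<Rightarrow> 's free_alg" where
  "free_scale c p = Poly_Mapping.map ((*) c) p"

definition free_star :: "'s free_alg \<Rightarrow> 's free_alg" where
  "free_star p =
     (\<Sum>w\<in>Poly_Mapping.keys p.
        Poly_Mapping.single (rev (map letter_adj w)) (cnj (Poly_Mapping.lookup p w)))"

definition free_gen :: "'s \<Rightarrow> 's free_alg" where
  "free_gen s = Poly_Mapping.single [Gen s] 1"

definition free_proj :: "'s \<Rightarrow> 's free_alg" where
  "free_proj s = free_gen s * free_star (free_gen s)"

definition relators :: "'s monoid \<Rightarrow> 's free_alg set" where
  "relators S =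
     {free_gen \<one>\<^bsub>S\<^esub> - 1}
     \<union> {free_star (free_gen s) * free_gen s - 1 | s. s \<in> carrier S}
     \<union> {free_gen s * free_gen t - free_gen (s \<otimes>\<^bsub>S\<^esub> t) | s t. s \<in> carrier S \<and> t \<in> carrier S}
     \<union> {free_proj s * free_proj t - free_proj r | s t r.
          s \<in> carrier S \<and> t \<in> carrier S \<and> r \<in> carrier S \<and>
          (s <#\<^bsub>S\<^esub> carrier S) \<inter> (t <#\<^bsub>S\<^esub> carrier S) = r <#\<^bsub>S\<^esub> carrier S}
     \<union> {free_proj s * free_proj t | s t.
          s \<in> carrier S \<and> t \<in> carrier S \<and>
          (s <#\<^bsub>S\<^esub> carrier S) \<inter> (t <#\<^bsub>S\<^esub> carrier S) = {}}"

text \<open>The C*-seminorms vanishing on the relators are exactly the functions \<open>p \<mapsto> \<parallel>\<pi> p\<parallel>\<close> for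
  *-homomorphisms \<open>\<pi>\<close> of the free algebra into C*-algebras that satisfy the relations. The
  universal C*-algebra is the separation and completion with respect to their supremum.\<close>

definition cstar_seminorm :: "'s monoid \<Rightarrow> ('s free_alg \<Rightarrow> real) \<Rightarrow> bool" where
  "cstar_seminorm S q \<longleftrightarrow>
     (\<forall>x\<in>free_carrier S. 0 \<le> q x) \<and>
     (\<forall>x\<in>free_carrier S. \<forall>y\<in>free_carrier S. q (x + y) \<le> q x + q y) \<and>
     (\<forall>c. \<forall>x\<in>free_carrier S. q (free_scale c x) = cmod c * q x) \<and>
     (\<forall>x\<in>free_carrier S. \<forall>y\<in>free_carrier S. q (x * y) \<le> q x * q y) \<and>
     (\<forall>x\<in>free_carrier S. q (free_star x * x) = (q x)\<^sup>2) \<and>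
     (\<forall>x\<in>relators S. q x = 0)"

definition universal_norm :: "'s monoid \<Rightarrow> 's free_alg \<Rightarrow> real" where
  "universal_norm S x = (SUP q\<in>{q. cstar_seminorm S q}. q x)"

definition cauchy_seqs :: "'s monoid \<Rightarrow> (nat \<Rightarrow> 's free_alg) set" where
  "cauchy_seqs S =
     {x. (\<forall>n. x n \<in> free_carrier S) \<and>
         (\<forall>e>0. \<exists>M. \<forall>m\<ge>M. \<forall>n\<ge>M. universal_norm S (x m - x n) < e)}"

definition null_rel :: "'s monoid \<Rightarrow> ((nat \<Rightarrow> 's free_alg) \<times> (nat \<Rightarrow> 's free_alg)) set" where
  "null_rel S =
     {(x, y). x \<in> cauchy_seqs S \<and> y \<in> cauchy_seqs S \<and>
        (\<lambda>n. universal_norm S (x n - y n)) \<longlonglongrightarrow> 0}"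

definition cls :: "'s monoid \<Rightarrow> (nat \<Rightarrow> 's free_alg) \<Rightarrow> (nat \<Rightarrow> 's free_alg) set" where
  "cls S x = null_rel S `` {x}"

record 'b normed_star_algebra = "(complex, 'b) module" +
  star :: "'b \<Rightarrow> 'b"
  anorm :: "'b \<Rightarrow> real"

type_synonym 's cstar_elem = "(nat \<Rightarrow> 's free_alg) set"

definition Cstar :: "'s monoid \<Rightarrow> 's cstar_elem normed_star_algebra" where
  "Cstar S =
    \<lparr>carrier = cauchy_seqs S // null_rel S,
     mult = (\<lambda>X Y. \<Union>x\<in>X. \<Union>y\<in>Y. cls S (\<lambda>n. x n * y n)),
     one = cls S (\<lambda>n. 1),
     zero = cls S (\<lambda>n. 0),
     add = (\<lambda>X Y. \<Union>x\<in>X. \<Union>y\<in>Y. cls S (\<lambda>n. x n + y n)),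
     smult = (\<lambda>c X. \<Union>x\<in>X. cls S (\<lambda>n. free_scale c (x n))),
     star = (\<lambda>X. \<Union>x\<in>X. cls S (\<lambda>n. free_star (x n))),
     anorm = (\<lambda>X. THE r. \<forall>x\<in>X. (\<lambda>n. universal_norm S (x n)) \<longlonglongrightarrow> r)\<rparr>"

definition isom :: "'s monoid \<Rightarrow> 's \<Rightarrow> 's cstar_elem" where
  "isom S s = cls S (\<lambda>n. free_gen s)"


section \<open>The dynamics\<close>

fun letter_weight :: "('s \<Rightarrow> real) \<Rightarrow> real \<Rightarrow> 's letter \<Rightarrow> complex" where
  "letter_weight N t (Gen s) = complex_of_real (N s) powr (\<i> * complex_of_real t)"
| "letter_weight N t (Adj s) = cnj (complex_of_real (N s) powr (\<i> * complex_of_real t))"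

definition free_dynamics :: "('s \<Rightarrow> real) \<Rightarrow> real \<Rightarrow> 's free_alg \<Rightarrow> 's free_alg" where
  "free_dynamics N t p =
     Poly_Mapping.mapp (\<lambda>w c. prod_list (map (letter_weight N t) w) * c) p"

definition dynamics :: "'s monoid \<Rightarrow> ('s \<Rightarrow> real) \<Rightarrow> real \<Rightarrow> 's cstar_elem \<Rightarrow> 's cstar_elem" where
  "dynamics S N t X = (\<Union>x\<in>X. cls S (\<lambda>n. free_dynamics N t (x n)))"


section \<open>States, traces and KMS states\<close>

text \<open>Functionals are extended by \<open>undefined\<close> outside the carrier, so that equality of functions
  is equality of functionals and the weak* topology is the product topology.\<close>

definition states :: "('b, 'm) normed_star_algebra_scheme \<Rightarrow> ('b \<Rightarrow> complex) set" where
  "states A =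
     {\<phi> \<in> extensional (carrier A).
        (\<forall>a\<in>carrier A. \<forall>b\<in>carrier A. \<phi> (a \<oplus>\<^bsub>A\<^esub> b) = \<phi> a + \<phi> b) \<and>
        (\<forall>c. \<forall>a\<in>carrier A. \<phi> (c \<odot>\<^bsub>A\<^esub> a) = c * \<phi> a) \<and>
        (\<forall>a\<in>carrier A. \<phi> (star A a \<otimes>\<^bsub>A\<^esub> a) \<in> \<real>\<^sub>\<ge>\<^sub>0) \<and>
        \<phi> \<one>\<^bsub>A\<^esub> = 1}"

definition tracial_states :: "('b, 'm) normed_star_algebra_scheme \<Rightarrow> ('b \<Rightarrow> complex) set" where
  "tracial_states A =
     {\<tau> \<in> states A. \<forall>a\<in>carrier A. \<forall>b\<in>carrier A. \<tau> (a \<otimes>\<^bsub>A\<^esub> b) = \<tau> (b \<otimes>\<^bsub>A\<^esub> a)}"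

definition weak_star :: "('b, 'm) normed_star_algebra_scheme \<Rightarrow> ('b \<Rightarrow> complex) topology" where
  "weak_star A = subtopology (product_topology (\<lambda>_. euclidean) (carrier A)) (states A)"

definition affine_on ::
  "('b, 'm) normed_star_algebra_scheme \<Rightarrow> ('c, 'n) normed_star_algebra_scheme \<Rightarrow>
   ('b \<Rightarrow> complex) set \<Rightarrow> (('b \<Rightarrow> complex) \<Rightarrow> 'c \<Rightarrow> complex) \<Rightarrow> bool" where
  "affine_on A B K f \<longleftrightarrow>
     (\<forall>\<phi>\<in>K. \<forall>\<psi>\<in>K. \<forall>u\<in>{0..1}.
        f (\<lambda>a\<in>carrier A. complex_of_real (1 - u) * \<phi> a + complex_of_real u * \<psi> a) =
        (\<lambda>b\<in>carrier B. complex_of_real (1 - u) * f \<phi> b + complex_of_real u * f \<psi> b))"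

text \<open>\<open>f\<close> is the entire function \<open>z \<mapsto> \<sigma>\<^sub>z(a)\<close>; by uniqueness of analytic continuation there is
  at most one.\<close>

definition analytic_extension ::
  "('b, 'm) normed_star_algebra_scheme \<Rightarrow> (real \<Rightarrow> 'b \<Rightarrow> 'b) \<Rightarrow> 'b \<Rightarrow> (complex \<Rightarrow> 'b) \<Rightarrow> bool" where
  "analytic_extension A \<sigma> a f \<longleftrightarrow>
     (\<forall>z. f z \<in> carrier A) \<and>
     (\<forall>t. f (complex_of_real t) = \<sigma> t a) \<and>
     (\<forall>z. \<exists>d\<in>carrier A.
        ((\<lambda>h. anorm A ((inverse h \<odot>\<^bsub>A\<^esub> (f (z + h) \<ominus>\<^bsub>A\<^esub> f z)) \<ominus>\<^bsub>A\<^esub> d)) \<longlongrightarrow> 0) (at 0))"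

definition dense_subspace :: "('b, 'm) normed_star_algebra_scheme \<Rightarrow> 'b set \<Rightarrow> bool" where
  "dense_subspace A D \<longleftrightarrow>
     D \<subseteq> carrier A \<and> \<zero>\<^bsub>A\<^esub> \<in> D \<and>
     (\<forall>a\<in>D. \<forall>b\<in>D. a \<oplus>\<^bsub>A\<^esub> b \<in> D) \<and>
     (\<forall>c. \<forall>a\<in>D. c \<odot>\<^bsub>A\<^esub> a \<in> D) \<and>
     (\<forall>a\<in>carrier A. \<forall>e>0. \<exists>d\<in>D. anorm A (a \<ominus>\<^bsub>A\<^esub> d) < e)"

text \<open>As usual, the dense subspace of analytic elements is required to be invariant under the
  dynamics; without this the condition would depend on the choice of the subspace.\<close>

definition kms_states ::
  "('b, 'm) normed_star_algebra_scheme \<Rightarrow> (real \<Rightarrow> 'b \<Rightarrow> 'b) \<Rightarrow> real \<Rightarrow> ('b \<Rightarrow> complex) set" where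
  "kms_states A \<sigma> \<beta> =
     {\<phi> \<in> states A.
        \<exists>D. dense_subspace A D \<and> (\<forall>t. \<sigma> t ` D \<subseteq> D) \<and>
          (\<forall>a\<in>D. \<exists>f. analytic_extension A \<sigma> a f \<and>
             (\<forall>b\<in>D. \<phi> (a \<otimes>\<^bsub>A\<^esub> b) = \<phi> (b \<otimes>\<^bsub>A\<^esub> f (\<i> * complex_of_real \<beta>))))}"

text \<open>Limits of nets \<open>(\<beta>\<^sub>i, \<phi>\<^sub>i)\<close> are expressed through the filter that the net generates on
  pairs.\<close>

definition kms_infinity_states ::
  "('b, 'm) normed_star_algebra_scheme \<Rightarrow> (real \<Rightarrow> 'b \<Rightarrow> 'b) \<Rightarrow> ('b \<Rightarrow> complex) set" where
  "kms_infinity_states A \<sigma> =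
     {\<phi>. \<exists>F :: (real \<times> ('b \<Rightarrow> complex)) filter.
        F \<noteq> bot \<and>
        (\<forall>\<^sub>F (\<beta>, \<psi>) in F. \<psi> \<in> kms_states A \<sigma> \<beta>) \<and>
        filterlim fst at_top F \<and>
        limitin (weak_star A) snd \<phi> F}"

end

theory Submission
  imports Defs "HOL-Complex_Analysis.Complex_Analysis"
begin

text \<open>A KMS state \<open>\<phi>\<close> at inverse temperature \<open>\<beta>\<close> satisfies
  \<open>\<phi> (v\<^sub>s b) = N(s)\<^bsup>-\<beta>\<^esup> \<phi> (b v\<^sub>s)\<close>. For \<open>\<beta> \<rightarrow> \<infinity>\<close> this makes a limit state central on \<open>ker N\<close> and
  zero on the monomials \<open>v\<^sub>s v\<^sub>t\<^sup>*\<close> with \<open>s\<close> or \<open>t\<close> outside \<open>ker N\<close>, so it is determined by its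
  restriction to \<open>C\<^sup>*(ker N)\<close>, which is a trace.

  Conversely, a trace \<open>\<tau>\<close> satisfies \<open>\<tau> (1 - v\<^sub>a v\<^sub>a\<^sup>*) = 0\<close> and hence defines an invariant positive
  definite kernel on the formal fractions \<open>s a\<^sup>-\<^sup>1\<close> with \<open>s \<in> S\<close>, \<open>a \<in> ker N\<close>, on which the words in
  \<open>v\<^sub>s\<close> and \<open>v\<^sub>s\<^sup>*\<close> act by partial injections. The vector state of the fraction \<open>r\<close> depends only on
  the class \<open>[r]\<close>; the average of these states with weights proportional to \<open>N(r)\<^bsup>-\<beta>\<^esup>\<close> is a KMS
  state, and only the class of the identity survives as \<open>\<beta> \<rightarrow> \<infinity>\<close>.

  A positive unital functional on the free *-algebra that kills the ideal of the relators is
  bounded by the universal norm, because its GNS operator norm is one of the C*-seminorms over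
  which the supremum is taken.\<close>

section \<open>The free *-algebra\<close>

text \<open>The KMS condition is given on an unspecified dense invariant subspace that need not
  contain any \<open>v_s\<close>. The relation for generators is therefore extracted by
  approximation: the strip function of a nearby element is compared with the one expected for
  \<open>v_s\<close> through a maximum principle. States on the completion are only assumed linear,
  positive and normalised; their boundedness comes from square roots of \<open>1 - h\<close>, built
  as limits of polynomials. No Hilbert space is formed: the GNS seminorm and its operator norm live
  on the free algebra, which suffices because the universal norm is a supremum of seminorms there.
  In the converse direction the obstacle is that \<open>ker N\<close> is only a semigroup, while a
  trace sees the \<open>v_a\<close> as unitaries. Directedness is the right Ore condition, so
  denominators from the kernel can be inverted; left cancellation makes the action on fractions
  injective. The LCM relation survives because a fraction reached from both \<open>s\<close> and
  \<open>t\<close> has a representative with numerator in the common right ideal. Convergence of the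
  averages rests on the class of the identity being the only one of scale 1.\<close>

abbreviation word :: "'s letter list \<Rightarrow> 's free_alg" where
  "word w \<equiv> Poly_Mapping.single w 1"

definition words :: "'s monoid \<Rightarrow> 's letter list set" where
  "words S = {w. \<forall>l\<in>set w. letter_base l \<in> carrier S}"

definition word_adj :: "'s letter list \<Rightarrow> 's letter list" where
  "word_adj w = rev (map letter_adj w)"

lemma letter_adj_adj [simp]: "letter_adj (letter_adj l) = l"
  by (cases l) auto

lemma letter_base_adj [simp]: "letter_base (letter_adj l) = letter_base l"
  by (cases l) auto

lemma word_adj_simps [simp]:
  "word_adj [] = []" "word_adj (u @ w) = word_adj w @ word_adj u"
  "word_adj (l # w) = word_adj w @ [letter_adj l]" "word_adj (word_adj w) = w"
  by (auto simp: word_adj_def rev_map comp_def)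

lemma word_adj_eq_iff: "word_adj u = w \<longleftrightarrow> u = word_adj w"
  by auto

lemma words_simps [simp]:
  "[] \<in> words S" "u @ w \<in> words S \<longleftrightarrow> u \<in> words S \<and> w \<in> words S"
  "l # w \<in> words S \<longleftrightarrow> letter_base l \<in> carrier S \<and> w \<in> words S"
  "word_adj w \<in> words S \<longleftrightarrow> w \<in> words S"
  by (auto simp: words_def word_adj_def)

lemma lookup_free_scale [simp]:
  "Poly_Mapping.lookup (free_scale c p) w = c * Poly_Mapping.lookup p w"
  by (simp add: free_scale_def Poly_Mapping.map.rep_eq when_def)

lemma free_scale_single [simp]:
  "free_scale c (Poly_Mapping.single w d) = Poly_Mapping.single w (c * d)"
  by (rule poly_mapping_eqI) (simp add: lookup_single when_def)

lemma word_mult: "word u * word w = word (u @ w)"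
  by (simp add: mult_single plus_list_def)

lemma word_Nil: "word [] = 1"
  by (metis single_one zero_list_def)

lemma free_scale_simps [simp]:
  "free_scale 1 p = p" "free_scale 0 p = 0" "free_scale c 0 = 0"
  "free_scale (-1) p = - p" "free_scale c (free_scale d p) = free_scale (c * d) p"
  by (rule poly_mapping_eqI; simp)+

lemma free_scale_add: "free_scale c (p + q) = free_scale c p + free_scale c q"
  and free_scale_diff: "free_scale c (p - q) = free_scale c p - free_scale c q"
  and free_scale_add_left: "free_scale (c + d) p = free_scale c p + free_scale d p"
  by (rule poly_mapping_eqI; simp add: lookup_add lookup_minus algebra_simps)+

lemma word_expansion:
  "p = (\<Sum>w\<in>Poly_Mapping.keys p. free_scale (Poly_Mapping.lookup p w) (word w))"
proof (rule poly_mapping_eqI)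
  fix u
  have "(\<Sum>w\<in>Poly_Mapping.keys p. Poly_Mapping.lookup p w * (1 when w = u)) =
      (\<Sum>w\<in>Poly_Mapping.keys p. if w = u then Poly_Mapping.lookup p w else 0)"
    by (intro sum.cong) (auto simp: when_def)
  then show "Poly_Mapping.lookup p u =
      Poly_Mapping.lookup (\<Sum>w\<in>Poly_Mapping.keys p. free_scale (Poly_Mapping.lookup p w) (word w)) u"
    by (auto simp: lookup_sum lookup_single in_keys_iff when_def)
qed

lemma free_scale_mult_left: "free_scale c p * q = free_scale c (p * q)"
  unfolding free_scale_def mult_map_scale_conv_mult by (simp add: mult.assoc)

text \<open>Scaling is multiplication by a multiple of the empty word, and such multiples commute
  with every word although the algebra is not commutative.\<close>

lemma free_scale_mult_right: "p * free_scale c q = free_scale c (p * q)"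
proof -
  have "p * Poly_Mapping.single 0 c = Poly_Mapping.single 0 c * p" for p :: "'a free_alg"
    by (subst (1 2) word_expansion[of p])
      (simp add: sum_distrib_left sum_distrib_right mult_single mult.commute)
  then show ?thesis
    unfolding free_scale_def mult_map_scale_conv_mult by (metis mult.assoc)
qed

lemma free_carrier_simps [simp]:
  "0 \<in> free_carrier S" "1 \<in> free_carrier S"
  "word w \<in> free_carrier S \<longleftrightarrow> w \<in> words S"
  by (auto simp: free_carrier_def words_def zero_list_def)

lemma free_carrier_add [simp]: "p \<in> free_carrier S \<Longrightarrow> q \<in> free_carrier S \<Longrightarrow> p + q \<in> free_carrier S"
  using keys_add[of p q] by (fastforce simp: free_carrier_def)

lemma free_carrier_scale [simp]: "p \<in> free_carrier S \<Longrightarrow> free_scale c p \<in> free_carrier S"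
  by (auto simp: free_carrier_def in_keys_iff)

lemma free_carrier_minus [simp]: "p \<in> free_carrier S \<Longrightarrow> - p \<in> free_carrier S"
  by (auto simp: free_carrier_def)

lemma free_carrier_diff [simp]: "p \<in> free_carrier S \<Longrightarrow> q \<in> free_carrier S \<Longrightarrow> p - q \<in> free_carrier S"
  by (metis free_carrier_add free_carrier_minus uminus_add_conv_diff add.commute)

lemma free_carrier_mult [simp]:
  assumes "p \<in> free_carrier S" "q \<in> free_carrier S"
  shows "p * q \<in> free_carrier S"
proof -
  have "l \<in> set u \<or> l \<in> set w" if "l \<in> set (u + w)" for l :: "'a letter" and u w
    using that by (auto simp: plus_list_def)
  then show ?thesis
    using assms keys_mult[of p q] unfolding free_carrier_def by blast
qed

lemma free_carrier_sum [simp]: "(\<And>a. a \<in> A \<Longrightarrow> f a \<in> free_carrier S) \<Longrightarrow> sum f A \<in> free_carrier S"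
  by (induction A rule: infinite_finite_induct) auto

lemma keys_subset_words: "p \<in> free_carrier S \<Longrightarrow> Poly_Mapping.keys p \<subseteq> words S"
  by (auto simp: free_carrier_def words_def)

text \<open>Words span the free algebra. This is the rule by which identities and properties that
  are linear in \<open>p\<close> are reduced to words.\<close>

lemma free_carrier_induct [consumes 1, case_names zero add scale]:
  assumes "p \<in> free_carrier S" "P 0"
    and "\<And>p q. p \<in> free_carrier S \<Longrightarrow> q \<in> free_carrier S \<Longrightarrow> P p \<Longrightarrow> P q \<Longrightarrow> P (p + q)"
    and "\<And>c w. w \<in> words S \<Longrightarrow> P (free_scale c (word w))"
  shows "P p"
proof -
  have "P (\<Sum>w\<in>W. free_scale (f w) (word w))" if "finite W" "W \<subseteq> words S"
    for W and f :: "_ \<Rightarrow> complex"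
    using that
    by (induction W rule: finite_induct)
      (auto intro!: assms(3) free_carrier_sum intro: assms(2,4) simp del: free_scale_single)
  from this[OF finite_keys keys_subset_words[OF assms(1)]] show ?thesis
    using word_expansion[of p] by metis
qed

lemma lookup_free_star [simp]:
  "Poly_Mapping.lookup (free_star p) w = cnj (Poly_Mapping.lookup p (word_adj w))"
proof -
  have "Poly_Mapping.lookup (free_star p) w =
      (\<Sum>u\<in>Poly_Mapping.keys p. if u = word_adj w then cnj (Poly_Mapping.lookup p u) else 0)"
    unfolding free_star_def lookup_sum lookup_single word_adj_def[symmetric]
    by (intro sum.cong) (auto simp: when_def)
  then show ?thesis by (auto simp: in_keys_iff)
qed

lemma free_star_simps [simp]:
  "free_star (free_star p) = p" "free_star 0 = 0" "free_star (word w) = word (word_adj w)"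
  "free_star (free_scale c p) = free_scale (cnj c) (free_star p)"
  "free_star (p + q) = free_star p + free_star q"
  "free_star (p - q) = free_star p - free_star q"
  "free_star (- p) = - free_star p"
  by (rule poly_mapping_eqI;
      auto simp: lookup_add lookup_minus lookup_single when_def word_adj_eq_iff)+

lemma free_star_one [simp]: "free_star 1 = 1"
  by (metis free_star_simps(3) word_Nil word_adj_simps(1))

lemma free_star_sum: "free_star (sum f A) = (\<Sum>a\<in>A. free_star (f a))"
  by (induction A rule: infinite_finite_induct) auto

text \<open>Both factors are expanded into words, where reversal is antimultiplicative; exchanging
  the two sums accounts for the reversed order.\<close>

lemma free_star_mult [simp]: "free_star (p * q) = free_star q * free_star p"
proof -
  have e: "free_star r = (\<Sum>w\<in>Poly_Mapping.keys r. free_star (free_scale (Poly_Mapping.lookup r w) (word w)))"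
    for r :: "'a free_alg"
    by (subst word_expansion[of r]) (simp only: free_star_sum)
  have "free_star (p * q) = (\<Sum>u\<in>Poly_Mapping.keys p. \<Sum>w\<in>Poly_Mapping.keys q.
      free_star (free_scale (Poly_Mapping.lookup p u) (word u) *
        free_scale (Poly_Mapping.lookup q w) (word w)))"
    by (subst word_expansion[of p], subst word_expansion[of q])
      (simp add: sum_distrib_left sum_distrib_right free_star_sum del: free_scale_single, rule sum.swap)
  also have "\<dots> = (\<Sum>u\<in>Poly_Mapping.keys p. \<Sum>w\<in>Poly_Mapping.keys q.
      free_star (free_scale (Poly_Mapping.lookup q w) (word w)) *
      free_star (free_scale (Poly_Mapping.lookup p u) (word u)))"
    by (intro sum.cong refl)
      (simp add: free_scale_mult_left free_scale_mult_right word_mult mult.commute del: free_scale_single)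
  also have "\<dots> = free_star q * free_star p"
    by (subst e[of p], subst e[of q]) (simp only: sum_product, rule sum.swap)
  finally show ?thesis .
qed

lemma free_star_carrier [simp]: "free_star p \<in> free_carrier S \<longleftrightarrow> p \<in> free_carrier S"
proof -
  have "free_star p \<in> free_carrier S" if "p \<in> free_carrier S" for p
  proof -
    have "Poly_Mapping.keys (free_star p) \<subseteq> words S"
    proof
      fix w assume "w \<in> Poly_Mapping.keys (free_star p)"
      then have "word_adj w \<in> words S"
        using keys_subset_words[OF that] by (auto simp: in_keys_iff)
      then show "w \<in> words S" by simp
    qed
    then show ?thesis by (auto simp: free_carrier_def words_def)
  qed
  then show ?thesis by (metis free_star_simps(1))
qed

lemma free_gen_carrier [simp]: "free_gen s \<in> free_carrier S \<longleftrightarrow> s \<in> carrier S"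
  by (simp add: free_gen_def)

lemma free_proj_carrier [simp]: "s \<in> carrier S \<Longrightarrow> free_proj s \<in> free_carrier S"
  by (simp add: free_proj_def)

lemma word_Gen: "word [Gen s] = free_gen s"
  by (simp add: free_gen_def)

lemma word_Adj: "word [Adj s] = free_star (free_gen s)"
  by (simp add: free_gen_def)

lemma word_proj: "word [Gen s, Adj s] = free_proj s"
  by (simp add: free_proj_def free_gen_def word_mult)

text \<open>Words form a basis, so any function on words has a unique linear extension. Functionals
  are prescribed in this way first and tested against the relators afterwards.\<close>

definition lin :: "('s letter list \<Rightarrow> complex) \<Rightarrow> 's free_alg \<Rightarrow> complex" where
  "lin f p = (\<Sum>w\<in>Poly_Mapping.keys p. Poly_Mapping.lookup p w * f w)"

lemma lin_superset:
  "finite A \<Longrightarrow> Poly_Mapping.keys p \<subseteq> A \<Longrightarrow> lin f p = (\<Sum>w\<in>A. Poly_Mapping.lookup p w * f w)"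
  unfolding lin_def by (rule sum.mono_neutral_left) (auto simp: in_keys_iff)

lemma lin_zero [simp]: "lin f 0 = 0"
  by (simp add: lin_def)

lemma lin_add [simp]: "lin f (p + q) = lin f p + lin f q"
proof -
  let ?A = "Poly_Mapping.keys p \<union> Poly_Mapping.keys q"
  have "lin f r = (\<Sum>w\<in>?A. Poly_Mapping.lookup r w * f w)" if "r \<in> {p, q, p + q}" for r
    using that keys_add[of p q] by (intro lin_superset) auto
  then show ?thesis by (simp add: lookup_add distrib_right sum.distrib)
qed

lemma lin_scale [simp]: "lin f (free_scale c p) = c * lin f p"
proof -
  have "lin f (free_scale c p) = (\<Sum>w\<in>Poly_Mapping.keys p. Poly_Mapping.lookup (free_scale c p) w * f w)"
    by (intro lin_superset) (auto simp: in_keys_iff)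
  then show ?thesis by (simp add: lin_def sum_distrib_left mult.assoc)
qed

lemma lin_minus [simp]: "lin f (- p) = - lin f p"
  by (metis free_scale_simps(4) lin_scale mult_minus1)

lemma lin_diff [simp]: "lin f (p - q) = lin f p - lin f q"
  by (metis lin_add lin_minus diff_conv_add_uminus)

lemma lin_word [simp]: "lin f (word w) = f w"
  by (simp add: lin_def)

lemma lin_sum: "lin f (sum g A) = (\<Sum>a\<in>A. lin f (g a))"
  by (induction A rule: infinite_finite_induct) auto

section \<open>C*-seminorms\<close>

text \<open>Every C*-seminorm that vanishes on the relators is at most 1 on words, hence lies below
  this norm. This is what makes the supremum in \<open>universal_norm\<close> finite.\<close>

definition l1_norm :: "'s free_alg \<Rightarrow> real" where
  "l1_norm p = (\<Sum>w\<in>Poly_Mapping.keys p. cmod (Poly_Mapping.lookup p w))"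

locale isometry_algebra =
  fixes S :: "'s monoid"
  assumes monoid_S: "monoid S"
begin

lemma one_carrier [simp]: "\<one>\<^bsub>S\<^esub> \<in> carrier S"
  using monoid_S by (rule monoid.one_closed)

lemma mult_carrier [simp]: "s \<in> carrier S \<Longrightarrow> t \<in> carrier S \<Longrightarrow> s \<otimes>\<^bsub>S\<^esub> t \<in> carrier S"
  using monoid_S by (rule monoid.m_closed)

lemma relators_carrier: "x \<in> relators S \<Longrightarrow> x \<in> free_carrier S"
  unfolding relators_def by auto

lemma relators_intros:
  "free_gen \<one>\<^bsub>S\<^esub> - 1 \<in> relators S"
  "s \<in> carrier S \<Longrightarrow> free_star (free_gen s) * free_gen s - 1 \<in> relators S"
  "s \<in> carrier S \<Longrightarrow> t \<in> carrier S \<Longrightarrow> free_gen s * free_gen t - free_gen (s \<otimes>\<^bsub>S\<^esub> t) \<in> relators S"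
  "s \<in> carrier S \<Longrightarrow> t \<in> carrier S \<Longrightarrow> r \<in> carrier S \<Longrightarrow>
    (s <#\<^bsub>S\<^esub> carrier S) \<inter> (t <#\<^bsub>S\<^esub> carrier S) = r <#\<^bsub>S\<^esub> carrier S \<Longrightarrow>
    free_proj s * free_proj t - free_proj r \<in> relators S"
  "s \<in> carrier S \<Longrightarrow> t \<in> carrier S \<Longrightarrow>
    (s <#\<^bsub>S\<^esub> carrier S) \<inter> (t <#\<^bsub>S\<^esub> carrier S) = {} \<Longrightarrow> free_proj s * free_proj t \<in> relators S"
  unfolding relators_def by blast+

context
  fixes q assumes q: "cstar_seminorm S q"
begin

lemma seminorm_nonneg: "x \<in> free_carrier S \<Longrightarrow> 0 \<le> q x"
  and seminorm_add: "x \<in> free_carrier S \<Longrightarrow> y \<in> free_carrier S \<Longrightarrow> q (x + y) \<le> q x + q y"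
  and seminorm_scale: "x \<in> free_carrier S \<Longrightarrow> q (free_scale c x) = cmod c * q x"
  and seminorm_mult: "x \<in> free_carrier S \<Longrightarrow> y \<in> free_carrier S \<Longrightarrow> q (x * y) \<le> q x * q y"
  and seminorm_cstar: "x \<in> free_carrier S \<Longrightarrow> q (free_star x * x) = (q x)\<^sup>2"
  and seminorm_relator: "x \<in> relators S \<Longrightarrow> q x = 0"
  using q unfolding cstar_seminorm_def by blast+

lemma seminorm_zero: "q 0 = 0"
  using seminorm_scale[of 0 0] by simp

lemma seminorm_minus: "x \<in> free_carrier S \<Longrightarrow> q (- x) = q x"
  using seminorm_scale[of x "-1"] by simp

lemma seminorm_sum:
  "(\<And>a. a \<in> A \<Longrightarrow> f a \<in> free_carrier S) \<Longrightarrow> q (sum f A) \<le> (\<Sum>a\<in>A. q (f a))"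
proof (induction A rule: infinite_finite_induct)
  case (insert a A)
  then have "q (f a + sum f A) \<le> q (f a) + q (sum f A)" by (intro seminorm_add) auto
  with insert show ?case by auto
qed (auto simp: seminorm_zero)

text \<open>The C*-identity makes \<open>q 1\<close> idempotent. The value 0 does occur, for the
  zero seminorm, so only an inequality can be claimed.\<close>

lemma seminorm_one: "q 1 \<le> 1"
proof -
  have "q 1 = (q 1)\<^sup>2" using seminorm_cstar[of 1] by simp
  then have "q 1 = 0 \<or> q 1 = 1" by (simp add: power2_eq_square)
  then show ?thesis by auto
qed

text \<open>From \<open>(q x)\<^sup>2 = q (free_star x * x)\<close> and submultiplicativity one
  factor \<open>q x\<close> cancels, unless it is 0. The reverse inequality is the same one for
  \<open>free_star x\<close>.\<close>

lemma seminorm_star: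
  assumes "x \<in> free_carrier S" shows "q (free_star x) = q x"
proof -
  have "q x \<le> q (free_star x)" if x: "x \<in> free_carrier S" for x
  proof (cases "q x = 0")
    case False
    then have "0 < q x" using seminorm_nonneg[OF x] by simp
    moreover have "q x * q x \<le> q (free_star x) * q x"
      using seminorm_cstar[OF x] seminorm_mult[of "free_star x" x] x by (simp add: power2_eq_square)
    ultimately show ?thesis by simp
  qed (use x in \<open>simp add: seminorm_nonneg\<close>)
  from this[OF assms] this[of "free_star x"] assms show ?thesis by simp
qed

text \<open>By the C*-identity the square of the value is that of
  \<open>free_star (free_gen s) * free_gen s\<close>, which is 1 up to a relator.\<close>

lemma seminorm_gen: "s \<in> carrier S \<Longrightarrow> q (free_gen s) \<le> 1"
proof -
  assume s: "s \<in> carrier S"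
  have "(q (free_gen s))\<^sup>2 = q ((free_star (free_gen s) * free_gen s - 1) + 1)"
    using seminorm_cstar[of "free_gen s"] s by simp
  also have "\<dots> \<le> q (free_star (free_gen s) * free_gen s - 1) + q 1"
    using s by (intro seminorm_add) auto
  also have "\<dots> \<le> 1\<^sup>2"
    using seminorm_relator[OF relators_intros(2)[OF s]] seminorm_one by simp
  finally show ?thesis by (rule power2_le_imp_le) simp
qed

lemma seminorm_word: "w \<in> words S \<Longrightarrow> q (word w) \<le> 1"
proof (induction w)
  case Nil
  then show ?case using seminorm_one by (simp add: word_Nil)
next
  case (Cons l w)
  have l: "q (word [l]) \<le> 1"
    using Cons.prems by (cases l) (auto simp: word_Gen word_Adj seminorm_star seminorm_gen)
  have "q (word (l # w)) = q (word [l] * word w)" by (simp add: word_mult)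
  also have "\<dots> \<le> q (word [l]) * q (word w)" using Cons.prems by (intro seminorm_mult) auto
  also have "\<dots> \<le> 1 * 1" using Cons l by (intro mult_mono) (auto simp: seminorm_nonneg)
  finally show ?case by simp
qed

lemma seminorm_le_l1:
  assumes "p \<in> free_carrier S" shows "q p \<le> l1_norm p"
proof -
  have w: "w \<in> words S" if "w \<in> Poly_Mapping.keys p" for w
    using keys_subset_words[OF assms] that by auto
  have "q p \<le> (\<Sum>w\<in>Poly_Mapping.keys p. q (free_scale (Poly_Mapping.lookup p w) (word w)))"
    by (subst word_expansion[of p]) (intro seminorm_sum free_carrier_scale, simp add: w)
  also have "\<dots> \<le> (\<Sum>w\<in>Poly_Mapping.keys p. cmod (Poly_Mapping.lookup p w))"
    using w by (intro sum_mono)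
      (auto simp: seminorm_scale seminorm_word mult_left_le simp del: free_scale_single)
  finally show ?thesis by (simp add: l1_norm_def)
qed

end

section \<open>The universal seminorm\<close>

lemma cstar_seminorm_zero: "cstar_seminorm S (\<lambda>x. 0)"
  by (simp add: cstar_seminorm_def)

lemma seminorm_le_universal:
  assumes "cstar_seminorm S q" "x \<in> free_carrier S" shows "q x \<le> universal_norm S x"
  unfolding universal_norm_def
proof (rule cSUP_upper)
  show "bdd_above ((\<lambda>q. q x) ` {q. cstar_seminorm S q})"
    using seminorm_le_l1[OF _ assms(2)] by (intro bdd_aboveI[where M = "l1_norm x"]) auto
qed (use assms in auto)

lemma universal_norm_le:
  assumes "\<And>q. cstar_seminorm S q \<Longrightarrow> q x \<le> M" shows "universal_norm S x \<le> M"
  unfolding universal_norm_def using assms cstar_seminorm_zero by (intro cSUP_least) auto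

lemma universal_norm_nonneg: "x \<in> free_carrier S \<Longrightarrow> 0 \<le> universal_norm S x"
  using seminorm_le_universal[OF cstar_seminorm_zero] by auto

text \<open>A supremum of seminorms inherits the inequalities directly. The two equalities need a
  reverse direction: for scaling it comes from the inverse scalar, for the C*-identity from bounding
  each \<open>q x\<close> by a square root before taking the supremum.\<close>

lemma universal_cstar_seminorm: "cstar_seminorm S (universal_norm S)"
proof -
  let ?U = "universal_norm S"
  have scale_le: "?U (free_scale c x) \<le> cmod c * ?U x" if "x \<in> free_carrier S" for c x
    using that by (intro universal_norm_le)
      (simp add: seminorm_scale mult_left_mono seminorm_le_universal)
  have scale: "?U (free_scale c x) = cmod c * ?U x" if x: "x \<in> free_carrier S" for c x
  proof (cases "c = 0")
    case True
    then show ?thesis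
      using scale_le[OF x, of 0] universal_norm_nonneg[of 0] by simp
  next
    case False
    have "?U x \<le> cmod (inverse c) * ?U (free_scale c x)"
      using scale_le[of "free_scale c x" "inverse c"] x False by simp
    then have "cmod c * ?U x \<le> ?U (free_scale c x)"
      using False by (simp add: norm_inverse norm_divide field_simps)
    with scale_le[OF x, of c] show ?thesis by simp
  qed
  have add: "?U (x + y) \<le> ?U x + ?U y" if "x \<in> free_carrier S" "y \<in> free_carrier S" for x y
    using that seminorm_add seminorm_le_universal by (intro universal_norm_le) (meson add_mono order_trans)
  have mult: "?U (x * y) \<le> ?U x * ?U y" if "x \<in> free_carrier S" "y \<in> free_carrier S" for x y
  proof (intro universal_norm_le)
    fix q assume q: "cstar_seminorm S q"
    have "q (x * y) \<le> q x * q y" using q that by (rule seminorm_mult)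
    also have "\<dots> \<le> ?U x * ?U y"
      using q that by (intro mult_mono) (auto simp: seminorm_nonneg seminorm_le_universal universal_norm_nonneg)
    finally show "q (x * y) \<le> ?U x * ?U y" .
  qed
  have cstar: "?U (free_star x * x) = (?U x)\<^sup>2" if x: "x \<in> free_carrier S" for x
  proof (rule antisym)
    show "?U (free_star x * x) \<le> (?U x)\<^sup>2"
      using x by (intro universal_norm_le)
        (simp add: seminorm_cstar power_mono seminorm_nonneg seminorm_le_universal)
    have "?U x \<le> sqrt (?U (free_star x * x))"
    proof (intro universal_norm_le)
      fix q assume q: "cstar_seminorm S q"
      have "(q x)\<^sup>2 \<le> ?U (free_star x * x)"
        using seminorm_cstar[OF q x] seminorm_le_universal[OF q, of "free_star x * x"] x by simp
      then show "q x \<le> sqrt (?U (free_star x * x))" by (rule real_le_rsqrt)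
    qed
    then show "(?U x)\<^sup>2 \<le> ?U (free_star x * x)"
      using x universal_norm_nonneg
      by (metis free_carrier_mult free_star_carrier power_mono real_sqrt_pow2)
  qed
  have rel: "?U x = 0" if "x \<in> relators S" for x
  proof (rule antisym)
    show "?U x \<le> 0" using that by (intro universal_norm_le) (simp add: seminorm_relator)
  qed (use that relators_carrier universal_norm_nonneg in auto)
  show ?thesis
    unfolding cstar_seminorm_def
    using scale add mult cstar rel universal_norm_nonneg by blast
qed

lemmas unorm_nonneg = seminorm_nonneg[OF universal_cstar_seminorm]
  and unorm_add = seminorm_add[OF universal_cstar_seminorm]
  and unorm_scale = seminorm_scale[OF universal_cstar_seminorm]
  and unorm_minus = seminorm_minus[OF universal_cstar_seminorm]
  and unorm_mult = seminorm_mult[OF universal_cstar_seminorm]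
  and unorm_cstar = seminorm_cstar[OF universal_cstar_seminorm]
  and unorm_relator = seminorm_relator[OF universal_cstar_seminorm]
  and unorm_zero = seminorm_zero[OF universal_cstar_seminorm]
  and unorm_star = seminorm_star[OF universal_cstar_seminorm]
  and unorm_word_le = seminorm_word[OF universal_cstar_seminorm]
  and unorm_le_l1 = seminorm_le_l1[OF universal_cstar_seminorm]

lemma unorm_minus_commute:
  "x \<in> free_carrier S \<Longrightarrow> y \<in> free_carrier S \<Longrightarrow> universal_norm S (x - y) = universal_norm S (y - x)"
  using unorm_minus[of "x - y"] by simp

lemma unorm_triangle:
  assumes "x \<in> free_carrier S" "y \<in> free_carrier S" "z \<in> free_carrier S"
  shows "universal_norm S (x - z) \<le> universal_norm S (x - y) + universal_norm S (y - z)"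
  using unorm_add[of "x - y" "y - z"] assms by simp

lemma unorm_diff_abs:
  assumes "x \<in> free_carrier S" "y \<in> free_carrier S"
  shows "\<bar>universal_norm S x - universal_norm S y\<bar> \<le> universal_norm S (x - y)"
  using unorm_add[of "x - y" y] unorm_add[of "y - x" x] unorm_minus_commute[of x y] assms by simp

lemma unorm_mult_diff:
  assumes "x \<in> free_carrier S" "y \<in> free_carrier S" "x' \<in> free_carrier S" "y' \<in> free_carrier S"
  shows "universal_norm S (x * y - x' * y') \<le>
    universal_norm S x * universal_norm S (y - y') + universal_norm S (x - x') * universal_norm S y'"
proof -
  have "x * y - x' * y' = x * (y - y') + (x - x') * y'" by (simp add: algebra_simps)
  then have "universal_norm S (x * y - x' * y') \<le>
      universal_norm S (x * (y - y')) + universal_norm S ((x - x') * y')"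
    using assms unorm_add by simp
  then show ?thesis
    using unorm_mult[of x "y - y'"] unorm_mult[of "x - x'" y'] assms by simp
qed

text \<open>Equality of the images in the universal C*-algebra, expressed without leaving the free
  algebra.\<close>

definition eqv :: "'s free_alg \<Rightarrow> 's free_alg \<Rightarrow> bool" where
  "eqv p q \<longleftrightarrow> p \<in> free_carrier S \<and> q \<in> free_carrier S \<and> universal_norm S (p - q) = 0"

lemma eqv_refl: "p \<in> free_carrier S \<Longrightarrow> eqv p p"
  by (simp add: eqv_def unorm_zero)

lemma eqv_sym: "eqv p q \<Longrightarrow> eqv q p"
  by (simp add: eqv_def unorm_minus_commute)

lemma eqv_trans [trans]: "eqv p q \<Longrightarrow> eqv q r \<Longrightarrow> eqv p r"
  using unorm_triangle[of p q r] unorm_nonneg[of "p - r"] by (simp add: eqv_def)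

lemma eqv_mult: "eqv p p' \<Longrightarrow> eqv q q' \<Longrightarrow> eqv (p * q) (p' * q')"
  using unorm_mult_diff[of p q p' q'] unorm_nonneg[of "p * q - p' * q'"] by (simp add: eqv_def)

lemma eqv_mult_left: "eqv q q' \<Longrightarrow> p \<in> free_carrier S \<Longrightarrow> eqv (p * q) (p * q')"
  by (simp add: eqv_mult eqv_refl)

lemma eqv_mult_right: "eqv p p' \<Longrightarrow> q \<in> free_carrier S \<Longrightarrow> eqv (p * q) (p' * q)"
  by (simp add: eqv_mult eqv_refl)

lemma eqv_star: "eqv p q \<Longrightarrow> eqv (free_star p) (free_star q)"
  using unorm_star[of "p - q"] by (simp add: eqv_def)

lemma eqv_relator: "p - q \<in> relators S \<Longrightarrow> p \<in> free_carrier S \<Longrightarrow> q \<in> free_carrier S \<Longrightarrow> eqv p q"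
  by (simp add: eqv_def unorm_relator)

lemma eqv_gen_one: "eqv (free_gen \<one>\<^bsub>S\<^esub>) 1"
  by (intro eqv_relator relators_intros) auto

lemma eqv_isometry: "s \<in> carrier S \<Longrightarrow> eqv (free_star (free_gen s) * free_gen s) 1"
  by (intro eqv_relator relators_intros) auto

lemma eqv_gen_mult:
  "s \<in> carrier S \<Longrightarrow> t \<in> carrier S \<Longrightarrow> eqv (free_gen s * free_gen t) (free_gen (s \<otimes>\<^bsub>S\<^esub> t))"
  by (intro eqv_relator relators_intros) auto

lemma eqv_gen_mult_star:
  assumes "s \<in> carrier S" "t \<in> carrier S"
  shows "eqv (free_star (free_gen t) * free_star (free_gen s)) (free_star (free_gen (s \<otimes>\<^bsub>S\<^esub> t)))"
  using eqv_star[OF eqv_gen_mult[OF assms]] by simp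

end

section \<open>Reduction of words to monomials \<open>v_s v_t*\<close>\<close>

locale right_lcm_algebra = right_lcm_semigroup S for S :: "'s monoid" (structure)

sublocale right_lcm_algebra \<subseteq> isometry_algebra S
  by unfold_locales

lemma (in right_lcm_algebra) l_coset_iff: "x \<in> s <# carrier S \<longleftrightarrow> (\<exists>y\<in>carrier S. x = s \<otimes> y)"
  by (auto simp: l_coset_def)

text \<open>Inserting \<open>v_r* v_r = 1\<close> and \<open>v_s* v_s = 1\<close> exposes the
  product of the two range projections. It is 0 or the range projection of the least common multiple
  \<open>u = r x = s y\<close>; in the second case the isometries cancel again and
  \<open>v_x v_y*\<close> remains.\<close>

lemma (in right_lcm_algebra) adj_gen_reduce:
  assumes r: "r \<in> carrier S" and s: "s \<in> carrier S"
  shows "(\<exists>x\<in>carrier S. \<exists>y\<in>carrier S. eqv (free_star (free_gen r) * free_gen s)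
      (free_gen x * free_star (free_gen y))) \<or> eqv (free_star (free_gen r) * free_gen s) 0"
proof -
  let ?v = "free_gen :: 's \<Rightarrow> 's free_alg" and ?a = "\<lambda>s. free_star (free_gen s) :: 's free_alg"
  have "eqv (1 * (?a r * ?v s) * 1) ((?a r * ?v r) * (?a r * ?v s) * (?a s * ?v s))"
    using r s by (intro eqv_mult eqv_refl eqv_sym[OF eqv_isometry]) auto
  then have insert: "eqv (?a r * ?v s) (?a r * (free_proj r * free_proj s) * ?v s)"
    by (simp add: free_proj_def mult.assoc)
  from right_lcm[OF r s] show ?thesis
  proof
    assume "(r <# carrier S) \<inter> (s <# carrier S) = {}"
    then have "eqv (free_proj r * free_proj s) 0"
      using r s by (intro eqv_relator) (auto intro: relators_intros)
    then have "eqv (?a r * (free_proj r * free_proj s) * ?v s) (?a r * 0 * ?v s)"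
      using r s by (intro eqv_mult eqv_refl) auto
    with insert show ?thesis by (auto intro: eqv_trans)
  next
    assume "\<exists>u\<in>carrier S. (r <# carrier S) \<inter> (s <# carrier S) = u <# carrier S"
    then obtain u where u: "u \<in> carrier S" "(r <# carrier S) \<inter> (s <# carrier S) = u <# carrier S" by auto
    then have "u \<in> (r <# carrier S) \<inter> (s <# carrier S)"
      using l_coset_iff[of u u] by (auto intro!: bexI[of _ \<one>])
    then obtain x y where xy: "x \<in> carrier S" "y \<in> carrier S" "u = r \<otimes> x" "u = s \<otimes> y"
      by (auto simp: l_coset_iff)
    have "eqv (free_proj r * free_proj s) (free_proj u)"
      using u r s by (intro eqv_relator) (auto intro: relators_intros)
    moreover have "eqv (free_proj u) ((?v r * ?v x) * (?a y * ?a s))"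
      unfolding free_proj_def
      using eqv_mult[OF eqv_gen_mult[of r x] eqv_gen_mult_star[of s y]] r s xy by (auto intro: eqv_sym)
    ultimately have "eqv (?a r * (free_proj r * free_proj s) * ?v s)
        (?a r * ((?v r * ?v x) * (?a y * ?a s)) * ?v s)"
      using r s by (intro eqv_mult[OF eqv_mult[OF eqv_refl] eqv_refl]) (auto intro: eqv_trans)
    also have "?a r * ((?v r * ?v x) * (?a y * ?a s)) * ?v s =
        (?a r * ?v r) * (?v x * ?a y) * (?a s * ?v s)" by (simp add: mult.assoc)
    also have "eqv \<dots> (1 * (?v x * ?a y) * 1)"
      using r s xy by (intro eqv_mult eqv_refl eqv_isometry) auto
    finally have "eqv (?a r * ?v s) (?v x * ?a y)"
      using insert by (auto intro: eqv_trans)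
    with xy show ?thesis by blast
  qed
qed

text \<open>Prepending a letter preserves the required form: \<open>Gen r\<close> is absorbed into
  \<open>s\<close>, while \<open>Adj r\<close> is first moved past \<open>v_s\<close> by
  \<open>adj_gen_reduce\<close>. Consequently a state is determined by its values on
  monomials.\<close>

lemma (in right_lcm_algebra) word_reduce:
  assumes "w \<in> words S"
  shows "(\<exists>s\<in>carrier S. \<exists>t\<in>carrier S. eqv (word w) (free_gen s * free_star (free_gen t))) \<or> eqv (word w) 0"
  using assms
proof (induction w)
  case Nil
  have "eqv (free_gen \<one> * free_star (free_gen \<one>)) (1 * free_star 1)"
    by (intro eqv_mult eqv_star eqv_gen_one)
  then show ?case by (metis eqv_sym free_star_one mult.left_neutral word_Nil one_closed)
next
  case (Cons l w)
  then have w: "w \<in> words S" and l: "letter_base l \<in> carrier S" by auto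
  have lw: "word (l # w) = word [l] * word w" by (simp add: word_mult)
  from Cons.IH[OF w] show ?case
  proof
    assume "eqv (word w) 0"
    then have "eqv (word [l] * word w) (word [l] * 0)" using l by (intro eqv_mult_left) auto
    then show ?thesis by (simp add: lw)
  next
    assume "\<exists>s\<in>carrier S. \<exists>t\<in>carrier S. eqv (word w) (free_gen s * free_star (free_gen t))"
    then obtain s t where st: "s \<in> carrier S" "t \<in> carrier S"
      "eqv (word w) (free_gen s * free_star (free_gen t))" by auto
    then have 1: "eqv (word (l # w)) (word [l] * (free_gen s * free_star (free_gen t)))"
      unfolding lw using l by (intro eqv_mult_left) auto
    show ?thesis
    proof (cases l)
      case (Gen r)
      have "eqv (free_gen r * free_gen s * free_star (free_gen t)) (free_gen (r \<otimes> s) * free_star (free_gen t))"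
        using st l Gen by (intro eqv_mult_right eqv_gen_mult) auto
      with 1 have "eqv (word (l # w)) (free_gen (r \<otimes> s) * free_star (free_gen t))"
        by (simp add: Gen word_Gen mult.assoc eqv_trans)
      then show ?thesis using st l Gen by auto
    next
      case (Adj r)
      then have r: "r \<in> carrier S" using l by simp
      from adj_gen_reduce[OF r st(1)] show ?thesis
      proof
        assume "\<exists>x\<in>carrier S. \<exists>y\<in>carrier S. eqv (free_star (free_gen r) * free_gen s)
          (free_gen x * free_star (free_gen y))"
        then obtain x y where xy: "x \<in> carrier S" "y \<in> carrier S"
          "eqv (free_star (free_gen r) * free_gen s) (free_gen x * free_star (free_gen y))" by auto
        have "eqv ((free_star (free_gen r) * free_gen s) * free_star (free_gen t))
            ((free_gen x * free_star (free_gen y)) * free_star (free_gen t))"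
          using xy st by (intro eqv_mult_right) auto
        also have "eqv ((free_gen x * free_star (free_gen y)) * free_star (free_gen t))
            (free_gen x * free_star (free_gen (t \<otimes> y)))"
          unfolding mult.assoc using xy st by (intro eqv_mult_left eqv_gen_mult_star) auto
        finally have "eqv (word (l # w)) (free_gen x * free_star (free_gen (t \<otimes> y)))"
          using 1 by (simp add: Adj word_Adj mult.assoc eqv_trans)
        then show ?thesis using xy st by blast
      next
        assume "eqv (free_star (free_gen r) * free_gen s) 0"
        then have "eqv ((free_star (free_gen r) * free_gen s) * free_star (free_gen t)) (0 * free_star (free_gen t))"
          using st by (intro eqv_mult_right) auto
        then show ?thesis using 1 by (simp add: Adj word_Adj mult.assoc eqv_trans)
      qed
    qed
  qed
qed

section \<open>The completion\<close>

text \<open>The canonical map of the free algebra to its completion, by constant sequences. It is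
  not injective: its kernel consists of the elements of universal norm 0.\<close>

definition emb :: "'s monoid \<Rightarrow> 's free_alg \<Rightarrow> 's cstar_elem" where
  "emb S p = cls S (\<lambda>_. p)"

lemma isom_eq_emb: "isom S s = emb S (free_gen s)"
  by (simp add: isom_def emb_def)

context isometry_algebra
begin

lemma cauchy_carrier: "x \<in> cauchy_seqs S \<Longrightarrow> x n \<in> free_carrier S"
  by (simp add: cauchy_seqs_def)

lemma cauchy_obtain:
  assumes "x \<in> cauchy_seqs S" "e > 0"
  obtains M where "\<And>m n. m \<ge> M \<Longrightarrow> n \<ge> M \<Longrightarrow> universal_norm S (x m - x n) < e"
  using assms unfolding cauchy_seqs_def mem_Collect_eq by blast

lemma cauchy_const [simp]: "p \<in> free_carrier S \<Longrightarrow> (\<lambda>_. p) \<in> cauchy_seqs S"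
  by (simp add: cauchy_seqs_def unorm_zero)

lemma cauchy_bounded:
  assumes x: "x \<in> cauchy_seqs S"
  obtains B where "B > 0" "\<And>n. universal_norm S (x n) \<le> B"
proof -
  note c = cauchy_carrier[OF x]
  obtain M where M: "\<And>m n. m \<ge> M \<Longrightarrow> n \<ge> M \<Longrightarrow> universal_norm S (x m - x n) < 1"
    using cauchy_obtain[OF x, of 1] by auto
  let ?B = "Max ((\<lambda>n. universal_norm S (x n)) ` {..M}) + 1"
  have "universal_norm S (x n) \<le> ?B" for n
  proof (cases "n \<le> M")
    case True
    then have "universal_norm S (x n) \<le> Max ((\<lambda>n. universal_norm S (x n)) ` {..M})"
      by (intro Max_ge) auto
    then show ?thesis by simp
  next
    case False
    then have "universal_norm S (x n) \<le> universal_norm S (x n - x M) + universal_norm S (x M)"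
      using unorm_add[of "x n - x M" "x M"] c by simp
    moreover have "universal_norm S (x M) \<le> Max ((\<lambda>n. universal_norm S (x n)) ` {..M})"
      by (intro Max_ge) auto
    moreover have "universal_norm S (x n - x M) < 1" using M False by simp
    ultimately show ?thesis by linarith
  qed
  moreover from this[of 0] have "?B + 1 > 0" using unorm_nonneg[OF c, of 0] by linarith
  ultimately show ?thesis using that[of "?B + 1"] by (metis add_increasing2 zero_le_one add.commute)
qed

lemma cauchy_add [simp]:
  assumes x: "x \<in> cauchy_seqs S" and y: "y \<in> cauchy_seqs S"
  shows "(\<lambda>n. x n + y n) \<in> cauchy_seqs S"
  unfolding cauchy_seqs_def
proof (intro CollectI conjI allI impI)
  note c = cauchy_carrier[OF x] cauchy_carrier[OF y]
  show "x n + y n \<in> free_carrier S" for n using c by simp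
  fix e :: real assume "e > 0"
  then have "e / 2 > 0" by simp
  obtain M1 where M1: "\<And>m n. m \<ge> M1 \<Longrightarrow> n \<ge> M1 \<Longrightarrow> universal_norm S (x m - x n) < e / 2"
    using cauchy_obtain[OF x \<open>e / 2 > 0\<close>] by blast
  obtain M2 where M2: "\<And>m n. m \<ge> M2 \<Longrightarrow> n \<ge> M2 \<Longrightarrow> universal_norm S (y m - y n) < e / 2"
    using cauchy_obtain[OF y \<open>e / 2 > 0\<close>] by blast
  have "universal_norm S (x m + y m - (x n + y n)) < e" if "m \<ge> max M1 M2" "n \<ge> max M1 M2" for m n
  proof -
    have "universal_norm S ((x m - x n) + (y m - y n)) \<le>
        universal_norm S (x m - x n) + universal_norm S (y m - y n)"
      using c by (intro unorm_add) auto
    also have "(x m - x n) + (y m - y n) = x m + y m - (x n + y n)" by simp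
    finally have "universal_norm S (x m + y m - (x n + y n)) \<le>
        universal_norm S (x m - x n) + universal_norm S (y m - y n)" .
    then show ?thesis using M1[of m n] M2[of m n] that by simp
  qed
  then show "\<exists>M. \<forall>m\<ge>M. \<forall>n\<ge>M. universal_norm S (x m + y m - (x n + y n)) < e" by blast
qed

lemma cauchy_mult [simp]:
  assumes x: "x \<in> cauchy_seqs S" and y: "y \<in> cauchy_seqs S"
  shows "(\<lambda>n. x n * y n) \<in> cauchy_seqs S"
  unfolding cauchy_seqs_def
proof (intro CollectI conjI allI impI)
  note c = cauchy_carrier[OF x] cauchy_carrier[OF y]
  show "x n * y n \<in> free_carrier S" for n using c by simp
  fix e :: real assume e: "e > 0"
  obtain B1 where B1: "B1 > 0" "\<And>n. universal_norm S (x n) \<le> B1" using cauchy_bounded[OF x] by blast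
  obtain B2 where B2: "B2 > 0" "\<And>n. universal_norm S (y n) \<le> B2" using cauchy_bounded[OF y] by blast
  obtain M1 where M1: "\<And>m n. m \<ge> M1 \<Longrightarrow> n \<ge> M1 \<Longrightarrow> universal_norm S (x m - x n) < e / (2 * B2)"
    using cauchy_obtain[OF x, of "e / (2 * B2)"] e B2(1) by auto
  obtain M2 where M2: "\<And>m n. m \<ge> M2 \<Longrightarrow> n \<ge> M2 \<Longrightarrow> universal_norm S (y m - y n) < e / (2 * B1)"
    using cauchy_obtain[OF y, of "e / (2 * B1)"] e B1(1) by auto
  have "universal_norm S (x m * y m - x n * y n) < e" if "m \<ge> max M1 M2" "n \<ge> max M1 M2" for m n
  proof -
    have "universal_norm S (x m * y m - x n * y n) \<le>
        universal_norm S (x m) * universal_norm S (y m - y n) + universal_norm S (x m - x n) * universal_norm S (y n)"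
      using c by (intro unorm_mult_diff)
    also have "\<dots> \<le> B1 * universal_norm S (y m - y n) + universal_norm S (x m - x n) * B2"
      using c B1 B2 by (intro add_mono mult_mono) (auto simp: unorm_nonneg less_imp_le)
    also have "\<dots> < B1 * (e / (2 * B1)) + e / (2 * B2) * B2"
      using M1[of m n] M2[of m n] B1 B2 that
      by (intro add_strict_mono mult_strict_left_mono mult_strict_right_mono) auto
    also have "\<dots> = e" using B1 B2 by simp
    finally show ?thesis .
  qed
  then show "\<exists>M. \<forall>m\<ge>M. \<forall>n\<ge>M. universal_norm S (x m * y m - x n * y n) < e" by blast
qed

text \<open>Scaling is multiplication by the constant sequence \<open>free_scale c 1\<close>, so the
  product case applies.\<close>

lemma cauchy_scale [simp]:
  assumes "x \<in> cauchy_seqs S" shows "(\<lambda>n. free_scale c (x n)) \<in> cauchy_seqs S"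
proof -
  have "(\<lambda>n. free_scale c 1 * x n) \<in> cauchy_seqs S"
    using assms by (intro cauchy_mult cauchy_const) auto
  then show ?thesis by (simp add: free_scale_mult_left)
qed

lemma cauchy_diff [simp]:
  "x \<in> cauchy_seqs S \<Longrightarrow> y \<in> cauchy_seqs S \<Longrightarrow> (\<lambda>n. x n - y n) \<in> cauchy_seqs S"
  using cauchy_add[of x "\<lambda>n. free_scale (-1) (y n)"] cauchy_scale[of y "-1"] by simp

lemma cauchy_star [simp]: "x \<in> cauchy_seqs S \<Longrightarrow> (\<lambda>n. free_star (x n)) \<in> cauchy_seqs S"
  by (simp add: cauchy_seqs_def unorm_star flip: free_star_simps(6))

lemma norm_convergent:
  assumes x: "x \<in> cauchy_seqs S" shows "convergent (\<lambda>n. universal_norm S (x n))"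
proof (rule Cauchy_convergent, rule CauchyI)
  fix e :: real assume "e > 0"
  then obtain M where "\<forall>m\<ge>M. \<forall>n\<ge>M. universal_norm S (x m - x n) < e"
    using x unfolding cauchy_seqs_def by blast
  then show "\<exists>M. \<forall>m\<ge>M. \<forall>n\<ge>M. norm (universal_norm S (x m) - universal_norm S (x n)) < e"
    using unorm_diff_abs[OF cauchy_carrier[OF x] cauchy_carrier[OF x]]
    by (metis order.strict_trans1 real_norm_def)
qed

lemma null_relI:
  "x \<in> cauchy_seqs S \<Longrightarrow> y \<in> cauchy_seqs S \<Longrightarrow> (\<lambda>n. universal_norm S (x n - y n)) \<longlonglongrightarrow> 0 \<Longrightarrow>
    (x, y) \<in> null_rel S"
  by (simp add: null_rel_def)

lemma null_rel_le:
  assumes "x \<in> cauchy_seqs S" "y \<in> cauchy_seqs S" "f \<longlonglongrightarrow> 0"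
    and "\<And>n. universal_norm S (x n - y n) \<le> f n"
  shows "(x, y) \<in> null_rel S"
proof (rule null_relI[OF assms(1,2)])
  show "(\<lambda>n. universal_norm S (x n - y n)) \<longlonglongrightarrow> 0"
    using assms cauchy_carrier[OF assms(1)] cauchy_carrier[OF assms(2)] unorm_nonneg
    by (intro tendsto_sandwich[OF _ _ tendsto_const assms(3)] always_eventually) auto
qed

lemma equiv_null_rel: "equiv (cauchy_seqs S) (null_rel S)"
proof (rule equivI)
  show "null_rel S \<subseteq> cauchy_seqs S \<times> cauchy_seqs S" by (auto simp: null_rel_def)
  show "refl_on (cauchy_seqs S) (null_rel S)"
    by (auto simp: refl_on_def null_rel_def unorm_zero)
  show "sym (null_rel S)"
  proof (rule symI)
    fix x y assume "(x, y) \<in> null_rel S"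
    then show "(y, x) \<in> null_rel S"
      using unorm_minus_commute[OF cauchy_carrier[of x] cauchy_carrier[of y]] by (simp add: null_rel_def)
  qed
  show "trans (null_rel S)"
  proof (rule transI)
    fix x y z assume "(x, y) \<in> null_rel S" "(y, z) \<in> null_rel S"
    then have *: "x \<in> cauchy_seqs S" "y \<in> cauchy_seqs S" "z \<in> cauchy_seqs S"
      and lim: "(\<lambda>n. universal_norm S (x n - y n)) \<longlonglongrightarrow> 0" "(\<lambda>n. universal_norm S (y n - z n)) \<longlonglongrightarrow> 0"
      unfolding null_rel_def by auto
    show "(x, z) \<in> null_rel S"
      using tendsto_add[OF lim] unorm_triangle[OF *[THEN cauchy_carrier]]
      by (intro null_rel_le[OF *(1,3)]) auto
  qed
qed

lemma cls_eq_iff: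
  "x \<in> cauchy_seqs S \<Longrightarrow> y \<in> cauchy_seqs S \<Longrightarrow>
    cls S x = cls S y \<longleftrightarrow> (\<lambda>n. universal_norm S (x n - y n)) \<longlonglongrightarrow> 0"
  unfolding cls_def using eq_equiv_class_iff[OF equiv_null_rel] by (simp add: null_rel_def)

lemma cls_eqI:
  "(x, y) \<in> null_rel S \<Longrightarrow> cls S x = cls S y"
  unfolding cls_def by (rule equiv_class_eq[OF equiv_null_rel])

lemma mem_cls: "y \<in> cls S x \<longleftrightarrow> (x, y) \<in> null_rel S"
  by (simp add: cls_def)

lemma mem_cls_self: "x \<in> cauchy_seqs S \<Longrightarrow> x \<in> cls S x"
  unfolding cls_def by (rule equiv_class_self[OF equiv_null_rel])

lemma Cstar_carrier: "carrier (Cstar S) = cls S ` cauchy_seqs S"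
proof -
  have "cls S = (\<lambda>x. null_rel S `` {x})" by (simp add: fun_eq_iff cls_def)
  then show ?thesis by (simp add: Cstar_def quotient_def UNION_singleton_eq_range)
qed

lemma cls_carrier [simp]: "x \<in> cauchy_seqs S \<Longrightarrow> cls S x \<in> carrier (Cstar S)"
  by (simp add: Cstar_carrier)

lemma Cstar_cases:
  assumes "X \<in> carrier (Cstar S)"
  obtains x where "x \<in> cauchy_seqs S" "X = cls S x"
  using assms by (auto simp: Cstar_carrier)

text \<open>The operations of \<open>Cstar\<close> are unions over all representatives. Once the
  value does not depend on the representative, the union collapses to a single term.\<close>

lemma UN_cls:
  assumes "x \<in> cauchy_seqs S" "\<And>y. (x, y) \<in> null_rel S \<Longrightarrow> F y = F x"
  shows "(\<Union>y\<in>cls S x. F y) = F x"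
proof (rule SUP_eq_const)
  show "cls S x \<noteq> {}" using mem_cls_self[OF assms(1)] by blast
  show "F y = F x" if "y \<in> cls S x" for y
    by (rule assms(2)) (use that in \<open>simp only: mem_cls\<close>)
qed

lemma null_rel_add:
  assumes "(x, x') \<in> null_rel S" "(y, y') \<in> null_rel S"
  shows "(\<lambda>n. x n + y n, \<lambda>n. x' n + y' n) \<in> null_rel S"
proof -
  from assms have *: "x \<in> cauchy_seqs S" "x' \<in> cauchy_seqs S" "y \<in> cauchy_seqs S" "y' \<in> cauchy_seqs S"
    and lim: "(\<lambda>n. universal_norm S (x n - x' n)) \<longlonglongrightarrow> 0" "(\<lambda>n. universal_norm S (y n - y' n)) \<longlonglongrightarrow> 0"
    unfolding null_rel_def by auto
  have "universal_norm S ((x n - x' n) + (y n - y' n)) \<le>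
      universal_norm S (x n - x' n) + universal_norm S (y n - y' n)" for n
    using *[THEN cauchy_carrier] by (intro unorm_add) auto
  then have "universal_norm S (x n + y n - (x' n + y' n)) \<le>
      universal_norm S (x n - x' n) + universal_norm S (y n - y' n)" for n
    by (simp add: add_diff_add)
  then show ?thesis using * tendsto_add[OF lim]
    by (intro null_rel_le[where f = "\<lambda>n. universal_norm S (x n - x' n) + universal_norm S (y n - y' n)"]) auto
qed

text \<open>One factor of each term in \<open>unorm_mult_diff\<close> is bounded along a Cauchy
  sequence while the other tends to 0.\<close>

lemma null_rel_mult:
  assumes "(x, x') \<in> null_rel S" "(y, y') \<in> null_rel S"
  shows "(\<lambda>n. x n * y n, \<lambda>n. x' n * y' n) \<in> null_rel S"
proof -
  from assms have *: "x \<in> cauchy_seqs S" "x' \<in> cauchy_seqs S" "y \<in> cauchy_seqs S" "y' \<in> cauchy_seqs S"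
    and lim: "(\<lambda>n. universal_norm S (x n - x' n)) \<longlonglongrightarrow> 0" "(\<lambda>n. universal_norm S (y n - y' n)) \<longlonglongrightarrow> 0"
    unfolding null_rel_def by auto
  note c = *[THEN cauchy_carrier]
  obtain B1 where B1: "B1 > 0" "\<And>n. universal_norm S (x n) \<le> B1" using cauchy_bounded[OF *(1)] by blast
  obtain B2 where B2: "B2 > 0" "\<And>n. universal_norm S (y' n) \<le> B2" using cauchy_bounded[OF *(4)] by blast
  have "universal_norm S (x n * y n - x' n * y' n) \<le>
      B1 * universal_norm S (y n - y' n) + universal_norm S (x n - x' n) * B2" for n
  proof -
    have "universal_norm S (x n * y n - x' n * y' n) \<le>
        universal_norm S (x n) * universal_norm S (y n - y' n) + universal_norm S (x n - x' n) * universal_norm S (y' n)"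
      using c by (intro unorm_mult_diff)
    also have "\<dots> \<le> B1 * universal_norm S (y n - y' n) + universal_norm S (x n - x' n) * B2"
      using c B1 B2 by (intro add_mono mult_mono) (auto simp: unorm_nonneg less_imp_le)
    finally show ?thesis .
  qed
  moreover have "(\<lambda>n. B1 * universal_norm S (y n - y' n) + universal_norm S (x n - x' n) * B2) \<longlonglongrightarrow> B1 * 0 + 0 * B2"
    by (intro tendsto_intros lim)
  ultimately show ?thesis using *
    by (intro null_rel_le[where f = "\<lambda>n. B1 * universal_norm S (y n - y' n) + universal_norm S (x n - x' n) * B2"]) auto
qed

lemma null_rel_refl: "x \<in> cauchy_seqs S \<Longrightarrow> (x, x) \<in> null_rel S"
  by (simp add: null_rel_def unorm_zero)

lemma null_rel_scale:
  assumes "(x, y) \<in> null_rel S"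
  shows "(\<lambda>n. free_scale c (x n), \<lambda>n. free_scale c (y n)) \<in> null_rel S"
  using null_rel_mult[OF null_rel_refl assms, of "\<lambda>_. free_scale c 1"]
  by (simp add: free_scale_mult_left)

lemma null_rel_star:
  assumes "(x, y) \<in> null_rel S"
  shows "(\<lambda>n. free_star (x n), \<lambda>n. free_star (y n)) \<in> null_rel S"
proof -
  have "x n \<in> free_carrier S" "y n \<in> free_carrier S" for n
    using assms cauchy_carrier[of x] cauchy_carrier[of y] by (auto simp: null_rel_def)
  then show ?thesis using assms by (simp add: null_rel_def unorm_star flip: free_star_simps(6))
qed

lemma null_rel_carrier: "(x, y) \<in> null_rel S \<Longrightarrow> x \<in> cauchy_seqs S \<and> y \<in> cauchy_seqs S"
  by (simp add: null_rel_def)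

section \<open>The operations and the norm of the completion on representatives\<close>

lemma Cstar_mult [simp]:
  assumes "x \<in> cauchy_seqs S" "y \<in> cauchy_seqs S"
  shows "cls S x \<otimes>\<^bsub>Cstar S\<^esub> cls S y = cls S (\<lambda>n. x n * y n)"
proof -
  have "(\<Union>y'\<in>cls S y. cls S (\<lambda>n. x' n * y' n)) = cls S (\<lambda>n. x' n * y n)" if "x' \<in> cauchy_seqs S" for x'
    using assms(2) that
    by (intro UN_cls[where F = "\<lambda>y'. cls S (\<lambda>n. x' n * y' n)"])
      (auto intro!: cls_eqI[symmetric] null_rel_mult null_rel_refl)
  then have "(\<Union>x'\<in>cls S x. \<Union>y'\<in>cls S y. cls S (\<lambda>n. x' n * y' n)) = (\<Union>x'\<in>cls S x. cls S (\<lambda>n. x' n * y n))"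
    by (intro SUP_cong) (auto simp: mem_cls dest: null_rel_carrier)
  also have "\<dots> = cls S (\<lambda>n. x n * y n)"
    using assms
    by (intro UN_cls[where F = "\<lambda>x'. cls S (\<lambda>n. x' n * y n)"])
      (auto intro!: cls_eqI[symmetric] null_rel_mult null_rel_refl)
  finally show ?thesis by (simp add: Cstar_def)
qed

lemma Cstar_add [simp]:
  assumes "x \<in> cauchy_seqs S" "y \<in> cauchy_seqs S"
  shows "cls S x \<oplus>\<^bsub>Cstar S\<^esub> cls S y = cls S (\<lambda>n. x n + y n)"
proof -
  have "(\<Union>y'\<in>cls S y. cls S (\<lambda>n. x' n + y' n)) = cls S (\<lambda>n. x' n + y n)" if "x' \<in> cauchy_seqs S" for x'
    using assms(2) that
    by (intro UN_cls[where F = "\<lambda>y'. cls S (\<lambda>n. x' n + y' n)"])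
      (auto intro!: cls_eqI[symmetric] null_rel_add null_rel_refl)
  then have "(\<Union>x'\<in>cls S x. \<Union>y'\<in>cls S y. cls S (\<lambda>n. x' n + y' n)) = (\<Union>x'\<in>cls S x. cls S (\<lambda>n. x' n + y n))"
    by (intro SUP_cong) (auto simp: mem_cls dest: null_rel_carrier)
  also have "\<dots> = cls S (\<lambda>n. x n + y n)"
    using assms
    by (intro UN_cls[where F = "\<lambda>x'. cls S (\<lambda>n. x' n + y n)"])
      (auto intro!: cls_eqI[symmetric] null_rel_add null_rel_refl)
  finally show ?thesis by (simp add: Cstar_def)
qed

lemma Cstar_smult [simp]:
  "x \<in> cauchy_seqs S \<Longrightarrow> c \<odot>\<^bsub>Cstar S\<^esub> cls S x = cls S (\<lambda>n. free_scale c (x n))"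
  using UN_cls[where F = "\<lambda>x. cls S (\<lambda>n. free_scale c (x n))" and x = x]
  by (auto simp: Cstar_def intro!: cls_eqI[symmetric] null_rel_scale)

lemma Cstar_star [simp]:
  "x \<in> cauchy_seqs S \<Longrightarrow> star (Cstar S) (cls S x) = cls S (\<lambda>n. free_star (x n))"
  using UN_cls[where F = "\<lambda>x. cls S (\<lambda>n. free_star (x n))" and x = x]
  by (auto simp: Cstar_def intro!: cls_eqI[symmetric] null_rel_star)

lemma Cstar_zero: "\<zero>\<^bsub>Cstar S\<^esub> = emb S 0"
  and Cstar_one: "\<one>\<^bsub>Cstar S\<^esub> = emb S 1"
  by (simp_all add: Cstar_def emb_def)

text \<open>The definite description in \<open>anorm\<close> is justified here: the norms of a
  Cauchy sequence converge, and equivalent sequences have the same limit.\<close>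

lemma anorm_cls:
  assumes x: "x \<in> cauchy_seqs S"
  shows "(\<lambda>n. universal_norm S (x n)) \<longlonglongrightarrow> anorm (Cstar S) (cls S x)"
proof -
  obtain r where r: "(\<lambda>n. universal_norm S (x n)) \<longlonglongrightarrow> r"
    using norm_convergent[OF x] by (auto simp: convergent_def)
  have y: "(\<lambda>n. universal_norm S (y n)) \<longlonglongrightarrow> r" if "(x, y) \<in> null_rel S" for y
  proof -
    have lim: "(\<lambda>n. universal_norm S (y n - x n)) \<longlonglongrightarrow> 0" and y: "y \<in> cauchy_seqs S"
      using that unorm_minus_commute[OF cauchy_carrier[OF x] cauchy_carrier[of y]] by (auto simp: null_rel_def)
    have "(\<lambda>n. universal_norm S (y n) - universal_norm S (x n)) \<longlonglongrightarrow> 0"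
      using unorm_diff_abs[OF cauchy_carrier[OF y] cauchy_carrier[OF x]]
      by (intro Lim_null_comparison[OF _ lim] always_eventually) auto
    from tendsto_add[OF this r] show ?thesis by simp
  qed
  have "anorm (Cstar S) (cls S x) = (THE r. \<forall>y\<in>cls S x. (\<lambda>n. universal_norm S (y n)) \<longlonglongrightarrow> r)"
    by (simp add: Cstar_def)
  also have "\<dots> = r"
  proof (rule the_equality)
    show "\<forall>y\<in>cls S x. (\<lambda>n. universal_norm S (y n)) \<longlonglongrightarrow> r" using y by (simp add: mem_cls)
    fix r' assume "\<forall>y\<in>cls S x. (\<lambda>n. universal_norm S (y n)) \<longlonglongrightarrow> r'"
    then show "r' = r" using mem_cls_self[OF x] r LIMSEQ_unique by blast
  qed
  finally show ?thesis using r by simp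
qed

lemma emb_carrier [simp]: "p \<in> free_carrier S \<Longrightarrow> emb S p \<in> carrier (Cstar S)"
  by (simp add: emb_def)

lemma anorm_emb: "p \<in> free_carrier S \<Longrightarrow> anorm (Cstar S) (emb S p) = universal_norm S p"
  using anorm_cls[of "\<lambda>_. p"] by (simp add: emb_def LIMSEQ_const_iff)

lemma emb_simps:
  assumes "p \<in> free_carrier S"
  shows "q \<in> free_carrier S \<Longrightarrow> emb S p \<otimes>\<^bsub>Cstar S\<^esub> emb S q = emb S (p * q)"
    "q \<in> free_carrier S \<Longrightarrow> emb S p \<oplus>\<^bsub>Cstar S\<^esub> emb S q = emb S (p + q)"
    "c \<odot>\<^bsub>Cstar S\<^esub> emb S p = emb S (free_scale c p)"
    "star (Cstar S) (emb S p) = emb S (free_star p)"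
  using assms by (simp_all add: emb_def)

lemma Cstar_closed [simp]:
  assumes "X \<in> carrier (Cstar S)"
  shows "Y \<in> carrier (Cstar S) \<Longrightarrow> X \<otimes>\<^bsub>Cstar S\<^esub> Y \<in> carrier (Cstar S)"
    "Y \<in> carrier (Cstar S) \<Longrightarrow> X \<oplus>\<^bsub>Cstar S\<^esub> Y \<in> carrier (Cstar S)"
    "c \<odot>\<^bsub>Cstar S\<^esub> X \<in> carrier (Cstar S)"
    "star (Cstar S) X \<in> carrier (Cstar S)"
  using assms by (auto elim!: Cstar_cases)

lemma abelian_group_Cstar: "abelian_group (Cstar S)"
proof (rule abelian_groupI)
  show "\<zero>\<^bsub>Cstar S\<^esub> \<in> carrier (Cstar S)" by (simp add: Cstar_zero)
  fix X assume "X \<in> carrier (Cstar S)"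
  then obtain x where x: "x \<in> cauchy_seqs S" "X = cls S x" by (rule Cstar_cases)
  show "\<zero>\<^bsub>Cstar S\<^esub> \<oplus>\<^bsub>Cstar S\<^esub> X = X" using x by (simp add: Cstar_zero emb_def)
  show "\<exists>Y\<in>carrier (Cstar S). Y \<oplus>\<^bsub>Cstar S\<^esub> X = \<zero>\<^bsub>Cstar S\<^esub>"
    using x cauchy_scale[OF x(1), of "-1"]
    by (intro bexI[of _ "cls S (\<lambda>n. free_scale (-1) (x n))"]) (simp_all add: Cstar_zero emb_def)
qed (auto elim!: Cstar_cases simp: add_ac)

lemma Cstar_minus [simp]:
  assumes x: "x \<in> cauchy_seqs S" and y: "y \<in> cauchy_seqs S"
  shows "cls S x \<ominus>\<^bsub>Cstar S\<^esub> cls S y = cls S (\<lambda>n. x n - y n)"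
proof -
  interpret abelian_group "Cstar S" by (rule abelian_group_Cstar)
  have m: "(\<lambda>n. - y n) \<in> cauchy_seqs S" using cauchy_scale[OF y, of "-1"] by simp
  have "\<ominus>\<^bsub>Cstar S\<^esub> cls S y = cls S (\<lambda>n. - y n)"
    using y m by (intro minus_equality) (simp_all add: Cstar_zero emb_def)
  then show ?thesis using x m by (simp add: a_minus_def)
qed

lemma emb_minus: "p \<in> free_carrier S \<Longrightarrow> q \<in> free_carrier S \<Longrightarrow> emb S p \<ominus>\<^bsub>Cstar S\<^esub> emb S q = emb S (p - q)"
  by (simp add: emb_def)

lemma Cstar_minus_closed [simp]:
  "X \<in> carrier (Cstar S) \<Longrightarrow> Y \<in> carrier (Cstar S) \<Longrightarrow> X \<ominus>\<^bsub>Cstar S\<^esub> Y \<in> carrier (Cstar S)"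
  by (auto elim!: Cstar_cases)

lemma anorm_nonneg: "X \<in> carrier (Cstar S) \<Longrightarrow> 0 \<le> anorm (Cstar S) X"
  by (erule Cstar_cases) (metis LIMSEQ_le_const[OF anorm_cls] unorm_nonneg cauchy_carrier)

lemma anorm_mult_le:
  assumes "X \<in> carrier (Cstar S)" "Y \<in> carrier (Cstar S)"
  shows "anorm (Cstar S) (X \<otimes>\<^bsub>Cstar S\<^esub> Y) \<le> anorm (Cstar S) X * anorm (Cstar S) Y"
proof -
  obtain x y where *: "x \<in> cauchy_seqs S" "X = cls S x" "y \<in> cauchy_seqs S" "Y = cls S y"
    using assms by (metis Cstar_cases)
  show ?thesis
    using LIMSEQ_le[OF anorm_cls[OF cauchy_mult[OF *(1,3)]] tendsto_mult[OF anorm_cls[OF *(1)] anorm_cls[OF *(3)]]]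
      unorm_mult[OF cauchy_carrier[OF *(1)] cauchy_carrier[OF *(3)]] * by simp
qed

lemma anorm_add_le:
  assumes "X \<in> carrier (Cstar S)" "Y \<in> carrier (Cstar S)"
  shows "anorm (Cstar S) (X \<oplus>\<^bsub>Cstar S\<^esub> Y) \<le> anorm (Cstar S) X + anorm (Cstar S) Y"
proof -
  obtain x y where *: "x \<in> cauchy_seqs S" "X = cls S x" "y \<in> cauchy_seqs S" "Y = cls S y"
    using assms by (metis Cstar_cases)
  show ?thesis
    using LIMSEQ_le[OF anorm_cls[OF cauchy_add[OF *(1,3)]] tendsto_add[OF anorm_cls[OF *(1)] anorm_cls[OF *(3)]]]
      unorm_add[OF cauchy_carrier[OF *(1)] cauchy_carrier[OF *(3)]] * by simp
qed

lemma anorm_smult: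
  assumes "X \<in> carrier (Cstar S)"
  shows "anorm (Cstar S) (c \<odot>\<^bsub>Cstar S\<^esub> X) = cmod c * anorm (Cstar S) X"
proof -
  obtain x where *: "x \<in> cauchy_seqs S" "X = cls S x" using assms by (rule Cstar_cases)
  have "(\<lambda>n. universal_norm S (free_scale c (x n))) \<longlonglongrightarrow> cmod c * anorm (Cstar S) X"
    using tendsto_mult[OF tendsto_const[of "cmod c"] anorm_cls[OF *(1)]] *
    by (simp add: unorm_scale cauchy_carrier[OF *(1)])
  with anorm_cls[OF cauchy_scale[OF *(1)], of c] show ?thesis
    using * LIMSEQ_unique by auto
qed

lemma Cstar_minus_add:
  assumes "X \<in> carrier (Cstar S)" "Y \<in> carrier (Cstar S)"
  shows "(X \<ominus>\<^bsub>Cstar S\<^esub> Y) \<oplus>\<^bsub>Cstar S\<^esub> Y = X"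
  using assms by (auto elim!: Cstar_cases)

text \<open>The class of a Cauchy sequence is the norm limit of its own terms. This yields density
  of the free algebra and evaluates bounded functionals along representatives.\<close>

lemma anorm_cls_minus_emb:
  assumes x: "x \<in> cauchy_seqs S"
  shows "(\<lambda>n. anorm (Cstar S) (cls S x \<ominus>\<^bsub>Cstar S\<^esub> emb S (x n))) \<longlonglongrightarrow> 0"
proof (rule LIMSEQ_I)
  fix e :: real assume "e > 0"
  then obtain M where M: "\<And>m n. m \<ge> M \<Longrightarrow> n \<ge> M \<Longrightarrow> universal_norm S (x m - x n) < e / 2"
    using cauchy_obtain[OF x, of "e / 2"] by auto
  have "anorm (Cstar S) (cls S x \<ominus>\<^bsub>Cstar S\<^esub> emb S (x n)) \<le> e / 2" if "n \<ge> M" for n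
  proof -
    have "(\<lambda>m. universal_norm S (x m - x n)) \<longlonglongrightarrow> anorm (Cstar S) (cls S x \<ominus>\<^bsub>Cstar S\<^esub> emb S (x n))"
      using anorm_cls[of "\<lambda>m. x m - x n"] x cauchy_carrier[OF x] by (simp add: emb_def)
    then show ?thesis
      by (rule LIMSEQ_le_const2) (use M that in \<open>auto intro!: exI[of _ M] less_imp_le\<close>)
  qed
  moreover have "0 \<le> anorm (Cstar S) (cls S x \<ominus>\<^bsub>Cstar S\<^esub> emb S (x n))" for n
    using x cauchy_carrier[OF x] by (intro anorm_nonneg Cstar_minus_closed) auto
  ultimately show "\<exists>M. \<forall>n\<ge>M. norm (anorm (Cstar S) (cls S x \<ominus>\<^bsub>Cstar S\<^esub> emb S (x n)) - 0) < e"
    using \<open>e > 0\<close> by (intro exI[of _ M] allI impI) (simp add: order.strict_trans1[of _ "e / 2"])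
qed

lemma emb_dense:
  assumes "X \<in> carrier (Cstar S)" "e > 0"
  obtains p where "p \<in> free_carrier S" "anorm (Cstar S) (X \<ominus>\<^bsub>Cstar S\<^esub> emb S p) < e"
proof -
  obtain x where x: "x \<in> cauchy_seqs S" "X = cls S x" using assms(1) by (rule Cstar_cases)
  from LIMSEQ_D[OF anorm_cls_minus_emb[OF x(1)] assms(2)] obtain n where
    "norm (anorm (Cstar S) (X \<ominus>\<^bsub>Cstar S\<^esub> emb S (x n)) - 0) < e" using x(2) by blast
  then show ?thesis using that[of "x n"] cauchy_carrier[OF x(1)] by auto
qed

end

section \<open>Positive functionals and states\<close>

text \<open>The polarisation step behind every Cauchy-Schwarz inequality below, with the left side
  standing for the value of a positive functional at the square of \<open>q + c p\<close>. The
  scalars 1 and \<i> give hermitian symmetry; taking \<open>c\<close> to be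
  \<open>- t * cnj B\<close> with real \<open>t\<close> gives a nonnegative real quadratic in
  \<open>t\<close>.\<close>

lemma nonneg_quadratic_complex:
  fixes A B B' D :: complex
  assumes D: "D \<in> \<real>\<^sub>\<ge>\<^sub>0" and nonneg: "\<And>c. A + c * B + cnj c * B' + c * cnj c * D \<in> \<real>\<^sub>\<ge>\<^sub>0"
  shows "B' = cnj B" "(cmod B)\<^sup>2 \<le> Re A * Re D"
proof -
  have im: "Im (A + c * B + cnj c * B' + c * cnj c * D) = 0"
    and re: "0 \<le> Re (A + c * B + cnj c * B' + c * cnj c * D)" for c
    using nonneg[of c] by (auto simp: complex_nonneg_Reals_iff)
  have D': "Im D = 0" "0 \<le> Re D" using D by (auto simp: complex_nonneg_Reals_iff)
  have "Im A = 0" using im[of 0] by simp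
  then show B': "B' = cnj B"
    using im[of 1] im[of \<i>] D' by (auto simp: complex_eq_iff)
  have real: "0 \<le> Re A - 2 * t * (cmod B)\<^sup>2 + t\<^sup>2 * (cmod B)\<^sup>2 * Re D" for t
    unfolding cmod_power2 using re[of "- of_real t * cnj B"] D'
    by (simp add: B' algebra_simps power2_eq_square)
  show "(cmod B)\<^sup>2 \<le> Re A * Re D"
  proof (cases "Re D = 0")
    case True
    have "B = 0"
    proof (rule ccontr)
      assume "B \<noteq> 0"
      then have pos: "(cmod B)\<^sup>2 > 0" by simp
      \<comment> \<open>With \<open>Re D = 0\<close> the quadratic is linear in \<open>t\<close>. At
        this \<open>t\<close> it equals \<open>- Re A - 2\<close>, which is negative because
        \<open>c = 0\<close> shows \<open>Re A\<close> to be nonnegative.\<close>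
      have "0 \<le> Re A - 2 * ((Re A + 1) / (cmod B)\<^sup>2) * (cmod B)\<^sup>2"
        using real[of "(Re A + 1) / (cmod B)\<^sup>2"] True by simp
      with pos re[of 0] show False by simp
    qed
    with True show ?thesis by simp
  next
    case False
    with D' have "Re D > 0" by simp
    \<comment> \<open>The choice \<open>t = 1 / Re D\<close> minimises the quadratic.\<close>
    have "0 \<le> Re A - 2 * (1 / Re D) * (cmod B)\<^sup>2 + (1 / Re D)\<^sup>2 * (cmod B)\<^sup>2 * Re D"
      by (rule real)
    also have "\<dots> = Re A - (cmod B)\<^sup>2 / Re D"
      using False by (simp add: power2_eq_square field_simps)
    finally show ?thesis using \<open>Re D > 0\<close> by (simp add: field_simps)
  qed
qed

definition linear_functional :: "'s monoid \<Rightarrow> ('s free_alg \<Rightarrow> complex) \<Rightarrow> bool" where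
  "linear_functional S \<omega> \<longleftrightarrow>
     (\<forall>p\<in>free_carrier S. \<forall>q\<in>free_carrier S. \<omega> (p + q) = \<omega> p + \<omega> q) \<and>
     (\<forall>c. \<forall>p\<in>free_carrier S. \<omega> (free_scale c p) = c * \<omega> p)"

definition positive_functional :: "'s monoid \<Rightarrow> ('s free_alg \<Rightarrow> complex) \<Rightarrow> bool" where
  "positive_functional S \<omega> \<longleftrightarrow> linear_functional S \<omega> \<and>
     (\<forall>p\<in>free_carrier S. \<omega> (free_star p * p) \<in> \<real>\<^sub>\<ge>\<^sub>0)"

text \<open>The restrictions of states to the image of the free algebra. The norm bound is what lets
  such a functional descend to that image and extend to the completion.\<close>

definition free_state :: "'s monoid \<Rightarrow> ('s free_alg \<Rightarrow> complex) \<Rightarrow> bool" where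
  "free_state S \<omega> \<longleftrightarrow> positive_functional S \<omega> \<and> \<omega> 1 = 1 \<and>
     (\<forall>p\<in>free_carrier S. cmod (\<omega> p) \<le> universal_norm S p)"

lemma linear_functional_lin: "linear_functional S (lin f)"
  by (simp add: linear_functional_def)

lemma linear_functional_add:
    "linear_functional S \<omega> \<Longrightarrow> p \<in> free_carrier S \<Longrightarrow> q \<in> free_carrier S \<Longrightarrow> \<omega> (p + q) = \<omega> p + \<omega> q"
  and linear_functional_scale:
    "linear_functional S \<omega> \<Longrightarrow> p \<in> free_carrier S \<Longrightarrow> \<omega> (free_scale c p) = c * \<omega> p"
  by (auto simp: linear_functional_def)

lemma linear_functional_zero: "linear_functional S \<omega> \<Longrightarrow> \<omega> 0 = 0"
  using linear_functional_scale[of S \<omega> 0 0] by simp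

lemma linear_functional_minus:
  "linear_functional S \<omega> \<Longrightarrow> p \<in> free_carrier S \<Longrightarrow> \<omega> (- p) = - \<omega> p"
  using linear_functional_scale[of S \<omega> p "-1"] by simp

lemma linear_functional_diff:
  "linear_functional S \<omega> \<Longrightarrow> p \<in> free_carrier S \<Longrightarrow> q \<in> free_carrier S \<Longrightarrow> \<omega> (p - q) = \<omega> p - \<omega> q"
  using linear_functional_add[of S \<omega> p "- q"] linear_functional_minus[of S \<omega> q] by simp

lemma linear_functional_sum:
  assumes "linear_functional S \<omega>" "\<And>a. a \<in> A \<Longrightarrow> f a \<in> free_carrier S"
  shows "\<omega> (sum f A) = (\<Sum>a\<in>A. \<omega> (f a))"
  using assms(2)
proof (induction A rule: infinite_finite_induct)
  case (insert a A)
  then have "\<omega> (f a + sum f A) = \<omega> (f a) + \<omega> (sum f A)"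
    by (intro linear_functional_add[OF assms(1)]) auto
  with insert show ?case by simp
qed (simp_all add: linear_functional_zero[OF assms(1)])

lemma linear_functional_eq_on_words:
  assumes "linear_functional S \<omega>" "linear_functional S \<omega>'"
    and "\<And>w. w \<in> words S \<Longrightarrow> \<omega> (word w) = \<omega>' (word w)" "p \<in> free_carrier S"
  shows "\<omega> p = \<omega>' p"
  using assms(4)
  by (induction rule: free_carrier_induct)
    (simp_all add: assms(3) linear_functional_zero[OF assms(1)] linear_functional_zero[OF assms(2)]
      linear_functional_add[OF assms(1)] linear_functional_add[OF assms(2)]
      linear_functional_scale[OF assms(1)] linear_functional_scale[OF assms(2)] del: free_scale_single)

lemma free_state_linear: "free_state S \<omega> \<Longrightarrow> linear_functional S \<omega>"
  by (simp add: free_state_def positive_functional_def)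

lemma free_state_positive: "free_state S \<omega> \<Longrightarrow> positive_functional S \<omega>"
  by (simp add: free_state_def)

lemma free_state_bound: "free_state S \<omega> \<Longrightarrow> p \<in> free_carrier S \<Longrightarrow> cmod (\<omega> p) \<le> universal_norm S p"
  by (simp add: free_state_def)

lemma free_state_one: "free_state S \<omega> \<Longrightarrow> \<omega> 1 = 1"
  by (simp add: free_state_def)

context
  fixes S :: "'s monoid" and \<omega>
  assumes pos: "positive_functional S \<omega>"
begin

lemma positive_functional_linear: "linear_functional S \<omega>"
  using pos by (simp add: positive_functional_def)

lemma positive_functional_nonneg: "p \<in> free_carrier S \<Longrightarrow> \<omega> (free_star p * p) \<in> \<real>\<^sub>\<ge>\<^sub>0"
  using pos by (simp add: positive_functional_def)

lemma
  assumes p: "p \<in> free_carrier S" and q: "q \<in> free_carrier S"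
  shows positive_functional_cnj: "\<omega> (free_star p * q) = cnj (\<omega> (free_star q * p))"
    and positive_functional_cauchy_schwarz:
      "(cmod (\<omega> (free_star q * p)))\<^sup>2 \<le> Re (\<omega> (free_star q * q)) * Re (\<omega> (free_star p * p))"
proof -
  have "\<omega> (free_star q * q) + c * \<omega> (free_star q * p) + cnj c * \<omega> (free_star p * q)
      + c * cnj c * \<omega> (free_star p * p) \<in> \<real>\<^sub>\<ge>\<^sub>0" for c
  proof -
    let ?x = "q + free_scale c p"
    have "free_star ?x * ?x = (free_star q * q + free_scale c (free_star q * p)) +
        (free_scale (cnj c) (free_star p * q) + free_scale (c * cnj c) (free_star p * p))"
      by (simp add: distrib_left distrib_right free_scale_mult_left free_scale_mult_right free_scale_add ac_simps)
    then have "\<omega> (free_star ?x * ?x) = \<omega> (free_star q * q) + c * \<omega> (free_star q * p) +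
        (cnj c * \<omega> (free_star p * q) + c * cnj c * \<omega> (free_star p * p))"
      using p q by (simp add: linear_functional_add[OF positive_functional_linear]
          linear_functional_scale[OF positive_functional_linear])
    then show ?thesis
      using positive_functional_nonneg[of ?x] p q by (simp add: add.assoc)
  qed
  from nonneg_quadratic_complex[OF positive_functional_nonneg[OF p] this]
  show "\<omega> (free_star p * q) = cnj (\<omega> (free_star q * p))"
    "(cmod (\<omega> (free_star q * p)))\<^sup>2 \<le> Re (\<omega> (free_star q * q)) * Re (\<omega> (free_star p * p))"
    by auto
qed

lemma positive_functional_star: "p \<in> free_carrier S \<Longrightarrow> \<omega> (free_star p) = cnj (\<omega> p)"
  using positive_functional_cnj[of p 1] by simp

end

subsection \<open>Automatic boundedness\<close>

text \<open>The iterates converge to \<open>1 - \<surd>(1 - h)\<close> when \<open>\<parallel>h\<parallel> < 1\<close>.\<close>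

fun sqrt_iter :: "'s free_alg \<Rightarrow> nat \<Rightarrow> 's free_alg" where
  "sqrt_iter h 0 = 0"
| "sqrt_iter h (Suc n) = free_scale (1/2) (h + sqrt_iter h n * sqrt_iter h n)"

context isometry_algebra
begin

lemma sqrt_iter_carrier [simp]: "h \<in> free_carrier S \<Longrightarrow> sqrt_iter h n \<in> free_carrier S"
  by (induction n) auto

lemma sqrt_iter_star: "free_star h = h \<Longrightarrow> free_star (sqrt_iter h n) = sqrt_iter h n"
  by (induction n) auto

context
  fixes \<rho> r :: real
  assumes r: "0 \<le> r" "r < 1" "\<rho> + r\<^sup>2 = 2 * r"
begin

text \<open>The equation \<open>\<rho> + r\<^sup>2 = 2 * r\<close> says that \<open>r\<close> is a
  fixed point of the scalar version of the iteration, so the bound \<open>r\<close> reproduces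
  itself at each step.\<close>

lemma norm_sqrt_iter:
  assumes h: "h \<in> free_carrier S" "universal_norm S h \<le> \<rho>"
  shows "universal_norm S (sqrt_iter h n) \<le> r"
proof (induction n)
  case (Suc n)
  let ?y = "sqrt_iter h n"
  have "universal_norm S (?y * ?y) \<le> universal_norm S ?y * universal_norm S ?y"
    using h by (intro unorm_mult) auto
  also have "\<dots> \<le> r * r" using Suc h by (intro mult_mono) (auto simp: unorm_nonneg r)
  finally have "universal_norm S (h + ?y * ?y) \<le> \<rho> + r\<^sup>2"
    using unorm_add[of h "?y * ?y"] h by (simp add: power2_eq_square)
  then show ?case using h r by (simp add: unorm_scale)
qed (use r in \<open>simp add: unorm_zero\<close>)

text \<open>A difference of squares costs a factor \<open>2 * r\<close>, and the factor 1/2 in the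
  iteration reduces it to \<open>r < 1\<close>. Different arguments and different indices are
  allowed, so that the estimate gives both convergence in the index and Lipschitz dependence on
  \<open>h\<close>.\<close>

lemma norm_sqrt_iter_diff:
  assumes h: "h \<in> free_carrier S" "universal_norm S h \<le> \<rho>"
    and h': "h' \<in> free_carrier S" "universal_norm S h' \<le> \<rho>"
  shows "universal_norm S (sqrt_iter h (Suc m) - sqrt_iter h' (Suc n)) \<le>
    universal_norm S (h - h') / 2 + r * universal_norm S (sqrt_iter h m - sqrt_iter h' n)"
proof -
  let ?y = "sqrt_iter h m" and ?y' = "sqrt_iter h' n"
  have "universal_norm S (?y * ?y - ?y' * ?y') \<le>
      universal_norm S ?y * universal_norm S (?y - ?y') + universal_norm S (?y - ?y') * universal_norm S ?y'"
    using h h' by (intro unorm_mult_diff) auto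
  also have "\<dots> \<le> r * universal_norm S (?y - ?y') + universal_norm S (?y - ?y') * r"
    using h h' norm_sqrt_iter[OF h] norm_sqrt_iter[OF h'] by (intro add_mono mult_mono) (auto simp: unorm_nonneg r)
  finally have "universal_norm S (?y * ?y - ?y' * ?y') \<le> 2 * (r * universal_norm S (?y - ?y'))" by simp
  moreover have "universal_norm S ((h - h') + (?y * ?y - ?y' * ?y')) \<le>
      universal_norm S (h - h') + universal_norm S (?y * ?y - ?y' * ?y')"
    using h h' by (intro unorm_add) auto
  moreover have "sqrt_iter h (Suc m) - sqrt_iter h' (Suc n) = free_scale (1/2) ((h - h') + (?y * ?y - ?y' * ?y'))"
    by (simp flip: free_scale_diff add: add_diff_add)
  ultimately show ?thesis using h h' by (simp add: unorm_scale)
qed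

lemma norm_sqrt_iter_step:
  assumes h: "h \<in> free_carrier S" "universal_norm S h \<le> \<rho>"
  shows "universal_norm S (sqrt_iter h (Suc n) - sqrt_iter h n) \<le> r ^ n"
proof (induction n)
  case 0
  show ?case using norm_sqrt_iter[OF h, of 1] r by simp
next
  case (Suc n)
  have "universal_norm S (sqrt_iter h (Suc (Suc n)) - sqrt_iter h (Suc n)) \<le>
      r * universal_norm S (sqrt_iter h (Suc n) - sqrt_iter h n)"
    using norm_sqrt_iter_diff[OF h h, of "Suc n" n] by (simp add: unorm_zero)
  also have "\<dots> \<le> r * r ^ n" using Suc r by (intro mult_left_mono) auto
  finally show ?case by simp
qed

text \<open>A partial geometric sum. The term \<open>r ^ m\<close> is kept because the induction on
  \<open>m\<close> closes with it.\<close>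

lemma norm_sqrt_iter_cauchy:
  assumes h: "h \<in> free_carrier S" "universal_norm S h \<le> \<rho>" and "n \<le> m"
  shows "universal_norm S (sqrt_iter h m - sqrt_iter h n) \<le> (r ^ n - r ^ m) / (1 - r)"
  using \<open>n \<le> m\<close>
proof (induction m rule: dec_induct)
  case base
  then show ?case by (simp add: unorm_zero)
next
  case (step m)
  have "universal_norm S (sqrt_iter h (Suc m) - sqrt_iter h n) \<le>
      universal_norm S (sqrt_iter h (Suc m) - sqrt_iter h m) + universal_norm S (sqrt_iter h m - sqrt_iter h n)"
    using h by (intro unorm_triangle sqrt_iter_carrier)
  also have "\<dots> \<le> r ^ m + (r ^ n - r ^ m) / (1 - r)"
    using step norm_sqrt_iter_step[OF h] by (intro add_mono)
  also have "\<dots> = (r ^ n - r ^ Suc m) / (1 - r)" using r by (simp add: field_simps)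
  finally show ?case .
qed

text \<open>The bound is the fixed point of \<open>d = \<delta> / 2 + r * d\<close>, where
  \<open>\<delta>\<close> is the distance of \<open>h\<close> and \<open>h'\<close>; it is uniform
  in the number of iterations.\<close>

lemma norm_sqrt_iter_lipschitz:
  assumes h: "h \<in> free_carrier S" "universal_norm S h \<le> \<rho>"
    and h': "h' \<in> free_carrier S" "universal_norm S h' \<le> \<rho>"
  shows "universal_norm S (sqrt_iter h n - sqrt_iter h' n) \<le> universal_norm S (h - h') / (2 * (1 - r))"
proof (induction n)
  case 0
  then show ?case using h h' r by (simp add: unorm_zero unorm_nonneg)
next
  case (Suc n)
  have "universal_norm S (sqrt_iter h (Suc n) - sqrt_iter h' (Suc n)) \<le>
      universal_norm S (h - h') / 2 + r * (universal_norm S (h - h') / (2 * (1 - r)))"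
    using norm_sqrt_iter_diff[OF h h', of n n] mult_left_mono[OF Suc r(1)] by linarith
  also have "\<dots> = universal_norm S (h - h') / (2 * (1 - r))" using r by (simp add: field_simps)
  finally show ?case .
qed

text \<open>Here \<open>h\<close> represents an element of the completion, and its square root
  series is represented by the diagonal sequence. Two of its terms are compared by changing the
  argument first and the number of iterations second.\<close>

lemma cauchy_sqrt_iter:
  assumes h: "h \<in> cauchy_seqs S" "\<And>n. universal_norm S (h n) \<le> \<rho>"
  shows "(\<lambda>n. sqrt_iter (h n) n) \<in> cauchy_seqs S"
  unfolding cauchy_seqs_def
proof (intro CollectI conjI allI impI)
  note c = cauchy_carrier[OF h(1)]
  show "sqrt_iter (h n) n \<in> free_carrier S" for n using c by simp
  fix e :: real assume e: "e > 0"
  obtain M1 where M1: "\<And>m n. m \<ge> M1 \<Longrightarrow> n \<ge> M1 \<Longrightarrow> universal_norm S (h m - h n) < e * (1 - r)"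
    using cauchy_obtain[OF h(1), of "e * (1 - r)"] e r by auto
  have "(\<lambda>n. r ^ n) \<longlonglongrightarrow> 0" using r by (intro LIMSEQ_power_zero) auto
  then obtain M2 where M2: "\<And>n. n \<ge> M2 \<Longrightarrow> norm (r ^ n - 0) < e / 2 * (1 - r)"
    using LIMSEQ_D[of "\<lambda>n. r ^ n" 0 "e / 2 * (1 - r)"] e r by auto
  have less: "universal_norm S (sqrt_iter (h m) m - sqrt_iter (h n) n) < e"
    if "m \<ge> n" "n \<ge> max M1 M2" for m n
  proof -
    have "universal_norm S (sqrt_iter (h m) m - sqrt_iter (h n) n) \<le>
        universal_norm S (sqrt_iter (h m) m - sqrt_iter (h n) m) +
        universal_norm S (sqrt_iter (h n) m - sqrt_iter (h n) n)"
      using c by (intro unorm_triangle sqrt_iter_carrier)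
    also have "\<dots> \<le> universal_norm S (h m - h n) / (2 * (1 - r)) + (r ^ n - r ^ m) / (1 - r)"
      by (intro add_mono norm_sqrt_iter_lipschitz norm_sqrt_iter_cauchy c h(2) that(1))
    also have "\<dots> < e / 2 + e / 2"
    proof (rule add_strict_mono)
      show "universal_norm S (h m - h n) / (2 * (1 - r)) < e / 2"
        using M1[of m n] that r by (simp add: field_simps)
      have "r ^ n - r ^ m < e / 2 * (1 - r)"
      proof -
        have "r ^ n < e / 2 * (1 - r)" using M2[of n] that r by simp
        with zero_le_power[OF r(1), of m] show ?thesis by linarith
      qed
      then show "(r ^ n - r ^ m) / (1 - r) < e / 2" using r by (simp add: pos_divide_less_eq)
    qed
    finally show ?thesis by simp
  qed
  have "universal_norm S (sqrt_iter (h m) m - sqrt_iter (h n) n) < e"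
    if "m \<ge> max M1 M2" "n \<ge> max M1 M2" for m n
    using less[of n m] less[of m n] that unorm_minus_commute[of "sqrt_iter (h m) m" "sqrt_iter (h n) n"] c
    by (cases "m \<ge> n") auto
  then show "\<exists>M. \<forall>m\<ge>M. \<forall>n\<ge>M. universal_norm S (sqrt_iter (h m) m - sqrt_iter (h n) n) < e" by blast
qed

text \<open>By the recursion, the defect of \<open>1 - sqrt_iter (h n) n\<close> as a square root of
  \<open>1 - h n\<close> is exactly twice the next increment of the iteration, hence at most
  \<open>2 * r ^ n\<close>.\<close>

lemma cls_sqrt_iter:
  assumes h: "h \<in> cauchy_seqs S" "\<And>n. universal_norm S (h n) \<le> \<rho>"
  shows "cls S (\<lambda>n. (1 - sqrt_iter (h n) n) * (1 - sqrt_iter (h n) n)) = cls S (\<lambda>n. 1 - h n)"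
proof (intro cls_eqI null_rel_le)
  note c = cauchy_carrier[OF h(1)]
  show "(\<lambda>n. (1 - sqrt_iter (h n) n) * (1 - sqrt_iter (h n) n)) \<in> cauchy_seqs S"
    "(\<lambda>n. 1 - h n) \<in> cauchy_seqs S"
    using cauchy_sqrt_iter[OF h] h(1) by (intro cauchy_mult cauchy_diff cauchy_const; simp)+
  show "(\<lambda>n. 2 * r ^ n) \<longlonglongrightarrow> 0"
    using tendsto_mult_right_zero[OF LIMSEQ_power_zero[of r], of 2] r by simp
  fix n
  let ?y = "sqrt_iter (h n)"
  have two: "free_scale 2 p = p + p" for p :: "'s free_alg"
    using free_scale_add_left[of 1 1 p] by simp
  have "free_scale 2 (?y (Suc n)) = h n + ?y n * ?y n" by simp
  then have "(1 - ?y n) * (1 - ?y n) - (1 - h n) = free_scale 2 (?y (Suc n) - ?y n)"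
    unfolding free_scale_diff two[of "?y n"] by (simp add: algebra_simps)
  then show "universal_norm S ((1 - ?y n) * (1 - ?y n) - (1 - h n)) \<le> 2 * r ^ n"
    using norm_sqrt_iter_step[OF c h(2), of n n] c[of n] by (simp add: unorm_scale del: sqrt_iter.simps)
qed

end

lemma
  assumes "\<phi> \<in> states (Cstar S)"
  shows states_add: "X \<in> carrier (Cstar S) \<Longrightarrow> Y \<in> carrier (Cstar S) \<Longrightarrow> \<phi> (X \<oplus>\<^bsub>Cstar S\<^esub> Y) = \<phi> X + \<phi> Y"
    and states_smult: "X \<in> carrier (Cstar S) \<Longrightarrow> \<phi> (c \<odot>\<^bsub>Cstar S\<^esub> X) = c * \<phi> X"
    and states_nonneg: "X \<in> carrier (Cstar S) \<Longrightarrow> \<phi> (star (Cstar S) X \<otimes>\<^bsub>Cstar S\<^esub> X) \<in> \<real>\<^sub>\<ge>\<^sub>0"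
    and states_one: "\<phi> (emb S 1) = 1"
  using assms by (auto simp: states_def Cstar_one)

lemma states_minus:
  assumes "\<phi> \<in> states (Cstar S)" "X \<in> carrier (Cstar S)" "Y \<in> carrier (Cstar S)"
  shows "\<phi> (X \<ominus>\<^bsub>Cstar S\<^esub> Y) = \<phi> X - \<phi> Y"
  using states_add[OF assms(1), of "X \<ominus>\<^bsub>Cstar S\<^esub> Y" Y] Cstar_minus_add[of X Y] assms by simp

text \<open>Cauchy-Schwarz against the unit, carried out in the completion itself because the
  continuity of \<open>\<phi>\<close> is not yet available.\<close>

lemma states_cauchy_schwarz:
  assumes "\<phi> \<in> states (Cstar S)" "x \<in> cauchy_seqs S"
  shows "(cmod (\<phi> (cls S x)))\<^sup>2 \<le> Re (\<phi> (cls S (\<lambda>n. free_star (x n) * x n)))"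
proof -
  let ?D = "\<phi> (cls S (\<lambda>n. free_star (x n) * x n))"
  have Q: "1 + c * \<phi> (cls S x) + cnj c * \<phi> (cls S (\<lambda>n. free_star (x n))) + c * cnj c * ?D \<in> \<real>\<^sub>\<ge>\<^sub>0" for c
  proof -
    let ?y = "\<lambda>n. 1 + free_scale c (x n)"
    have y: "?y \<in> cauchy_seqs S" using assms by (intro cauchy_add cauchy_const cauchy_scale) auto
    have "star (Cstar S) (cls S ?y) \<otimes>\<^bsub>Cstar S\<^esub> cls S ?y =
        cls S (\<lambda>n. free_star (?y n) * ?y n)"
      by (simp only: Cstar_star[OF y] Cstar_mult[OF cauchy_star[OF y] y])
    also have "(\<lambda>n. free_star (?y n) * ?y n) = (\<lambda>n. (1 + free_scale c (x n)) +
        (free_scale (cnj c) (free_star (x n)) + free_scale (c * cnj c) (free_star (x n) * x n)))"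
      by (rule ext) (simp add: distrib_left distrib_right free_scale_mult_left free_scale_mult_right free_scale_add ac_simps)
    also have "cls S \<dots> = (emb S 1 \<oplus>\<^bsub>Cstar S\<^esub> c \<odot>\<^bsub>Cstar S\<^esub> cls S x) \<oplus>\<^bsub>Cstar S\<^esub>
        (cnj c \<odot>\<^bsub>Cstar S\<^esub> cls S (\<lambda>n. free_star (x n)) \<oplus>\<^bsub>Cstar S\<^esub>
         (c * cnj c) \<odot>\<^bsub>Cstar S\<^esub> cls S (\<lambda>n. free_star (x n) * x n))"
      using assms(2) by (simp add: emb_def)
    also have "\<phi> \<dots> = 1 + c * \<phi> (cls S x) +
        (cnj c * \<phi> (cls S (\<lambda>n. free_star (x n))) + c * cnj c * ?D)"
      using assms
      by (simp add: states_add states_smult states_one del: Cstar_add Cstar_smult)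
    finally show ?thesis using states_nonneg[OF assms(1), of "cls S ?y"] y by (simp add: add.assoc)
  qed
  have D: "?D \<in> \<real>\<^sub>\<ge>\<^sub>0" using states_nonneg[OF assms(1), of "cls S x"] assms(2) by simp
  show ?thesis using nonneg_quadratic_complex(2)[OF D Q] by simp
qed

text \<open>A square root \<open>w\<close> of \<open>1 - x* x\<close> is self-adjoint, so positivity
  at \<open>w* w\<close> gives \<open>\<phi> (x* x) \<le> 1\<close>. Cauchy-Schwarz then bounds
  \<open>\<phi> x\<close> itself.\<close>

lemma states_le_one:
  assumes \<phi>: "\<phi> \<in> states (Cstar S)" and x: "x \<in> cauchy_seqs S"
    and b: "b < 1" "\<And>n. universal_norm S (x n) \<le> b"
  shows "cmod (\<phi> (cls S x)) \<le> 1"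
proof -
  note c = cauchy_carrier[OF x]
  let ?h = "\<lambda>n. free_star (x n) * x n"
  have h: "?h \<in> cauchy_seqs S" using x by simp
  have "0 \<le> b" using unorm_nonneg[OF c[of 0]] b(2)[of 0] by simp
  \<comment> \<open>The smaller root of \<open>b\<^sup>2 + r\<^sup>2 = 2 * r\<close>, as the
    iteration requires; \<open>b < 1\<close> makes it less than 1.\<close>
  define r where "r = 1 - sqrt (1 - b\<^sup>2)"
  have b2: "b\<^sup>2 < 1" using b \<open>0 \<le> b\<close> by (simp add: power_less_one_iff)
  then have r: "0 \<le> r" "r < 1" "b\<^sup>2 + r\<^sup>2 = 2 * r"
    by (auto simp: r_def power2_diff)
  have bound: "universal_norm S (?h n) \<le> b\<^sup>2" for n
    using c b(2) by (simp add: unorm_cstar power_mono unorm_nonneg)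
  define w where "w = (\<lambda>n. 1 - sqrt_iter (?h n) n)"
  have w: "w \<in> cauchy_seqs S"
    unfolding w_def using cauchy_sqrt_iter[OF r h bound] by (intro cauchy_diff cauchy_const) auto
  have "free_star (w n) = w n" for n by (simp add: w_def sqrt_iter_star)
  then have "star (Cstar S) (cls S w) \<otimes>\<^bsub>Cstar S\<^esub> cls S w = cls S (\<lambda>n. w n * w n)"
    using w cauchy_star[OF w] by simp
  also have "\<dots> = cls S (\<lambda>n. 1 - ?h n)"
    unfolding w_def by (rule cls_sqrt_iter[OF r h bound])
  also have "\<dots> = emb S 1 \<ominus>\<^bsub>Cstar S\<^esub> cls S ?h" using h by (simp add: emb_def)
  finally have "\<phi> (star (Cstar S) (cls S w) \<otimes>\<^bsub>Cstar S\<^esub> cls S w) = 1 - \<phi> (cls S ?h)"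
    using h \<phi> by (simp add: states_minus states_one)
  with states_nonneg[OF \<phi>, of "cls S w"] w have "Re (\<phi> (cls S ?h)) \<le> 1"
    by (simp add: complex_nonneg_Reals_iff)
  with states_cauchy_schwarz[OF \<phi> x] have "(cmod (\<phi> (cls S x)))\<^sup>2 \<le> 1\<^sup>2" by simp
  then show ?thesis by (rule power2_le_imp_le) simp
qed

text \<open>Dropping initial terms replaces a representative by one whose terms all obey a bound
  that originally held only eventually.\<close>

lemma cauchy_shift:
  assumes x: "x \<in> cauchy_seqs S"
  shows "(\<lambda>n. x (n + k)) \<in> cauchy_seqs S" "cls S (\<lambda>n. x (n + k)) = cls S x"
proof -
  note c = cauchy_carrier[OF x]
  show 1: "(\<lambda>n. x (n + k)) \<in> cauchy_seqs S"
    unfolding cauchy_seqs_def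
  proof (intro CollectI conjI allI impI)
    fix e :: real assume "e > 0"
    then obtain M where "\<And>m n. m \<ge> M \<Longrightarrow> n \<ge> M \<Longrightarrow> universal_norm S (x m - x n) < e"
      using cauchy_obtain[OF x] by blast
    then show "\<exists>M. \<forall>m\<ge>M. \<forall>n\<ge>M. universal_norm S (x (m + k) - x (n + k)) < e"
      by (intro exI[of _ M]) auto
  qed (rule c)
  have "(\<lambda>n. universal_norm S (x (n + k) - x n)) \<longlonglongrightarrow> 0"
  proof (rule LIMSEQ_I)
    fix e :: real assume "e > 0"
    then obtain M where "\<And>m n. m \<ge> M \<Longrightarrow> n \<ge> M \<Longrightarrow> universal_norm S (x m - x n) < e"
      using cauchy_obtain[OF x] by blast
    then show "\<exists>M. \<forall>n\<ge>M. norm (universal_norm S (x (n + k) - x n) - 0) < e"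
      using c by (intro exI[of _ M]) (auto simp: unorm_nonneg)
  qed
  then show "cls S (\<lambda>n. x (n + k)) = cls S x" using cls_eq_iff[OF 1 x] by simp
qed

lemma states_bound:
  assumes \<phi>: "\<phi> \<in> states (Cstar S)" and X: "X \<in> carrier (Cstar S)"
  shows "cmod (\<phi> X) \<le> anorm (Cstar S) X"
proof -
  have less: "cmod (\<phi> X) \<le> 1" if X: "X \<in> carrier (Cstar S)" and lt: "anorm (Cstar S) X < 1" for X
  proof -
    obtain x where x: "x \<in> cauchy_seqs S" "X = cls S x" using X by (rule Cstar_cases)
    obtain b where b: "anorm (Cstar S) X < b" "b < 1" using dense lt by blast
    have "eventually (\<lambda>n. universal_norm S (x n) < b) sequentially"
      using order_tendstoD(2)[OF anorm_cls[OF x(1)]] b x(2) by simp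
    then obtain k where "\<And>n. n \<ge> k \<Longrightarrow> universal_norm S (x n) < b"
      by (auto simp: eventually_sequentially)
    then have "cmod (\<phi> (cls S (\<lambda>n. x (n + k)))) \<le> 1"
      by (intro states_le_one[OF \<phi> cauchy_shift(1)[OF x(1)] b(2)]) (simp add: less_imp_le)
    then show ?thesis using cauchy_shift(2)[OF x(1)] x(2) by simp
  qed
  show ?thesis
  proof (rule field_le_epsilon)
    fix e :: real assume "e > 0"
    \<comment> \<open>Adding \<open>e\<close> makes the rescaled element have norm strictly below 1
      and also covers an element of norm 0.\<close>
    let ?a = "anorm (Cstar S) X + e"
    have a: "?a > 0" using anorm_nonneg[OF X] \<open>e > 0\<close> by simp
    have "cmod (\<phi> (of_real (inverse ?a) \<odot>\<^bsub>Cstar S\<^esub> X)) \<le> 1"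
      using X a \<open>e > 0\<close> by (intro less) (auto simp: anorm_smult norm_inverse norm_divide field_simps simp del: of_real_inverse of_real_add)
    then show "cmod (\<phi> X) \<le> ?a"
      using X a by (simp add: states_smult[OF \<phi>] norm_mult norm_inverse norm_divide field_simps del: of_real_inverse of_real_add)
  qed
qed

end

subsection \<open>The Gelfand--Naimark--Segal seminorm\<close>

text \<open>The last assumption says that \<omega> kills the two-sided ideal of the relators.
  Boundedness by the universal norm is the conclusion drawn in this locale.\<close>

locale gns = isometry_algebra S for S :: "'s monoid" +
  fixes \<omega> :: "'s free_alg \<Rightarrow> complex"
  assumes pos: "positive_functional S \<omega>"
    and unital: "\<omega> 1 = 1"
    and relators_zero: "\<lbrakk>a \<in> free_carrier S; b \<in> free_carrier S; x \<in> relators S\<rbrakk> \<Longrightarrow> \<omega> (a * x * b) = 0"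
begin

lemmas lin_add = linear_functional_add[OF positive_functional_linear[OF pos]]
  and lin_scale = linear_functional_scale[OF positive_functional_linear[OF pos]]
  and lin_zero = linear_functional_zero[OF positive_functional_linear[OF pos]]
  and lin_diff = linear_functional_diff[OF positive_functional_linear[OF pos]]
  and lin_minus = linear_functional_minus[OF positive_functional_linear[OF pos]]

text \<open>The length of the vector that \<open>b\<close> represents in the GNS space. Null vectors
  are not divided out, so this is only a seminorm.\<close>

definition vnorm :: "'s free_alg \<Rightarrow> real" where
  "vnorm b = sqrt (Re (\<omega> (free_star b * b)))"

lemma vnorm_nonneg: "b \<in> free_carrier S \<Longrightarrow> 0 \<le> vnorm b"
  and vnorm_square: "b \<in> free_carrier S \<Longrightarrow> (vnorm b)\<^sup>2 = Re (\<omega> (free_star b * b))"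
  using positive_functional_nonneg[OF pos, of b]
  by (auto simp: vnorm_def complex_nonneg_Reals_iff)

lemma vnorm_cauchy_schwarz:
  assumes "a \<in> free_carrier S" "b \<in> free_carrier S"
  shows "cmod (\<omega> (free_star a * b)) \<le> vnorm a * vnorm b"
proof -
  have "(cmod (\<omega> (free_star a * b)))\<^sup>2 \<le> (vnorm a * vnorm b)\<^sup>2"
    using positive_functional_cauchy_schwarz[OF pos assms(2,1)] assms
    by (simp add: power_mult_distrib vnorm_square)
  then show ?thesis by (rule power2_le_imp_le) (use assms vnorm_nonneg in auto)
qed

lemma vnorm_add:
  assumes a: "a \<in> free_carrier S" and b: "b \<in> free_carrier S"
  shows "vnorm (a + b) \<le> vnorm a + vnorm b"
proof -
  have "free_star (a + b) * (a + b) =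
      (free_star a * a + free_star a * b) + (free_star b * a + free_star b * b)"
    by (simp add: distrib_left distrib_right)
  then have "(vnorm (a + b))\<^sup>2 =
      (vnorm a)\<^sup>2 + Re (\<omega> (free_star a * b)) + (Re (\<omega> (free_star b * a)) + (vnorm b)\<^sup>2)"
    using a b by (simp add: vnorm_square lin_add)
  also have "\<dots> \<le> (vnorm a)\<^sup>2 + vnorm a * vnorm b + (vnorm b * vnorm a + (vnorm b)\<^sup>2)"
    using vnorm_cauchy_schwarz[OF a b] vnorm_cauchy_schwarz[OF b a]
      complex_Re_le_cmod[of "\<omega> (free_star a * b)"] complex_Re_le_cmod[of "\<omega> (free_star b * a)"]
    by linarith
  also have "\<dots> = (vnorm a + vnorm b)\<^sup>2" by (simp add: power2_eq_square algebra_simps)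
  finally show ?thesis by (rule power2_le_imp_le) (use a b vnorm_nonneg in auto)
qed

lemma vnorm_scale:
  assumes "b \<in> free_carrier S" shows "vnorm (free_scale c b) = cmod c * vnorm b"
proof -
  have "\<omega> (free_star (free_scale c b) * free_scale c b) = cnj c * c * \<omega> (free_star b * b)"
    using assms by (simp add: free_scale_mult_left free_scale_mult_right lin_scale mult.commute)
  also have "cnj c * c = of_real ((cmod c)\<^sup>2)"
    by (metis complex_norm_square mult.commute)
  finally have "Re (\<omega> (free_star (free_scale c b) * free_scale c b)) = (cmod c)\<^sup>2 * Re (\<omega> (free_star b * b))"
    by simp
  then show ?thesis by (simp add: vnorm_def real_sqrt_mult)
qed

lemma vnorm_zero: "vnorm 0 = 0"
  by (simp add: vnorm_def lin_zero)

lemma vnorm_one: "vnorm 1 = 1"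
  by (simp add: vnorm_def unital)

lemma vnorm_sum:
  "(\<And>a. a \<in> A \<Longrightarrow> f a \<in> free_carrier S) \<Longrightarrow> vnorm (sum f A) \<le> (\<Sum>a\<in>A. vnorm (f a))"
proof (induction A rule: infinite_finite_induct)
  case (insert a A)
  then have "vnorm (f a + sum f A) \<le> vnorm (f a) + vnorm (sum f A)" by (intro vnorm_add) auto
  with insert show ?case by auto
qed (auto simp: vnorm_zero)

text \<open>The two vector lengths differ by the value of \<omega> on an element of the ideal
  containing \<open>v_s* v_s - 1\<close>.\<close>

lemma vnorm_gen:
  assumes s: "s \<in> carrier S" and b: "b \<in> free_carrier S"
  shows "vnorm (free_gen s * b) = vnorm b"
proof -
  have "free_star (free_gen s * b) * (free_gen s * b) =
      free_star b * (free_star (free_gen s) * free_gen s - 1) * b + free_star b * b"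
    by (simp add: algebra_simps)
  then have "\<omega> (free_star (free_gen s * b) * (free_gen s * b)) = \<omega> (free_star b * b)"
    using s b relators_zero[OF _ _ relators_intros(2), of "free_star b" b s] by (simp add: lin_add)
  then show ?thesis by (simp add: vnorm_def)
qed

text \<open>The projection \<open>1 - v\<^sub>s v\<^sub>s\<^sup>*\<close> is positive.\<close>

lemma vnorm_adj:
  assumes s: "s \<in> carrier S" and b: "b \<in> free_carrier S"
  shows "vnorm (free_star (free_gen s) * b) \<le> vnorm b"
proof -
  let ?v = "free_gen s" and ?a = "free_star (free_gen s)"
  let ?c = "b - ?v * (?a * b)"
  have "free_star ?c * ?c = (free_star b * b - free_star (?a * b) * (?a * b)) +
      (free_star b * ?v) * (?a * ?v - 1) * (?a * b)"
    by (simp add: algebra_simps)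
  then have "\<omega> (free_star ?c * ?c) = \<omega> (free_star b * b) - \<omega> (free_star (?a * b) * (?a * b))"
    using s b relators_zero[OF _ _ relators_intros(2), of "free_star b * ?v" "?a * b" s]
    by (simp add: lin_add lin_diff)
  moreover have "0 \<le> Re (\<omega> (free_star ?c * ?c))"
    using positive_functional_nonneg[OF pos, of ?c] s b by (simp add: complex_nonneg_Reals_iff)
  ultimately show ?thesis by (simp add: vnorm_def)
qed

lemma vnorm_word:
  assumes b: "b \<in> free_carrier S"
  shows "w \<in> words S \<Longrightarrow> vnorm (word w * b) \<le> vnorm b"
proof (induction w)
  case (Cons l w)
  have "word (l # w) * b = word [l] * (word w * b)"
    by (simp add: word_mult flip: mult.assoc)
  then have "vnorm (word (l # w) * b) \<le> vnorm (word w * b)"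
    using Cons.prems b by (cases l) (simp_all add: word_Gen word_Adj vnorm_gen vnorm_adj)
  with Cons show ?case by auto
qed (simp add: word_Nil)

lemma vnorm_l1:
  assumes p: "p \<in> free_carrier S" and b: "b \<in> free_carrier S"
  shows "vnorm (p * b) \<le> l1_norm p * vnorm b"
proof -
  have w: "w \<in> words S" if "w \<in> Poly_Mapping.keys p" for w
    using keys_subset_words[OF p] that by auto
  have "p * b = (\<Sum>w\<in>Poly_Mapping.keys p. free_scale (Poly_Mapping.lookup p w) (word w * b))"
    by (subst word_expansion[of p]) (simp add: sum_distrib_right free_scale_mult_left del: free_scale_single)
  then have "vnorm (p * b) \<le> (\<Sum>w\<in>Poly_Mapping.keys p. vnorm (free_scale (Poly_Mapping.lookup p w) (word w * b)))"
    using w b by (simp add: vnorm_sum)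
  also have "\<dots> \<le> (\<Sum>w\<in>Poly_Mapping.keys p. cmod (Poly_Mapping.lookup p w) * vnorm b)"
    using w b by (intro sum_mono) (simp add: vnorm_scale vnorm_word mult_left_mono)
  finally show ?thesis by (simp add: l1_norm_def sum_distrib_right)
qed

text \<open>The operator norm of left multiplication by \<open>x\<close> on the pre-Hilbert space.
  Words act as contractions, so it is bounded by \<open>l1_norm x\<close>.\<close>

definition opnorm :: "'s free_alg \<Rightarrow> real" where
  "opnorm x = (SUP b\<in>{b \<in> free_carrier S. vnorm b \<le> 1}. vnorm (x * b))"

lemma l1_norm_nonneg: "0 \<le> l1_norm x"
  by (simp add: l1_norm_def sum_nonneg)

lemma opnorm_upper:
  assumes x: "x \<in> free_carrier S" and b: "b \<in> free_carrier S"
  shows "vnorm (x * b) \<le> opnorm x * vnorm b"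
proof -
  have unit: "vnorm (x * b) \<le> opnorm x" if "b \<in> free_carrier S" "vnorm b \<le> 1" for b
    unfolding opnorm_def
  proof (rule cSUP_upper)
    have "vnorm (x * b) \<le> l1_norm x" if "b \<in> free_carrier S" "vnorm b \<le> 1" for b
      using vnorm_l1[OF x that(1)] mult_left_le[OF that(2) l1_norm_nonneg[of x]] by simp
    then show "bdd_above ((\<lambda>b. vnorm (x * b)) ` {b \<in> free_carrier S. vnorm b \<le> 1})"
      by (intro bdd_aboveI[where M = "l1_norm x"]) auto
  qed (use that in auto)
  show ?thesis
  proof (cases "vnorm b = 0")
    \<comment> \<open>A null vector cannot be normalised; the \<open>l1_norm\<close> bound shows
      that left multiplication keeps it null.\<close>
    case True
    then show ?thesis using vnorm_l1[OF x b] by simp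
  next
    case False
    with vnorm_nonneg[OF b] have v: "vnorm b > 0" by simp
    let ?c = "complex_of_real (1 / vnorm b)"
    have "vnorm (x * free_scale ?c b) \<le> opnorm x"
      using b v by (intro unit) (auto simp: vnorm_scale norm_divide)
    then show ?thesis using x b v
      by (simp add: free_scale_mult_right vnorm_scale norm_divide field_simps)
  qed
qed

lemma opnorm_least:
  assumes "\<And>b. b \<in> free_carrier S \<Longrightarrow> vnorm b \<le> 1 \<Longrightarrow> vnorm (x * b) \<le> M"
  shows "opnorm x \<le> M"
  unfolding opnorm_def
proof (rule cSUP_least)
  show "{b \<in> free_carrier S. vnorm b \<le> 1} \<noteq> {}"
    using vnorm_zero by (auto intro!: exI[of _ 0])
qed (use assms in auto)

lemma opnorm_nonneg: "x \<in> free_carrier S \<Longrightarrow> 0 \<le> opnorm x"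
  using opnorm_upper[of x 1] vnorm_nonneg[of x] by (simp add: vnorm_one)

lemma opnorm_le_of_bound:
  assumes "0 \<le> M" "\<And>b. b \<in> free_carrier S \<Longrightarrow> vnorm (x * b) \<le> M * vnorm b"
  shows "opnorm x \<le> M"
proof (rule opnorm_least)
  fix b assume "b \<in> free_carrier S" "vnorm b \<le> 1"
  then show "vnorm (x * b) \<le> M" using assms(2)[of b] mult_left_le[of "vnorm b" M] assms(1) by simp
qed

lemma opnorm_mult:
  assumes "x \<in> free_carrier S" "y \<in> free_carrier S"
  shows "opnorm (x * y) \<le> opnorm x * opnorm y"
proof (rule opnorm_le_of_bound)
  fix b assume b: "b \<in> free_carrier S"
  have "vnorm (x * (y * b)) \<le> opnorm x * vnorm (y * b)" using assms b by (intro opnorm_upper) auto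
  also have "\<dots> \<le> opnorm x * (opnorm y * vnorm b)"
    using assms b by (intro mult_left_mono opnorm_upper opnorm_nonneg)
  finally show "vnorm (x * y * b) \<le> opnorm x * opnorm y * vnorm b" by (simp add: mult.assoc)
qed (use assms opnorm_nonneg in auto)

lemma opnorm_add:
  assumes "x \<in> free_carrier S" "y \<in> free_carrier S"
  shows "opnorm (x + y) \<le> opnorm x + opnorm y"
proof (rule opnorm_le_of_bound)
  fix b assume b: "b \<in> free_carrier S"
  have "vnorm (x * b + y * b) \<le> vnorm (x * b) + vnorm (y * b)" using assms b by (intro vnorm_add) auto
  also have "\<dots> \<le> opnorm x * vnorm b + opnorm y * vnorm b"
    using assms b by (intro add_mono opnorm_upper)
  finally show "vnorm ((x + y) * b) \<le> (opnorm x + opnorm y) * vnorm b" by (simp add: distrib_right)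
qed (use assms opnorm_nonneg in auto)

lemma opnorm_scale_le:
  assumes "x \<in> free_carrier S" shows "opnorm (free_scale c x) \<le> cmod c * opnorm x"
proof (rule opnorm_le_of_bound)
  fix b assume b: "b \<in> free_carrier S"
  have "vnorm (free_scale c x * b) = cmod c * vnorm (x * b)"
    using assms b by (simp add: free_scale_mult_left vnorm_scale)
  also have "\<dots> \<le> cmod c * (opnorm x * vnorm b)"
    using assms b by (intro mult_left_mono opnorm_upper) auto
  finally show "vnorm (free_scale c x * b) \<le> cmod c * opnorm x * vnorm b" by simp
qed (use assms opnorm_nonneg in auto)

lemma opnorm_scale:
  assumes x: "x \<in> free_carrier S" shows "opnorm (free_scale c x) = cmod c * opnorm x"
proof (cases "c = 0")
  case True
  then show ?thesis using opnorm_scale_le[OF x, of 0] opnorm_nonneg[of 0] by simp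
next
  case False
  have "opnorm x \<le> cmod (inverse c) * opnorm (free_scale c x)"
    using opnorm_scale_le[of "free_scale c x" "inverse c"] x False by simp
  then have "cmod c * opnorm x \<le> opnorm (free_scale c x)"
    using False by (simp add: norm_inverse norm_divide field_simps)
  with opnorm_scale_le[OF x, of c] show ?thesis by simp
qed

text \<open>The square of the length of \<open>x b\<close> is the inner product of \<open>b\<close>
  with \<open>x* x b\<close>, to which Cauchy-Schwarz is applied.\<close>

lemma opnorm_square_le:
  assumes x: "x \<in> free_carrier S" shows "(opnorm x)\<^sup>2 \<le> opnorm (free_star x * x)"
proof -
  have "opnorm x \<le> sqrt (opnorm (free_star x * x))"
  proof (rule opnorm_least)
    fix b assume b: "b \<in> free_carrier S" "vnorm b \<le> 1"
    have "(vnorm (x * b))\<^sup>2 = Re (\<omega> (free_star b * (free_star x * x * b)))"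
      using x b by (simp add: vnorm_square mult.assoc)
    also have "\<dots> \<le> vnorm b * vnorm (free_star x * x * b)"
      using vnorm_cauchy_schwarz[of b "free_star x * x * b"] complex_Re_le_cmod x b
      by (meson free_carrier_mult free_star_carrier order_trans)
    also have "\<dots> \<le> 1 * (opnorm (free_star x * x) * vnorm b)"
      using x b opnorm_upper[of "free_star x * x" b] by (intro mult_mono) (auto simp: vnorm_nonneg)
    also have "\<dots> \<le> opnorm (free_star x * x)"
      using b x by (simp add: mult_left_le opnorm_nonneg)
    finally show "vnorm (x * b) \<le> sqrt (opnorm (free_star x * x))" by (rule real_le_rsqrt)
  qed
  then have "(opnorm x)\<^sup>2 \<le> (sqrt (opnorm (free_star x * x)))\<^sup>2"
    using x by (intro power_mono opnorm_nonneg)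
  then show ?thesis using x by (simp add: opnorm_nonneg)
qed

lemma opnorm_star_le:
  assumes x: "x \<in> free_carrier S" shows "opnorm (free_star x) \<le> opnorm x"
proof (cases "opnorm (free_star x) = 0")
  case False
  then have "opnorm (free_star x) > 0" using opnorm_nonneg[of "free_star x"] x by simp
  moreover have "opnorm (free_star x) * opnorm (free_star x) \<le> opnorm x * opnorm (free_star x)"
    using opnorm_square_le[of "free_star x"] opnorm_mult[of x "free_star x"] x by (simp add: power2_eq_square)
  ultimately show ?thesis by simp
qed (use x opnorm_nonneg in simp)

lemma opnorm_cstar:
  assumes x: "x \<in> free_carrier S" shows "opnorm (free_star x * x) = (opnorm x)\<^sup>2"
proof (rule antisym)
  have "opnorm (free_star x * x) \<le> opnorm (free_star x) * opnorm x" using x by (intro opnorm_mult) auto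
  also have "\<dots> \<le> opnorm x * opnorm x"
    using x by (intro mult_right_mono opnorm_star_le opnorm_nonneg)
  finally show "opnorm (free_star x * x) \<le> (opnorm x)\<^sup>2" by (simp add: power2_eq_square)
qed (rule opnorm_square_le[OF x])

text \<open>The square of the length of \<open>x b\<close> is \<omega> evaluated in the ideal
  generated by the relator \<open>x\<close>.\<close>

lemma opnorm_relator:
  assumes x: "x \<in> relators S" shows "opnorm x = 0"
proof (rule antisym)
  have xc: "x \<in> free_carrier S" using x by (rule relators_carrier)
  show "opnorm x \<le> 0"
  proof (rule opnorm_least)
    fix b assume b: "b \<in> free_carrier S"
    have "\<omega> (free_star b * free_star x * x * b) = 0"
      using xc b x by (intro relators_zero) auto
    then show "vnorm (x * b) \<le> 0" by (simp add: vnorm_def mult.assoc)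
  qed
  show "0 \<le> opnorm x" by (rule opnorm_nonneg[OF xc])
qed

lemma opnorm_cstar_seminorm: "cstar_seminorm S opnorm"
  unfolding cstar_seminorm_def
  using opnorm_nonneg opnorm_add opnorm_scale opnorm_mult opnorm_cstar opnorm_relator by blast

text \<open>The value \<open>\<omega> p\<close> is the matrix coefficient of \<open>p\<close> at the
  unit vector represented by 1, hence at most \<open>opnorm p\<close>.\<close>

lemma gns_free_state: "free_state S \<omega>"
  unfolding free_state_def
proof (intro conjI ballI)
  fix p assume p: "p \<in> free_carrier S"
  have "cmod (\<omega> p) \<le> vnorm 1 * vnorm p" using vnorm_cauchy_schwarz[of 1 p] p by simp
  also have "\<dots> \<le> opnorm p" using opnorm_upper[OF p, of 1] by (simp add: vnorm_one)
  also have "\<dots> \<le> universal_norm S p" using opnorm_cstar_seminorm p by (rule seminorm_le_universal)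
  finally show "cmod (\<omega> p) \<le> universal_norm S p" .
qed (use pos unital in auto)

end

subsection \<open>Extension to the completion\<close>

text \<open>Extension by continuity, with an arbitrarily chosen representative;
  \<open>state_ext_cls\<close> shows that every representative gives the same limit. The restriction
  to the carrier makes the result extensional, as \<open>states\<close> demands.\<close>

definition state_ext :: "'s monoid \<Rightarrow> ('s free_alg \<Rightarrow> complex) \<Rightarrow> 's cstar_elem \<Rightarrow> complex" where
  "state_ext S \<omega> = (\<lambda>X\<in>carrier (Cstar S). lim (\<lambda>n. \<omega> ((SOME x. x \<in> cauchy_seqs S \<and> X = cls S x) n)))"

context isometry_algebra
begin

lemma free_state_diff_bound:
  assumes "free_state S \<omega>" "p \<in> free_carrier S" "q \<in> free_carrier S"
  shows "cmod (\<omega> p - \<omega> q) \<le> universal_norm S (p - q)"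
  using free_state_bound[OF assms(1), of "p - q"] assms
  by (simp add: linear_functional_diff[OF free_state_linear[OF assms(1)]])

lemma free_state_eqv: "free_state S \<omega> \<Longrightarrow> eqv p q \<Longrightarrow> \<omega> p = \<omega> q"
  using free_state_diff_bound[of \<omega> p q] by (auto simp: eqv_def)

lemma state_ext_cls:
  assumes \<omega>: "free_state S \<omega>" and x: "x \<in> cauchy_seqs S"
  shows "(\<lambda>n. \<omega> (x n)) \<longlonglongrightarrow> state_ext S \<omega> (cls S x)"
proof -
  define y where "y = (SOME y. y \<in> cauchy_seqs S \<and> cls S x = cls S y)"
  have y: "y \<in> cauchy_seqs S" "cls S x = cls S y"
    unfolding y_def using someI[of "\<lambda>y. y \<in> cauchy_seqs S \<and> cls S x = cls S y" x] x by blast+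
  note c = cauchy_carrier[OF x] cauchy_carrier[OF y(1)]
  have "Cauchy (\<lambda>n. \<omega> (y n))"
  proof (rule CauchyI)
    fix e :: real assume "e > 0"
    then obtain M where M: "\<And>m n. m \<ge> M \<Longrightarrow> n \<ge> M \<Longrightarrow> universal_norm S (y m - y n) < e"
      using cauchy_obtain[OF y(1)] by blast
    show "\<exists>M. \<forall>m\<ge>M. \<forall>n\<ge>M. cmod (\<omega> (y m) - \<omega> (y n)) < e"
      by (intro exI[of _ M] allI impI le_less_trans[OF free_state_diff_bound[OF \<omega> c(2) c(2)]] M)
  qed
  then have "(\<lambda>n. \<omega> (y n)) \<longlonglongrightarrow> lim (\<lambda>n. \<omega> (y n))"
    by (simp add: Cauchy_convergent_iff convergent_LIMSEQ_iff)
  also have "lim (\<lambda>n. \<omega> (y n)) = state_ext S \<omega> (cls S x)"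
    unfolding state_ext_def y_def restrict_apply' [OF cls_carrier[OF x]] ..
  finally have lim: "(\<lambda>n. \<omega> (y n)) \<longlonglongrightarrow> state_ext S \<omega> (cls S x)" .
  have "(\<lambda>n. \<omega> (x n) - \<omega> (y n)) \<longlonglongrightarrow> 0"
  proof (rule Lim_null_comparison)
    show "\<forall>\<^sub>F n in sequentially. cmod (\<omega> (x n) - \<omega> (y n)) \<le> universal_norm S (x n - y n)"
      by (intro always_eventually allI free_state_diff_bound[OF \<omega> c])
    show "(\<lambda>n. universal_norm S (x n - y n)) \<longlonglongrightarrow> 0"
      using cls_eq_iff[OF x y(1)] y(2) by blast
  qed
  from tendsto_add[OF this lim] show ?thesis by simp
qed

lemma state_ext_emb:
  assumes "free_state S \<omega>" "p \<in> free_carrier S"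
  shows "state_ext S \<omega> (emb S p) = \<omega> p"
  using state_ext_cls[OF assms(1) cauchy_const[OF assms(2)]] by (simp add: emb_def LIMSEQ_const_iff)

lemma state_ext_states:
  assumes \<omega>: "free_state S \<omega>" shows "state_ext S \<omega> \<in> states (Cstar S)"
  unfolding states_def
proof (intro CollectI conjI ballI allI)
  note L = free_state_linear[OF \<omega>]
  show "state_ext S \<omega> \<in> extensional (carrier (Cstar S))" by (simp add: state_ext_def)
  show "state_ext S \<omega> \<one>\<^bsub>Cstar S\<^esub> = 1"
    by (simp add: Cstar_one state_ext_emb[OF \<omega>] free_state_one[OF \<omega>])
  fix X assume "X \<in> carrier (Cstar S)"
  then obtain x where x: "x \<in> cauchy_seqs S" "X = cls S x" by (rule Cstar_cases)
  note c = cauchy_carrier[OF x(1)]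
  note lim = state_ext_cls[OF \<omega>]
  show "state_ext S \<omega> (c \<odot>\<^bsub>Cstar S\<^esub> X) = c * state_ext S \<omega> X" for c
    using LIMSEQ_unique[OF lim[OF cauchy_scale[OF x(1), of c]]]
      tendsto_mult[OF tendsto_const[of c] lim[OF x(1)]] x c
    by (simp add: linear_functional_scale[OF L])
  have "state_ext S \<omega> (cls S (\<lambda>n. free_star (x n) * x n)) \<in> \<real>\<^sub>\<ge>\<^sub>0"
    using positive_functional_nonneg[OF free_state_positive[OF \<omega>]] c
    by (intro closed_sequentially[OF closed_nonneg_Reals_complex _ lim]) (use x in auto)
  then show "state_ext S \<omega> (star (Cstar S) X \<otimes>\<^bsub>Cstar S\<^esub> X) \<in> \<real>\<^sub>\<ge>\<^sub>0" using x by simp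
  fix Y assume "Y \<in> carrier (Cstar S)"
  then obtain y where y: "y \<in> cauchy_seqs S" "Y = cls S y" by (rule Cstar_cases)
  show "state_ext S \<omega> (X \<oplus>\<^bsub>Cstar S\<^esub> Y) = state_ext S \<omega> X + state_ext S \<omega> Y"
    using LIMSEQ_unique[OF lim[OF cauchy_add[OF x(1) y(1)]]]
      tendsto_add[OF lim[OF x(1)] lim[OF y(1)]] x y c cauchy_carrier[OF y(1)]
    by (simp add: linear_functional_add[OF L])
qed

lemma states_emb_lim:
  assumes \<phi>: "\<phi> \<in> states (Cstar S)" and x: "x \<in> cauchy_seqs S"
  shows "(\<lambda>n. \<phi> (emb S (x n))) \<longlonglongrightarrow> \<phi> (cls S x)"
proof -
  have "(\<lambda>n. \<phi> (cls S x) - \<phi> (emb S (x n))) \<longlonglongrightarrow> 0"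
  proof (rule Lim_null_comparison[OF _ anorm_cls_minus_emb[OF x]])
    show "\<forall>\<^sub>F n in sequentially. cmod (\<phi> (cls S x) - \<phi> (emb S (x n))) \<le>
        anorm (Cstar S) (cls S x \<ominus>\<^bsub>Cstar S\<^esub> emb S (x n))"
    proof (rule always_eventually, rule allI)
      fix n
      have e: "emb S (x n) \<in> carrier (Cstar S)" using cauchy_carrier[OF x] by simp
      show "cmod (\<phi> (cls S x) - \<phi> (emb S (x n))) \<le> anorm (Cstar S) (cls S x \<ominus>\<^bsub>Cstar S\<^esub> emb S (x n))"
        using states_bound[OF \<phi> Cstar_minus_closed[OF cls_carrier[OF x] e]]
          states_minus[OF \<phi> cls_carrier[OF x] e] by simp
    qed
  qed
  from tendsto_diff[OF tendsto_const[of "\<phi> (cls S x)"] this] show ?thesis by simp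
qed

lemma states_free_state:
  assumes \<phi>: "\<phi> \<in> states (Cstar S)" shows "free_state S (\<lambda>p. \<phi> (emb S p))"
  unfolding free_state_def positive_functional_def linear_functional_def
proof (intro conjI ballI allI)
  fix p assume p: "p \<in> free_carrier S"
  show "\<phi> (emb S (free_star p * p)) \<in> \<real>\<^sub>\<ge>\<^sub>0"
    using states_nonneg[OF \<phi>, of "emb S p"] p by (simp add: emb_simps)
  show "cmod (\<phi> (emb S p)) \<le> universal_norm S p"
    using states_bound[OF \<phi>, of "emb S p"] p by (simp add: anorm_emb)
  show "\<phi> (emb S (free_scale c p)) = c * \<phi> (emb S p)" for c
    using states_smult[OF \<phi>, of "emb S p" c] p by (simp add: emb_simps)
  show "\<phi> (emb S (p + q)) = \<phi> (emb S p) + \<phi> (emb S q)" if "q \<in> free_carrier S" for q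
    using states_add[OF \<phi>, of "emb S p" "emb S q"] p that by (simp add: emb_simps)
qed (rule states_one[OF \<phi>])

text \<open>Words span a dense subspace and states are bounded.\<close>

lemma states_eqI:
  assumes \<phi>: "\<phi> \<in> states (Cstar S)" and \<psi>: "\<psi> \<in> states (Cstar S)"
    and eq: "\<And>w. w \<in> words S \<Longrightarrow> \<phi> (emb S (word w)) = \<psi> (emb S (word w))"
  shows "\<phi> = \<psi>"
proof (rule extensionalityI)
  show "\<phi> \<in> extensional (carrier (Cstar S))" "\<psi> \<in> extensional (carrier (Cstar S))"
    using \<phi> \<psi> by (auto simp: states_def)
  fix X assume "X \<in> carrier (Cstar S)"
  then obtain x where x: "x \<in> cauchy_seqs S" "X = cls S x" by (rule Cstar_cases)
  have "\<phi> (emb S (x n)) = \<psi> (emb S (x n))" for n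
    by (rule linear_functional_eq_on_words[OF free_state_linear[OF states_free_state[OF \<phi>]]
          free_state_linear[OF states_free_state[OF \<psi>]] eq cauchy_carrier[OF x(1)]])
  then show "\<phi> X = \<psi> X"
    using states_emb_lim[OF \<phi> x(1)] states_emb_lim[OF \<psi> x(1)] x(2) LIMSEQ_unique by simp
qed

lemma tracial_state_ext:
  assumes \<omega>: "free_state S \<omega>"
    and tr: "\<And>p q. p \<in> free_carrier S \<Longrightarrow> q \<in> free_carrier S \<Longrightarrow> \<omega> (p * q) = \<omega> (q * p)"
  shows "state_ext S \<omega> \<in> tracial_states (Cstar S)"
  unfolding tracial_states_def
proof (intro CollectI conjI ballI state_ext_states[OF \<omega>])
  fix X Y assume "X \<in> carrier (Cstar S)" "Y \<in> carrier (Cstar S)"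
  then obtain x y where *: "x \<in> cauchy_seqs S" "X = cls S x" "y \<in> cauchy_seqs S" "Y = cls S y"
    by (metis Cstar_cases)
  show "state_ext S \<omega> (X \<otimes>\<^bsub>Cstar S\<^esub> Y) = state_ext S \<omega> (Y \<otimes>\<^bsub>Cstar S\<^esub> X)"
    using LIMSEQ_unique[OF state_ext_cls[OF \<omega> cauchy_mult[OF *(1,3)]]]
      state_ext_cls[OF \<omega> cauchy_mult[OF *(3,1)]] * cauchy_carrier[OF *(1)] cauchy_carrier[OF *(3)]
    by (simp add: tr)
qed

end

text \<open>\<open>word_reduce\<close> turns a word into a monomial or 0, and a free state cannot
  distinguish equivalent elements.\<close>

lemma (in right_lcm_algebra) free_states_eq_on_words:
  assumes \<omega>: "free_state S \<omega>" and \<omega>': "free_state S \<omega>'"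
    and eq: "\<And>s t. s \<in> carrier S \<Longrightarrow> t \<in> carrier S \<Longrightarrow>
      \<omega> (free_gen s * free_star (free_gen t)) = \<omega>' (free_gen s * free_star (free_gen t))"
    and w: "w \<in> words S"
  shows "\<omega> (word w) = \<omega>' (word w)"
  using word_reduce[OF w]
proof
  assume "eqv (word w) 0"
  then show ?thesis
    using free_state_eqv[OF \<omega>] free_state_eqv[OF \<omega>'] linear_functional_zero[OF free_state_linear[OF \<omega>]]
      linear_functional_zero[OF free_state_linear[OF \<omega>']] by metis
next
  assume "\<exists>s\<in>carrier S. \<exists>t\<in>carrier S. eqv (word w) (free_gen s * free_star (free_gen t))"
  then obtain s t where "s \<in> carrier S" "t \<in> carrier S" "eqv (word w) (free_gen s * free_star (free_gen t))"
    by blast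
  then show ?thesis
    using free_state_eqv[OF \<omega>] free_state_eqv[OF \<omega>'] eq by metis
qed

section \<open>The dynamics\<close>

text \<open>The diagonal operator on the basis of words; it is multiplicative when \<open>f\<close>
  is a character of the word monoid. It covers the dynamics, its derivatives and its difference
  quotients alike.\<close>

definition wmul :: "('s letter list \<Rightarrow> complex) \<Rightarrow> 's free_alg \<Rightarrow> 's free_alg" where
  "wmul f p = Poly_Mapping.mapp (\<lambda>w c. f w * c) p"

lemma lookup_wmul [simp]: "Poly_Mapping.lookup (wmul f p) w = f w * Poly_Mapping.lookup p w"
  by (simp add: wmul_def lookup_mapp when_def in_keys_iff)

lemma wmul_simps:
  "wmul f (p + q) = wmul f p + wmul f q" "wmul f (p - q) = wmul f p - wmul f q"
  "wmul f (free_scale c p) = free_scale c (wmul f p)" "wmul f 0 = 0"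
  "wmul f (word w) = free_scale (f w) (word w)" "wmul f (wmul g p) = wmul (\<lambda>w. f w * g w) p"
  by (rule poly_mapping_eqI; simp add: lookup_add lookup_minus lookup_single when_def algebra_simps)+

lemma wmul_carrier [simp]: "p \<in> free_carrier S \<Longrightarrow> wmul f p \<in> free_carrier S"
  by (auto simp: free_carrier_def in_keys_iff)

lemma wmul_sum: "wmul f (sum g A) = (\<Sum>a\<in>A. wmul f (g a))"
  by (induction A rule: infinite_finite_induct) (auto simp: wmul_simps)

lemma wmul_mult:
  assumes "\<And>u w. f (u @ w) = f u * f w"
  shows "wmul f (p * q) = wmul f p * wmul f q"
proof -
  have e: "wmul f r = (\<Sum>w\<in>Poly_Mapping.keys r. free_scale (Poly_Mapping.lookup r w) (free_scale (f w) (word w)))" for r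
    by (subst word_expansion[of r]) (simp only: wmul_sum wmul_simps)
  have "wmul f (p * q) = (\<Sum>u\<in>Poly_Mapping.keys p. \<Sum>w\<in>Poly_Mapping.keys q.
      wmul f (free_scale (Poly_Mapping.lookup p u) (word u) * free_scale (Poly_Mapping.lookup q w) (word w)))"
    by (subst word_expansion[of p], subst word_expansion[of q]) (simp only: wmul_sum sum_product)
  also have "\<dots> = wmul f p * wmul f q"
    unfolding e[of p] e[of q] sum_product
    by (intro sum.cong refl)
      (simp add: free_scale_mult_left free_scale_mult_right word_mult wmul_simps assms ac_simps
        del: free_scale_single)
  finally show ?thesis .
qed

fun letter_log :: "('s \<Rightarrow> real) \<Rightarrow> 's letter \<Rightarrow> real" where
  "letter_log N (Gen s) = ln (N s)"
| "letter_log N (Adj s) = - ln (N s)"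

definition word_log :: "('s \<Rightarrow> real) \<Rightarrow> 's letter list \<Rightarrow> real" where
  "word_log N w = sum_list (map (letter_log N) w)"

lemma letter_log_adj [simp]: "letter_log N (letter_adj l) = - letter_log N l"
  by (cases l) auto

lemma word_log_simps [simp]:
  "word_log N [] = 0" "word_log N (l # w) = letter_log N l + word_log N w"
  "word_log N (u @ w) = word_log N u + word_log N w"
  by (auto simp: word_log_def)

lemma word_log_adj [simp]: "word_log N (word_adj w) = - word_log N w"
  by (induction w) auto

text \<open>The dynamics at complex time. The conjugation in \<open>letter_weight\<close> amounts,
  at real time, to a sign of the logarithm; in this exponential form the coefficients are entire in
  \<open>z\<close>.\<close>

definition free_dyn :: "('s \<Rightarrow> real) \<Rightarrow> complex \<Rightarrow> 's free_alg \<Rightarrow> 's free_alg" where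
  "free_dyn N z = wmul (\<lambda>w. exp (\<i> * z * word_log N w))"

lemma free_dyn_carrier [simp]: "p \<in> free_carrier S \<Longrightarrow> free_dyn N z p \<in> free_carrier S"
  by (simp add: free_dyn_def)

lemma free_dyn_simps:
  "free_dyn N z (p + q) = free_dyn N z p + free_dyn N z q"
  "free_dyn N z (p - q) = free_dyn N z p - free_dyn N z q"
  "free_dyn N z (free_scale c p) = free_scale c (free_dyn N z p)" "free_dyn N z 0 = 0"
  "free_dyn N z (p * q) = free_dyn N z p * free_dyn N z q"
  "free_dyn N z (free_dyn N z' p) = free_dyn N (z + z') p"
  by (simp_all add: free_dyn_def wmul_simps wmul_mult exp_add ring_distribs)

lemma free_dyn_zero: "free_dyn N 0 p = p"
  by (rule poly_mapping_eqI) (simp add: free_dyn_def)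

lemma free_dyn_one: "free_dyn N z 1 = 1"
  unfolding free_dyn_def word_Nil[symmetric] wmul_simps by simp

lemma free_dyn_star: "free_dyn N (of_real t) (free_star p) = free_star (free_dyn N (of_real t) p)"
  by (rule poly_mapping_eqI) (simp add: free_dyn_def exp_cnj)

lemma free_dyn_gen: "free_dyn N z (free_gen s) = free_scale (exp (\<i> * z * ln (N s))) (free_gen s)"
  unfolding word_Gen[symmetric] by (simp add: free_dyn_def wmul_simps del: free_scale_single)

section \<open>Invariance of the universal norm under the dynamics\<close>

locale scaled_algebra = isometry_algebra S for S :: "'s monoid" +
  fixes N :: "'s \<Rightarrow> real"
  assumes scale_N: "scale S N"
begin

lemma N_ge_one: "s \<in> carrier S \<Longrightarrow> 1 \<le> N s"
  and N_mult: "s \<in> carrier S \<Longrightarrow> t \<in> carrier S \<Longrightarrow> N (s \<otimes>\<^bsub>S\<^esub> t) = N s * N t"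
  using scale_N by (auto simp: scale_def)

lemma N_one: "N \<one>\<^bsub>S\<^esub> = 1"
proof -
  have "N \<one>\<^bsub>S\<^esub> = N \<one>\<^bsub>S\<^esub> * N \<one>\<^bsub>S\<^esub>"
    using N_mult[OF one_carrier one_carrier] monoid.l_one[OF monoid_S one_carrier] by simp
  then show ?thesis using N_ge_one[OF one_carrier] by auto
qed

lemma ln_N_mult: "s \<in> carrier S \<Longrightarrow> t \<in> carrier S \<Longrightarrow> ln (N (s \<otimes>\<^bsub>S\<^esub> t)) = ln (N s) + ln (N t)"
  using N_ge_one[of s] N_ge_one[of t] by (simp add: N_mult ln_mult)

lemma letter_weight_eq:
  assumes "letter_base l \<in> carrier S"
  shows "letter_weight N t l = exp (\<i> * of_real t * letter_log N l)"
proof (cases l)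
  case (Gen s)
  then have "N s > 0" using N_ge_one[of s] assms by simp
  then show ?thesis using Gen by (simp add: powr_def Ln_of_real mult_ac)
next
  case (Adj s)
  then have "N s > 0" using N_ge_one[of s] assms by simp
  then show ?thesis using Adj by (simp add: powr_def Ln_of_real exp_cnj mult_ac)
qed

lemma word_weight_eq:
  "w \<in> words S \<Longrightarrow> prod_list (map (letter_weight N t) w) = exp (\<i> * of_real t * word_log N w)"
  by (induction w) (simp_all add: letter_weight_eq exp_add ring_distribs)

lemma free_dynamics_eq: "p \<in> free_carrier S \<Longrightarrow> free_dynamics N t p = free_dyn N (of_real t) p"
  unfolding free_dynamics_def free_dyn_def wmul_def
  using keys_subset_words[of p S] by (intro mapp_cong refl) (auto simp: word_weight_eq)

text \<open>Each relator is homogeneous for the dynamics, since \<open>N\<close> is multiplicative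
  and projections have degree 0. The eigenvalue has modulus 1, so seminorms vanishing on relators
  still do so after the dynamics is applied.\<close>

lemma free_dyn_relators:
  assumes "x \<in> relators S"
  shows "\<exists>c. cmod c = 1 \<and> free_dyn N (of_real t) x = free_scale c x"
proof -
  let ?D = "free_dyn N (of_real t)"
  have gen: "?D (free_gen s) = free_scale (exp (\<i> * of_real t * ln (N s))) (free_gen s)" for s
    by (rule free_dyn_gen)
  have inv: "cnj (exp (\<i> * of_real t * of_real a)) * exp (\<i> * of_real t * of_real a) = 1" for a
    by (simp add: exp_cnj flip: exp_add)
  have proj: "?D (free_proj s) = free_proj s" for s
    unfolding free_proj_def free_dyn_simps free_dyn_star gen free_star_simps free_scale_mult_left
      free_scale_mult_right
    by (simp add: inv mult.commute[of "exp _" "cnj _"])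
  have iso: "?D (free_star (free_gen s) * free_gen s - 1) = free_star (free_gen s) * free_gen s - 1" for s
    unfolding free_dyn_simps free_dyn_star gen free_star_simps free_scale_mult_left
      free_scale_mult_right free_dyn_one
    by (simp add: inv mult.commute[of "exp _" "cnj _"])
  have mul: "?D (free_gen s * free_gen u - free_gen (s \<otimes>\<^bsub>S\<^esub> u)) =
      free_scale (exp (\<i> * of_real t * ln (N (s \<otimes>\<^bsub>S\<^esub> u)))) (free_gen s * free_gen u - free_gen (s \<otimes>\<^bsub>S\<^esub> u))"
    if "s \<in> carrier S" "u \<in> carrier S" for s u
    using that by (simp add: free_dyn_simps gen free_scale_mult_left free_scale_mult_right
        free_scale_diff ln_N_mult exp_add ring_distribs mult.commute[of "exp _" "exp _"])
  from assms consider "x = free_gen \<one>\<^bsub>S\<^esub> - 1"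
    | s where "x = free_star (free_gen s) * free_gen s - 1"
    | s u where "s \<in> carrier S" "u \<in> carrier S" "x = free_gen s * free_gen u - free_gen (s \<otimes>\<^bsub>S\<^esub> u)"
    | s u r where "x = free_proj s * free_proj u - free_proj r"
    | s u where "x = free_proj s * free_proj u"
    unfolding relators_def by blast
  then show ?thesis
  proof cases
    case 1
    then show ?thesis by (intro exI[of _ 1]) (simp add: free_dyn_simps gen free_dyn_one N_one)
  next
    case 2
    then show ?thesis by (intro exI[of _ 1]) (simp add: iso)
  next
    case 3
    then show ?thesis
      by (intro exI[of _ "exp (\<i> * of_real t * ln (N (s \<otimes>\<^bsub>S\<^esub> u)))"]) (simp add: mul norm_exp_eq_Re)
  next
    case 4
    then show ?thesis by (intro exI[of _ 1]) (simp add: free_dyn_simps proj)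
  next
    case 5
    then show ?thesis by (intro exI[of _ 1]) (simp add: free_dyn_simps proj)
  qed
qed

lemma free_dyn_seminorm:
  assumes q: "cstar_seminorm S q"
  shows "cstar_seminorm S (\<lambda>x. q (free_dyn N (of_real t) x))"
proof -
  have "q (free_dyn N (of_real t) x) = 0" if "x \<in> relators S" for x
    using free_dyn_relators[OF that, of t] relators_carrier[OF that]
      seminorm_scale[OF q, of x] seminorm_relator[OF q that] by auto
  moreover have "q (free_dyn N (of_real t) (free_star x * x)) = (q (free_dyn N (of_real t) x))\<^sup>2"
    if "x \<in> free_carrier S" for x
    using that by (simp add: free_dyn_simps free_dyn_star seminorm_cstar[OF q])
  ultimately show ?thesis
    unfolding cstar_seminorm_def
    by (simp add: seminorm_nonneg[OF q] seminorm_add[OF q] seminorm_scale[OF q] seminorm_mult[OF q] free_dyn_simps(1,3,5))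
qed

text \<open>Composition with the dynamics maps C*-seminorms to C*-seminorms, so the universal norm
  cannot grow. Applying this at time \<open>- t\<close> as well gives equality.\<close>

lemma norm_free_dyn:
  assumes p: "p \<in> free_carrier S"
  shows "universal_norm S (free_dyn N (of_real t) p) = universal_norm S p"
proof -
  have le: "universal_norm S (free_dyn N (of_real t) p) \<le> universal_norm S p" if "p \<in> free_carrier S" for p t
    using seminorm_le_universal[OF free_dyn_seminorm[OF universal_cstar_seminorm] that] .
  have "free_dyn N (of_real (- t)) (free_dyn N (of_real t) p) = p"
    unfolding free_dyn_simps by (simp add: free_dyn_zero)
  then show ?thesis using le[OF p, of t] le[of "free_dyn N (of_real t) p" "- t"] p by simp
qed

lemma cauchy_free_dyn [simp]:
  assumes x: "x \<in> cauchy_seqs S" shows "(\<lambda>n. free_dyn N (of_real t) (x n)) \<in> cauchy_seqs S"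
proof -
  note c = cauchy_carrier[OF x]
  have "universal_norm S (free_dyn N (of_real t) (x m) - free_dyn N (of_real t) (x n)) = universal_norm S (x m - x n)" for m n
    unfolding free_dyn_simps(2)[symmetric] using c by (intro norm_free_dyn) auto
  then show ?thesis using x c by (simp add: cauchy_seqs_def)
qed

lemma dynamics_cls:
  assumes x: "x \<in> cauchy_seqs S"
  shows "dynamics S N t (cls S x) = cls S (\<lambda>n. free_dyn N (of_real t) (x n))"
proof -
  have e: "(\<lambda>n. free_dynamics N t (y n)) = (\<lambda>n. free_dyn N (of_real t) (y n))" if "y \<in> cauchy_seqs S" for y
    using cauchy_carrier[OF that] by (simp add: free_dynamics_eq)
  have "cls S (\<lambda>n. free_dynamics N t (y n)) = cls S (\<lambda>n. free_dynamics N t (x n))" if "(x, y) \<in> null_rel S" for y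
  proof -
    have y: "y \<in> cauchy_seqs S" using that by (simp add: null_rel_def)
    have "universal_norm S (free_dyn N (of_real t) (x n) - free_dyn N (of_real t) (y n)) = universal_norm S (x n - y n)" for n
      unfolding free_dyn_simps(2)[symmetric] using cauchy_carrier[OF x] cauchy_carrier[OF y] by (intro norm_free_dyn) auto
    then have "cls S (\<lambda>n. free_dyn N (of_real t) (x n)) = cls S (\<lambda>n. free_dyn N (of_real t) (y n))"
      using that cls_eq_iff[OF cauchy_free_dyn[OF x, of t] cauchy_free_dyn[OF y, of t]] by (simp add: null_rel_def)
    then show ?thesis using e[OF x] e[OF y] by simp
  qed
  from UN_cls[of x "\<lambda>y. cls S (\<lambda>n. free_dynamics N t (y n))", OF x this]
  show ?thesis using e[OF x] by (simp add: dynamics_def)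
qed

lemma dynamics_emb: "p \<in> free_carrier S \<Longrightarrow> dynamics S N t (emb S p) = emb S (free_dyn N (of_real t) p)"
  by (simp add: emb_def dynamics_cls)

lemma dynamics_carrier [simp]: "X \<in> carrier (Cstar S) \<Longrightarrow> dynamics S N t X \<in> carrier (Cstar S)"
  by (auto elim!: Cstar_cases simp: dynamics_cls)

lemma dynamics_minus:
  "X \<in> carrier (Cstar S) \<Longrightarrow> Y \<in> carrier (Cstar S) \<Longrightarrow>
    dynamics S N t (X \<ominus>\<^bsub>Cstar S\<^esub> Y) = dynamics S N t X \<ominus>\<^bsub>Cstar S\<^esub> dynamics S N t Y"
  by (auto elim!: Cstar_cases simp: dynamics_cls free_dyn_simps)

lemma dynamics_smult:
  "X \<in> carrier (Cstar S) \<Longrightarrow> dynamics S N t (c \<odot>\<^bsub>Cstar S\<^esub> X) = c \<odot>\<^bsub>Cstar S\<^esub> dynamics S N t X"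
  by (auto elim!: Cstar_cases simp: dynamics_cls free_dyn_simps)

lemma dynamics_add_time:
  "X \<in> carrier (Cstar S) \<Longrightarrow> dynamics S N t (dynamics S N u X) = dynamics S N (t + u) X"
  by (auto elim!: Cstar_cases simp: dynamics_cls free_dyn_simps)

lemma anorm_dynamics:
  assumes "X \<in> carrier (Cstar S)" shows "anorm (Cstar S) (dynamics S N t X) = anorm (Cstar S) X"
proof -
  obtain x where x: "x \<in> cauchy_seqs S" "X = cls S x" using assms by (rule Cstar_cases)
  have "(\<lambda>n. universal_norm S (x n)) \<longlonglongrightarrow> anorm (Cstar S) (dynamics S N t X)"
    using anorm_cls[OF cauchy_free_dyn[OF x(1), of t]] cauchy_carrier[OF x(1)]
    by (simp add: x dynamics_cls norm_free_dyn)
  then show ?thesis using anorm_cls[OF x(1)] x(2) LIMSEQ_unique by blast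
qed

end

section \<open>KMS states\<close>

subsection \<open>A maximum principle on the strip\<close>

text \<open>A Phragmen-Lindelof argument: \<open>G\<close> is divided by
  \<open>1 - \<i> * \<eta> * z\<close>, whose modulus is at least 1 on the strip and grows with the
  real part. The maximum principle holds for the quotient on a long rectangle, and then
  \<open>\<eta>\<close> tends to 0.\<close>

lemma strip_max:
  fixes G :: "complex \<Rightarrow> complex"
  assumes hol: "G holomorphic_on UNIV" and "0 < \<kappa>"
    and bounded: "\<And>z. 0 \<le> Im z \<Longrightarrow> Im z \<le> \<beta> \<Longrightarrow> cmod (G z) \<le> M"
    and bottom: "\<And>z. Im z = 0 \<Longrightarrow> cmod (G z) \<le> \<kappa>"
    and top: "\<And>z. Im z = \<beta> \<Longrightarrow> cmod (G z) \<le> \<kappa>"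
    and z: "0 \<le> Im z" "Im z \<le> \<beta>"
  shows "cmod (G z) \<le> \<kappa>"
proof -
  have bound: "cmod (G z) \<le> \<kappa> * (1 + \<eta> * cmod z)" if "\<eta> > 0" for \<eta>
  proof -
    let ?F = "\<lambda>w. G w / (1 - \<i> * of_real \<eta> * w)"
    have re: "Re (1 - \<i> * of_real \<eta> * w) = 1 + \<eta> * Im w" "Im (1 - \<i> * of_real \<eta> * w) = - \<eta> * Re w" for w
      by simp_all
    have den1: "1 \<le> cmod (1 - \<i> * of_real \<eta> * w)" if "0 \<le> Im w" for w
    proof -
      have "0 \<le> \<eta> * Im w" using that \<open>\<eta> > 0\<close> by simp
      then show ?thesis using complex_Re_le_cmod[of "1 - \<i> * of_real \<eta> * w"] unfolding re(1) by linarith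
    qed
    have den2: "\<eta> * \<bar>Re w\<bar> \<le> cmod (1 - \<i> * of_real \<eta> * w)" for w
      using abs_Im_le_cmod[of "1 - \<i> * of_real \<eta> * w"] re(2)[of w] \<open>\<eta> > 0\<close> by (simp add: abs_mult)
    \<comment> \<open>The rectangle must contain \<open>z\<close>, and on its vertical sides the
      denominator, of modulus at least \<open>\<eta> * R\<close>, must push the bound
      \<open>M\<close> below \<open>\<kappa>\<close>.\<close>
    define R where "R = max (\<bar>Re z\<bar>) (M / (\<eta> * \<kappa>)) + 1"
    let ?B = "cbox (Complex (- R) 0) (Complex R \<beta>)"
    have B: "w \<in> ?B \<longleftrightarrow> - R \<le> Re w \<and> Re w \<le> R \<and> 0 \<le> Im w \<and> Im w \<le> \<beta>" for w
      by (simp add: in_cbox_complex_iff)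
    have holF: "?F holomorphic_on ?B"
    proof (intro holomorphic_intros holomorphic_on_subset[OF hol])
      fix w assume "w \<in> ?B"
      then have "1 \<le> cmod (1 - \<i> * of_real \<eta> * w)" using B den1 by blast
      then show "1 - \<i> * of_real \<eta> * w \<noteq> 0" by auto
    qed auto
    have M: "M \<ge> 0" using bounded[OF z] norm_ge_zero[of "G z"] by linarith
    have "cmod (?F z) \<le> \<kappa>"
    proof (rule maximum_modulus_frontier[of ?F ?B])
      show "?F holomorphic_on interior ?B" using holF interior_subset by (rule holomorphic_on_subset)
      show "continuous_on (closure ?B) ?F" using holF by (simp add: holomorphic_on_imp_continuous_on)
      show "bounded ?B" by simp
      have "\<bar>Re z\<bar> \<le> R" by (simp add: R_def)
      then show "z \<in> ?B" using z B[of z] by (simp add: abs_le_iff)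
      fix w assume "w \<in> frontier ?B"
      then have w: "w \<in> ?B" "w \<notin> box (Complex (- R) 0) (Complex R \<beta>)"
        by (auto simp: frontier_cbox)
      then have "Im w = 0 \<or> Im w = \<beta> \<or> \<bar>Re w\<bar> = R"
        unfolding in_box_complex_iff B by auto
      then show "cmod (?F w) \<le> \<kappa>"
      proof (elim disjE)
        assume "\<bar>Re w\<bar> = R"
        have "M / (\<eta> * \<kappa>) \<le> R" by (simp add: R_def)
        then have "M \<le> \<kappa> * (\<eta> * R)" using \<open>0 < \<kappa>\<close> \<open>\<eta> > 0\<close> by (simp add: field_simps)
        also have "\<dots> \<le> \<kappa> * cmod (1 - \<i> * of_real \<eta> * w)"
          using den2[of w] \<open>\<bar>Re w\<bar> = R\<close> \<open>0 < \<kappa>\<close> by simp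
        finally have "cmod (G w) \<le> \<kappa> * cmod (1 - \<i> * of_real \<eta> * w)"
          using bounded[of w] w(1) B[of w] by simp
        moreover have "0 < cmod (1 - \<i> * of_real \<eta> * w)" using den1[of w] w(1) B[of w] by linarith
        ultimately show ?thesis by (simp add: norm_divide pos_divide_le_eq)
      next
        have *: "cmod (?F w) \<le> \<kappa>" if "cmod (G w) \<le> \<kappa>"
        proof -
          have "1 \<le> cmod (1 - \<i> * of_real \<eta> * w)" using w(1) B den1 by blast
          then have "\<kappa> \<le> \<kappa> * cmod (1 - \<i> * of_real \<eta> * w)" using \<open>0 < \<kappa>\<close> by simp
          then have "cmod (G w) \<le> \<kappa> * cmod (1 - \<i> * of_real \<eta> * w)" using that by linarith
          moreover have "0 < cmod (1 - \<i> * of_real \<eta> * w)"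
            using \<open>1 \<le> cmod (1 - \<i> * of_real \<eta> * w)\<close> by linarith
          ultimately show ?thesis by (simp add: norm_divide pos_divide_le_eq)
        qed
        { assume "Im w = 0" then show ?thesis using * bottom by blast }
        { assume "Im w = \<beta>" then show ?thesis using * top by blast }
      qed
    qed
    moreover have "0 < cmod (1 - \<i> * of_real \<eta> * z)" using den1[OF z(1)] by linarith
    ultimately have "cmod (G z) \<le> \<kappa> * cmod (1 - \<i> * of_real \<eta> * z)"
      by (simp add: norm_divide pos_divide_le_eq)
    also have "\<dots> \<le> \<kappa> * (1 + \<eta> * cmod z)"
      using norm_triangle_ineq4[of 1 "\<i> * of_real \<eta> * z"] \<open>0 < \<kappa>\<close> \<open>\<eta> > 0\<close>
      by (simp add: norm_mult)
    finally show ?thesis .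
  qed
  show ?thesis
  proof (rule field_le_epsilon)
    fix e :: real assume "e > 0"
    \<comment> \<open>Chosen so that the error \<open>\<kappa> * \<eta> * cmod z\<close> stays below
      \<open>e\<close>; the summand 1 keeps the denominator positive at
      \<open>z = 0\<close>.\<close>
    let ?\<eta> = "e / (\<kappa> * (cmod z + 1))"
    have pos: "cmod z + 1 > 0" by (simp add: add_nonneg_pos)
    have "cmod (G z) \<le> \<kappa> * (1 + ?\<eta> * cmod z)"
      using \<open>e > 0\<close> \<open>0 < \<kappa>\<close> pos by (intro bound) simp
    also have "\<kappa> * (1 + ?\<eta> * cmod z) = \<kappa> + e * (cmod z / (cmod z + 1))"
    proof -
      have eq: "\<kappa> * (e / (\<kappa> * a) * m) = e * (m / a)" for a m using \<open>0 < \<kappa>\<close> by simp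
      show ?thesis by (simp only: distrib_left[of \<kappa> 1] mult_1_right eq)
    qed
    also have "\<dots> \<le> \<kappa> + e * 1" using \<open>e > 0\<close> pos by (intro add_left_mono mult_left_mono) auto
    finally show "cmod (G z) \<le> \<kappa> + e" by simp
  qed
qed

text \<open>If \<open>P\<close> is close to \<open>0\<close> on one boundary line and close to \<open>c\<close> on the other, then
  \<open>P (P - c)\<close> is small on the whole strip, although \<open>\<bar>P\<bar> = \<bar>P - c\<bar> \<ge> \<bar>c\<bar> / 2\<close> somewhere.\<close>

lemma strip_zero:
  fixes c :: complex
  assumes "0 < \<beta>"
    and approx: "\<And>\<epsilon>. \<epsilon> > 0 \<Longrightarrow> \<exists>P M. P holomorphic_on UNIV \<and>
      (\<forall>z. 0 \<le> Im z \<longrightarrow> Im z \<le> \<beta> \<longrightarrow> cmod (P z) \<le> M) \<and>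
      (\<forall>z. Im z = 0 \<longrightarrow> cmod (P z) \<le> \<epsilon>) \<and> (\<forall>z. Im z = \<beta> \<longrightarrow> cmod (P z - c) \<le> \<epsilon>)"
  shows "c = 0"
proof (rule ccontr)
  assume "c \<noteq> 0"
  then have c: "cmod c > 0" by simp
  \<comment> \<open>With this value \<open>\<epsilon> * (\<epsilon> + cmod c)\<close> is 11/100 of
    the square of \<open>cmod c\<close>, below the quarter that is forced at an equidistant
    point.\<close>
  define \<epsilon> where "\<epsilon> = cmod c / 10"
  have "\<epsilon> > 0" using c by (simp add: \<epsilon>_def)
  from approx[OF this] obtain P M where P: "P holomorphic_on UNIV"
    and M: "\<And>z. 0 \<le> Im z \<Longrightarrow> Im z \<le> \<beta> \<Longrightarrow> cmod (P z) \<le> M"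
    and bot: "\<And>z. Im z = 0 \<Longrightarrow> cmod (P z) \<le> \<epsilon>" and top: "\<And>z. Im z = \<beta> \<Longrightarrow> cmod (P z - c) \<le> \<epsilon>"
    by blast
  have small: "cmod (P z * (P z - c)) \<le> \<epsilon> * (\<epsilon> + cmod c)" if "0 \<le> Im z" "Im z \<le> \<beta>" for z
  proof (rule strip_max[of "\<lambda>z. P z * (P z - c)" _ \<beta> "M * (M + cmod c)"])
    show "(\<lambda>z. P z * (P z - c)) holomorphic_on UNIV" by (intro holomorphic_intros P)
    show "0 < \<epsilon> * (\<epsilon> + cmod c)" using \<open>\<epsilon> > 0\<close> c by (intro mult_pos_pos add_pos_pos)
    fix w :: complex
    show "cmod (P w * (P w - c)) \<le> M * (M + cmod c)" if "0 \<le> Im w" "Im w \<le> \<beta>"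
    proof -
      have "cmod (P w - c) \<le> M + cmod c" using norm_triangle_ineq4[of "P w" c] M[OF that] by linarith
      moreover have "0 \<le> M" using M[OF that] norm_ge_zero[of "P w"] by linarith
      ultimately show ?thesis unfolding norm_mult by (intro mult_mono M[OF that] norm_ge_zero)
    qed
    show "cmod (P w * (P w - c)) \<le> \<epsilon> * (\<epsilon> + cmod c)" if "Im w = 0"
    proof -
      have "cmod (P w - c) \<le> \<epsilon> + cmod c" using norm_triangle_ineq4[of "P w" c] bot[OF that] by linarith
      then show ?thesis
        using bot[OF that] \<open>\<epsilon> > 0\<close> unfolding norm_mult by (intro mult_mono) auto
    qed
    show "cmod (P w * (P w - c)) \<le> \<epsilon> * (\<epsilon> + cmod c)" if "Im w = \<beta>"
    proof -
      have "cmod (P w) \<le> \<epsilon> + cmod c" using norm_triangle_ineq[of "P w - c" c] top[OF that] by simp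
      then have "cmod (P w) * cmod (P w - c) \<le> (\<epsilon> + cmod c) * \<epsilon>"
        using top[OF that] \<open>\<epsilon> > 0\<close> by (intro mult_mono) auto
      then show ?thesis by (simp add: norm_mult mult.commute)
    qed
  qed (use that in auto)
  have cont: "continuous_on UNIV P" using P by (rule holomorphic_on_imp_continuous_on)
  \<comment> \<open>On the imaginary segment \<open>P\<close> travels from near 0 to near
    \<open>c\<close>. A zero of \<open>h\<close> is a point where \<open>P\<close> is equidistant
    from both.\<close>
  define h where "h = (\<lambda>y. cmod (P (\<i> * of_real y)) - cmod (P (\<i> * of_real y) - c))"
  have "continuous_on {0..\<beta>} h"
    unfolding h_def by (intro continuous_intros continuous_on_compose2[OF cont]) auto
  moreover have "h 0 \<le> 0"
  proof -
    have "cmod (P 0) \<le> \<epsilon>" using bot[of 0] by simp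
    moreover have "cmod c \<le> cmod (P 0) + cmod (P 0 - c)" using norm_triangle_ineq4[of "P 0" "P 0 - c"] by simp
    moreover have "h 0 = cmod (P 0) - cmod (P 0 - c)" by (simp add: h_def)
    ultimately show ?thesis using c unfolding \<epsilon>_def by linarith
  qed
  moreover have "0 \<le> h \<beta>"
  proof -
    let ?p = "P (\<i> * of_real \<beta>)"
    have "cmod (?p - c) \<le> \<epsilon>" using top[of "\<i> * of_real \<beta>"] by simp
    moreover have "cmod c \<le> cmod ?p + cmod (?p - c)" using norm_triangle_ineq4[of ?p "?p - c"] by simp
    moreover have "h \<beta> = cmod ?p - cmod (?p - c)" by (simp add: h_def)
    ultimately show ?thesis using c unfolding \<epsilon>_def by linarith
  qed
  ultimately obtain y where y: "0 \<le> y" "y \<le> \<beta>" "h y = 0"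
    using IVT'[of h 0 0 \<beta>] \<open>0 < \<beta>\<close> by auto
  let ?p = "P (\<i> * of_real y)"
  have eq: "cmod ?p = cmod (?p - c)" using y(3) by (simp add: h_def)
  have "cmod c \<le> cmod ?p + cmod (?p - c)" using norm_triangle_ineq4[of ?p "?p - c"] by simp
  with eq have "cmod c / 2 \<le> cmod ?p" by simp
  then have "(cmod c / 2) * (cmod c / 2) \<le> cmod ?p * cmod ?p" using c by (intro mult_mono) auto
  also have "\<dots> \<le> \<epsilon> * (\<epsilon> + cmod c)"
    using small[of "\<i> * of_real y"] y eq by (simp add: norm_mult)
  \<comment> \<open>The number 14 is 25 - 11: a quarter against eleven hundredths, in
    hundredths.\<close>
  finally have "cmod c * cmod c * 14 \<le> 0" by (simp add: \<epsilon>_def field_simps)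
  then show False using c by (simp add: mult_le_0_iff)
qed

subsection \<open>The KMS condition on generators\<close>

text \<open>Continuous linear functionals, with linearity phrased through differences because
  difference quotients are where it is applied.\<close>

definition bounded_functional :: "'s monoid \<Rightarrow> ('s cstar_elem \<Rightarrow> complex) \<Rightarrow> bool" where
  "bounded_functional S \<Lambda> \<longleftrightarrow>
     (\<forall>X\<in>carrier (Cstar S). \<forall>Y\<in>carrier (Cstar S). \<Lambda> (X \<ominus>\<^bsub>Cstar S\<^esub> Y) = \<Lambda> X - \<Lambda> Y) \<and>
     (\<forall>c. \<forall>X\<in>carrier (Cstar S). \<Lambda> (c \<odot>\<^bsub>Cstar S\<^esub> X) = c * \<Lambda> X) \<and>
     (\<exists>K. \<forall>X\<in>carrier (Cstar S). cmod (\<Lambda> X) \<le> K * anorm (Cstar S) X)"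

lemma entire_eq_of_eq_on_reals:
  fixes F G :: "complex \<Rightarrow> complex"
  assumes "F holomorphic_on UNIV" "G holomorphic_on UNIV" "\<And>t. F (of_real t) = G (of_real t)"
  shows "F z = G z"
proof -
  have "F z - G z = 0"
  proof (rule analytic_continuation[where f = "\<lambda>z. F z - G z" and S = UNIV
        and U = "range complex_of_real" and \<xi> = 0])
    show "(\<lambda>z. F z - G z) holomorphic_on UNIV" using assms by (intro holomorphic_intros)
    show "0 islimpt range complex_of_real"
    proof (unfold islimpt_approachable, intro allI impI)
      fix e :: real assume "e > 0"
      then show "\<exists>x'\<in>range complex_of_real. x' \<noteq> 0 \<and> dist x' 0 < e"
        by (intro bexI[of _ "of_real (e / 2)"] conjI rangeI) auto
    qed
  qed (use assms in auto)
  then show ?thesis by simp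
qed

context isometry_algebra
begin

lemma Cstar_distrib:
  assumes "X \<in> carrier (Cstar S)" "Y \<in> carrier (Cstar S)" "Z \<in> carrier (Cstar S)"
  shows "X \<otimes>\<^bsub>Cstar S\<^esub> (Y \<ominus>\<^bsub>Cstar S\<^esub> Z) = (X \<otimes>\<^bsub>Cstar S\<^esub> Y) \<ominus>\<^bsub>Cstar S\<^esub> (X \<otimes>\<^bsub>Cstar S\<^esub> Z)"
    "(Y \<ominus>\<^bsub>Cstar S\<^esub> Z) \<otimes>\<^bsub>Cstar S\<^esub> X = (Y \<otimes>\<^bsub>Cstar S\<^esub> X) \<ominus>\<^bsub>Cstar S\<^esub> (Z \<otimes>\<^bsub>Cstar S\<^esub> X)"
    "X \<otimes>\<^bsub>Cstar S\<^esub> (c \<odot>\<^bsub>Cstar S\<^esub> Y) = c \<odot>\<^bsub>Cstar S\<^esub> (X \<otimes>\<^bsub>Cstar S\<^esub> Y)"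
    "(c \<odot>\<^bsub>Cstar S\<^esub> Y) \<otimes>\<^bsub>Cstar S\<^esub> X = c \<odot>\<^bsub>Cstar S\<^esub> (Y \<otimes>\<^bsub>Cstar S\<^esub> X)"
proof -
  obtain x y z where "x \<in> cauchy_seqs S" "X = cls S x" "y \<in> cauchy_seqs S" "Y = cls S y"
    "z \<in> cauchy_seqs S" "Z = cls S z"
    using assms by (metis Cstar_cases)
  then show "X \<otimes>\<^bsub>Cstar S\<^esub> (Y \<ominus>\<^bsub>Cstar S\<^esub> Z) = (X \<otimes>\<^bsub>Cstar S\<^esub> Y) \<ominus>\<^bsub>Cstar S\<^esub> (X \<otimes>\<^bsub>Cstar S\<^esub> Z)"
    "(Y \<ominus>\<^bsub>Cstar S\<^esub> Z) \<otimes>\<^bsub>Cstar S\<^esub> X = (Y \<otimes>\<^bsub>Cstar S\<^esub> X) \<ominus>\<^bsub>Cstar S\<^esub> (Z \<otimes>\<^bsub>Cstar S\<^esub> X)"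
    "X \<otimes>\<^bsub>Cstar S\<^esub> (c \<odot>\<^bsub>Cstar S\<^esub> Y) = c \<odot>\<^bsub>Cstar S\<^esub> (X \<otimes>\<^bsub>Cstar S\<^esub> Y)"
    "(c \<odot>\<^bsub>Cstar S\<^esub> Y) \<otimes>\<^bsub>Cstar S\<^esub> X = c \<odot>\<^bsub>Cstar S\<^esub> (Y \<otimes>\<^bsub>Cstar S\<^esub> X)"
    by (simp_all add: algebra_simps free_scale_mult_left free_scale_mult_right)
qed

lemma Cstar_scale_scale:
  assumes "X \<in> carrier (Cstar S)"
  shows "c \<odot>\<^bsub>Cstar S\<^esub> (d \<odot>\<^bsub>Cstar S\<^esub> X) = (c * d) \<odot>\<^bsub>Cstar S\<^esub> X" "1 \<odot>\<^bsub>Cstar S\<^esub> X = X"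
  using assms by (auto elim!: Cstar_cases)

lemma anorm_minus_abs:
  assumes "X \<in> carrier (Cstar S)" "Y \<in> carrier (Cstar S)"
  shows "anorm (Cstar S) X \<le> anorm (Cstar S) (X \<ominus>\<^bsub>Cstar S\<^esub> Y) + anorm (Cstar S) Y"
  using anorm_add_le[of "X \<ominus>\<^bsub>Cstar S\<^esub> Y" Y] Cstar_minus_add[of X Y] assms by simp

lemma anorm_minus_commute:
  assumes "X \<in> carrier (Cstar S)" "Y \<in> carrier (Cstar S)"
  shows "anorm (Cstar S) (X \<ominus>\<^bsub>Cstar S\<^esub> Y) = anorm (Cstar S) (Y \<ominus>\<^bsub>Cstar S\<^esub> X)"
proof -
  have "X \<ominus>\<^bsub>Cstar S\<^esub> Y = (-1) \<odot>\<^bsub>Cstar S\<^esub> (Y \<ominus>\<^bsub>Cstar S\<^esub> X)"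
    using assms by (auto elim!: Cstar_cases)
  then show ?thesis using assms by (simp add: anorm_smult)
qed

lemma analytic_extension_carrier: "analytic_extension (Cstar S) \<sigma> a f \<Longrightarrow> f z \<in> carrier (Cstar S)"
  by (simp add: analytic_extension_def)

text \<open>A bounded functional carries norm convergence of difference quotients to convergence of
  scalar ones, so scalar complex analysis becomes applicable.\<close>

lemma analytic_extension_holomorphic:
  assumes f: "analytic_extension (Cstar S) \<sigma> a f" and \<Lambda>: "bounded_functional S \<Lambda>"
  shows "(\<lambda>z. \<Lambda> (f z)) holomorphic_on UNIV"
proof (rule holomorphic_onI, rule field_differentiable_at_within)
  fix z
  note c = analytic_extension_carrier[OF f]
  obtain d where d: "d \<in> carrier (Cstar S)" and lim:
    "((\<lambda>h. anorm (Cstar S) ((inverse h \<odot>\<^bsub>Cstar S\<^esub> (f (z + h) \<ominus>\<^bsub>Cstar S\<^esub> f z)) \<ominus>\<^bsub>Cstar S\<^esub> d)) \<longlongrightarrow> 0) (at 0)"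
    using f unfolding analytic_extension_def by blast
  obtain K where K: "\<And>X. X \<in> carrier (Cstar S) \<Longrightarrow> cmod (\<Lambda> X) \<le> K * anorm (Cstar S) X"
    and \<Lambda>': "\<And>X Y. X \<in> carrier (Cstar S) \<Longrightarrow> Y \<in> carrier (Cstar S) \<Longrightarrow> \<Lambda> (X \<ominus>\<^bsub>Cstar S\<^esub> Y) = \<Lambda> X - \<Lambda> Y"
      "\<And>X c. X \<in> carrier (Cstar S) \<Longrightarrow> \<Lambda> (c \<odot>\<^bsub>Cstar S\<^esub> X) = c * \<Lambda> X"
    using \<Lambda> unfolding bounded_functional_def by blast
  let ?Q = "\<lambda>h. (inverse h \<odot>\<^bsub>Cstar S\<^esub> (f (z + h) \<ominus>\<^bsub>Cstar S\<^esub> f z)) \<ominus>\<^bsub>Cstar S\<^esub> d"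
  have "((\<lambda>h. (\<Lambda> (f (z + h)) - \<Lambda> (f z)) / h - \<Lambda> d) \<longlongrightarrow> 0) (at 0)"
  proof (rule Lim_null_comparison)
    have "(\<Lambda> (f (z + h)) - \<Lambda> (f z)) / h - \<Lambda> d = \<Lambda> (?Q h)" for h
      using c d by (simp add: \<Lambda>' divide_inverse mult.commute)
    then show "\<forall>\<^sub>F h in at 0. cmod ((\<Lambda> (f (z + h)) - \<Lambda> (f z)) / h - \<Lambda> d) \<le> K * anorm (Cstar S) (?Q h)"
      using c d by (intro always_eventually allI) (simp add: K)
    show "((\<lambda>h. K * anorm (Cstar S) (?Q h)) \<longlongrightarrow> 0) (at 0)"
      using tendsto_mult_right_zero[OF lim] .
  qed
  then have "((\<lambda>h. (\<Lambda> (f (z + h)) - \<Lambda> (f z)) / h) \<longlongrightarrow> \<Lambda> d) (at 0)"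
    by (rule LIM_zero_cancel)
  then show "(\<lambda>z. \<Lambda> (f z)) field_differentiable at z"
    unfolding field_differentiable_def by (auto simp: DERIV_def)
qed

text \<open>Differentiability in norm gives continuity in norm; compactness then bounds
  \<open>f\<close> on the segment from 0 to \<i>\<beta>.\<close>

lemma analytic_extension_continuous:
  assumes f: "analytic_extension (Cstar S) \<sigma> a f"
  shows "continuous_on UNIV (\<lambda>z. anorm (Cstar S) (f z))"
proof (rule continuous_at_imp_continuous_on, rule ballI)
  fix z
  note c = analytic_extension_carrier[OF f]
  obtain d where d: "d \<in> carrier (Cstar S)" and lim:
    "((\<lambda>h. anorm (Cstar S) ((inverse h \<odot>\<^bsub>Cstar S\<^esub> (f (z + h) \<ominus>\<^bsub>Cstar S\<^esub> f z)) \<ominus>\<^bsub>Cstar S\<^esub> d)) \<longlongrightarrow> 0) (at 0)"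
    using f unfolding analytic_extension_def by blast
  let ?N = "anorm (Cstar S)"
  let ?Q = "\<lambda>h. inverse h \<odot>\<^bsub>Cstar S\<^esub> (f (z + h) \<ominus>\<^bsub>Cstar S\<^esub> f z)"
  have "((\<lambda>h. ?N (f (z + h)) - ?N (f z)) \<longlongrightarrow> 0) (at 0)"
  proof (rule Lim_null_comparison)
    have "\<bar>?N (f (z + h)) - ?N (f z)\<bar> \<le> cmod h * (?N (?Q h \<ominus>\<^bsub>Cstar S\<^esub> d) + ?N d)" if "h \<noteq> 0" for h
    proof -
      have "\<bar>?N (f (z + h)) - ?N (f z)\<bar> \<le> ?N (f (z + h) \<ominus>\<^bsub>Cstar S\<^esub> f z)"
        using anorm_minus_abs[OF c c, of "z + h" z] anorm_minus_abs[OF c c, of z "z + h"]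
          anorm_minus_commute[OF c c, of "z + h" z] by linarith
      also have "f (z + h) \<ominus>\<^bsub>Cstar S\<^esub> f z = h \<odot>\<^bsub>Cstar S\<^esub> ?Q h"
        using that c by (simp add: Cstar_scale_scale)
      also have "?N \<dots> = cmod h * ?N (?Q h)" using c by (simp add: anorm_smult)
      also have "\<dots> \<le> cmod h * (?N (?Q h \<ominus>\<^bsub>Cstar S\<^esub> d) + ?N d)"
        using c d by (intro mult_left_mono anorm_minus_abs) auto
      finally show ?thesis .
    qed
    then show "\<forall>\<^sub>F h in at 0. norm (?N (f (z + h)) - ?N (f z)) \<le> cmod h * (?N (?Q h \<ominus>\<^bsub>Cstar S\<^esub> d) + ?N d)"
      by (auto simp: eventually_at_filter)
    have "((\<lambda>h. cmod h * (?N (?Q h \<ominus>\<^bsub>Cstar S\<^esub> d) + ?N d)) \<longlongrightarrow> cmod 0 * (0 + ?N d)) (at 0)"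
      by (intro tendsto_intros lim)
    then show "((\<lambda>h. cmod h * (?N (?Q h \<ominus>\<^bsub>Cstar S\<^esub> d) + ?N d)) \<longlongrightarrow> 0) (at 0)" by simp
  qed
  then have "((\<lambda>h. ?N (f (z + h))) \<longlongrightarrow> ?N (f z)) (at 0)" by (rule LIM_zero_cancel)
  then show "isCont (\<lambda>z. ?N (f z)) z" by (simp add: isCont_iff)
qed

lemma bounded_functional_left:
  assumes "\<psi> \<in> states (Cstar S)" "b \<in> carrier (Cstar S)"
  shows "bounded_functional S (\<lambda>X. \<psi> (b \<otimes>\<^bsub>Cstar S\<^esub> X))"
  unfolding bounded_functional_def
proof (intro conjI ballI allI exI)
  show "cmod (\<psi> (b \<otimes>\<^bsub>Cstar S\<^esub> X)) \<le> anorm (Cstar S) b * anorm (Cstar S) X" if "X \<in> carrier (Cstar S)" for X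
    using states_bound[OF assms(1), of "b \<otimes>\<^bsub>Cstar S\<^esub> X"] anorm_mult_le[OF assms(2) that] assms that by simp
qed (use assms in \<open>simp_all add: Cstar_distrib states_minus states_smult\<close>)

end

context scaled_algebra
begin

lemma bounded_functional_dynamics:
  assumes "bounded_functional S \<Lambda>"
  shows "bounded_functional S (\<lambda>X. \<Lambda> (dynamics S N t X))"
proof -
  obtain K where K: "\<forall>X\<in>carrier (Cstar S). cmod (\<Lambda> X) \<le> K * anorm (Cstar S) X"
    using assms unfolding bounded_functional_def by blast
  have "cmod (\<Lambda> (dynamics S N t X)) \<le> K * anorm (Cstar S) X" if "X \<in> carrier (Cstar S)" for X
    using K[rule_format, of "dynamics S N t X"] that by (simp add: anorm_dynamics)
  then show ?thesis
    using assms unfolding bounded_functional_def by (simp add: dynamics_minus dynamics_smult) blast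
qed

context
  fixes \<psi> \<beta> D
  assumes \<psi>: "\<psi> \<in> states (Cstar S)" and \<beta>: "0 < \<beta>" and dense: "dense_subspace (Cstar S) D"
    and invariant: "\<And>t. dynamics S N t ` D \<subseteq> D"
    and kms: "\<And>a. a \<in> D \<Longrightarrow> \<exists>f. analytic_extension (Cstar S) (dynamics S N) a f \<and>
      (\<forall>b\<in>D. \<psi> (a \<otimes>\<^bsub>Cstar S\<^esub> b) = \<psi> (b \<otimes>\<^bsub>Cstar S\<^esub> f (\<i> * of_real \<beta>)))"
begin

lemma D_carrier: "a \<in> D \<Longrightarrow> a \<in> carrier (Cstar S)"
  using dense by (auto simp: dense_subspace_def)

text \<open>The function \<open>g z = \<psi> (b f(z))\<close> of the KMS condition. Its values on
  the lower line hold by construction, those on the upper line come from the KMS identity for the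
  translates of \<open>a\<close>. It is bounded because real translations act isometrically.\<close>

lemma kms_entire:
  assumes a: "a \<in> D" and b: "b \<in> D"
  obtains g M where "g holomorphic_on UNIV"
    "\<And>z. 0 \<le> Im z \<Longrightarrow> Im z \<le> \<beta> \<Longrightarrow> cmod (g z) \<le> M"
    "\<And>t. g (of_real t) = \<psi> (b \<otimes>\<^bsub>Cstar S\<^esub> dynamics S N t a)"
    "\<And>t. g (of_real t + \<i> * of_real \<beta>) = \<psi> (dynamics S N t a \<otimes>\<^bsub>Cstar S\<^esub> b)"
proof -
  obtain f where f: "analytic_extension (Cstar S) (dynamics S N) a f" using kms[OF a] by blast
  have fr: "f (of_real t) = dynamics S N t a" for t using f by (simp add: analytic_extension_def)
  have bc: "b \<in> carrier (Cstar S)" and ac: "a \<in> carrier (Cstar S)" using a b D_carrier by auto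
  note left = bounded_functional_left[OF \<psi> bc]
  txt \<open>Uniqueness of analytic continuation for scalar functions suffices to compare \<open>f (t + z)\<close>
    with \<open>\<sigma>\<^sub>t (f z)\<close> under \<open>\<psi> (b \<cdot>)\<close>; this bounds \<open>g\<close> on the strip without Hahn--Banach.\<close>
  define g where "g = (\<lambda>z. \<psi> (b \<otimes>\<^bsub>Cstar S\<^esub> f z))"
  have hol: "g holomorphic_on UNIV" unfolding g_def by (rule analytic_extension_holomorphic[OF f left])
  have shift: "(\<lambda>z. g (of_real t + z)) holomorphic_on UNIV" for t
  proof -
    have "g \<circ> (\<lambda>z. of_real t + z) holomorphic_on UNIV"
      by (rule holomorphic_on_compose_gen[OF _ hol]) (auto intro!: holomorphic_intros)
    then show ?thesis by (simp add: o_def)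
  qed
  have bounded: "\<exists>B. \<forall>y\<in>{0..\<beta>}. anorm (Cstar S) (f (\<i> * of_real y)) \<le> B"
  proof -
    have "continuous_on {0..\<beta>} (\<lambda>y. anorm (Cstar S) (f (\<i> * of_real y)))"
      by (rule continuous_on_compose2[OF analytic_extension_continuous[OF f]]) (auto intro!: continuous_intros)
    from compact_continuous_image[OF this] have "bounded ((\<lambda>y. anorm (Cstar S) (f (\<i> * of_real y))) ` {0..\<beta>})"
      by (simp add: compact_imp_bounded)
    then obtain B where "\<forall>x\<in>((\<lambda>y. anorm (Cstar S) (f (\<i> * of_real y))) ` {0..\<beta>}). norm x \<le> B"
      unfolding bounded_iff by blast
    then show ?thesis by (intro exI[of _ B]) auto
  qed
  then obtain B where B: "\<And>y. 0 \<le> y \<Longrightarrow> y \<le> \<beta> \<Longrightarrow> anorm (Cstar S) (f (\<i> * of_real y)) \<le> B"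
    by (metis atLeastAtMost_iff)
  show ?thesis
  proof (rule that[OF hol])
    fix z assume z: "0 \<le> Im z" "Im z \<le> \<beta>"
    have "g (of_real (Re z) + w) = \<psi> (b \<otimes>\<^bsub>Cstar S\<^esub> dynamics S N (Re z) (f w))" for w
    proof (rule entire_eq_of_eq_on_reals[OF shift])
      show "(\<lambda>w. \<psi> (b \<otimes>\<^bsub>Cstar S\<^esub> dynamics S N (Re z) (f w))) holomorphic_on UNIV"
        by (rule analytic_extension_holomorphic[OF f bounded_functional_dynamics[OF left]])
      show "g (of_real (Re z) + of_real u) = \<psi> (b \<otimes>\<^bsub>Cstar S\<^esub> dynamics S N (Re z) (f (of_real u)))" for u
        unfolding g_def of_real_add[symmetric] fr by (simp add: dynamics_add_time ac)
    qed
    from this[of "\<i> * of_real (Im z)"]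
    have "g z = \<psi> (b \<otimes>\<^bsub>Cstar S\<^esub> dynamics S N (Re z) (f (\<i> * of_real (Im z))))"
      by (simp add: complex_eq mult.commute flip: complex_eq)
    also have "cmod \<dots> \<le> anorm (Cstar S) (b \<otimes>\<^bsub>Cstar S\<^esub> dynamics S N (Re z) (f (\<i> * of_real (Im z))))"
      using bc analytic_extension_carrier[OF f] by (intro states_bound[OF \<psi>]) simp
    also have "\<dots> \<le> anorm (Cstar S) b * anorm (Cstar S) (dynamics S N (Re z) (f (\<i> * of_real (Im z))))"
      using bc analytic_extension_carrier[OF f] by (intro anorm_mult_le) auto
    also have "\<dots> \<le> anorm (Cstar S) b * B"
      using B[OF z] anorm_nonneg[OF bc] analytic_extension_carrier[OF f]
      by (intro mult_left_mono) (auto simp: anorm_dynamics)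
    finally show "cmod (g z) \<le> anorm (Cstar S) b * B" .
  next
    fix t :: real
    show "g (of_real t) = \<psi> (b \<otimes>\<^bsub>Cstar S\<^esub> dynamics S N t a)" by (simp add: g_def fr)
    \<comment> \<open>Invariance of \<open>D\<close> makes the KMS identity available for the
      translate of \<open>a\<close>, with an extension \<open>f'\<close> of its own. Under the
      functional \<open>\<psi> (b \<cdot>)\<close>, \<open>f'\<close> and the shifted
      \<open>f\<close> agree on the reals, hence everywhere.\<close>
    have "dynamics S N t a \<in> D" using invariant a by blast
    from kms[OF this] obtain f' where f': "analytic_extension (Cstar S) (dynamics S N) (dynamics S N t a) f'"
      and k: "\<psi> (dynamics S N t a \<otimes>\<^bsub>Cstar S\<^esub> b) = \<psi> (b \<otimes>\<^bsub>Cstar S\<^esub> f' (\<i> * of_real \<beta>))"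
      using b by blast
    have "g (of_real t + w) = \<psi> (b \<otimes>\<^bsub>Cstar S\<^esub> f' w)" for w
    proof (rule entire_eq_of_eq_on_reals[OF shift])
      show "(\<lambda>w. \<psi> (b \<otimes>\<^bsub>Cstar S\<^esub> f' w)) holomorphic_on UNIV"
        by (rule analytic_extension_holomorphic[OF f' left])
      have "f' (of_real u) = dynamics S N u (dynamics S N t a)" for u
        using f' by (simp add: analytic_extension_def)
      then show "g (of_real t + of_real u) = \<psi> (b \<otimes>\<^bsub>Cstar S\<^esub> f' (of_real u))" for u
        unfolding g_def of_real_add[symmetric] fr by (simp add: dynamics_add_time ac add.commute)
    qed
    then show "g (of_real t + \<i> * of_real \<beta>) = \<psi> (dynamics S N t a \<otimes>\<^bsub>Cstar S\<^esub> b)" using k by simp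
  qed
qed

text \<open>Since \<open>v_s\<close> need not lie in \<open>D\<close>, it is approximated by some
  \<open>a\<close> in \<open>D\<close>. The strip function of \<open>a\<close>, stripped of the
  oscillation expected for \<open>v_s\<close>, is nearly constant on each boundary line, and
  \<open>strip_zero\<close> forces the two constants to coincide.\<close>

lemma kms_generator_dense:
  assumes s: "s \<in> carrier S" and b: "b \<in> D"
  shows "\<psi> (emb S (free_gen s) \<otimes>\<^bsub>Cstar S\<^esub> b) =
    exp (- of_real (\<beta> * ln (N s))) * \<psi> (b \<otimes>\<^bsub>Cstar S\<^esub> emb S (free_gen s))"
proof -
  let ?v = "emb S (free_gen s)"
  define l where "l = ln (N s)"
  let ?L = "\<psi> (b \<otimes>\<^bsub>Cstar S\<^esub> ?v)" and ?R = "\<psi> (?v \<otimes>\<^bsub>Cstar S\<^esub> b)"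
  have v: "?v \<in> carrier (Cstar S)" and bc: "b \<in> carrier (Cstar S)" using s b D_carrier by auto
  have dv: "dynamics S N t ?v = exp (\<i> * of_real (l * t)) \<odot>\<^bsub>Cstar S\<^esub> ?v" for t
    using s by (simp add: dynamics_emb free_dyn_gen emb_simps l_def mult_ac)
  \<comment> \<open>After multiplication by \<open>exp (- \<i> * l * z)\<close> the strip function
    is close to \<open>?L\<close> on the real line and to \<open>exp (l * \<beta>) * ?R\<close> on
    the upper line; \<open>c\<close> is the difference.\<close>
  define c where "c = exp (of_real (l * \<beta>)) * ?R - ?L"
  have "c = 0"
  proof (rule strip_zero[OF \<beta>])
    fix \<epsilon> :: real assume "\<epsilon> > 0"
    \<comment> \<open>The exponential pays for the factor gained on the upper line; the summand 1
      covers the case that \<open>b\<close> has norm 0.\<close>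
    define \<delta> where "\<delta> = \<epsilon> / ((anorm (Cstar S) b + 1) * exp (\<bar>l\<bar> * \<beta>))"
    have pos: "anorm (Cstar S) b + 1 > 0" using anorm_nonneg[OF bc] by simp
    then have "\<delta> > 0" using \<open>\<epsilon> > 0\<close> by (simp add: \<delta>_def)
    then obtain a where a: "a \<in> D" "anorm (Cstar S) (?v \<ominus>\<^bsub>Cstar S\<^esub> a) < \<delta>"
      using dense v unfolding dense_subspace_def by blast
    have ac: "a \<in> carrier (Cstar S)" using a D_carrier by auto
    have small: "anorm (Cstar S) (dynamics S N t a \<ominus>\<^bsub>Cstar S\<^esub> dynamics S N t ?v) \<le> \<delta>" for t
      using a(2) ac v anorm_minus_commute[OF ac v]
      by (simp flip: dynamics_minus add: anorm_dynamics)
    have eb: "anorm (Cstar S) b * \<delta> * exp (\<bar>l\<bar> * \<beta>) \<le> \<epsilon>"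
    proof -
      have "anorm (Cstar S) b * (\<delta> * exp (\<bar>l\<bar> * \<beta>)) \<le> (anorm (Cstar S) b + 1) * (\<delta> * exp (\<bar>l\<bar> * \<beta>))"
        using \<open>\<delta> > 0\<close> by (intro mult_right_mono) auto
      also have "\<dots> = \<epsilon>" using pos by (simp add: \<delta>_def)
      finally show ?thesis by (simp add: mult.assoc)
    qed
    have "1 \<le> exp (\<bar>l\<bar> * \<beta>)" using \<beta> by simp
    then have "anorm (Cstar S) b * \<delta> * 1 \<le> anorm (Cstar S) b * \<delta> * exp (\<bar>l\<bar> * \<beta>)"
      using anorm_nonneg[OF bc] \<open>\<delta> > 0\<close> by (intro mult_left_mono mult_nonneg_nonneg) auto
    with eb have eb1: "anorm (Cstar S) b * \<delta> \<le> \<epsilon>" by simp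
    have est: "cmod (\<psi> (b \<otimes>\<^bsub>Cstar S\<^esub> dynamics S N t a) - exp (\<i> * of_real (l * t)) * ?L) \<le> anorm (Cstar S) b * \<delta>"
      "cmod (\<psi> (dynamics S N t a \<otimes>\<^bsub>Cstar S\<^esub> b) - exp (\<i> * of_real (l * t)) * ?R) \<le> anorm (Cstar S) b * \<delta>" for t
    proof -
      let ?E = "dynamics S N t a \<ominus>\<^bsub>Cstar S\<^esub> dynamics S N t ?v"
      have E: "?E \<in> carrier (Cstar S)" using ac v by simp
      have "\<psi> (b \<otimes>\<^bsub>Cstar S\<^esub> ?E) = \<psi> (b \<otimes>\<^bsub>Cstar S\<^esub> dynamics S N t a) - exp (\<i> * of_real (l * t)) * ?L"
        using ac v bc by (simp add: Cstar_distrib states_minus[OF \<psi>] states_smult[OF \<psi>] dv)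
      moreover have "cmod (\<psi> (b \<otimes>\<^bsub>Cstar S\<^esub> ?E)) \<le> anorm (Cstar S) b * anorm (Cstar S) ?E"
        using states_bound[OF \<psi>, of "b \<otimes>\<^bsub>Cstar S\<^esub> ?E"] anorm_mult_le[OF bc E] bc E by simp
      moreover have "\<dots> \<le> anorm (Cstar S) b * \<delta>" using small anorm_nonneg[OF bc] by (intro mult_left_mono)
      ultimately show "cmod (\<psi> (b \<otimes>\<^bsub>Cstar S\<^esub> dynamics S N t a) - exp (\<i> * of_real (l * t)) * ?L) \<le> anorm (Cstar S) b * \<delta>"
        by simp
      have "\<psi> (?E \<otimes>\<^bsub>Cstar S\<^esub> b) = \<psi> (dynamics S N t a \<otimes>\<^bsub>Cstar S\<^esub> b) - exp (\<i> * of_real (l * t)) * ?R"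
        using ac v bc by (simp add: Cstar_distrib states_minus[OF \<psi>] states_smult[OF \<psi>] dv)
      moreover have "cmod (\<psi> (?E \<otimes>\<^bsub>Cstar S\<^esub> b)) \<le> anorm (Cstar S) ?E * anorm (Cstar S) b"
        using states_bound[OF \<psi>, of "?E \<otimes>\<^bsub>Cstar S\<^esub> b"] anorm_mult_le[OF E bc] bc E by simp
      moreover have "\<dots> \<le> \<delta> * anorm (Cstar S) b" using small anorm_nonneg[OF bc] by (intro mult_right_mono)
      ultimately show "cmod (\<psi> (dynamics S N t a \<otimes>\<^bsub>Cstar S\<^esub> b) - exp (\<i> * of_real (l * t)) * ?R) \<le> anorm (Cstar S) b * \<delta>"
        by (simp add: mult.commute)
    qed
    obtain g M where g: "g holomorphic_on UNIV"
      and M: "\<And>z. 0 \<le> Im z \<Longrightarrow> Im z \<le> \<beta> \<Longrightarrow> cmod (g z) \<le> M"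
      and bot: "\<And>t. g (of_real t) = \<psi> (b \<otimes>\<^bsub>Cstar S\<^esub> dynamics S N t a)"
      and top: "\<And>t. g (of_real t + \<i> * of_real \<beta>) = \<psi> (dynamics S N t a \<otimes>\<^bsub>Cstar S\<^esub> b)"
      using kms_entire[OF a(1) b] by metis
    let ?P = "\<lambda>z. g z * exp (- \<i> * of_real l * z) - ?L"
    have ex: "cmod (exp (- \<i> * of_real l * z)) = exp (l * Im z)" for z by simp
    have rot: "exp (- \<i> * of_real l * of_real t) * exp (\<i> * of_real (l * t)) = 1" for t
      by (simp flip: exp_add)
    show "\<exists>P M. P holomorphic_on UNIV \<and>
      (\<forall>z. 0 \<le> Im z \<longrightarrow> Im z \<le> \<beta> \<longrightarrow> cmod (P z) \<le> M) \<and>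
      (\<forall>z. Im z = 0 \<longrightarrow> cmod (P z) \<le> \<epsilon>) \<and> (\<forall>z. Im z = \<beta> \<longrightarrow> cmod (P z - c) \<le> \<epsilon>)"
    proof (intro exI[of _ ?P] exI[of _ "M * exp (\<bar>l\<bar> * \<beta>) + cmod ?L"] conjI allI impI)
      show "?P holomorphic_on UNIV" by (intro holomorphic_intros g)
      fix z :: complex
      { assume z: "0 \<le> Im z" "Im z \<le> \<beta>"
        have "l * Im z \<le> \<bar>l\<bar> * \<beta>" using z \<beta> by (meson abs_ge_self abs_ge_zero mult_mono)
        moreover have "0 \<le> M" using M[OF z] norm_ge_zero[of "g z"] by linarith
        ultimately have "cmod (g z) * exp (l * Im z) \<le> M * exp (\<bar>l\<bar> * \<beta>)"
          using M[OF z] by (intro mult_mono) auto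
        then have "cmod (g z * exp (- \<i> * of_real l * z)) \<le> M * exp (\<bar>l\<bar> * \<beta>)"
          by (simp add: norm_mult)
        then show "cmod (?P z) \<le> M * exp (\<bar>l\<bar> * \<beta>) + cmod ?L"
          using norm_triangle_ineq4[of "g z * exp (- \<i> * of_real l * z)" ?L] by linarith }
      { assume "Im z = 0"
        then obtain t where z: "z = of_real t" by (metis complex_is_Real_iff Reals_cases)
        have "?P z = exp (- \<i> * of_real l * of_real t) * (g z - exp (\<i> * of_real (l * t)) * ?L)"
          using rot[of t] unfolding z by (simp add: algebra_simps)
        also have "cmod \<dots> = cmod (\<psi> (b \<otimes>\<^bsub>Cstar S\<^esub> dynamics S N t a) - exp (\<i> * of_real (l * t)) * ?L)"
          unfolding norm_mult z bot ex by simp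
        finally show "cmod (?P z) \<le> \<epsilon>" using est(1)[of t] eb1 by linarith }
      { assume "Im z = \<beta>"
        then have z: "z = of_real (Re z) + \<i> * of_real \<beta>" by (simp add: complex_eq_iff)
        define t where "t = Re z"
        have z: "z = of_real t + \<i> * of_real \<beta>" using z by (simp add: t_def)
        have e: "exp (- \<i> * of_real l * z) = exp (- \<i> * of_real l * of_real t) * exp (of_real (l * \<beta>))"
          unfolding z by (simp add: algebra_simps flip: exp_add)
        have "?P z - c = exp (- \<i> * of_real l * of_real t) * exp (of_real (l * \<beta>)) *
            (g z - exp (\<i> * of_real (l * t)) * ?R)"
          using rot[of t] unfolding e c_def by (simp add: algebra_simps)
        also have "cmod \<dots> = exp (l * \<beta>) *
            cmod (\<psi> (dynamics S N t a \<otimes>\<^bsub>Cstar S\<^esub> b) - exp (\<i> * of_real (l * t)) * ?R)"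
          unfolding norm_mult z top ex by simp
        also have "\<dots> \<le> exp (\<bar>l\<bar> * \<beta>) * (anorm (Cstar S) b * \<delta>)"
          using est(2)[of t] \<beta> by (intro mult_mono) auto
        finally show "cmod (?P z - c) \<le> \<epsilon>" using eb by (simp add: mult_ac) }
    qed
  qed
  then have "?L = exp (of_real (l * \<beta>)) * ?R" by (simp add: c_def)
  then have "exp (- of_real (\<beta> * l)) * ?L = ?R"
    by (simp add: mult.commute[of l] flip: exp_add mult.assoc)
  then show ?thesis by (simp add: l_def)
qed

text \<open>The difference of both sides is continuous in \<open>b\<close> and vanishes on the dense
  set \<open>D\<close>.\<close>

lemma kms_generator_aux:
  assumes s: "s \<in> carrier S" and p: "p \<in> free_carrier S"
  shows "\<psi> (emb S (free_gen s * p)) = exp (- of_real (\<beta> * ln (N s))) * \<psi> (emb S (p * free_gen s))"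
proof -
  let ?v = "emb S (free_gen s)" and ?c = "exp (- of_real (\<beta> * ln (N s))) :: complex"
  have v: "?v \<in> carrier (Cstar S)" and pc: "emb S p \<in> carrier (Cstar S)" using s p by auto
  define \<Lambda> where "\<Lambda> = (\<lambda>X. \<psi> (?v \<otimes>\<^bsub>Cstar S\<^esub> X) - ?c * \<psi> (X \<otimes>\<^bsub>Cstar S\<^esub> ?v))"
  have "cmod (\<Lambda> (emb S p)) \<le> 0"
  proof (rule field_le_epsilon)
    fix e :: real assume "e > 0"
    define K where "K = anorm (Cstar S) ?v * (1 + cmod ?c) + 1"
    have K: "K > 0" using anorm_nonneg[OF v] by (auto simp: K_def intro!: add_nonneg_pos)
    then have "e / K > 0" using \<open>e > 0\<close> by simp
    then obtain b where b: "b \<in> D" "anorm (Cstar S) (emb S p \<ominus>\<^bsub>Cstar S\<^esub> b) < e / K"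
      using dense pc unfolding dense_subspace_def by blast
    have bc: "b \<in> carrier (Cstar S)" using b D_carrier by auto
    let ?E = "emb S p \<ominus>\<^bsub>Cstar S\<^esub> b"
    have E: "?E \<in> carrier (Cstar S)" using pc bc by simp
    have "\<Lambda> (emb S p) = \<Lambda> ?E"
      using v pc bc kms_generator_dense[OF s b(1)]
      by (simp add: \<Lambda>_def Cstar_distrib states_minus[OF \<psi>] algebra_simps)
    also have "cmod \<dots> \<le> cmod (\<psi> (?v \<otimes>\<^bsub>Cstar S\<^esub> ?E)) + cmod ?c * cmod (\<psi> (?E \<otimes>\<^bsub>Cstar S\<^esub> ?v))"
      unfolding \<Lambda>_def norm_mult[symmetric] by (rule norm_triangle_ineq4)
    also have "\<dots> \<le> anorm (Cstar S) ?v * anorm (Cstar S) ?E + cmod ?c * (anorm (Cstar S) ?E * anorm (Cstar S) ?v)"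
      using v E
      by (intro add_mono mult_left_mono order_trans[OF states_bound[OF \<psi>] anorm_mult_le]) auto
    also have "\<dots> = anorm (Cstar S) ?v * (1 + cmod ?c) * anorm (Cstar S) ?E" by (simp add: algebra_simps)
    also have "\<dots> \<le> K * anorm (Cstar S) ?E"
      using anorm_nonneg[OF E] by (intro mult_right_mono) (auto simp: K_def)
    also have "\<dots> \<le> K * (e / K)" using b(2) K by (intro mult_left_mono) auto
    finally show "cmod (\<Lambda> (emb S p)) \<le> 0 + e" using K by simp
  qed
  then show ?thesis using s p by (simp add: \<Lambda>_def emb_simps)
qed

end

lemma kms_generator:
  assumes "\<psi> \<in> kms_states (Cstar S) (dynamics S N) \<beta>" "0 < \<beta>" "s \<in> carrier S" "p \<in> free_carrier S"
  shows "\<psi> (emb S (free_gen s * p)) = exp (- of_real (\<beta> * ln (N s))) * \<psi> (emb S (p * free_gen s))"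
proof -
  from assms(1) obtain D where D: "\<psi> \<in> states (Cstar S)" "dense_subspace (Cstar S) D" "\<forall>t. dynamics S N t ` D \<subseteq> D"
    "\<forall>a\<in>D. \<exists>f. analytic_extension (Cstar S) (dynamics S N) a f \<and>
      (\<forall>b\<in>D. \<psi> (a \<otimes>\<^bsub>Cstar S\<^esub> b) = \<psi> (b \<otimes>\<^bsub>Cstar S\<^esub> f (\<i> * of_real \<beta>)))"
    unfolding kms_states_def mem_Collect_eq by (elim conjE exE)
  show ?thesis
    by (rule kms_generator_aux[OF D(1) assms(2) D(2) D(3)[THEN spec] D(4)[THEN bspec] assms(3,4)])
qed

subsection \<open>KMS states from functionals on words\<close>

lemma norm_wmul_le:
  assumes p: "p \<in> free_carrier S"
  shows "universal_norm S (wmul f p) \<le> (\<Sum>w\<in>Poly_Mapping.keys p. cmod (f w) * cmod (Poly_Mapping.lookup p w))"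
proof -
  have "universal_norm S (wmul f p) \<le> l1_norm (wmul f p)" using p by (intro unorm_le_l1) auto
  also have "\<dots> \<le> (\<Sum>w\<in>Poly_Mapping.keys p. cmod (Poly_Mapping.lookup (wmul f p) w))"
    unfolding l1_norm_def by (intro sum_mono2) (auto simp: in_keys_iff)
  finally show ?thesis by (simp add: norm_mult)
qed

text \<open>Each word is an eigenvector of the dynamics, so the derivative can be taken coefficient
  by coefficient. Only finitely many coefficients occur, and the universal norm is dominated by
  their absolute sum.\<close>

lemma analytic_extension_emb:
  assumes p: "p \<in> free_carrier S"
  shows "analytic_extension (Cstar S) (dynamics S N) (emb S p) (\<lambda>z. emb S (free_dyn N z p))"
  unfolding analytic_extension_def
proof (intro conjI allI)
  show "emb S (free_dyn N z p) \<in> carrier (Cstar S)" for z using p by simp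
  show "emb S (free_dyn N (complex_of_real t) p) = dynamics S N t (emb S p)" for t
    using p by (simp add: dynamics_emb)
  fix z
  let ?e = "\<lambda>z w. exp (\<i> * z * word_log N w)"
  let ?d = "wmul (\<lambda>w. \<i> * word_log N w * ?e z w) p"
  let ?q = "\<lambda>h w. (?e (z + h) w - ?e z w) / h - \<i> * word_log N w * ?e z w"
  show "\<exists>d\<in>carrier (Cstar S). ((\<lambda>h. anorm (Cstar S) ((inverse h \<odot>\<^bsub>Cstar S\<^esub>
      (emb S (free_dyn N (z + h) p) \<ominus>\<^bsub>Cstar S\<^esub> emb S (free_dyn N z p))) \<ominus>\<^bsub>Cstar S\<^esub> d)) \<longlongrightarrow> 0) (at 0)"
  proof (intro bexI[of _ "emb S ?d"])
    have eq: "free_scale (inverse h) (free_dyn N (z + h) p - free_dyn N z p) - ?d = wmul (?q h) p" for h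
      by (rule poly_mapping_eqI) (simp add: free_dyn_def lookup_minus algebra_simps divide_inverse)
    have "((\<lambda>h. \<Sum>w\<in>Poly_Mapping.keys p. cmod (?q h w) * cmod (Poly_Mapping.lookup p w)) \<longlongrightarrow>
        (\<Sum>w\<in>Poly_Mapping.keys p. cmod 0 * cmod (Poly_Mapping.lookup p w))) (at 0)"
    proof (intro tendsto_intros)
      fix w
      have "((\<lambda>z. ?e z w) has_field_derivative \<i> * word_log N w * ?e z w) (at z)"
        by (auto intro!: derivative_eq_intros)
      then show "((\<lambda>h. ?q h w) \<longlongrightarrow> 0) (at 0)" unfolding DERIV_def by (rule LIM_zero)
    qed
    then have lim: "((\<lambda>h. \<Sum>w\<in>Poly_Mapping.keys p. cmod (?q h w) * cmod (Poly_Mapping.lookup p w)) \<longlongrightarrow> 0) (at 0)"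
      by simp
    show "((\<lambda>h. anorm (Cstar S) ((inverse h \<odot>\<^bsub>Cstar S\<^esub>
        (emb S (free_dyn N (z + h) p) \<ominus>\<^bsub>Cstar S\<^esub> emb S (free_dyn N z p))) \<ominus>\<^bsub>Cstar S\<^esub> emb S ?d)) \<longlongrightarrow> 0) (at 0)"
    proof (rule Lim_null_comparison[OF always_eventually lim], rule allI)
      fix h
      show "norm (anorm (Cstar S) ((inverse h \<odot>\<^bsub>Cstar S\<^esub>
          (emb S (free_dyn N (z + h) p) \<ominus>\<^bsub>Cstar S\<^esub> emb S (free_dyn N z p))) \<ominus>\<^bsub>Cstar S\<^esub> emb S ?d)) \<le>
        (\<Sum>w\<in>Poly_Mapping.keys p. cmod (?q h w) * cmod (Poly_Mapping.lookup p w))"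
        using norm_wmul_le[OF p, of "?q h"] p
        by (simp add: emb_minus emb_simps anorm_emb eq unorm_nonneg)
    qed
  qed (use p in simp)
qed

lemma dense_subspace_emb: "dense_subspace (Cstar S) (emb S ` free_carrier S)"
  unfolding dense_subspace_def
proof (intro conjI ballI allI impI)
  show "emb S ` free_carrier S \<subseteq> carrier (Cstar S)" by auto
  show "\<zero>\<^bsub>Cstar S\<^esub> \<in> emb S ` free_carrier S" by (simp add: Cstar_zero)
  show "a \<oplus>\<^bsub>Cstar S\<^esub> b \<in> emb S ` free_carrier S" if "a \<in> emb S ` free_carrier S" "b \<in> emb S ` free_carrier S" for a b
    using that by (auto simp: emb_simps)
  show "c \<odot>\<^bsub>Cstar S\<^esub> a \<in> emb S ` free_carrier S" if "a \<in> emb S ` free_carrier S" for a c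
    using that by (auto simp: emb_simps)
  show "\<exists>d\<in>emb S ` free_carrier S. anorm (Cstar S) (a \<ominus>\<^bsub>Cstar S\<^esub> d) < e"
    if "a \<in> carrier (Cstar S)" "0 < e" for a e
    using emb_dense[OF that] by blast
qed

text \<open>The image of the free algebra serves as the dense invariant subspace. The KMS identity
  is bilinear, so words suffice.\<close>

lemma kms_statesI:
  assumes \<omega>: "free_state S \<omega>"
    and words: "\<And>u w. u \<in> words S \<Longrightarrow> w \<in> words S \<Longrightarrow>
      \<omega> (word (u @ w)) = exp (- of_real (\<beta> * word_log N u)) * \<omega> (word (w @ u))"
  shows "state_ext S \<omega> \<in> kms_states (Cstar S) (dynamics S N) \<beta>"
proof -
  note L = free_state_linear[OF \<omega>]
  note lin = linear_functional_add[OF L] linear_functional_scale[OF L] linear_functional_zero[OF L]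
  let ?D = "free_dyn N (\<i> * of_real \<beta>)"
  have word_left: "\<omega> (word u * q) = \<omega> (q * ?D (word u))" if u: "u \<in> words S" and "q \<in> free_carrier S" for u q
    using that(2)
  proof (induction rule: free_carrier_induct)
    case (scale c w)
    \<comment> \<open>At time \<i>\<beta> the exponent \<open>\<i> * z * word_log N u\<close>
      becomes real and negative of \<open>\<beta> * word_log N u\<close>.\<close>
    have "?D (word u) = free_scale (exp (- of_real (\<beta> * word_log N u))) (word u)"
      by (simp add: free_dyn_def wmul_simps del: free_scale_single)
    then show ?case using scale u words[OF u scale]
      by (simp add: free_scale_mult_left free_scale_mult_right word_mult lin del: free_scale_single)
  qed (use u in \<open>simp_all add: lin ring_distribs\<close>)
  have kms: "\<omega> (p * q) = \<omega> (q * ?D p)" if "p \<in> free_carrier S" and q: "q \<in> free_carrier S" for p q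
    using that(1)
  proof (induction rule: free_carrier_induct)
    case (scale c w)
    then show ?case using q
      by (simp add: free_dyn_simps free_scale_mult_left free_scale_mult_right lin word_left del: free_scale_single)
  qed (use q in \<open>simp_all add: lin ring_distribs free_dyn_simps\<close>)
  have "\<exists>f. analytic_extension (Cstar S) (dynamics S N) a f \<and> (\<forall>b\<in>emb S ` free_carrier S.
      state_ext S \<omega> (a \<otimes>\<^bsub>Cstar S\<^esub> b) = state_ext S \<omega> (b \<otimes>\<^bsub>Cstar S\<^esub> f (\<i> * of_real \<beta>)))"
    if "a \<in> emb S ` free_carrier S" for a
  proof -
    from that obtain p where p: "p \<in> free_carrier S" "a = emb S p" by blast
    show ?thesis
      using p by (intro exI[of _ "\<lambda>z. emb S (free_dyn N z p)"] conjI ballI)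
        (auto simp: analytic_extension_emb emb_simps state_ext_emb[OF \<omega>] kms)
  qed
  moreover have "dynamics S N t ` (emb S ` free_carrier S) \<subseteq> emb S ` free_carrier S" for t
    by (auto simp: dynamics_emb)
  ultimately show ?thesis
    unfolding kms_states_def using state_ext_states[OF \<omega>] dense_subspace_emb by blast
qed

end

section \<open>Fractions over the kernel of a scale\<close>

locale lcm_scale = right_lcm_algebra S for S :: "'s monoid" (structure) +
  fixes N :: "'s \<Rightarrow> real"
  assumes scale_SN: "scale S N" and directed: "directed_kernel S N"

sublocale lcm_scale \<subseteq> scaled_algebra S N
  by unfold_locales (rule scale_SN)

context lcm_scale
begin

definition K :: "'s set" where "K = {s \<in> carrier S. N s = 1}"

lemma carrier_ker [simp]: "carrier (ker_scale S N) = K"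
  and mult_ker [simp]: "s \<otimes>\<^bsub>ker_scale S N\<^esub> t = s \<otimes> t"
  and one_ker [simp]: "\<one>\<^bsub>ker_scale S N\<^esub> = \<one>"
  by (simp_all add: ker_scale_def K_def)

lemma K_carrier: "a \<in> K \<Longrightarrow> a \<in> carrier S"
  by (simp add: K_def)

lemma K_one [simp]: "\<one> \<in> K"
  by (simp add: K_def N_one)

lemma K_mult [simp]: "a \<in> K \<Longrightarrow> b \<in> K \<Longrightarrow> a \<otimes> b \<in> K"
  by (simp add: K_def N_mult)

text \<open>Two numbers that are at least 1 have product 1 only if both equal 1. Thus the kernel
  contains all factors of its elements, a fact used throughout.\<close>

lemma K_mult_iff:
  assumes "s \<in> carrier S" "t \<in> carrier S" shows "s \<otimes> t \<in> K \<longleftrightarrow> s \<in> K \<and> t \<in> K"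
proof -
  have "N s * N t = 1 \<longleftrightarrow> N s = 1 \<and> N t = 1"
  proof
    assume *: "N s * N t = 1"
    have "N s * 1 \<le> N s * N t" "1 * N t \<le> N s * N t"
      using N_ge_one[OF assms(1)] N_ge_one[OF assms(2)] by (intro mult_left_mono mult_right_mono; simp)+
    then show "N s = 1 \<and> N t = 1" using * N_ge_one[OF assms(1)] N_ge_one[OF assms(2)] by simp
  qed simp
  then show ?thesis using assms by (simp add: K_def N_mult)
qed

text \<open>Directedness read as the right Ore condition: any two kernel elements have a common
  right multiple with kernel cofactors.\<close>

lemma ore:
  assumes "a \<in> K" "b \<in> K" obtains c d where "c \<in> K" "d \<in> K" "a \<otimes> c = b \<otimes> d"
proof -
  have "(a <#\<^bsub>ker_scale S N\<^esub> K) \<inter> (b <#\<^bsub>ker_scale S N\<^esub> K) \<noteq> {}"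
    using directed assms unfolding directed_kernel_def Let_def by simp
  then show ?thesis using that by (auto simp: l_coset_def)
qed

lemma assoc_K: "x \<in> carrier S \<Longrightarrow> b \<in> K \<Longrightarrow> c \<in> K \<Longrightarrow> x \<otimes> b \<otimes> c = x \<otimes> (b \<otimes> c)"
  by (simp add: m_assoc K_carrier)

text \<open>The relation of Ore localisation: numerator and denominator may be expanded on the right
  by the same kernel element, and two pairs are identified when suitable expansions agree.\<close>

definition frac_rel :: "(('s \<times> 's) \<times> ('s \<times> 's)) set" where
  "frac_rel = {((s, a), (t, b)). s \<in> carrier S \<and> t \<in> carrier S \<and> a \<in> K \<and> b \<in> K \<and>
     (\<exists>c\<in>K. \<exists>d\<in>K. s \<otimes> c = t \<otimes> d \<and> a \<otimes> c = b \<otimes> d)}"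

text \<open>\<open>fraction s a\<close> plays the role of \<open>s a\<^sup>-\<^sup>1\<close>.\<close>

definition fraction :: "'s \<Rightarrow> 's \<Rightarrow> ('s \<times> 's) set" where
  "fraction s a = frac_rel `` {(s, a)}"

definition fractions :: "('s \<times> 's) set set" where
  "fractions = (carrier S \<times> K) // frac_rel"

lemma equiv_frac_rel: "equiv (carrier S \<times> K) frac_rel"
proof (rule equivI)
  show "frac_rel \<subseteq> (carrier S \<times> K) \<times> (carrier S \<times> K)" by (auto simp: frac_rel_def)
  show "refl_on (carrier S \<times> K) frac_rel"
    by (auto simp: refl_on_def frac_rel_def intro!: bexI[of _ \<one>])
  show "sym frac_rel"
    by (rule symI) (auto simp: frac_rel_def; metis)
  show "trans frac_rel"
  proof (rule transI)
    fix x y z assume "(x, y) \<in> frac_rel" "(y, z) \<in> frac_rel"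
    then obtain s a t b u e c d c' d' where *: "x = (s, a)" "y = (t, b)" "z = (u, e)"
      "s \<in> carrier S" "t \<in> carrier S" "u \<in> carrier S" "a \<in> K" "b \<in> K" "e \<in> K"
      "c \<in> K" "d \<in> K" "c' \<in> K" "d' \<in> K"
      "s \<otimes> c = t \<otimes> d" "a \<otimes> c = b \<otimes> d" "t \<otimes> c' = u \<otimes> d'" "b \<otimes> c' = e \<otimes> d'"
      by (auto simp: frac_rel_def)
    \<comment> \<open>The middle fraction is expanded by \<open>d\<close> in one equation and by
      \<open>c'\<close> in the other; a common right multiple reconciles the two.\<close>
    obtain p q where pq: "p \<in> K" "q \<in> K" "d \<otimes> p = c' \<otimes> q" using ore[OF *(11,12)] by metis
    have "s \<otimes> (c \<otimes> p) = u \<otimes> (d' \<otimes> q)" "a \<otimes> (c \<otimes> p) = e \<otimes> (d' \<otimes> q)"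
      using * pq by (metis assoc_K K_carrier)+
    then have "\<exists>c\<in>K. \<exists>d\<in>K. s \<otimes> c = u \<otimes> d \<and> a \<otimes> c = e \<otimes> d"
      using * pq by (intro bexI[of _ "c \<otimes> p"] bexI[of _ "d' \<otimes> q"] conjI) auto
    then show "(x, z) \<in> frac_rel" using * by (simp add: frac_rel_def)
  qed
qed

lemma frac_eq_iff:
  assumes "s \<in> carrier S" "t \<in> carrier S" "a \<in> K" "b \<in> K"
  shows "fraction s a = fraction t b \<longleftrightarrow> (\<exists>c\<in>K. \<exists>d\<in>K. s \<otimes> c = t \<otimes> d \<and> a \<otimes> c = b \<otimes> d)"
  unfolding fraction_def using eq_equiv_class_iff[OF equiv_frac_rel, of "(s, a)" "(t, b)"] assms
  by (simp add: frac_rel_def)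

lemma frac_eqI:
  "\<lbrakk>s \<in> carrier S; t \<in> carrier S; a \<in> K; b \<in> K; c \<in> K; d \<in> K; s \<otimes> c = t \<otimes> d; a \<otimes> c = b \<otimes> d\<rbrakk> \<Longrightarrow>
    fraction s a = fraction t b"
  using frac_eq_iff by blast

lemma frac_in [simp]: "s \<in> carrier S \<Longrightarrow> a \<in> K \<Longrightarrow> fraction s a \<in> fractions"
  unfolding fraction_def fractions_def by (rule quotientI) simp

lemma fracs_cases:
  assumes "X \<in> fractions" obtains s a where "s \<in> carrier S" "a \<in> K" "X = fraction s a"
  using assms unfolding fractions_def fraction_def by (auto elim!: quotientE)

lemma frac_cancel:
  "s \<in> carrier S \<Longrightarrow> a \<in> K \<Longrightarrow> c \<in> K \<Longrightarrow> fraction (s \<otimes> c) (a \<otimes> c) = fraction s a"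
  by (rule frac_eqI[of _ _ _ _ \<one> c]) (auto simp: K_carrier)

lemma UN_frac:
  assumes "s \<in> carrier S" "a \<in> K" "\<And>t b. t \<in> carrier S \<Longrightarrow> b \<in> K \<Longrightarrow> fraction t b = fraction s a \<Longrightarrow> F t b = F s a"
  shows "(\<Union>(t, b)\<in>fraction s a. F t b) = F s a"
proof (rule SUP_eq_const)
  show "fraction s a \<noteq> {}" unfolding fraction_def using equiv_class_self[OF equiv_frac_rel, of "(s, a)"] assms by auto
  fix x assume "x \<in> fraction s a"
  then obtain t b where x: "x = (t, b)" "((s, a), (t, b)) \<in> frac_rel" by (cases x) (auto simp: fraction_def)
  then have "fraction s a = fraction t b" unfolding fraction_def using equiv_class_eq[OF equiv_frac_rel] by blast
  then show "(case x of (t, b) \<Rightarrow> F t b) = F s a"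
    using x assms(3)[of t b] by (auto simp: frac_rel_def)
qed

section \<open>Left multiplication and right translation of fractions\<close>

definition gact :: "'s \<Rightarrow> ('s \<times> 's) set \<Rightarrow> ('s \<times> 's) set" where
  "gact t X = (\<Union>(s, a)\<in>X. fraction (t \<otimes> s) a)"

text \<open>Right multiplication by the inverse of \<open>a\<close>, which turns the denominator
  \<open>b\<close> into \<open>a \<otimes> b\<close>. It commutes with the left action, so it can
  identify the vector states of all fractions in one class.\<close>

definition rtrans :: "'s \<Rightarrow> ('s \<times> 's) set \<Rightarrow> ('s \<times> 's) set" where
  "rtrans a X = (\<Union>(s, b)\<in>X. fraction s (a \<otimes> b))"

lemma gact_frac:
  assumes "t \<in> carrier S" "s \<in> carrier S" "a \<in> K" shows "gact t (fraction s a) = fraction (t \<otimes> s) a"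
  unfolding gact_def
proof (rule UN_frac[OF assms(2,3)])
  fix s' b assume *: "s' \<in> carrier S" "b \<in> K" "fraction s' b = fraction s a"
  then obtain c d where "c \<in> K" "d \<in> K" "s' \<otimes> c = s \<otimes> d" "b \<otimes> c = a \<otimes> d"
    using assms by (auto simp: frac_eq_iff)
  then show "fraction (t \<otimes> s') b = fraction (t \<otimes> s) a"
    using assms * by (intro frac_eqI[of _ _ _ _ c d]) (auto simp: m_assoc K_carrier)
qed

lemma rtrans_frac:
  assumes "e \<in> K" "s \<in> carrier S" "a \<in> K" shows "rtrans e (fraction s a) = fraction s (e \<otimes> a)"
  unfolding rtrans_def
proof (rule UN_frac[OF assms(2,3)])
  fix s' b assume *: "s' \<in> carrier S" "b \<in> K" "fraction s' b = fraction s a"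
  then obtain c d where "c \<in> K" "d \<in> K" "s' \<otimes> c = s \<otimes> d" "b \<otimes> c = a \<otimes> d"
    using assms by (auto simp: frac_eq_iff)
  then show "fraction s' (e \<otimes> b) = fraction s (e \<otimes> a)"
    using assms * by (intro frac_eqI[of _ _ _ _ c d]) (auto simp: m_assoc K_carrier)
qed

lemma gact_in [simp]: "t \<in> carrier S \<Longrightarrow> X \<in> fractions \<Longrightarrow> gact t X \<in> fractions"
  by (erule fracs_cases) (simp add: gact_frac)

lemma rtrans_in [simp]: "e \<in> K \<Longrightarrow> X \<in> fractions \<Longrightarrow> rtrans e X \<in> fractions"
  by (erule fracs_cases) (simp add: rtrans_frac)

text \<open>Left cancellation in \<open>S\<close> passes to fractions. It makes the adjoint of a
  generator a well-defined partial map.\<close>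

lemma gact_inj:
  assumes "t \<in> carrier S" "X \<in> fractions" "Y \<in> fractions" "gact t X = gact t Y" shows "X = Y"
proof -
  obtain s a where X: "s \<in> carrier S" "a \<in> K" "X = fraction s a" using assms(2) by (rule fracs_cases)
  obtain u b where Y: "u \<in> carrier S" "b \<in> K" "Y = fraction u b" using assms(3) by (rule fracs_cases)
  obtain c d where cd: "c \<in> K" "d \<in> K" "t \<otimes> s \<otimes> c = t \<otimes> u \<otimes> d" "a \<otimes> c = b \<otimes> d"
    using assms(1,4) X Y by (auto simp: gact_frac frac_eq_iff)
  then have "s \<otimes> c = u \<otimes> d"
    using assms(1) X Y left_cancel[of t "s \<otimes> c" "u \<otimes> d"] by (simp add: m_assoc K_carrier)
  then show ?thesis using X Y cd by (auto simp: frac_eq_iff)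
qed

lemma gact_one: "X \<in> fractions \<Longrightarrow> gact \<one> X = X"
  by (erule fracs_cases) (simp add: gact_frac)

lemma gact_gact: "s \<in> carrier S \<Longrightarrow> t \<in> carrier S \<Longrightarrow> X \<in> fractions \<Longrightarrow> gact s (gact t X) = gact (s \<otimes> t) X"
  by (erule fracs_cases) (simp add: gact_frac m_assoc)

lemma gact_rtrans: "t \<in> carrier S \<Longrightarrow> e \<in> K \<Longrightarrow> X \<in> fractions \<Longrightarrow> gact t (rtrans e X) = rtrans e (gact t X)"
  by (erule fracs_cases) (simp add: gact_frac rtrans_frac)

text \<open>Undoing a right translation does not leave the range of \<open>gact t\<close>: after
  expanding \<open>X\<close> by \<open>c'\<close> its numerator is
  \<open>t \<otimes> y \<otimes> c\<close>. Hence \<open>Adj t\<close> has the same domain before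
  and after the translation.\<close>

lemma gact_rtrans_image:
  assumes t: "t \<in> carrier S" and e: "e \<in> K" and X: "X \<in> fractions" and Y: "Y \<in> fractions" "gact t Y = rtrans e X"
  shows "\<exists>Z\<in>fractions. gact t Z = X"
proof -
  obtain s b where s: "s \<in> carrier S" "b \<in> K" "X = fraction s b" using X by (rule fracs_cases)
  obtain y d where y: "y \<in> carrier S" "d \<in> K" "Y = fraction y d" using Y(1) by (rule fracs_cases)
  obtain c c' where c: "c \<in> K" "c' \<in> K" "t \<otimes> y \<otimes> c = s \<otimes> c'"
    using Y(2) s y t e by (auto simp: gact_frac rtrans_frac frac_eq_iff)
  have "gact t (fraction (y \<otimes> c) (b \<otimes> c')) = fraction (s \<otimes> c') (b \<otimes> c')"
    using c s y t by (simp add: gact_frac m_assoc K_carrier)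
  also have "\<dots> = X" using s c by (simp add: frac_cancel)
  finally show ?thesis using s y c by (auto simp: K_carrier)
qed

text \<open>Equality of the two images yields expansions with one common numerator, which is then a
  right multiple of both \<open>s\<close> and \<open>t\<close>. This connects ranges of the action
  with right ideals of \<open>S\<close>.\<close>

lemma gact_image_int:
  assumes "s \<in> carrier S" "t \<in> carrier S" "X \<in> fractions" "Y \<in> fractions" "gact s X = gact t Y"
  shows "\<exists>u\<in>(s <# carrier S) \<inter> (t <# carrier S). \<exists>a\<in>K. gact s X = fraction u a"
proof -
  obtain x a where X: "x \<in> carrier S" "a \<in> K" "X = fraction x a" using assms(3) by (rule fracs_cases)
  obtain y b where Y: "y \<in> carrier S" "b \<in> K" "Y = fraction y b" using assms(4) by (rule fracs_cases)
  obtain c d where cd: "c \<in> K" "d \<in> K" "s \<otimes> x \<otimes> c = t \<otimes> y \<otimes> d" "a \<otimes> c = b \<otimes> d"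
  proof -
    have "fraction (s \<otimes> x) a = fraction (t \<otimes> y) b"
      using assms(5) unfolding X(3) Y(3) gact_frac[OF assms(1) X(1,2)] gact_frac[OF assms(2) Y(1,2)] .
    then show ?thesis
      using that frac_eq_iff[of "s \<otimes> x" "t \<otimes> y" a b] assms(1,2) X(1,2) Y(1,2) by auto
  qed
  have "gact s X = fraction (s \<otimes> x \<otimes> c) (a \<otimes> c)"
    unfolding X(3) gact_frac[OF assms(1) X(1,2)] using assms X cd by (intro frac_cancel[symmetric]) auto
  moreover have "s \<otimes> x \<otimes> c \<in> s <# carrier S"
    unfolding l_coset_iff using assms(1) X cd(1) by (intro bexI[of _ "x \<otimes> c"]) (auto simp: m_assoc K_carrier)
  moreover have "s \<otimes> x \<otimes> c \<in> t <# carrier S"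
    unfolding l_coset_iff cd(3) using assms(2) Y cd(2)
    by (intro bexI[of _ "y \<otimes> d"]) (auto simp: m_assoc K_carrier)
  moreover have "a \<otimes> c \<in> K" using X(2) cd(1) by simp
  ultimately show ?thesis by blast
qed

lemma image_gact_of_coset:
  assumes "r \<in> carrier S" "u \<in> r <# carrier S" "a \<in> K" shows "\<exists>Z\<in>fractions. gact r Z = fraction u a"
proof -
  obtain y where "y \<in> carrier S" "u = r \<otimes> y" using assms(2) unfolding l_coset_iff by blast
  then show ?thesis using assms(1,3) by (intro bexI[of _ "fraction y a"]) (simp_all add: gact_frac)
qed

subsection \<open>The partial action of words\<close>

text \<open>\<open>None\<close> stands for the zero vector: the adjoint of an isometry annihilates
  what is orthogonal to its range. The description is unique by \<open>gact_inj\<close>.\<close>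

fun act :: "'s letter \<Rightarrow> ('s \<times> 's) set \<Rightarrow> ('s \<times> 's) set option" where
  "act (Gen t) X = Some (gact t X)"
| "act (Adj t) X = (if \<exists>Y\<in>fractions. gact t Y = X then Some (THE Y. Y \<in> fractions \<and> gact t Y = X) else None)"

fun wact :: "'s letter list \<Rightarrow> ('s \<times> 's) set \<Rightarrow> ('s \<times> 's) set option" where
  "wact [] X = Some X"
| "wact (l # w) X = Option.bind (wact w X) (act l)"

lemma act_Adj_gact:
  assumes "t \<in> carrier S" "Y \<in> fractions" shows "act (Adj t) (gact t Y) = Some Y"
proof -
  have "(THE Z. Z \<in> fractions \<and> gact t Z = gact t Y) = Y"
    using assms gact_inj by (intro the_equality) blast+
  then show ?thesis unfolding act.simps using assms(2) by (metis)
qed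

lemma act_Adj_None: "(\<And>Y. Y \<in> fractions \<Longrightarrow> gact t Y \<noteq> X) \<Longrightarrow> act (Adj t) X = None"
  by auto

lemma act_Adj_cases:
  assumes "t \<in> carrier S"
  obtains Y where "Y \<in> fractions" "X = gact t Y" "act (Adj t) X = Some Y"
    | "\<And>Y. Y \<in> fractions \<Longrightarrow> gact t Y \<noteq> X" "act (Adj t) X = None"
proof (cases "\<exists>Y\<in>fractions. gact t Y = X")
  case True
  then obtain Y where Y: "Y \<in> fractions" "gact t Y = X" by blast
  have "act (Adj t) X = Some Y" using act_Adj_gact[OF assms Y(1)] unfolding Y(2) .
  then show ?thesis by (rule that(1)[OF Y(1) Y(2)[symmetric]])
next
  case False
  then have no: "\<And>Y. Y \<in> fractions \<Longrightarrow> gact t Y \<noteq> X" by blast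
  show ?thesis by (rule that(2)[OF no act_Adj_None[OF no]])
qed

lemma act_in:
  assumes "letter_base l \<in> carrier S" "X \<in> fractions" "act l X = Some Y" shows "Y \<in> fractions"
proof (cases l)
  case (Adj t)
  then have t: "t \<in> carrier S" using assms by simp
  show ?thesis
    by (rule act_Adj_cases[OF t, of X]) (use assms(3) Adj in auto)
qed (use assms in auto)

lemma wact_in: "w \<in> words S \<Longrightarrow> X \<in> fractions \<Longrightarrow> wact w X = Some Y \<Longrightarrow> Y \<in> fractions"
  by (induction w arbitrary: Y) (auto simp: bind_eq_Some_conv intro: act_in)

lemma wact_append: "wact (u @ w) X = Option.bind (wact w X) (wact u)"
  by (induction u) (auto simp: Option.bind_assoc)

text \<open>A defining relation verified as an identity of partial maps may be applied inside any
  word.\<close>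

lemma wact_cong_mid:
  assumes "w \<in> words S" "X \<in> fractions" "\<And>Y. Y \<in> fractions \<Longrightarrow> wact m Y = wact m' Y"
  shows "wact (u @ m @ w) X = wact (u @ m' @ w) X"
  using assms wact_in[OF assms(1,2)] by (cases "wact w X") (auto simp: wact_append)

lemma wact_isometry: "s \<in> carrier S \<Longrightarrow> X \<in> fractions \<Longrightarrow> wact [Adj s, Gen s] X = Some X"
  using act_Adj_gact[of s X] by simp

lemma wact_proj:
  assumes "s \<in> carrier S"
  shows "wact [Gen s, Adj s] X = (if \<exists>Y\<in>fractions. gact s Y = X then Some X else None)"
  using assms by (cases rule: act_Adj_cases[of s X]) (auto simp del: act.simps(2))

lemma wact_proj_proj:
  assumes "s \<in> carrier S" "t \<in> carrier S"
  shows "wact [Gen s, Adj s, Gen t, Adj t] X =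
    (if (\<exists>Y\<in>fractions. gact s Y = X) \<and> (\<exists>Y\<in>fractions. gact t Y = X) then Some X else None)"
proof -
  have "wact ([Gen s, Adj s] @ [Gen t, Adj t]) X = Option.bind (wact [Gen t, Adj t] X) (wact [Gen s, Adj s])"
    by (rule wact_append)
  then show ?thesis unfolding wact_proj[OF assms(1)] wact_proj[OF assms(2)] by simp
qed

text \<open>Both sides are partial identities, so only their domains matter: a fraction lies in the
  ranges of \<open>s\<close> and \<open>t\<close> exactly when it lies in the range of
  \<open>r\<close>.\<close>

lemma wact_lcm:
  assumes s: "s \<in> carrier S" and t: "t \<in> carrier S" and r: "r \<in> carrier S"
    and lcm: "(s <# carrier S) \<inter> (t <# carrier S) = r <# carrier S"
  shows "wact [Gen s, Adj s, Gen t, Adj t] X = wact [Gen r, Adj r] X"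
proof -
  have "(\<exists>Y\<in>fractions. gact s Y = X) \<and> (\<exists>Y\<in>fractions. gact t Y = X) \<longleftrightarrow> (\<exists>Y\<in>fractions. gact r Y = X)"
  proof
    assume "(\<exists>Y\<in>fractions. gact s Y = X) \<and> (\<exists>Y\<in>fractions. gact t Y = X)"
    then obtain Y Z where YZ: "Y \<in> fractions" "Z \<in> fractions" "gact s Y = X" "gact t Z = X" by blast
    then obtain u a where "u \<in> r <# carrier S" "a \<in> K" "X = fraction u a"
      using gact_image_int[OF s t, of Y Z] lcm by auto
    then show "\<exists>Y\<in>fractions. gact r Y = X" using image_gact_of_coset[OF r] by auto
  next
    assume "\<exists>Y\<in>fractions. gact r Y = X"
    then obtain y a where y: "y \<in> carrier S" "a \<in> K" "X = fraction (r \<otimes> y) a"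
      using r by (auto elim!: fracs_cases simp: gact_frac)
    then have "r \<otimes> y \<in> (s <# carrier S) \<inter> (t <# carrier S)" unfolding lcm by (auto simp: l_coset_iff)
    then show "(\<exists>Y\<in>fractions. gact s Y = X) \<and> (\<exists>Y\<in>fractions. gact t Y = X)"
      using image_gact_of_coset[OF s] image_gact_of_coset[OF t] y by auto
  qed
  then show ?thesis unfolding wact_proj_proj[OF s t] wact_proj[OF r] by simp
qed

lemma wact_disjoint:
  assumes s: "s \<in> carrier S" and t: "t \<in> carrier S" and "(s <# carrier S) \<inter> (t <# carrier S) = {}"
  shows "wact [Gen s, Adj s, Gen t, Adj t] X = None"
  unfolding wact_proj_proj[OF s t] using gact_image_int[OF s t] assms(3) by auto

lemma act_rtrans:
  assumes "letter_base l \<in> carrier S" "e \<in> K" "X \<in> fractions"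
  shows "act l (rtrans e X) = map_option (rtrans e) (act l X)"
proof (cases l)
  case (Gen t)
  then show ?thesis using assms by (simp add: gact_rtrans)
next
  case (Adj t)
  then have t: "t \<in> carrier S" using assms by simp
  show ?thesis
  proof (cases rule: act_Adj_cases[OF t, of X])
    case (1 Y)
    then have "act (Adj t) (rtrans e X) = Some (rtrans e Y)"
      using act_Adj_gact[OF t, of "rtrans e Y"] gact_rtrans[OF t assms(2), of Y] assms by simp
    with 1 Adj show ?thesis by simp
  next
    case 2
    have "act (Adj t) (rtrans e X) = None"
      using gact_rtrans_image[OF t assms(2,3)] 2(1) by (intro act_Adj_None) blast
    with 2 Adj show ?thesis by simp
  qed
qed

lemma wact_rtrans:
  "w \<in> words S \<Longrightarrow> e \<in> K \<Longrightarrow> X \<in> fractions \<Longrightarrow> wact w (rtrans e X) = map_option (rtrans e) (wact w X)"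
proof (induction w)
  case (Cons l w)
  then show ?case
    using wact_in[of w X] by (cases "wact w X") (auto simp: act_rtrans simp del: act.simps(2))
qed simp

subsection \<open>Classes of the scale relation\<close>

abbreviation rel :: "('s \<times> 's) set" where "rel \<equiv> scale_rel S N"

lemma rel_iff: "(s, t) \<in> rel \<longleftrightarrow> s \<in> carrier S \<and> t \<in> carrier S \<and> (\<exists>a\<in>K. \<exists>b\<in>K. s \<otimes> a = t \<otimes> b)"
  by (simp add: scale_rel_def)

lemma equiv_rel: "equiv (carrier S) rel"
proof (rule equivI)
  show "rel \<subseteq> carrier S \<times> carrier S" by (auto simp: rel_iff)
  show "refl_on (carrier S) rel"
    by (simp add: refl_on_def rel_iff) (use K_one in blast)
  show "sym rel" by (rule symI) (auto simp: rel_iff; metis)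
  show "trans rel"
  proof (rule transI)
    fix s t u assume "(s, t) \<in> rel" "(t, u) \<in> rel"
    then obtain a b c d where *: "s \<in> carrier S" "t \<in> carrier S" "u \<in> carrier S" "a \<in> K" "b \<in> K" "c \<in> K" "d \<in> K"
      "s \<otimes> a = t \<otimes> b" "t \<otimes> c = u \<otimes> d" by (auto simp: rel_iff)
    obtain p q where pq: "p \<in> K" "q \<in> K" "b \<otimes> p = c \<otimes> q" using ore[OF *(5,6)] by metis
    have "s \<otimes> (a \<otimes> p) = u \<otimes> (d \<otimes> q)" using * pq by (metis assoc_K)
    then have "\<exists>a\<in>K. \<exists>b\<in>K. s \<otimes> a = u \<otimes> b"
      using * pq by (intro bexI[of _ "a \<otimes> p"] bexI[of _ "d \<otimes> q"]) auto
    then show "(s, u) \<in> rel" using * by (simp add: rel_iff)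
  qed
qed

lemma rel_N: "(s, t) \<in> rel \<Longrightarrow> N s = N t"
proof -
  assume "(s, t) \<in> rel"
  then obtain a b where "s \<in> carrier S" "t \<in> carrier S" "a \<in> K" "b \<in> K" "s \<otimes> a = t \<otimes> b" by (auto simp: rel_iff)
  then show ?thesis using N_mult[of s a] N_mult[of t b] by (simp add: K_def)
qed

text \<open>By left cancellation \<open>S\<close> acts on the classes by injections; this later
  permits reindexing the sum over classes.\<close>

lemma rel_gact: "s \<in> carrier S \<Longrightarrow> t \<in> carrier S \<Longrightarrow> u \<in> carrier S \<Longrightarrow> (s \<otimes> t, s \<otimes> u) \<in> rel \<longleftrightarrow> (t, u) \<in> rel"
proof
  assume c: "s \<in> carrier S" "t \<in> carrier S" "u \<in> carrier S" and "(s \<otimes> t, s \<otimes> u) \<in> rel"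
  then obtain a b where "a \<in> K" "b \<in> K" "s \<otimes> (t \<otimes> a) = s \<otimes> (u \<otimes> b)" by (auto simp: rel_iff m_assoc K_carrier)
  then show "(t, u) \<in> rel" using c left_cancel[of s "t \<otimes> a" "u \<otimes> b"] by (auto simp: rel_iff K_carrier)
qed (auto simp: rel_iff m_assoc K_carrier; metis)

lemma frac_common:
  assumes "(s, t) \<in> rel" "a \<in> K" "b \<in> K"
  obtains u a' b' where "u \<in> carrier S" "a' \<in> K" "b' \<in> K" "fraction s a = fraction u a'" "fraction t b = fraction u b'"
proof -
  obtain c d where *: "s \<in> carrier S" "t \<in> carrier S" "c \<in> K" "d \<in> K" "s \<otimes> c = t \<otimes> d"
    using assms(1) by (auto simp: rel_iff)
  then show ?thesis
    using assms that[of "s \<otimes> c" "a \<otimes> c" "b \<otimes> d"] frac_cancel[of s a c] frac_cancel[of t b d] by (simp add: K_carrier)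
qed

lemma frac_eq_rel: "s \<in> carrier S \<Longrightarrow> t \<in> carrier S \<Longrightarrow> a \<in> K \<Longrightarrow> b \<in> K \<Longrightarrow> fraction s a = fraction t b \<Longrightarrow> (s, t) \<in> rel"
  by (auto simp: frac_eq_iff rel_iff)

text \<open>The class of the numerator, independent of the representative. Fractions with different
  orbits will be orthogonal.\<close>

definition orbit :: "('s \<times> 's) set \<Rightarrow> 's set" where
  "orbit X = (\<Union>(s, a)\<in>X. rel `` {s})"

lemma orbit_frac: "s \<in> carrier S \<Longrightarrow> a \<in> K \<Longrightarrow> orbit (fraction s a) = rel `` {s}"
  unfolding orbit_def
  by (rule UN_frac) (auto intro!: equiv_class_eq[OF equiv_rel] intro: frac_eq_rel)

lemma orbit_eq_obtain:
  assumes "X \<in> fractions" "Y \<in> fractions" "orbit X = orbit Y"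
  obtains u a b where "u \<in> carrier S" "a \<in> K" "b \<in> K" "X = fraction u a" "Y = fraction u b"
proof -
  obtain s a where X: "s \<in> carrier S" "a \<in> K" "X = fraction s a" using assms(1) by (rule fracs_cases)
  obtain t b where Y: "t \<in> carrier S" "b \<in> K" "Y = fraction t b" using assms(2) by (rule fracs_cases)
  have "(s, t) \<in> rel" using assms(3) X Y eq_equiv_class[OF _ equiv_rel] by (simp add: orbit_frac)
  then show ?thesis using that frac_common[of s t a b] X Y by metis
qed

text \<open>Adding one fraction at a time, the numerator found so far is multiplied on the right
  until it agrees with the new one. Positivity then needs to be known only for denominators, that
  is, inside the kernel.\<close>

lemma finite_common_numerator:
  assumes "finite A" "A \<noteq> {}" "\<And>i. i \<in> A \<Longrightarrow> g i \<in> fractions" "\<And>i. i \<in> A \<Longrightarrow> orbit (g i) = C"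
  shows "\<exists>u\<in>carrier S. \<exists>a. \<forall>i\<in>A. a i \<in> K \<and> g i = fraction u (a i)"
  using assms
proof (induction A rule: finite_ne_induct)
  case (singleton i)
  then obtain s b where "s \<in> carrier S" "b \<in> K" "g i = fraction s b" using fracs_cases[of "g i"] by auto
  then show ?case by (intro bexI[of _ s] exI[of _ "\<lambda>_. b"]) auto
next
  case (insert i A)
  then obtain u a where u: "u \<in> carrier S" "\<And>j. j \<in> A \<Longrightarrow> a j \<in> K" "\<And>j. j \<in> A \<Longrightarrow> g j = fraction u (a j)"
    using insert by (metis insertCI)
  obtain j where j: "j \<in> A" using insert by blast
  obtain s b where s: "s \<in> carrier S" "b \<in> K" "g i = fraction s b" using fracs_cases[of "g i"] insert by auto
  have "orbit (g i) = orbit (g j)" using insert j by simp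
  then have "(s, u) \<in> rel"
    using s u(1) u(2)[OF j] u(3)[OF j] eq_equiv_class[OF _ equiv_rel] by (simp add: orbit_frac)
  then obtain c d where c: "c \<in> K" "d \<in> K" "s \<otimes> c = u \<otimes> d" by (auto simp: rel_iff)
  have "g i = fraction (u \<otimes> d) (b \<otimes> c)" using s c frac_cancel[of s b c] by simp
  moreover have "g k = fraction (u \<otimes> d) (a k \<otimes> d)" if "k \<in> A" for k
    using u that c frac_cancel[of u "a k" d] by simp
  ultimately show ?case
    using insert u s c
    by (intro bexI[of _ "u \<otimes> d"] exI[of _ "\<lambda>k. if k = i then b \<otimes> c else a k \<otimes> d"]) (auto simp: K_carrier)
qed

end

section \<open>Vector states of the induced representation\<close>

text \<open>The value at \<open>a * x * b\<close> is linear in \<open>a\<close> and in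
  \<open>b\<close>, so replacing one side of a relation by the other inside a word is all that must
  be checked.\<close>

lemma (in isometry_algebra) relators_vanish_words:
  assumes unit: "\<And>u w. u \<in> words S \<Longrightarrow> w \<in> words S \<Longrightarrow> f (u @ [Gen \<one>\<^bsub>S\<^esub>] @ w) = f (u @ w)"
    and iso: "\<And>u w s. u \<in> words S \<Longrightarrow> w \<in> words S \<Longrightarrow> s \<in> carrier S \<Longrightarrow>
      f (u @ [Adj s, Gen s] @ w) = f (u @ w)"
    and mul: "\<And>u w s t. u \<in> words S \<Longrightarrow> w \<in> words S \<Longrightarrow> s \<in> carrier S \<Longrightarrow> t \<in> carrier S \<Longrightarrow>
      f (u @ [Gen s, Gen t] @ w) = f (u @ [Gen (s \<otimes>\<^bsub>S\<^esub> t)] @ w)"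
    and lcm: "\<And>u w s t r. u \<in> words S \<Longrightarrow> w \<in> words S \<Longrightarrow> s \<in> carrier S \<Longrightarrow> t \<in> carrier S \<Longrightarrow> r \<in> carrier S \<Longrightarrow>
      (s <#\<^bsub>S\<^esub> carrier S) \<inter> (t <#\<^bsub>S\<^esub> carrier S) = r <#\<^bsub>S\<^esub> carrier S \<Longrightarrow>
      f (u @ [Gen s, Adj s, Gen t, Adj t] @ w) = f (u @ [Gen r, Adj r] @ w)"
    and disj: "\<And>u w s t. u \<in> words S \<Longrightarrow> w \<in> words S \<Longrightarrow> s \<in> carrier S \<Longrightarrow> t \<in> carrier S \<Longrightarrow>
      (s <#\<^bsub>S\<^esub> carrier S) \<inter> (t <#\<^bsub>S\<^esub> carrier S) = {} \<Longrightarrow> f (u @ [Gen s, Adj s, Gen t, Adj t] @ w) = 0"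
    and a: "a \<in> free_carrier S" and b: "b \<in> free_carrier S" and x: "x \<in> relators S"
  shows "lin f (a * x * b) = 0"
proof -
  have w2: "free_gen s * free_gen t = word [Gen s, Gen t]"
    "free_star (free_gen s) * free_gen s = word [Adj s, Gen s]"
    "free_proj s * free_proj t = word [Gen s, Adj s, Gen t, Adj t]" for s t :: 's
    by (simp_all add: free_gen_def free_proj_def word_mult)
  have words: "lin f (word u * x * word w) = 0" if u: "u \<in> words S" and w: "w \<in> words S" for u w
  proof -
    from x consider "x = word [Gen \<one>\<^bsub>S\<^esub>] - word []"
      | s where "s \<in> carrier S" "x = word [Adj s, Gen s] - word []"
      | s t where "s \<in> carrier S" "t \<in> carrier S" "x = word [Gen s, Gen t] - word [Gen (s \<otimes>\<^bsub>S\<^esub> t)]"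
      | s t r where "s \<in> carrier S" "t \<in> carrier S" "r \<in> carrier S"
        "(s <#\<^bsub>S\<^esub> carrier S) \<inter> (t <#\<^bsub>S\<^esub> carrier S) = r <#\<^bsub>S\<^esub> carrier S"
        "x = word [Gen s, Adj s, Gen t, Adj t] - word [Gen r, Adj r]"
      | s t where "s \<in> carrier S" "t \<in> carrier S"
        "(s <#\<^bsub>S\<^esub> carrier S) \<inter> (t <#\<^bsub>S\<^esub> carrier S) = {}" "x = word [Gen s, Adj s, Gen t, Adj t]"
      unfolding relators_def w2 word_Nil word_Gen word_proj by blast
    then show ?thesis
    proof cases
      case 1
      then show ?thesis using unit[OF u w] by (simp add: right_diff_distrib left_diff_distrib word_mult)
    next
      case (2 s)
      then show ?thesis using iso[OF u w] by (simp add: right_diff_distrib left_diff_distrib word_mult)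
    next
      case (3 s t)
      then show ?thesis using mul[OF u w] by (simp add: right_diff_distrib left_diff_distrib word_mult)
    next
      case (4 s t r)
      then show ?thesis using lcm[OF u w 4(1-4)] by (simp add: right_diff_distrib left_diff_distrib word_mult)
    next
      case (5 s t)
      then show ?thesis using disj[OF u w 5(1-3)] by (simp add: word_mult)
    qed
  qed
  have left: "lin f (word u * x * b) = 0" if u: "u \<in> words S" for u
    using b by (induction rule: free_carrier_induct)
      (simp_all add: distrib_left free_scale_mult_right words u del: free_scale_single)
  show ?thesis
    using a by (induction rule: free_carrier_induct)
      (simp_all add: distrib_right free_scale_mult_left left del: free_scale_single)
qed

lemma sum_nonneg_Reals:
  fixes f :: "'a \<Rightarrow> complex"
  shows "(\<And>i. i \<in> A \<Longrightarrow> f i \<in> \<real>\<^sub>\<ge>\<^sub>0) \<Longrightarrow> sum f A \<in> \<real>\<^sub>\<ge>\<^sub>0"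
  by (induction A rule: infinite_finite_induct) auto

text \<open>\<open>\<kappa> x y\<close> abstracts the value of a trace at \<open>v_x v_y*\<close>.
  Left invariance reflects the trace property, right invariance that \<open>1 - v_c v_c*\<close> has
  trace 0. The indices in the positivity condition are words because it is applied to vectors
  obtained by letting words act.\<close>

locale kernel_trace = lcm_scale S N for S :: "'s monoid" (structure) and N :: "'s \<Rightarrow> real" +
  fixes \<kappa> :: "'s \<Rightarrow> 's \<Rightarrow> complex"
  assumes \<kappa>_right: "\<lbrakk>x \<in> K; y \<in> K; c \<in> K\<rbrakk> \<Longrightarrow> \<kappa> (x \<otimes> c) (y \<otimes> c) = \<kappa> x y"
    and \<kappa>_left: "\<lbrakk>x \<in> K; y \<in> K; c \<in> K\<rbrakk> \<Longrightarrow> \<kappa> (c \<otimes> x) (c \<otimes> y) = \<kappa> x y"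
    and \<kappa>_one: "\<kappa> \<one> \<one> = 1"
    and \<kappa>_cnj: "\<lbrakk>x \<in> K; y \<in> K\<rbrakk> \<Longrightarrow> \<kappa> y x = cnj (\<kappa> x y)"
    and \<kappa>_pos: "\<And>(I :: 's letter list set) a z. \<lbrakk>finite I; \<And>i. i \<in> I \<Longrightarrow> a i \<in> K\<rbrakk> \<Longrightarrow>
      (\<Sum>i\<in>I. \<Sum>j\<in>I. cnj (z j) * z i * \<kappa> (a j) (a i)) \<in> \<real>\<^sub>\<ge>\<^sub>0"
begin

text \<open>Two fractions in the same class have the form \<open>s a\<^sup>-\<^sup>1\<close> and \<open>s b\<^sup>-\<^sup>1\<close>; their inner product is
  \<open>\<tau> (v\<^sub>b v\<^sub>a\<^sup>*)\<close>.\<close>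

definition kern :: "('s \<times> 's) set \<Rightarrow> ('s \<times> 's) set \<Rightarrow> complex" where
  "kern X Y = (if \<exists>s\<in>carrier S. \<exists>a\<in>K. \<exists>b\<in>K. X = fraction s a \<and> Y = fraction s b
     then THE z. \<exists>s\<in>carrier S. \<exists>a\<in>K. \<exists>b\<in>K. X = fraction s a \<and> Y = fraction s b \<and> z = \<kappa> b a else 0)"

text \<open>The two equalities of fractions come with unrelated cofactors. A common right multiple
  of \<open>c\<close> and \<open>c2\<close>, together with left cancellation of \<open>t\<close>,
  makes them equal; right invariance of \<kappa> then removes them.\<close>

lemma \<kappa>_well_defined:
  assumes s: "s \<in> carrier S" "a \<in> K" "b \<in> K" and t: "t \<in> carrier S" "a' \<in> K" "b' \<in> K"
    and eq: "fraction s a = fraction t a'" "fraction s b = fraction t b'"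
  shows "\<kappa> b a = \<kappa> b' a'"
proof -
  obtain c d where cd: "c \<in> K" "d \<in> K" "s \<otimes> c = t \<otimes> d" "a \<otimes> c = a' \<otimes> d"
    using eq(1) frac_eq_iff[OF s(1) t(1) s(2) t(2)] by blast
  obtain c2 d2 where cd2: "c2 \<in> K" "d2 \<in> K" "s \<otimes> c2 = t \<otimes> d2" "b \<otimes> c2 = b' \<otimes> d2"
    using eq(2) frac_eq_iff[OF s(1) t(1) s(3) t(3)] by blast
  obtain p q where pq: "p \<in> K" "q \<in> K" "c \<otimes> p = c2 \<otimes> q" using ore[OF cd(1) cd2(1)] .
  have "t \<otimes> (d \<otimes> p) = s \<otimes> (c \<otimes> p)"
    unfolding assoc_K[OF t(1) cd(2) pq(1), symmetric] cd(3)[symmetric] by (rule assoc_K[OF s(1) cd(1) pq(1)])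
  also have "\<dots> = t \<otimes> (d2 \<otimes> q)"
    unfolding pq(3) assoc_K[OF s(1) cd2(1) pq(2), symmetric] cd2(3) by (rule assoc_K[OF t(1) cd2(2) pq(2)])
  finally have dp: "d \<otimes> p = d2 \<otimes> q"
    using left_cancel[of t "d \<otimes> p" "d2 \<otimes> q"] t cd cd2 pq by (simp add: K_carrier)
  have "\<kappa> b a = \<kappa> (b \<otimes> (c \<otimes> p)) (a \<otimes> (c \<otimes> p))" by (intro \<kappa>_right[symmetric] K_mult s(2,3) cd(1) pq(1))
  also have "b \<otimes> (c \<otimes> p) = b' \<otimes> (d \<otimes> p)"
    unfolding pq(3) dp assoc_K[OF K_carrier[OF s(3)] cd2(1) pq(2), symmetric] cd2(4)
    by (rule assoc_K[OF K_carrier[OF t(3)] cd2(2) pq(2)])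
  also have "a \<otimes> (c \<otimes> p) = a' \<otimes> (d \<otimes> p)"
    unfolding assoc_K[OF K_carrier[OF s(2)] cd(1) pq(1), symmetric] cd(4)
    by (rule assoc_K[OF K_carrier[OF t(2)] cd(2) pq(1)])
  also have "\<kappa> (b' \<otimes> (d \<otimes> p)) (a' \<otimes> (d \<otimes> p)) = \<kappa> b' a'" by (intro \<kappa>_right K_mult t(2,3) cd(2) pq(1))
  finally show ?thesis .
qed

lemma kern_frac:
  assumes "s \<in> carrier S" "a \<in> K" "b \<in> K" shows "kern (fraction s a) (fraction s b) = \<kappa> b a"
proof -
  have "(THE z. \<exists>t\<in>carrier S. \<exists>a'\<in>K. \<exists>b'\<in>K. fraction s a = fraction t a' \<and> fraction s b = fraction t b' \<and> z = \<kappa> b' a') = \<kappa> b a"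
  proof (rule the_equality)
    fix z assume "\<exists>t\<in>carrier S. \<exists>a'\<in>K. \<exists>b'\<in>K. fraction s a = fraction t a' \<and> fraction s b = fraction t b' \<and> z = \<kappa> b' a'"
    then obtain t a' b' where "t \<in> carrier S" "a' \<in> K" "b' \<in> K" "fraction s a = fraction t a'"
      "fraction s b = fraction t b'" "z = \<kappa> b' a'" by blast
    then show "z = \<kappa> b a" using \<kappa>_well_defined[OF assms] by metis
  qed (use assms in blast)
  moreover have "\<exists>t\<in>carrier S. \<exists>a'\<in>K. \<exists>b'\<in>K. fraction s a = fraction t a' \<and> fraction s b = fraction t b'"
    using assms by blast
  ultimately show ?thesis unfolding kern_def by simp
qed

lemma kern_orbit: assumes "kern X Y \<noteq> 0" shows "orbit X = orbit Y"
proof -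
  obtain s a b where "s \<in> carrier S" "a \<in> K" "b \<in> K" "X = fraction s a" "Y = fraction s b"
    using assms unfolding kern_def by (metis (no_types, lifting))
  then show ?thesis by (simp add: orbit_frac)
qed

lemma kern_cnj:
  assumes "X \<in> fractions" "Y \<in> fractions" shows "kern Y X = cnj (kern X Y)"
proof (cases "orbit X = orbit Y")
  case True
  obtain u a b where "u \<in> carrier S" "a \<in> K" "b \<in> K" "X = fraction u a" "Y = fraction u b"
    using orbit_eq_obtain[OF assms True] .
  then show ?thesis using \<kappa>_cnj[of b a] by (simp add: kern_frac)
next
  case False
  then have "kern X Y = 0" "kern Y X = 0" using kern_orbit[of X Y] kern_orbit[of Y X] by auto
  then show ?thesis by simp
qed

lemma orbit_gact_iff:
  assumes "t \<in> carrier S" "X \<in> fractions" "Y \<in> fractions"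
  shows "orbit (gact t X) = orbit (gact t Y) \<longleftrightarrow> orbit X = orbit Y"
proof -
  obtain s a where X: "s \<in> carrier S" "a \<in> K" "X = fraction s a" using assms(2) by (rule fracs_cases)
  obtain u b where Y: "u \<in> carrier S" "b \<in> K" "Y = fraction u b" using assms(3) by (rule fracs_cases)
  show ?thesis
    using assms(1) X Y rel_gact[of t s u]
    by (simp add: gact_frac orbit_frac eq_equiv_class_iff[OF equiv_rel])
qed

lemma kern_gact:
  assumes t: "t \<in> carrier S" and XY: "X \<in> fractions" "Y \<in> fractions"
  shows "kern (gact t X) (gact t Y) = kern X Y"
proof (cases "orbit X = orbit Y")
  case True
  obtain u a b where "u \<in> carrier S" "a \<in> K" "b \<in> K" "X = fraction u a" "Y = fraction u b"
    using orbit_eq_obtain[OF XY True] .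
  then show ?thesis using t by (simp add: kern_frac gact_frac)
next
  case False
  then have "kern X Y = 0" "kern (gact t X) (gact t Y) = 0"
    using kern_orbit[of X Y] kern_orbit[of "gact t X" "gact t Y"] orbit_gact_iff[OF t XY] by auto
  then show ?thesis by simp
qed

lemma orbit_rtrans: "e \<in> K \<Longrightarrow> X \<in> fractions \<Longrightarrow> orbit (rtrans e X) = orbit X"
  by (erule fracs_cases) (simp add: rtrans_frac orbit_frac)

text \<open>Right translation multiplies both denominators on the left, which is left invariance of
  \<kappa>, that is, the trace property.\<close>

lemma kern_rtrans:
  assumes e: "e \<in> K" and XY: "X \<in> fractions" "Y \<in> fractions"
  shows "kern (rtrans e X) (rtrans e Y) = kern X Y"
proof (cases "orbit X = orbit Y")
  case True
  obtain u a b where "u \<in> carrier S" "a \<in> K" "b \<in> K" "X = fraction u a" "Y = fraction u b"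
    using orbit_eq_obtain[OF XY True] .
  then show ?thesis using e by (simp add: kern_frac rtrans_frac \<kappa>_left)
next
  case False
  then have "kern X Y = 0" "kern (rtrans e X) (rtrans e Y) = 0"
    using kern_orbit[of X Y] kern_orbit[of "rtrans e X" "rtrans e Y"] orbit_rtrans e XY by auto
  then show ?thesis by simp
qed

text \<open>The range of \<open>gact t\<close> is a union of classes. A fraction outside it is
  therefore orthogonal to it, which is why the partial inverse is the true adjoint.\<close>

lemma orbit_gact_image:
  assumes t: "t \<in> carrier S" and X: "X \<in> fractions" and Y: "Y \<in> fractions" and eq: "orbit (gact t X) = orbit Y"
  shows "\<exists>Z\<in>fractions. Y = gact t Z"
proof -
  obtain x a where x: "x \<in> carrier S" "a \<in> K" "X = fraction x a" using X by (rule fracs_cases)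
  obtain y b where y: "y \<in> carrier S" "b \<in> K" "Y = fraction y b" using Y by (rule fracs_cases)
  have "(t \<otimes> x, y) \<in> rel"
    using eq t x y eq_equiv_class[OF _ equiv_rel] by (simp add: gact_frac orbit_frac)
  then obtain c d where cd: "c \<in> K" "d \<in> K" "t \<otimes> x \<otimes> c = y \<otimes> d" by (auto simp: rel_iff)
  have "Y = fraction (y \<otimes> d) (b \<otimes> d)" using y cd frac_cancel[of y b d] by simp
  also have "\<dots> = gact t (fraction (x \<otimes> c) (b \<otimes> d))"
    using t x y cd by (simp add: gact_frac K_carrier m_assoc flip: cd(3))
  finally show ?thesis using x y cd by (auto simp: K_carrier)
qed

definition kern1 :: "('s \<times> 's) set option \<Rightarrow> ('s \<times> 's) set \<Rightarrow> complex" where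
  "kern1 X Y = (case X of None \<Rightarrow> 0 | Some X \<Rightarrow> kern X Y)"

lemma kern1_simps [simp]: "kern1 None Y = 0" "kern1 (Some X) Y = kern X Y"
  by (simp_all add: kern1_def)

lemma kern_Gen:
  assumes t: "t \<in> carrier S" and XY: "X \<in> fractions" "Y \<in> fractions"
  shows "kern (gact t X) Y = cnj (kern1 (act (Adj t) Y) X)"
proof (cases rule: act_Adj_cases[OF t, of Y])
  case (1 Z)
  then show ?thesis using kern_gact[OF t XY(1) 1(1)] kern_cnj[OF 1(1) XY(1)] by (simp del: act.simps)
next
  case 2
  then have "kern (gact t X) Y = 0"
    using kern_orbit[of "gact t X" Y] orbit_gact_image[OF t XY] by metis
  then show ?thesis using 2 by (simp del: act.simps)
qed

lemma kern1_act:
  assumes l: "letter_base l \<in> carrier S" and XY: "X \<in> fractions" "Y \<in> fractions"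
  shows "kern1 (act l X) Y = cnj (kern1 (act (letter_adj l) Y) X)"
proof (cases l)
  case (Gen t)
  then show ?thesis using kern_Gen[of t X Y] assms by (simp del: act.simps(2))
next
  case (Adj t)
  then show ?thesis using kern_Gen[of t Y X] assms by (simp del: act.simps(2))
qed

text \<open>Letters are moved to the other argument one at a time by \<open>kern1_act\<close>; an
  undefined step on either side makes both sides 0.\<close>

lemma kern1_wact:
  "w \<in> words S \<Longrightarrow> X \<in> fractions \<Longrightarrow> Y \<in> fractions \<Longrightarrow>
    kern1 (wact w X) Y = cnj (kern1 (wact (word_adj w) Y) X)"
proof (induction w arbitrary: Y)
  case Nil
  then show ?case using kern_cnj[of Y X] by simp
next
  case (Cons l w)
  note X = \<open>X \<in> fractions\<close> and Y = \<open>Y \<in> fractions\<close>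
  have l: "letter_base l \<in> carrier S" and w: "w \<in> words S" using Cons.prems by auto
  have adj: "wact (word_adj (l # w)) Y = Option.bind (act (letter_adj l) Y) (wact (word_adj w))"
    by (simp add: wact_append)
  show ?case
  proof (cases "act (letter_adj l) Y")
    case None
    have "kern1 (Option.bind (wact w X) (act l)) Y = 0"
    proof (cases "wact w X")
      case Some': (Some W)
      show ?thesis using kern1_act[OF l wact_in[OF w X Some'] Y] by (simp add: Some' None del: act.simps)
    qed simp
    then show ?thesis unfolding adj None by simp
  next
    case (Some Y')
    have Y': "Y' \<in> fractions" using act_in[of "letter_adj l" Y Y'] Some l Y by simp
    have "kern1 (Option.bind (wact w X) (act l)) Y = kern1 (wact w X) Y'"
    proof (cases "wact w X")
      case Some': (Some W)
      note W = wact_in[OF w X Some']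
      have "kern1 (act l W) Y = cnj (kern Y' W)" using kern1_act[OF l W Y] by (simp add: Some del: act.simps)
      also have "\<dots> = kern W Y'" using kern_cnj[OF Y' W] by simp
      finally show ?thesis by (simp add: Some' del: act.simps)
    qed simp
    then show ?thesis unfolding adj Some using Cons.IH[OF w X Y'] by simp
  qed
qed

text \<open>The Gram matrix is block diagonal over the classes. Within a block a common numerator
  turns its entries into values of \<kappa>.\<close>

lemma kern_positive:
  fixes A :: "'s letter list set"
  assumes "finite A" "\<And>i. i \<in> A \<Longrightarrow> g i \<in> fractions"
  shows "(\<Sum>i\<in>A. \<Sum>j\<in>A. cnj (c j) * c i * kern (g i) (g j)) \<in> \<real>\<^sub>\<ge>\<^sub>0"
proof -
  let ?o = "\<lambda>i. orbit (g i)" and ?h = "\<lambda>i j. cnj (c j) * c i * kern (g i) (g j)"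
  let ?B = "\<lambda>C. {i \<in> A. ?o i = C}"
  have "(\<Sum>i\<in>A. \<Sum>j\<in>A. ?h i j) = (\<Sum>C\<in>?o ` A. \<Sum>i\<in>?B C. \<Sum>j\<in>A. ?h i j)"
    using assms(1) by (rule sum.image_gen)
  also have "\<dots> = (\<Sum>C\<in>?o ` A. \<Sum>i\<in>?B C. \<Sum>j\<in>?B C. ?h i j)"
  proof (rule sum.cong[OF refl], rule sum.cong[OF refl])
    fix C i assume "i \<in> ?B C"
    then have i: "orbit (g i) = C" by simp
    show "(\<Sum>j\<in>A. ?h i j) = (\<Sum>j\<in>?B C. ?h i j)"
    proof (rule sum.mono_neutral_right[OF assms(1)])
      show "\<forall>j\<in>A - ?B C. ?h i j = 0"
      proof
        fix j assume "j \<in> A - ?B C"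
        then have "kern (g i) (g j) = 0" using kern_orbit[of "g i" "g j"] i by blast
        then show "?h i j = 0" by simp
      qed
    qed simp
  qed
  also have "\<dots> \<in> \<real>\<^sub>\<ge>\<^sub>0"
  proof (rule sum_nonneg_Reals)
    fix C assume "C \<in> ?o ` A"
    then have fin: "finite (?B C)" "?B C \<noteq> {}" using assms(1) by auto
    obtain u a where u: "u \<in> carrier S" and a: "\<forall>i\<in>?B C. a i \<in> K \<and> g i = fraction u (a i)"
      using finite_common_numerator[OF fin, of g C] assms(2) by blast
    have "(\<Sum>i\<in>?B C. \<Sum>j\<in>?B C. ?h i j) = (\<Sum>i\<in>?B C. \<Sum>j\<in>?B C. cnj (c j) * c i * \<kappa> (a j) (a i))"
    proof (rule sum.cong[OF refl], rule sum.cong[OF refl])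
      fix i j assume "i \<in> ?B C" "j \<in> ?B C"
      then have "a i \<in> K" "a j \<in> K" "g i = fraction u (a i)" "g j = fraction u (a j)" using a by blast+
      then show "?h i j = cnj (c j) * c i * \<kappa> (a j) (a i)" using kern_frac[OF u, of "a i" "a j"] by simp
    qed
    also have "\<dots> \<in> \<real>\<^sub>\<ge>\<^sub>0" using a by (intro \<kappa>_pos fin(1)) blast
    finally show "(\<Sum>i\<in>?B C. \<Sum>j\<in>?B C. ?h i j) \<in> \<real>\<^sub>\<ge>\<^sub>0" .
  qed
  finally show ?thesis .
qed

definition vector_state :: "('s \<times> 's) set \<Rightarrow> 's letter list \<Rightarrow> complex" where
  "vector_state X w = kern1 (wact w X) X"

lemma vec_cong_mid:
  "u \<in> words S \<Longrightarrow> w \<in> words S \<Longrightarrow> X \<in> fractions \<Longrightarrow> (\<And>Y. Y \<in> fractions \<Longrightarrow> wact m Y = wact m' Y) \<Longrightarrow>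
    vector_state X (u @ m @ w) = vector_state X (u @ m' @ w)"
  unfolding vector_state_def using wact_cong_mid[of w X m m' u] by simp

context
  fixes X assumes X: "X \<in> fractions"
begin

lemma vec_relations:
  assumes "u \<in> words S" "w \<in> words S"
  shows "vector_state X (u @ [Gen \<one>] @ w) = vector_state X (u @ w)"
    "s \<in> carrier S \<Longrightarrow> vector_state X (u @ [Adj s, Gen s] @ w) = vector_state X (u @ w)"
    "s \<in> carrier S \<Longrightarrow> t \<in> carrier S \<Longrightarrow> vector_state X (u @ [Gen s, Gen t] @ w) = vector_state X (u @ [Gen (s \<otimes> t)] @ w)"
    "s \<in> carrier S \<Longrightarrow> t \<in> carrier S \<Longrightarrow> r \<in> carrier S \<Longrightarrow> (s <# carrier S) \<inter> (t <# carrier S) = r <# carrier S \<Longrightarrow>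
      vector_state X (u @ [Gen s, Adj s, Gen t, Adj t] @ w) = vector_state X (u @ [Gen r, Adj r] @ w)"
    "s \<in> carrier S \<Longrightarrow> t \<in> carrier S \<Longrightarrow> (s <# carrier S) \<inter> (t <# carrier S) = {} \<Longrightarrow>
      vector_state X (u @ [Gen s, Adj s, Gen t, Adj t] @ w) = 0"
proof -
  show "vector_state X (u @ [Gen \<one>] @ w) = vector_state X (u @ w)"
    using vec_cong_mid[OF assms X, of "[Gen \<one>]" "[]"] by (simp add: gact_one)
  show "vector_state X (u @ [Adj s, Gen s] @ w) = vector_state X (u @ w)" if "s \<in> carrier S"
    using vec_cong_mid[OF assms X, of "[Adj s, Gen s]" "[]"] wact_isometry[OF that] by simp
  show "vector_state X (u @ [Gen s, Gen t] @ w) = vector_state X (u @ [Gen (s \<otimes> t)] @ w)" if "s \<in> carrier S" "t \<in> carrier S"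
    using that by (intro vec_cong_mid[OF assms X]) (simp add: gact_gact)
  show "vector_state X (u @ [Gen s, Adj s, Gen t, Adj t] @ w) = vector_state X (u @ [Gen r, Adj r] @ w)"
    if "s \<in> carrier S" "t \<in> carrier S" "r \<in> carrier S" "(s <# carrier S) \<inter> (t <# carrier S) = r <# carrier S"
    using wact_lcm[OF that] by (intro vec_cong_mid[OF assms X])
  show "vector_state X (u @ [Gen s, Adj s, Gen t, Adj t] @ w) = 0"
    if "s \<in> carrier S" "t \<in> carrier S" "(s <# carrier S) \<inter> (t <# carrier S) = {}"
    unfolding vector_state_def wact_append[of u] wact_append[of _ w] using wact_disjoint[OF that]
    by (cases "wact w X") (simp_all del: wact.simps)
qed

lemma vec_Nil: "vector_state X [] = 1"
proof -
  obtain s a where s: "s \<in> carrier S" "a \<in> K" "X = fraction s a" using X by (rule fracs_cases)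
  have "\<kappa> a a = 1" using \<kappa>_right[of \<one> \<one> a] s by (simp add: \<kappa>_one K_carrier)
  then show ?thesis using s by (simp add: vector_state_def kern_frac)
qed

text \<open>The value at \<open>word_adj j @ i\<close> is the inner product of the vectors reached
  by \<open>i\<close> and \<open>j\<close> from \<open>X\<close>, so the double sum is a Gram form;
  words undefined at \<open>X\<close> contribute nothing.\<close>

lemma vec_positive:
  assumes p: "p \<in> free_carrier S" shows "lin (vector_state X) (free_star p * p) \<in> \<real>\<^sub>\<ge>\<^sub>0"
proof -
  let ?k = "Poly_Mapping.keys p" and ?c = "Poly_Mapping.lookup p"
  have words: "w \<in> words S" if "w \<in> ?k" for w using keys_subset_words[OF p] that by auto
  have star: "free_star p = (\<Sum>w\<in>?k. free_scale (cnj (?c w)) (word (word_adj w)))"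
    by (subst word_expansion[of p]) (simp only: free_star_sum free_star_simps)
  have "free_star p * p = (\<Sum>j\<in>?k. \<Sum>i\<in>?k. free_scale (cnj (?c j) * ?c i) (word (word_adj j @ i)))"
    unfolding star by (subst (3) word_expansion[of p])
      (simp add: sum_product free_scale_mult_left free_scale_mult_right word_mult mult.commute del: free_scale_single)
  then have "lin (vector_state X) (free_star p * p) = (\<Sum>j\<in>?k. \<Sum>i\<in>?k. cnj (?c j) * ?c i * vector_state X (word_adj j @ i))"
    by (simp add: lin_sum del: free_scale_single)
  also have "\<dots> = (\<Sum>i\<in>?k. \<Sum>j\<in>?k. cnj (?c j) * ?c i * vector_state X (word_adj j @ i))"
    by (rule sum.swap)
  also have "\<dots> = (\<Sum>i\<in>{i\<in>?k. wact i X \<noteq> None}. \<Sum>j\<in>{i\<in>?k. wact i X \<noteq> None}.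
      cnj (?c j) * ?c i * kern (the (wact i X)) (the (wact j X)))"
  proof -
    have v: "vector_state X (word_adj j @ i) = (if wact i X = None \<or> wact j X = None then 0
        else kern (the (wact i X)) (the (wact j X)))" if ij: "i \<in> ?k" "j \<in> ?k" for i j
    proof (cases "wact i X")
      case (Some Y)
      then have Y: "Y \<in> fractions" using wact_in[of i X Y] words[OF ij(1)] X by simp
      have "vector_state X (word_adj j @ i) = kern1 (wact (word_adj j) Y) X" by (simp add: vector_state_def wact_append Some)
      also have "\<dots> = cnj (kern1 (wact j X) Y)"
        using kern1_wact[of "word_adj j" Y X] words[OF ij(2)] X Y by simp
      finally have v: "vector_state X (word_adj j @ i) = cnj (kern1 (wact j X) Y)" .
      show ?thesis
      proof (cases "wact j X")
        case Some': (Some Z)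
        then show ?thesis using v Some kern_cnj[OF wact_in[OF words[OF ij(2)] X Some'] Y] by simp
      qed (use v in simp)
    qed (simp add: vector_state_def wact_append)
    have "(\<Sum>i\<in>?k. \<Sum>j\<in>?k. cnj (?c j) * ?c i * vector_state X (word_adj j @ i)) =
        (\<Sum>i\<in>?k. \<Sum>j\<in>{i\<in>?k. wact i X \<noteq> None}. cnj (?c j) * ?c i * vector_state X (word_adj j @ i))"
      using v by (intro sum.cong refl sum.mono_neutral_right) auto
    also have "\<dots> = (\<Sum>i\<in>{i\<in>?k. wact i X \<noteq> None}. \<Sum>j\<in>{i\<in>?k. wact i X \<noteq> None}.
        cnj (?c j) * ?c i * vector_state X (word_adj j @ i))"
      using v by (intro sum.mono_neutral_right) auto
    also have "\<dots> = (\<Sum>i\<in>{i\<in>?k. wact i X \<noteq> None}. \<Sum>j\<in>{i\<in>?k. wact i X \<noteq> None}.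
      cnj (?c j) * ?c i * kern (the (wact i X)) (the (wact j X)))"
      using v by (intro sum.cong refl) auto
    finally show ?thesis .
  qed
  also have "\<dots> \<in> \<real>\<^sub>\<ge>\<^sub>0"
    using wact_in[OF words X] by (intro kern_positive) auto
  finally show ?thesis .
qed

lemma vec_free_state: "free_state S (lin (vector_state X))"
proof -
  interpret gns S "lin (vector_state X)"
  proof
    show "positive_functional S (lin (vector_state X))"
      unfolding positive_functional_def using linear_functional_lin vec_positive by blast
    show "lin (vector_state X) 1 = 1" using lin_word[of "vector_state X" "[]"] by (simp add: vec_Nil word_Nil)
    show "lin (vector_state X) (a * x * b) = 0" if "a \<in> free_carrier S" "b \<in> free_carrier S" "x \<in> relators S" for a b x
      by (rule relators_vanish_words[OF vec_relations that])
  qed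
  show ?thesis by (rule gns_free_state)
qed

lemma vec_bound: "w \<in> words S \<Longrightarrow> cmod (vector_state X w) \<le> 1"
  using free_state_bound[OF vec_free_state, of "word w"] unorm_word_le[of w] by simp

end

lemma vec_rtrans:
  assumes "e \<in> K" "X \<in> fractions" "w \<in> words S" shows "vector_state (rtrans e X) w = vector_state X w"
  using assms wact_in[of w X] by (cases "wact w X") (simp_all add: vector_state_def wact_rtrans kern_rtrans)

text \<open>With a common numerator \<open>u\<close>, both fractions are right translates of
  \<open>fraction u \<one>\<close>.\<close>

lemma vec_orbit:
  assumes "X \<in> fractions" "Y \<in> fractions" "orbit X = orbit Y" "w \<in> words S" shows "vector_state X w = vector_state Y w"
proof -
  obtain u a b where u: "u \<in> carrier S" "a \<in> K" "b \<in> K" "X = fraction u a" "Y = fraction u b"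
    using orbit_eq_obtain[OF assms(1-3)] .
  then have "X = rtrans a (fraction u \<one>)" "Y = rtrans b (fraction u \<one>)"
    by (simp_all add: rtrans_frac K_carrier)
  then show ?thesis using u assms(4) by (simp add: vec_rtrans)
qed

text \<open>The generator acts isometrically, so it can be removed from both arguments of the inner
  product. Up to the weight of the class this is the KMS relation.\<close>

lemma vec_Gen_gact:
  assumes s: "s \<in> carrier S" and Y: "Y \<in> fractions" and w: "w \<in> words S"
  shows "vector_state (gact s Y) (Gen s # w) = vector_state Y (w @ [Gen s])"
  using wact_in[OF w gact_in[OF s Y]]
  by (cases "wact w (gact s Y)") (simp_all add: vector_state_def wact_append kern_gact s Y)

lemma vec_Gen_zero:
  assumes s: "s \<in> carrier S" and X: "X \<in> fractions" and w: "w \<in> words S"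
    and no: "\<And>Z. Z \<in> fractions \<Longrightarrow> X \<noteq> gact s Z"
  shows "vector_state X (Gen s # w) = 0"
proof (cases "wact w X")
  case (Some W)
  then have "kern (gact s W) X = 0"
    using kern_orbit[of "gact s W" X] orbit_gact_image[OF s _ X] wact_in[OF w X] no by metis
  then show ?thesis by (simp add: vector_state_def Some)
qed (simp add: vector_state_def)

text \<open>At the fraction of the identity the vector state reproduces the trace: an adjoint with
  \<open>t\<close> outside the kernel is undefined there, and a generator with \<open>s\<close>
  outside leads to an orthogonal class.\<close>

lemma vec_one_monomial:
  assumes s: "s \<in> carrier S" and t: "t \<in> carrier S"
  shows "vector_state (fraction \<one> \<one>) [Gen s, Adj t] = (if s \<in> K \<and> t \<in> K then \<kappa> s t else 0)"
proof (cases "t \<in> K")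
  case True
  have "fraction \<one> \<one> = gact t (fraction \<one> t)"
    using True t frac_cancel[of \<one> \<one> t] by (simp add: gact_frac K_carrier)
  then have w: "wact [Gen s, Adj t] (fraction \<one> \<one>) = Some (fraction s t)"
    using act_Adj_gact[OF t, of "fraction \<one> t"] True s by (simp add: gact_frac del: act.simps(2))
  show ?thesis
  proof (cases "s \<in> K")
    case s': True
    \<comment> \<open>Rewriting the unit fraction with numerator \<open>s\<close> makes the inner
      product with \<open>fraction s t\<close> readable.\<close>
    have "fraction \<one> \<one> = fraction s s" using s' s frac_cancel[of \<one> \<one> s] by simp
    then show ?thesis using w s' True s by (simp add: vector_state_def kern_frac del: wact.simps)
  next
    case False
    \<comment> \<open>A relation \<open>s \<otimes> a = b\<close> with \<open>a\<close> and
      \<open>b\<close> in the kernel would force its factor \<open>s\<close> into the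
      kernel.\<close>
    have "(s, \<one>) \<notin> rel"
      using False s by (auto simp: rel_iff) (metis K_carrier K_mult K_mult_iff K_one)
    then have "orbit (fraction s t) \<noteq> orbit (fraction \<one> \<one>)"
      using s True eq_equiv_class[OF _ equiv_rel, of s \<one>] by (auto simp: orbit_frac)
    then show ?thesis using w False kern_orbit[of "fraction s t" "fraction \<one> \<one>"]
      by (auto simp: vector_state_def simp del: wact.simps)
  qed
next
  case False
  have "gact t Y \<noteq> fraction \<one> \<one>" if Y: "Y \<in> fractions" for Y
  proof
    assume *: "gact t Y = fraction \<one> \<one>"
    obtain y b where y: "y \<in> carrier S" "b \<in> K" "Y = fraction y b" using Y by (rule fracs_cases)
    obtain c d where "c \<in> K" "d \<in> K" "t \<otimes> y \<otimes> c = \<one> \<otimes> d"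
      using * y t frac_eq_iff[of "t \<otimes> y" \<one> b \<one>] by (auto simp: gact_frac)
    then have "t \<otimes> (y \<otimes> c) \<in> K" using t y by (simp add: m_assoc K_carrier)
    then show False using False K_mult_iff[of t "y \<otimes> c"] t y \<open>c \<in> K\<close> by (simp add: K_carrier)
  qed
  then have "act (Adj t) (fraction \<one> \<one>) = None" by (rule act_Adj_None)
  then show ?thesis using False by (simp add: vector_state_def del: act.simps(2))
qed

end

section \<open>KMS states at finite temperature\<close>

context lcm_scale
begin

section \<open>Weights of classes and the partition function\<close>

definition scale_classes :: "'s set set" where "scale_classes = carrier S // rel"

definition rep :: "'s set \<Rightarrow> 's" where "rep C = (SOME r. r \<in> C)"

abbreviation weight :: "real \<Rightarrow> 's set \<Rightarrow> real" where
  "weight \<beta> C \<equiv> N (rep C) powr (- \<beta>)"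

definition base :: "'s set \<Rightarrow> ('s \<times> 's) set" where "base C = fraction (rep C) \<one>"

lemma class_rep:
  assumes "C \<in> scale_classes" shows "rep C \<in> C" "rep C \<in> carrier S" "C = rel `` {rep C}"
proof -
  obtain s where s: "s \<in> carrier S" "C = rel `` {s}" using assms by (auto simp: scale_classes_def elim: quotientE)
  then have "s \<in> C" using equiv_class_self[OF equiv_rel] by blast
  then show r: "rep C \<in> C" unfolding rep_def by (rule someI)
  then have sr: "(s, rep C) \<in> rel" using s by simp
  then show "rep C \<in> carrier S" by (simp add: rel_iff)
  show "C = rel `` {rep C}" using s(2) equiv_class_eq[OF equiv_rel sr] by simp
qed

lemma class_in [simp]: "s \<in> carrier S \<Longrightarrow> rel `` {s} \<in> scale_classes"
  by (auto simp: scale_classes_def intro: quotientI)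

lemma rep_rel: "s \<in> carrier S \<Longrightarrow> (s, rep (rel `` {s})) \<in> rel"
  using class_rep(1)[of "rel `` {s}"] by simp

lemma N_rep: "s \<in> carrier S \<Longrightarrow> N (rep (rel `` {s})) = N s"
  using rel_N[OF rep_rel] by simp

lemma N_rep_ge: "C \<in> scale_classes \<Longrightarrow> 1 \<le> N (rep C)"
  using N_ge_one class_rep(2) by blast

lemma the_elem_N: assumes C: "C \<in> scale_classes" shows "the_elem (N ` C) = N (rep C)"
proof (rule the_elem_image_unique)
  show "C \<noteq> {}" using class_rep(1)[OF C] by blast
  fix s assume "s \<in> C"
  then have "(rep C, s) \<in> rel" using class_rep(3)[OF C] by blast
  then show "N s = N (rep C)" by (rule rel_N[symmetric])
qed

lemma base_in [simp]: "C \<in> scale_classes \<Longrightarrow> base C \<in> fractions"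
  by (simp add: base_def class_rep)

lemma orbit_base: assumes C: "C \<in> scale_classes" shows "orbit (base C) = C"
  unfolding base_def orbit_frac[OF class_rep(2)[OF C] K_one] by (rule class_rep(3)[OF C, symmetric])

lemma weight_summable_mono:
  assumes "weight \<beta> summable_on scale_classes" "\<beta> \<le> \<beta>'" shows "weight \<beta>' summable_on scale_classes"
  using assms N_rep_ge by (intro summable_on_comparison_test[OF assms(1)]) (auto intro: powr_mono)

text \<open>A finite abscissa is not the infimum of the empty set, so the series converges for at
  least one exponent.\<close>

lemma weight_summable:
  assumes "\<bar>abscissa S N\<bar> \<noteq> \<infinity>" obtains \<beta> where "weight \<beta> summable_on scale_classes"
proof -
  have "{\<beta>. (\<lambda>C. the_elem (N ` C) powr (-\<beta>)) summable_on (carrier S // rel)} \<noteq> {}"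
  proof
    assume "{\<beta>. (\<lambda>C. the_elem (N ` C) powr (-\<beta>)) summable_on (carrier S // rel)} = {}"
    then have "abscissa S N = Inf {}" unfolding abscissa_def by simp
    then show False using assms by (simp add: top_ereal_def)
  qed
  then obtain \<beta> where "(\<lambda>C. the_elem (N ` C) powr (-\<beta>)) summable_on scale_classes"
    by (auto simp: scale_classes_def)
  then have "weight \<beta> summable_on scale_classes"
    by (subst (asm) summable_on_cong[where g = "weight \<beta>"]) (auto simp: the_elem_N)
  then show ?thesis by (rule that)
qed

definition class_one :: "'s set" where "class_one = rel `` {\<one>}"

lemma class_one_in [simp]: "class_one \<in> scale_classes"
  by (simp add: class_one_def)

lemma weight_class_one: "weight \<beta> class_one = 1"
  using N_rep[of \<one>] by (simp add: class_one_def N_one)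

text \<open>A representative of scale 1 lies in the kernel, and all kernel elements are related to
  the identity.\<close>

lemma N_rep_gt: assumes C: "C \<in> scale_classes - {class_one}" shows "1 < N (rep C)"
proof (rule ccontr)
  assume "\<not> 1 < N (rep C)"
  then have "rep C \<in> K" using C N_rep_ge[of C] class_rep(2)[of C] by (simp add: K_def)
  moreover have "rep C \<otimes> \<one> = \<one> \<otimes> rep C" using C class_rep(2)[of C] by simp
  ultimately have "(rep C, \<one>) \<in> rel" using C class_rep(2)[of C] unfolding rel_iff
    by (intro conjI bexI[of _ "\<one>"] bexI[of _ "rep C"]) auto
  then have "rel `` {rep C} = class_one" unfolding class_one_def by (rule equiv_class_eq[OF equiv_rel])
  then have "C = class_one" using class_rep(3)[of C] C by blast
  then show False using C by simp
qed

definition partition_function :: "real \<Rightarrow> real" where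
  "partition_function \<beta> = infsum (weight \<beta>) scale_classes"

definition tail :: "real \<Rightarrow> real" where
  "tail \<beta> = infsum (weight \<beta>) (scale_classes - {class_one})"

lemma
  assumes "weight \<beta> summable_on scale_classes"
  shows partition_function_eq: "partition_function \<beta> = 1 + tail \<beta>"
    and tail_nonneg: "0 \<le> tail \<beta>"
    and tail_summable: "weight \<beta> summable_on (scale_classes - {class_one})"
proof -
  show *: "weight \<beta> summable_on (scale_classes - {class_one})"
    using assms by (rule summable_on_subset) auto
  have "scale_classes = insert class_one (scale_classes - {class_one})" by auto
  then show "partition_function \<beta> = 1 + tail \<beta>"
    using infsum_insert[OF *, of class_one]
    unfolding partition_function_def tail_def weight_class_one by simp
  show "0 \<le> tail \<beta>" unfolding tail_def by (rule infsum_nonneg) simp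
qed

text \<open>Dominated convergence by hand: a finite set of classes carries the sum at
  \<open>\<beta>0\<close> up to \<open>e / 2\<close>. Its finitely many weights decay exponentially,
  while the rest stays below its value at \<open>\<beta>0\<close>.\<close>

lemma tail_tendsto:
  assumes sm: "weight \<beta>0 summable_on scale_classes" shows "(tail \<longlongrightarrow> 0) at_top"
proof (rule tendstoI)
  fix e :: real assume "e > 0"
  let ?I = "scale_classes - {class_one}"
  note t0 = tail_summable[OF sm]
  obtain F where F: "finite F" "F \<subseteq> ?I" "dist (sum (weight \<beta>0) F) (tail \<beta>0) \<le> e / 2"
    using infsum_finite_approximation[OF t0, of "e / 2"] \<open>e > 0\<close> unfolding tail_def by auto
  have split: "tail \<beta> = sum (weight \<beta>) F + infsum (weight \<beta>) (?I - F)"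
    and rest: "weight \<beta> summable_on (?I - F)" if "\<beta>0 \<le> \<beta>" for \<beta>
  proof -
    have s: "weight \<beta> summable_on ?I" using tail_summable[OF weight_summable_mono[OF sm that]] .
    show r: "weight \<beta> summable_on (?I - F)" using s by (rule summable_on_subset) auto
    have "F \<union> (?I - F) = ?I" using F(2) by auto
    then show "tail \<beta> = sum (weight \<beta>) F + infsum (weight \<beta>) (?I - F)"
      using infsum_Un_disjoint[of "weight \<beta>" F "?I - F"] r F(1) by (simp add: tail_def)
  qed
  have "((\<lambda>\<beta>. \<Sum>C\<in>F. weight \<beta> C) \<longlongrightarrow> (\<Sum>C\<in>F. 0)) at_top"
  proof (intro tendsto_sum)
    fix C assume "C \<in> F"
    then have n: "1 < N (rep C)" using F(2) by (intro N_rep_gt) auto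
    have "((\<lambda>\<beta>. exp (- (ln (N (rep C)) * \<beta>))) \<longlongrightarrow> 0) at_top"
      using n by (intro filterlim_compose[OF exp_at_bot] filterlim_compose[OF filterlim_uminus_at_bot_at_top]
          filterlim_tendsto_pos_mult_at_top[OF tendsto_const]) (auto intro: filterlim_ident)
    moreover have "weight \<beta> C = exp (- (ln (N (rep C)) * \<beta>))" for \<beta>
      using n by (simp add: powr_def mult.commute)
    ultimately show "((\<lambda>\<beta>. weight \<beta> C) \<longlongrightarrow> 0) at_top" by simp
  qed
  then have "\<forall>\<^sub>F \<beta> in at_top. (\<Sum>C\<in>F. weight \<beta> C) < e / 2"
    using order_tendstoD(2)[of _ "0::real" at_top "e / 2"] \<open>e > 0\<close> by simp
  then show "\<forall>\<^sub>F \<beta> in at_top. dist (tail \<beta>) 0 < e"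
    using eventually_ge_at_top[of \<beta>0]
  proof eventually_elim
    case (elim \<beta>)
    have "infsum (weight \<beta>) (?I - F) \<le> infsum (weight \<beta>0) (?I - F)"
      using rest elim N_rep_ge by (intro infsum_mono) (auto intro: powr_mono)
    also have "\<dots> = tail \<beta>0 - sum (weight \<beta>0) F" using split[of \<beta>0] by simp
    also have "\<dots> \<le> e / 2" using F(3) unfolding dist_real_def by linarith
    finally have "tail \<beta> < e" using split[of \<beta>] elim by simp
    then show ?case using tail_nonneg[OF weight_summable_mono[OF sm elim(2)]] by simp
  qed
qed

end

context kernel_trace
begin

definition kms_word :: "real \<Rightarrow> 's letter list \<Rightarrow> complex" where
  "kms_word \<beta> w = (\<Sum>\<^sub>\<infinity>C\<in>scale_classes. of_real (weight \<beta> C) * vector_state (base C) w) / of_real (partition_function \<beta>)"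

text \<open>The classes are reindexed by left multiplication with \<open>s\<close>, which is
  injective and multiplies each weight by \<open>N s powr (- \<beta>)\<close>. Classes outside the
  image contribute 0, because their fractions are not in the range of \<open>gact s\<close>.\<close>

lemma kms_word_Gen:
  assumes s: "s \<in> carrier S" and w: "w \<in> words S"
  shows "kms_word \<beta> (Gen s # w) = of_real (N s powr (- \<beta>)) * kms_word \<beta> (w @ [Gen s])"
proof -
  let ?T = "\<lambda>C. of_real (weight \<beta> C) * vector_state (base C) (Gen s # w) :: complex"
  let ?m = "\<lambda>C. rel `` {s \<otimes> rep C}"
  have m: "?m C \<in> scale_classes" if "C \<in> scale_classes" for C using s class_rep(2)[OF that] by simp
  have inj: "inj_on ?m scale_classes"
  proof (rule inj_onI)
    fix C D assume CD: "C \<in> scale_classes" "D \<in> scale_classes" "?m C = ?m D"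
    then have "(rep C, rep D) \<in> rel"
      using s class_rep(2) eq_equiv_class_iff[OF equiv_rel] rel_gact by simp
    then show "C = D" using class_rep(3)[OF CD(1)] class_rep(3)[OF CD(2)] equiv_class_eq[OF equiv_rel] by metis
  qed
  have zero: "?T C = 0" if C: "C \<in> scale_classes - ?m ` scale_classes" for C
  proof -
    have "base C \<noteq> gact s Z" if Z: "Z \<in> fractions" for Z
    proof
      assume eq: "base C = gact s Z"
      obtain y b where y: "y \<in> carrier S" "b \<in> K" "Z = fraction y b" using Z by (rule fracs_cases)
      have "C = rel `` {s \<otimes> y}" using orbit_base[of C] C eq s y by (simp add: gact_frac orbit_frac)
      also have "\<dots> = ?m (rel `` {y})"
        using rep_rel[OF y(1)] rel_gact[of s y "rep (rel `` {y})"] s y class_rep(2)[of "rel `` {y}"]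
        by (intro equiv_class_eq[OF equiv_rel]) simp
      finally show False using C y by auto
    qed
    then have "vector_state (base C) (Gen s # w) = 0" using s C w by (intro vec_Gen_zero) auto
    then show ?thesis by simp
  qed
  have T: "?T (?m C) = of_real (N s powr (- \<beta>)) * (of_real (weight \<beta> C) * vector_state (base C) (w @ [Gen s]))"
    if C: "C \<in> scale_classes" for C
  proof -
    have r: "rep C \<in> carrier S" using class_rep(2)[OF C] .
    have "orbit (base (?m C)) = orbit (gact s (base C))"
      using orbit_base[OF m[OF C]] s r by (simp add: base_def gact_frac orbit_frac)
    then have "vector_state (base (?m C)) (Gen s # w) = vector_state (gact s (base C)) (Gen s # w)"
      using m[OF C] s C w by (intro vec_orbit) auto
    also have "\<dots> = vector_state (base C) (w @ [Gen s])" using s C w by (intro vec_Gen_gact) auto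
    finally have v: "vector_state (base (?m C)) (Gen s # w) = vector_state (base C) (w @ [Gen s])" .
    have "weight \<beta> (?m C) = N s powr (- \<beta>) * weight \<beta> C"
      using N_rep[of "s \<otimes> rep C"] s r N_ge_one[OF s] N_ge_one[OF r] by (simp add: N_mult powr_mult)
    then show ?thesis unfolding v by simp
  qed
  have "infsum ?T scale_classes = infsum ?T (?m ` scale_classes)"
    using zero m by (intro infsum_cong_neutral) auto
  also have "\<dots> = infsum (?T \<circ> ?m) scale_classes" by (rule infsum_reindex[OF inj])
  also have "\<dots> = (\<Sum>\<^sub>\<infinity>C\<in>scale_classes. of_real (N s powr (- \<beta>)) * (of_real (weight \<beta> C) * vector_state (base C) (w @ [Gen s])))"
    using T by (intro infsum_cong) simp
  also have "\<dots> = of_real (N s powr (- \<beta>)) * (\<Sum>\<^sub>\<infinity>C\<in>scale_classes. of_real (weight \<beta> C) * vector_state (base C) (w @ [Gen s]))"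
    by (rule infsum_cmult_right')
  finally show ?thesis unfolding kms_word_def by simp
qed

lemma kms_word_Gen_exp:
  assumes s: "s \<in> carrier S" and w: "w \<in> words S"
  shows "kms_word \<beta> (Gen s # w) = exp (- of_real (\<beta> * ln (N s))) * kms_word \<beta> (w @ [Gen s])"
proof -
  have "complex_of_real (N s powr (- \<beta>)) = of_real (exp (- (\<beta> * ln (N s))))"
    using N_ge_one[OF s] by (simp add: powr_def)
  also have "\<dots> = exp (of_real (- (\<beta> * ln (N s))))" by (rule exp_of_real[symmetric])
  finally show ?thesis using kms_word_Gen[OF s w, of \<beta>] by simp
qed

lemma weighted_bound:
  assumes "C \<in> scale_classes" "w \<in> words S"
  shows "norm (of_real (weight \<beta> C) * vector_state (base C) w) \<le> weight \<beta> C"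
proof -
  have "norm (of_real (weight \<beta> C) * vector_state (base C) w) = weight \<beta> C * cmod (vector_state (base C) w)"
    by (simp add: norm_mult)
  also have "\<dots> \<le> weight \<beta> C * 1"
    using assms by (intro mult_left_mono vec_bound) auto
  finally show ?thesis by simp
qed

context
  fixes \<beta> assumes summable: "weight \<beta> summable_on scale_classes"
begin

lemma partition_function_ge: "1 \<le> partition_function \<beta>"
  using partition_function_eq[OF summable] tail_nonneg[OF summable] by simp

lemma vec_summable:
  assumes w: "w \<in> words S" and A: "A \<subseteq> scale_classes"
  shows "(\<lambda>C. norm (of_real (weight \<beta> C) * vector_state (base C) w)) summable_on A"
proof (rule Infinite_Sum.abs_summable_on_comparison_test')
  show "weight \<beta> summable_on A" using summable A by (rule summable_on_subset)
  show "norm (of_real (weight \<beta> C) * vector_state (base C) w) \<le> weight \<beta> C" if "C \<in> A" for C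
    using weighted_bound[OF _ w] that A by blast
qed

lemma kms_word_has_sum:
  assumes w: "w \<in> words S"
  shows "((\<lambda>C. of_real (weight \<beta> C) * vector_state (base C) w) has_sum (of_real (partition_function \<beta>) * kms_word \<beta> w)) scale_classes"
proof -
  have "of_real (partition_function \<beta>) * kms_word \<beta> w =
      (\<Sum>\<^sub>\<infinity>C\<in>scale_classes. of_real (weight \<beta> C) * vector_state (base C) w)"
    unfolding kms_word_def using partition_function_ge by simp
  then show ?thesis
    by (simp only:) (rule has_sum_infsum[OF abs_summable_summable[OF vec_summable[OF w order_refl]]])
qed

lemma kms_lin_has_sum:
  assumes p: "p \<in> free_carrier S"
  shows "((\<lambda>C. of_real (weight \<beta> C) * lin (vector_state (base C)) p) has_sum
    (of_real (partition_function \<beta>) * lin (kms_word \<beta>) p)) scale_classes"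
  using p
proof (induction rule: free_carrier_induct)
  case (add p q)
  then show ?case using has_sum_add[OF add(3,4)] by (simp add: distrib_left)
next
  case (scale c w)
  then show ?case using has_sum_cmult_right[OF kms_word_has_sum[OF scale], of c]
    by (simp add: mult_ac del: free_scale_single)
qed simp

lemma kms_word_relations:
  assumes "u \<in> words S" "w \<in> words S"
  shows "kms_word \<beta> (u @ [Gen \<one>] @ w) = kms_word \<beta> (u @ w)"
    "s \<in> carrier S \<Longrightarrow> kms_word \<beta> (u @ [Adj s, Gen s] @ w) = kms_word \<beta> (u @ w)"
    "s \<in> carrier S \<Longrightarrow> t \<in> carrier S \<Longrightarrow> kms_word \<beta> (u @ [Gen s, Gen t] @ w) = kms_word \<beta> (u @ [Gen (s \<otimes> t)] @ w)"
    "s \<in> carrier S \<Longrightarrow> t \<in> carrier S \<Longrightarrow> r \<in> carrier S \<Longrightarrow> (s <# carrier S) \<inter> (t <# carrier S) = r <# carrier S \<Longrightarrow>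
      kms_word \<beta> (u @ [Gen s, Adj s, Gen t, Adj t] @ w) = kms_word \<beta> (u @ [Gen r, Adj r] @ w)"
    "s \<in> carrier S \<Longrightarrow> t \<in> carrier S \<Longrightarrow> (s <# carrier S) \<inter> (t <# carrier S) = {} \<Longrightarrow>
      kms_word \<beta> (u @ [Gen s, Adj s, Gen t, Adj t] @ w) = 0"
proof -
  have cong: "kms_word \<beta> x = kms_word \<beta> y" if "\<And>C. C \<in> scale_classes \<Longrightarrow> vector_state (base C) x = vector_state (base C) y" for x y
    unfolding kms_word_def using that by (simp cong: infsum_cong)
  note rels = vec_relations[OF base_in assms]
  show "kms_word \<beta> (u @ [Gen \<one>] @ w) = kms_word \<beta> (u @ w)" by (rule cong[OF rels(1)])
  show "kms_word \<beta> (u @ [Adj s, Gen s] @ w) = kms_word \<beta> (u @ w)" if "s \<in> carrier S"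
    by (rule cong[OF rels(2)[OF _ that]])
  show "kms_word \<beta> (u @ [Gen s, Gen t] @ w) = kms_word \<beta> (u @ [Gen (s \<otimes> t)] @ w)"
    if "s \<in> carrier S" "t \<in> carrier S"
    by (rule cong[OF rels(3)[OF _ that]])
  show "kms_word \<beta> (u @ [Gen s, Adj s, Gen t, Adj t] @ w) = kms_word \<beta> (u @ [Gen r, Adj r] @ w)"
    if "s \<in> carrier S" "t \<in> carrier S" "r \<in> carrier S" "(s <# carrier S) \<inter> (t <# carrier S) = r <# carrier S"
    by (rule cong[OF rels(4)[OF _ that]])
  show "kms_word \<beta> (u @ [Gen s, Adj s, Gen t, Adj t] @ w) = 0"
    if "s \<in> carrier S" "t \<in> carrier S" "(s <# carrier S) \<inter> (t <# carrier S) = {}"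
  proof -
    have "(\<Sum>\<^sub>\<infinity>C\<in>scale_classes. of_real (weight \<beta> C) * vector_state (base C) (u @ [Gen s, Adj s, Gen t, Adj t] @ w)) = (0::complex)"
      using rels(5)[OF _ that] by (intro infsum_0) simp
    then show ?thesis unfolding kms_word_def by simp
  qed
qed

lemma kms_free_state: "free_state S (lin (kms_word \<beta>))"
proof -
  interpret gns S "lin (kms_word \<beta>)"
  proof
    have "lin (kms_word \<beta>) (free_star p * p) \<in> \<real>\<^sub>\<ge>\<^sub>0" if p: "p \<in> free_carrier S" for p
    proof -
      have "of_real (weight \<beta> C) * lin (vector_state (base C)) (free_star p * p) \<in> \<real>\<^sub>\<ge>\<^sub>0" if "C \<in> scale_classes" for C
        using vec_positive[OF base_in[OF that] p] by (intro nonneg_Reals_mult_I) auto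
      \<comment> \<open>The sum over classes is a limit of finite nonnegative sums, and the
        nonnegative reals are closed.\<close>
      then have "of_real (partition_function \<beta>) * lin (kms_word \<beta>) (free_star p * p) \<in> \<real>\<^sub>\<ge>\<^sub>0"
        using kms_lin_has_sum[of "free_star p * p"] p unfolding has_sum_def
        by (intro Lim_in_closed_set[OF closed_nonneg_Reals_complex])
          (auto intro!: eventually_finite_subsets_at_top_weakI sum_nonneg_Reals)
      moreover have "complex_of_real (inverse (partition_function \<beta>)) \<in> \<real>\<^sub>\<ge>\<^sub>0"
        using partition_function_ge by (simp only: nonneg_Reals_of_real_iff) simp
      ultimately have "of_real (inverse (partition_function \<beta>)) *
          (of_real (partition_function \<beta>) * lin (kms_word \<beta>) (free_star p * p)) \<in> \<real>\<^sub>\<ge>\<^sub>0"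
        by (rule nonneg_Reals_mult_I[rotated])
      moreover have "of_real (inverse (partition_function \<beta>)) * (of_real (partition_function \<beta>) * z) = z" for z :: complex
        using partition_function_ge by simp
      ultimately show ?thesis by (simp only:)
    qed
    then show "positive_functional S (lin (kms_word \<beta>))"
      unfolding positive_functional_def using linear_functional_lin by blast
    have "(\<Sum>\<^sub>\<infinity>C\<in>scale_classes. of_real (weight \<beta> C) * vector_state (base C) []) = (\<Sum>\<^sub>\<infinity>C\<in>scale_classes. complex_of_real (weight \<beta> C))"
      by (intro infsum_cong) (simp add: vec_Nil)
    also have "\<dots> = of_real (partition_function \<beta>)"
      unfolding partition_function_def using has_sum_of_real[OF has_sum_infsum[OF summable]] by (rule infsumI)
    finally have "kms_word \<beta> [] = 1" using partition_function_ge by (simp add: kms_word_def)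
    then show "lin (kms_word \<beta>) 1 = 1" using lin_word[of "kms_word \<beta>" "[]"] by (simp add: word_Nil)
    show "lin (kms_word \<beta>) (a * x * b) = 0" if "a \<in> free_carrier S" "b \<in> free_carrier S" "x \<in> relators S" for a b x
      by (rule relators_vanish_words[OF kms_word_relations that])
  qed
  show ?thesis by (rule gns_free_state)
qed

lemma kms_word_adj: "w \<in> words S \<Longrightarrow> kms_word \<beta> (word_adj w) = cnj (kms_word \<beta> w)"
  using positive_functional_star[OF free_state_positive[OF kms_free_state], of "word w"] by simp

text \<open>For an adjoint letter the relation for the generator is conjugated, which moves its
  factor to the other side and inverts it.\<close>

lemma kms_word_letter:
  assumes l: "letter_base l \<in> carrier S" and w: "w \<in> words S"
  shows "kms_word \<beta> (l # w) = exp (- of_real (\<beta> * letter_log N l)) * kms_word \<beta> (w @ [l])"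
proof (cases l)
  case (Gen s)
  then show ?thesis using kms_word_Gen_exp[of s w \<beta>] l w by simp
next
  case (Adj s)
  then have s: "s \<in> carrier S" using l by simp
  have "cnj (kms_word \<beta> (w @ [Adj s])) = kms_word \<beta> (Gen s # word_adj w)"
    using kms_word_adj[of "w @ [Adj s]"] w s by simp
  also have "\<dots> = exp (- of_real (\<beta> * ln (N s))) * kms_word \<beta> (word_adj w @ [Gen s])"
    using kms_word_Gen_exp[OF s, of "word_adj w" \<beta>] w by simp
  also have "kms_word \<beta> (word_adj w @ [Gen s]) = cnj (kms_word \<beta> (Adj s # w))"
    using kms_word_adj[of "Adj s # w"] w s by simp
  also have "exp (- of_real (\<beta> * ln (N s))) * cnj (kms_word \<beta> (Adj s # w)) =
      cnj (exp (- of_real (\<beta> * ln (N s))) * kms_word \<beta> (Adj s # w))"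
    by (simp add: exp_cnj)
  finally have "kms_word \<beta> (w @ [Adj s]) = exp (- of_real (\<beta> * ln (N s))) * kms_word \<beta> (Adj s # w)"
    by (simp only: complex_cnj_cancel_iff)
  then show ?thesis using Adj by (simp flip: exp_add mult.assoc)
qed

text \<open>The letters of \<open>u\<close> are rotated to the end one at a time, and their factors
  multiply.\<close>

lemma kms_word_kms:
  "u \<in> words S \<Longrightarrow> w \<in> words S \<Longrightarrow>
    kms_word \<beta> (u @ w) = exp (- of_real (\<beta> * word_log N u)) * kms_word \<beta> (w @ u)"
proof (induction u arbitrary: w)
  case (Cons l u)
  then have l: "letter_base l \<in> carrier S" "u \<in> words S" by auto
  have "kms_word \<beta> ((l # u) @ w) = exp (- of_real (\<beta> * letter_log N l)) * kms_word \<beta> (u @ (w @ [l]))"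
    using kms_word_letter[of l "u @ w"] l Cons.prems by simp
  also have "kms_word \<beta> (u @ (w @ [l])) = exp (- of_real (\<beta> * word_log N u)) * kms_word \<beta> ((w @ [l]) @ u)"
    using Cons.IH[of "w @ [l]"] l Cons.prems by simp
  finally show ?case by (simp add: ring_distribs flip: exp_add mult.assoc)
qed simp

lemma kms_word_kms_state: "state_ext S (lin (kms_word \<beta>)) \<in> kms_states (Cstar S) (dynamics S N) \<beta>"
  by (rule kms_statesI[OF kms_free_state]) (simp only: lin_word, rule kms_word_kms)

text \<open>The class of the identity has weight 1. The other classes contribute at most
  \<open>tail \<beta>\<close> to the numerator, and the normalisation
  \<open>1 + tail \<beta>\<close> costs at most \<open>tail \<beta>\<close> more.\<close>

lemma kms_word_ground_bound:
  assumes w: "w \<in> words S"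
  shows "cmod (kms_word \<beta> w - vector_state (fraction \<one> \<one>) w) \<le> 2 * tail \<beta>"
proof -
  let ?I = "scale_classes - {class_one}" and ?f = "\<lambda>C. of_real (weight \<beta> C) * vector_state (base C) w :: complex"
  let ?v = "vector_state (fraction \<one> \<one>) w" and ?E = "infsum ?f ?I"
  have v: "vector_state (base class_one) w = ?v"
    using w by (intro vec_orbit) (auto simp: orbit_base orbit_frac class_one_def)
  have f: "?f summable_on ?I" by (rule abs_summable_summable[OF vec_summable[OF w]]) auto
  have "insert class_one ?I = scale_classes" by auto
  then have "infsum ?f scale_classes = ?v + ?E"
    using infsum_insert[OF f, of class_one] unfolding weight_class_one v by simp
  then have eq: "kms_word \<beta> w = (?v + ?E) / of_real (1 + tail \<beta>)"
    unfolding kms_word_def partition_function_eq[OF summable] by simp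
  have t: "0 \<le> tail \<beta>" by (rule tail_nonneg[OF summable])
  then have nz: "complex_of_real (1 + tail \<beta>) \<noteq> 0" unfolding of_real_eq_0_iff by simp
  have "cmod ?E \<le> tail \<beta>"
    unfolding tail_def
  proof (rule norm_infsum_le)
    show "(?f has_sum ?E) ?I" using f by (rule has_sum_infsum)
    show "(weight \<beta> has_sum infsum (weight \<beta>) ?I) ?I" using tail_summable[OF summable] by (rule has_sum_infsum)
    show "norm (?f C) \<le> weight \<beta> C" if "C \<in> ?I" for C
      using weighted_bound[OF _ w] that by blast
  qed
  moreover have "cmod (?v * of_real (tail \<beta>)) \<le> tail \<beta>"
  proof -
    have "cmod (?v * of_real (tail \<beta>)) = cmod ?v * tail \<beta>" using t by (simp add: norm_mult)
    also have "\<dots> \<le> 1 * tail \<beta>" using t w by (intro mult_right_mono vec_bound) auto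
    finally show ?thesis by simp
  qed
  ultimately have num: "cmod (?E - ?v * of_real (tail \<beta>)) \<le> 2 * tail \<beta>"
    using norm_triangle_ineq4[of ?E "?v * of_real (tail \<beta>)"] by linarith
  have frac: "(a + b) / (1 + d) - a = (b - a * d) / (1 + d)" if "1 + d \<noteq> 0" for a b d :: complex
    using that by (simp add: field_simps)
  have "kms_word \<beta> w - ?v = (?E - ?v * of_real (tail \<beta>)) / of_real (1 + tail \<beta>)"
    unfolding eq of_real_add of_real_1 by (rule frac) (use nz in simp)
  then have "cmod (kms_word \<beta> w - ?v) = cmod (?E - ?v * of_real (tail \<beta>)) / (1 + tail \<beta>)"
    using t by (simp only: norm_divide norm_of_real)
  also have "\<dots> \<le> cmod (?E - ?v * of_real (tail \<beta>)) / 1"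
    using t by (intro divide_left_mono) auto
  finally show ?thesis using num by simp
qed

end

end

section \<open>Weak* convergence of states\<close>

context isometry_algebra
begin

lemma states_emb_expand:
  assumes \<phi>: "\<phi> \<in> states (Cstar S)" and p: "p \<in> free_carrier S"
  shows "\<phi> (emb S p) = (\<Sum>w\<in>Poly_Mapping.keys p. Poly_Mapping.lookup p w * \<phi> (emb S (word w)))"
proof -
  note L = free_state_linear[OF states_free_state[OF \<phi>]]
  have "\<phi> (emb S p) = \<phi> (emb S (\<Sum>w\<in>Poly_Mapping.keys p. free_scale (Poly_Mapping.lookup p w) (word w)))"
    using word_expansion[of p] by simp
  also have "\<dots> = (\<Sum>w\<in>Poly_Mapping.keys p. \<phi> (emb S (free_scale (Poly_Mapping.lookup p w) (word w))))"
    using keys_subset_words[OF p] by (intro linear_functional_sum[OF L] free_carrier_scale) auto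
  also have "\<dots> = (\<Sum>w\<in>Poly_Mapping.keys p. Poly_Mapping.lookup p w * \<phi> (emb S (word w)))"
    using keys_subset_words[OF p] by (intro sum.cong refl linear_functional_scale[OF L]) auto
  finally show ?thesis .
qed

text \<open>All states are contractive, so one approximation of \<open>X\<close> by the free algebra
  serves every \<open>\<psi> i\<close> and the limit at once.\<close>

lemma states_tendsto:
  assumes \<phi>: "\<phi> \<in> states (Cstar S)" and \<psi>: "\<forall>\<^sub>F i in F. \<psi> i \<in> states (Cstar S)"
    and words: "\<And>w. w \<in> words S \<Longrightarrow> ((\<lambda>i. \<psi> i (emb S (word w))) \<longlongrightarrow> \<phi> (emb S (word w))) F"
    and X: "X \<in> carrier (Cstar S)"
  shows "((\<lambda>i. \<psi> i X) \<longlongrightarrow> \<phi> X) F"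
proof (rule tendstoI)
  fix e :: real assume "e > 0"
  then have "e / 3 > 0" by simp
  obtain p where p: "p \<in> free_carrier S" "anorm (Cstar S) (X \<ominus>\<^bsub>Cstar S\<^esub> emb S p) < e / 3"
    using emb_dense[OF X \<open>e / 3 > 0\<close>] .
  have near: "cmod (\<phi>' X - \<phi>' (emb S p)) < e / 3" if "\<phi>' \<in> states (Cstar S)" for \<phi>'
    using states_bound[OF that Cstar_minus_closed[OF X emb_carrier[OF p(1)]]]
      states_minus[OF that X emb_carrier[OF p(1)]] p(2) by simp
  have "((\<lambda>i. \<Sum>w\<in>Poly_Mapping.keys p. Poly_Mapping.lookup p w * \<psi> i (emb S (word w))) \<longlongrightarrow> \<phi> (emb S p)) F"
    unfolding states_emb_expand[OF \<phi> p(1)]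
    using keys_subset_words[OF p(1)] by (intro tendsto_sum tendsto_mult tendsto_const words) auto
  then have "\<forall>\<^sub>F i in F. dist (\<Sum>w\<in>Poly_Mapping.keys p. Poly_Mapping.lookup p w * \<psi> i (emb S (word w))) (\<phi> (emb S p)) < e / 3"
    using \<open>e / 3 > 0\<close> by (rule tendstoD)
  with \<psi> show "\<forall>\<^sub>F i in F. dist (\<psi> i X) (\<phi> X) < e"
  proof eventually_elim
    case (elim i)
    have "dist (\<psi> i (emb S p)) (\<phi> (emb S p)) < e / 3"
      unfolding states_emb_expand[OF elim(1) p(1)] by (rule elim(2))
    moreover have "dist (\<psi> i X) (\<psi> i (emb S p)) < e / 3" "dist (\<phi> (emb S p)) (\<phi> X) < e / 3"
      using near[OF elim(1)] near[OF \<phi>] by (simp_all add: dist_norm norm_minus_commute)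
    moreover have "dist (\<psi> i X) (\<phi> X) \<le>
        dist (\<psi> i X) (\<psi> i (emb S p)) + (dist (\<psi> i (emb S p)) (\<phi> (emb S p)) + dist (\<phi> (emb S p)) (\<phi> X))"
      by (meson add_left_mono dist_triangle order_trans)
    ultimately show ?case by linarith
  qed
qed

lemma limitin_weak_star:
  "limitin (weak_star (Cstar S)) f \<phi> F \<longleftrightarrow> \<phi> \<in> states (Cstar S) \<and> (\<forall>\<^sub>F i in F. f i \<in> states (Cstar S)) \<and>
    (\<forall>X\<in>carrier (Cstar S). ((\<lambda>i. f i X) \<longlongrightarrow> \<phi> X) F)"
proof -
  have sub: "states (Cstar S) \<subseteq> extensional (carrier (Cstar S))" by (auto simp: states_def)
  have ev: "\<forall>\<^sub>F i in F. f i \<in> extensional (carrier (Cstar S))" if "\<forall>\<^sub>F i in F. f i \<in> states (Cstar S)"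
    using that by (rule eventually_mono) (use sub in blast)
  show ?thesis
    unfolding weak_star_def limitin_subtopology limitin_componentwise
    using sub ev by (auto simp: PiE_UNIV_domain PiE_def)
qed

lemma topspace_weak_star: "topspace (weak_star (Cstar S)) = states (Cstar S)"
  by (auto simp: weak_star_def states_def PiE_def)

lemma continuous_map_evaluation:
  assumes "X \<in> carrier (Cstar S)"
  shows "continuous_map (subtopology (weak_star (Cstar S)) T) euclidean (\<lambda>\<phi>. \<phi> X)"
  unfolding weak_star_def
  by (intro continuous_map_from_subtopology continuous_map_product_projection assms)

lemma continuous_map_weak_star:
  assumes T: "\<And>x. x \<in> topspace X \<Longrightarrow> f x \<in> T \<and> f x \<in> states (Cstar S)"
    and words: "\<And>w. w \<in> words S \<Longrightarrow> continuous_map X euclidean (\<lambda>x. f x (emb S (word w)))"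
  shows "continuous_map X (subtopology (weak_star (Cstar S)) T) f"
  unfolding continuous_map_atin limitin_subtopology limitin_weak_star
proof (intro ballI conjI)
  fix x assume x: "x \<in> topspace X"
  show "f x \<in> T" "f x \<in> states (Cstar S)" using T[OF x] by auto
  have ev: "\<forall>\<^sub>F y in atin X x. y \<in> topspace X"
    unfolding eventually_atin by (intro disjI2 exI[of _ "topspace X"]) (use x in auto)
  show "\<forall>\<^sub>F y in atin X x. f y \<in> T" using ev by (rule eventually_mono) (use T in blast)
  show st: "\<forall>\<^sub>F y in atin X x. f y \<in> states (Cstar S)" using ev by (rule eventually_mono) (use T in blast)
  fix Y assume "Y \<in> carrier (Cstar S)"
  moreover have "((\<lambda>y. f y (emb S (word w))) \<longlongrightarrow> f x (emb S (word w))) (atin X x)" if "w \<in> words S" for w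
    using words[OF that] x unfolding continuous_map_atin limitin_canonical_iff by blast
  ultimately show "((\<lambda>y. f y Y) \<longlongrightarrow> f x Y) (atin X x)"
    using states_tendsto[of "f x" f "atin X x" Y] T[OF x] st by blast
qed

lemma states_convex:
  assumes \<phi>: "\<phi> \<in> states (Cstar S)" and \<psi>: "\<psi> \<in> states (Cstar S)" and u: "u \<in> {0..1::real}"
  shows "(\<lambda>a\<in>carrier (Cstar S). of_real (1 - u) * \<phi> a + of_real u * \<psi> a) \<in> states (Cstar S)"
  unfolding states_def
proof (intro CollectI conjI ballI allI)
  let ?f = "\<lambda>a\<in>carrier (Cstar S). of_real (1 - u) * \<phi> a + of_real u * \<psi> a"
  show "?f \<one>\<^bsub>Cstar S\<^esub> = 1"
    by (simp add: Cstar_one states_one[OF \<phi>] states_one[OF \<psi>])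
  fix X assume X: "X \<in> carrier (Cstar S)"
  show "?f (c \<odot>\<^bsub>Cstar S\<^esub> X) = c * ?f X" for c
    using X by (simp add: states_smult[OF \<phi>] states_smult[OF \<psi>] algebra_simps)
  show "?f (X \<oplus>\<^bsub>Cstar S\<^esub> Y) = ?f X + ?f Y" if "Y \<in> carrier (Cstar S)" for Y
    using X that by (simp add: states_add[OF \<phi>] states_add[OF \<psi>] algebra_simps)
  have "of_real (1 - u) * \<phi> (star (Cstar S) X \<otimes>\<^bsub>Cstar S\<^esub> X) \<in> \<real>\<^sub>\<ge>\<^sub>0"
    using u by (intro nonneg_Reals_mult_I states_nonneg[OF \<phi> X]) (simp only: nonneg_Reals_of_real_iff, simp)
  moreover have "of_real u * \<psi> (star (Cstar S) X \<otimes>\<^bsub>Cstar S\<^esub> X) \<in> \<real>\<^sub>\<ge>\<^sub>0"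
    using u by (intro nonneg_Reals_mult_I states_nonneg[OF \<psi> X]) auto
  ultimately show "?f (star (Cstar S) X \<otimes>\<^bsub>Cstar S\<^esub> X) \<in> \<real>\<^sub>\<ge>\<^sub>0"
    using X by (simp only: restrict_apply' Cstar_closed nonneg_Reals_add_I)
qed simp

lemma tracial_states_convex:
  assumes "\<phi> \<in> tracial_states (Cstar S)" "\<psi> \<in> tracial_states (Cstar S)" "u \<in> {0..1::real}"
  shows "(\<lambda>a\<in>carrier (Cstar S). of_real (1 - u) * \<phi> a + of_real u * \<psi> a) \<in> tracial_states (Cstar S)"
  using states_convex[of \<phi> \<psi> u] assms unfolding tracial_states_def by auto

end

section \<open>The kernel of the scale\<close>

context lcm_scale
begin

abbreviation KS :: "'s monoid" where "KS \<equiv> ker_scale S N"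

lemma l_coset_ker: "s \<in> K \<Longrightarrow> s <#\<^bsub>KS\<^esub> K = (s <# carrier S) \<inter> K"
proof -
  assume s: "s \<in> K"
  have "x \<in> s <#\<^bsub>KS\<^esub> K \<longleftrightarrow> (\<exists>y\<in>K. x = s \<otimes> y)" for x by (auto simp: l_coset_def)
  moreover have "(\<exists>y\<in>K. x = s \<otimes> y) \<longleftrightarrow> x \<in> (s <# carrier S) \<inter> K" for x
    using s K_mult_iff[of s] K_carrier unfolding Int_iff l_coset_iff by blast
  ultimately show ?thesis by blast
qed

text \<open>A common multiple inside the kernel exists by \<open>ore\<close>; the least common
  multiple divides it and so belongs to the kernel.\<close>

lemma ker_lcm:
  assumes s: "s \<in> K" and t: "t \<in> K"
  obtains r where "r \<in> K" "(s <# carrier S) \<inter> (t <# carrier S) = r <# carrier S"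
proof -
  obtain c d where cd: "c \<in> K" "d \<in> K" "s \<otimes> c = t \<otimes> d" using ore[OF s t] .
  have mem: "s \<otimes> c \<in> (s <# carrier S) \<inter> (t <# carrier S)"
    using cd K_carrier unfolding Int_iff l_coset_iff by metis
  then obtain r where r: "r \<in> carrier S" "(s <# carrier S) \<inter> (t <# carrier S) = r <# carrier S"
    using right_lcm[OF K_carrier[OF s] K_carrier[OF t]] by blast
  from mem obtain y where "y \<in> carrier S" "s \<otimes> c = r \<otimes> y" unfolding r(2) l_coset_iff by blast
  then have "r \<in> K" using K_mult_iff[OF r(1), of y] K_mult[OF s cd(1)] by simp
  then show ?thesis using that r(2) by blast
qed

lemma ker_right_lcm_algebra: "right_lcm_algebra KS"
proof (intro right_lcm_algebra.intro right_lcm_semigroup.intro right_lcm_semigroup_axioms.intro)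
  show "monoid KS" by (rule monoidI) (simp_all add: m_assoc K_carrier)
  show "x = y" if "a \<in> carrier KS" "x \<in> carrier KS" "y \<in> carrier KS" "a \<otimes>\<^bsub>KS\<^esub> x = a \<otimes>\<^bsub>KS\<^esub> y" for a x y
    using left_cancel[of a x y] that by (simp add: K_carrier)
  fix s t assume st: "s \<in> carrier KS" "t \<in> carrier KS"
  then have "s \<in> K" "t \<in> K" by simp_all
  from ker_lcm[OF this] obtain r where r: "r \<in> K" "(s <# carrier S) \<inter> (t <# carrier S) = r <# carrier S" .
  then have "(s <#\<^bsub>KS\<^esub> carrier KS) \<inter> (t <#\<^bsub>KS\<^esub> carrier KS) = r <#\<^bsub>KS\<^esub> carrier KS"
    using st by (auto simp: l_coset_ker)
  then show "(s <#\<^bsub>KS\<^esub> carrier KS) \<inter> (t <#\<^bsub>KS\<^esub> carrier KS) = {} \<or>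
      (\<exists>r\<in>carrier KS. (s <#\<^bsub>KS\<^esub> carrier KS) \<inter> (t <#\<^bsub>KS\<^esub> carrier KS) = r <#\<^bsub>KS\<^esub> carrier KS)"
    using r(1) by auto
qed

sublocale ker: right_lcm_algebra KS by (rule ker_right_lcm_algebra)

lemma ker_words: "w \<in> words KS \<Longrightarrow> w \<in> words S"
  by (simp add: words_def K_carrier)

lemma ker_free_carrier: "p \<in> free_carrier KS \<Longrightarrow> p \<in> free_carrier S"
  by (simp add: free_carrier_def K_carrier)

text \<open>Inside the kernel \<open>r\<close> and the least common multiple \<open>r'\<close> taken
  in \<open>S\<close> generate the same right ideal. They then divide each other, so they also
  generate the same right ideal of \<open>S\<close>.\<close>

lemma ker_coset_eq:
  assumes s: "s \<in> K" and t: "t \<in> K" and r: "r \<in> K"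
    and eq: "(s <#\<^bsub>KS\<^esub> K) \<inter> (t <#\<^bsub>KS\<^esub> K) = r <#\<^bsub>KS\<^esub> K"
  shows "(s <# carrier S) \<inter> (t <# carrier S) = r <# carrier S"
proof -
  obtain r' where r': "r' \<in> K" "(s <# carrier S) \<inter> (t <# carrier S) = r' <# carrier S" using ker_lcm[OF s t] .
  have same: "(r <# carrier S) \<inter> K = (r' <# carrier S) \<inter> K"
    using eq r'(2) by (simp add: l_coset_ker s t r) blast
  have self: "x \<in> x <# carrier S" if "x \<in> K" for x
    unfolding l_coset_iff using K_carrier[OF that] by (intro bexI[of _ \<one>]) auto
  obtain x y where xy: "x \<in> carrier S" "y \<in> carrier S" "r = r' \<otimes> x" "r' = r \<otimes> y"
    using self[OF r] self[OF r'(1)] r r'(1) same unfolding l_coset_iff by (metis IntD1 IntI l_coset_iff)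
  have "r <# carrier S \<subseteq> r' <# carrier S"
  proof
    fix z assume "z \<in> r <# carrier S"
    then obtain u where "u \<in> carrier S" "z = r' \<otimes> x \<otimes> u" unfolding l_coset_iff xy(3)[symmetric] by blast
    then show "z \<in> r' <# carrier S"
      unfolding l_coset_iff using xy(1) K_carrier[OF r'(1)] by (intro bexI[of _ "x \<otimes> u"]) (auto simp: m_assoc)
  qed
  moreover have "r' <# carrier S \<subseteq> r <# carrier S"
  proof
    fix z assume "z \<in> r' <# carrier S"
    then obtain u where "u \<in> carrier S" "z = r \<otimes> y \<otimes> u" unfolding l_coset_iff xy(4)[symmetric] by blast
    then show "z \<in> r <# carrier S"
      unfolding l_coset_iff using xy(2) K_carrier[OF r] by (intro bexI[of _ "y \<otimes> u"]) (auto simp: m_assoc)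
  qed
  ultimately show ?thesis using r'(2) by blast
qed

text \<open>This is what induces the homomorphism from C*(ker N) to C*(S): every C*-seminorm for
  \<open>S\<close> restricts to one for the kernel.\<close>

lemma ker_relators: "relators KS \<subseteq> relators S"
proof
  fix x assume "x \<in> relators KS"
  then consider "x = free_gen \<one> - 1"
    | s where "s \<in> K" "x = free_star (free_gen s) * free_gen s - 1"
    | s t where "s \<in> K" "t \<in> K" "x = free_gen s * free_gen t - free_gen (s \<otimes> t)"
    | s t r where "s \<in> K" "t \<in> K" "r \<in> K" "(s <#\<^bsub>KS\<^esub> K) \<inter> (t <#\<^bsub>KS\<^esub> K) = r <#\<^bsub>KS\<^esub> K"
        "x = free_proj s * free_proj t - free_proj r"
    | s t where "s \<in> K" "t \<in> K" "(s <#\<^bsub>KS\<^esub> K) \<inter> (t <#\<^bsub>KS\<^esub> K) = {}" "x = free_proj s * free_proj t"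
    unfolding relators_def carrier_ker mult_ker one_ker by blast
  then show "x \<in> relators S"
  proof cases
    case 1 then show ?thesis using relators_intros(1) by simp
  next
    case (2 s) then show ?thesis using relators_intros(2)[OF K_carrier] by simp
  next
    case (3 s t) then show ?thesis using relators_intros(3)[OF K_carrier K_carrier] by simp
  next
    case (4 s t r)
    then show ?thesis
      using relators_intros(4)[OF K_carrier K_carrier K_carrier ker_coset_eq, of s t r] by simp
  next
    \<comment> \<open>Vacuous: directedness gives the two right ideals of the kernel a common
      element.\<close>
    case (5 s t)
    then show ?thesis using directed unfolding directed_kernel_def Let_def by simp
  qed
qed

lemma ker_cstar_seminorm: "cstar_seminorm S q \<Longrightarrow> cstar_seminorm KS q"
  unfolding cstar_seminorm_def using ker_free_carrier ker_relators by blast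

lemma ker_universal_norm:
  assumes "p \<in> free_carrier KS" shows "universal_norm S p \<le> universal_norm KS p"
  using ker.seminorm_le_universal[OF ker_cstar_seminorm assms] by (rule universal_norm_le)

lemma ker_free_state: assumes "free_state S \<omega>" shows "free_state KS \<omega>"
  using assms ker_free_carrier order_trans[OF _ ker_universal_norm]
  unfolding free_state_def positive_functional_def linear_functional_def by blast

lemma trace_kernel:
  assumes \<omega>: "free_state KS \<omega>"
    and tr: "\<And>p q. p \<in> free_carrier KS \<Longrightarrow> q \<in> free_carrier KS \<Longrightarrow> \<omega> (p * q) = \<omega> (q * p)"
  shows "kernel_trace S N (\<lambda>x y. \<omega> (free_gen x * free_star (free_gen y)))"
proof
  let ?\<kappa> = "\<lambda>x y. \<omega> (free_gen x * free_star (free_gen y))"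
  note L = free_state_linear[OF \<omega>] and pos = free_state_positive[OF \<omega>] and eqv = ker.free_state_eqv[OF \<omega>]
  have g: "free_gen x \<in> free_carrier KS" if "x \<in> K" for x using that by simp
  have mult: "ker.eqv (free_gen x * free_gen y) (free_gen (x \<otimes> y))"
    "ker.eqv (free_star (free_gen y) * free_star (free_gen x)) (free_star (free_gen (x \<otimes> y)))"
    if "x \<in> K" "y \<in> K" for x y
    using ker.eqv_gen_mult[of x y] ker.eqv_gen_mult_star[of x y] that by simp_all
  show "?\<kappa> \<one> \<one> = 1"
  proof -
    have "ker.eqv (free_gen \<one> * free_star (free_gen \<one>)) (1 * free_star 1)"
      using ker.eqv_gen_one by (intro ker.eqv_mult ker.eqv_star) simp_all
    from eqv[OF this] show ?thesis by (simp add: free_state_one[OF \<omega>])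
  qed
  fix x y assume x: "x \<in> K" and y: "y \<in> K"
  show "?\<kappa> y x = cnj (?\<kappa> x y)"
    using positive_functional_star[OF pos, of "free_gen x * free_star (free_gen y)"] x y by simp
  fix c assume c: "c \<in> K"
  note xyc = g[OF x] g[OF y] g[OF c]
  have iso: "ker.eqv (free_star (free_gen c) * free_gen c) 1" using ker.eqv_isometry[of c] c by simp
  show "?\<kappa> (c \<otimes> x) (c \<otimes> y) = ?\<kappa> x y"
  proof -
    have "?\<kappa> (c \<otimes> x) (c \<otimes> y) =
        \<omega> ((free_gen c * free_gen x) * (free_star (free_gen y) * free_star (free_gen c)))"
      using mult(1)[OF c x] mult(2)[OF c y] by (intro eqv ker.eqv_mult) (auto intro: ker.eqv_sym)
    also have "\<dots> = \<omega> (free_gen c * (free_gen x * free_star (free_gen y) * free_star (free_gen c)))"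
      by (simp add: mult.assoc)
    also have "\<dots> = \<omega> ((free_gen x * free_star (free_gen y) * free_star (free_gen c)) * free_gen c)"
      using xyc by (intro tr) auto
    also have "\<dots> = \<omega> ((free_gen x * free_star (free_gen y)) * (free_star (free_gen c) * free_gen c))"
      by (simp add: mult.assoc)
    also have "\<dots> = \<omega> ((free_gen x * free_star (free_gen y)) * 1)"
      using xyc iso by (intro eqv ker.eqv_mult_left) auto
    finally show ?thesis by simp
  qed
  show "?\<kappa> (x \<otimes> c) (y \<otimes> c) = ?\<kappa> x y"
  proof -
    txt \<open>\<open>1 - v\<^sub>c v\<^sub>c\<^sup>*\<close> is a projection of trace zero.\<close>
    let ?P = "1 - free_gen c * free_star (free_gen c)" and ?z = "free_star (free_gen y) * free_gen x"
    have P: "?P \<in> free_carrier KS" and z: "?z \<in> free_carrier KS" using xyc by auto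
    have "\<omega> (free_gen c * free_star (free_gen c)) = \<omega> (free_star (free_gen c) * free_gen c)"
      using xyc by (intro tr) auto
    also have "\<dots> = 1" using eqv[OF iso] by (simp add: free_state_one[OF \<omega>])
    finally have one: "\<omega> (free_gen c * free_star (free_gen c)) = 1" .
    \<comment> \<open>In the free algebra \<open>?P\<close> is self-adjoint but idempotent only up
      to a correction containing \<open>1 - v_c* v_c\<close>, on which \<omega> vanishes.\<close>
    have "?P * ?P = ?P - free_gen c * ((1 - free_star (free_gen c) * free_gen c) * free_star (free_gen c))"
      by (simp add: algebra_simps)
    moreover have "\<omega> (free_gen c * ((1 - free_star (free_gen c) * free_gen c) * free_star (free_gen c))) = 0"
    proof -
      have "ker.eqv (1 - free_star (free_gen c) * free_gen c) 0"
        using ker.eqv_sym[OF iso] by (simp add: ker.eqv_def)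
      then have "ker.eqv (free_gen c * ((1 - free_star (free_gen c) * free_gen c) * free_star (free_gen c)))
          (free_gen c * (0 * free_star (free_gen c)))"
        using xyc by (intro ker.eqv_mult_left ker.eqv_mult_right) auto
      from eqv[OF this] show ?thesis by (simp add: linear_functional_zero[OF L])
    qed
    ultimately have "\<omega> (free_star ?P * ?P) = 0"
      using xyc one by (simp add: linear_functional_diff[OF L] free_state_one[OF \<omega>])
    then have "(cmod (\<omega> (free_star ?P * ?z)))\<^sup>2 \<le> 0"
      using positive_functional_cauchy_schwarz[OF pos z P] by simp
    then have "\<omega> (?P * ?z) = 0" by simp
    then have eq: "\<omega> (free_gen c * free_star (free_gen c) * ?z) = \<omega> ?z"
      using linear_functional_diff[OF L, of ?z "free_gen c * free_star (free_gen c) * ?z"] xyc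
      by (simp add: left_diff_distrib)
    have "?\<kappa> (x \<otimes> c) (y \<otimes> c) =
        \<omega> ((free_gen x * free_gen c) * (free_star (free_gen c) * free_star (free_gen y)))"
      using mult(1)[OF x c] mult(2)[OF y c] by (intro eqv ker.eqv_mult) (auto intro: ker.eqv_sym)
    also have "\<dots> = \<omega> (free_gen x * (free_gen c * free_star (free_gen c) * free_star (free_gen y)))"
      by (simp add: mult.assoc)
    also have "\<dots> = \<omega> ((free_gen c * free_star (free_gen c) * free_star (free_gen y)) * free_gen x)"
      using xyc by (intro tr) auto
    also have "\<dots> = \<omega> ?z" using eq by (simp add: mult.assoc)
    also have "\<dots> = ?\<kappa> x y" using xyc by (intro tr) auto
    finally show ?thesis .
  qed
next
  fix I :: "'s letter list set" and a z
  assume I: "finite I" "\<And>i. i \<in> I \<Longrightarrow> a i \<in> K"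
  note L = free_state_linear[OF \<omega>]
  \<comment> \<open>Adjoints are used here so that the square of \<open>?P\<close> consists of the
    products \<open>v_a v_b*\<close> that define the kernel function.\<close>
  let ?P = "\<Sum>i\<in>I. free_scale (z i) (free_star (free_gen (a i)))"
  have P: "?P \<in> free_carrier KS" using I by (intro free_carrier_sum) auto
  have "free_star ?P * ?P = (\<Sum>j\<in>I. \<Sum>i\<in>I. free_scale (cnj (z j) * z i) (free_gen (a j) * free_star (free_gen (a i))))"
    by (simp add: free_star_sum sum_product free_scale_mult_left free_scale_mult_right mult.commute)
  then have "\<omega> (free_star ?P * ?P) = (\<Sum>j\<in>I. \<Sum>i\<in>I. cnj (z j) * z i * \<omega> (free_gen (a j) * free_star (free_gen (a i))))"
    using I by (simp add: linear_functional_sum[OF L] linear_functional_scale[OF L])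
  also have "\<dots> = (\<Sum>i\<in>I. \<Sum>j\<in>I. cnj (z j) * z i * \<omega> (free_gen (a j) * free_star (free_gen (a i))))"
    by (rule sum.swap)
  finally show "(\<Sum>i\<in>I. \<Sum>j\<in>I. cnj (z j) * z i * \<omega> (free_gen (a j) * free_star (free_gen (a i)))) \<in> \<real>\<^sub>\<ge>\<^sub>0"
    using positive_functional_nonneg[OF free_state_positive[OF \<omega>] P] by simp
qed

end

section \<open>KMS states at zero temperature\<close>

context scaled_algebra
begin

lemma kms_infinity_obtain:
  assumes "\<phi> \<in> kms_infinity_states (Cstar S) (dynamics S N)"
  obtains F :: "(real \<times> ('s cstar_elem \<Rightarrow> complex)) filter" where "F \<noteq> bot"
    "\<forall>\<^sub>F x in F. snd x \<in> kms_states (Cstar S) (dynamics S N) (fst x) \<and> 0 < fst x"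
    "filterlim fst at_top F" "\<phi> \<in> states (Cstar S)"
    "\<And>X. X \<in> carrier (Cstar S) \<Longrightarrow> ((\<lambda>x. snd x X) \<longlongrightarrow> \<phi> X) F"
proof -
  from assms obtain F :: "(real \<times> ('s cstar_elem \<Rightarrow> complex)) filter" where F: "F \<noteq> bot"
    "\<forall>\<^sub>F (\<beta>, \<psi>) in F. \<psi> \<in> kms_states (Cstar S) (dynamics S N) \<beta>"
    "filterlim fst at_top F" "limitin (weak_star (Cstar S)) snd \<phi> F"
    unfolding kms_infinity_states_def by blast
  have "\<forall>\<^sub>F x in F. snd x \<in> kms_states (Cstar S) (dynamics S N) (fst x) \<and> 0 < fst x"
    using F(2) filterlim_at_top_dense[THEN iffD1, OF F(3), rule_format, of 0]
    by eventually_elim (auto simp: case_prod_beta)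
  then show ?thesis using that F limitin_weak_star by blast
qed

lemma kms_infinity_states:
  "\<phi> \<in> kms_infinity_states (Cstar S) (dynamics S N) \<Longrightarrow> \<phi> \<in> states (Cstar S)"
  by (erule kms_infinity_obtain)

text \<open>For \<open>N s = 1\<close> the KMS factor is 1 at every temperature, so commutation
  passes to the limit.\<close>

lemma kms_infinity_commute:
  assumes \<phi>: "\<phi> \<in> kms_infinity_states (Cstar S) (dynamics S N)"
    and s: "s \<in> carrier S" "N s = 1" and p: "p \<in> free_carrier S"
  shows "\<phi> (emb S (free_gen s * p)) = \<phi> (emb S (p * free_gen s))"
  using \<phi>
proof (rule kms_infinity_obtain)
  fix F :: "(real \<times> ('s cstar_elem \<Rightarrow> complex)) filter"
  assume F: "F \<noteq> bot" "\<forall>\<^sub>F x in F. snd x \<in> kms_states (Cstar S) (dynamics S N) (fst x) \<and> 0 < fst x"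
    and lim: "\<And>X. X \<in> carrier (Cstar S) \<Longrightarrow> ((\<lambda>x. snd x X) \<longlongrightarrow> \<phi> X) F"
  have "\<forall>\<^sub>F x in F. snd x (emb S (free_gen s * p)) = snd x (emb S (p * free_gen s))"
    using F(2)
  proof eventually_elim
    case (elim x)
    then show ?case using kms_generator[of "snd x" "fst x" s p] s p by simp
  qed
  then have "((\<lambda>x. snd x (emb S (p * free_gen s))) \<longlongrightarrow> \<phi> (emb S (free_gen s * p))) F"
    using lim[of "emb S (free_gen s * p)"] s p by (simp add: filterlim_cong)
  then show ?thesis using lim[of "emb S (p * free_gen s)"] s p F(1) tendsto_unique by fastforce
qed

text \<open>For \<open>N s > 1\<close> the KMS factor decays exponentially in \<beta>, while the
  value it multiplies stays below the norm of \<open>p * free_gen s\<close>.\<close>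

lemma kms_infinity_zero:
  assumes \<phi>: "\<phi> \<in> kms_infinity_states (Cstar S) (dynamics S N)"
    and s: "s \<in> carrier S" "N s \<noteq> 1" and p: "p \<in> free_carrier S"
  shows "\<phi> (emb S (free_gen s * p)) = 0"
  using \<phi>
proof (rule kms_infinity_obtain)
  fix F :: "(real \<times> ('s cstar_elem \<Rightarrow> complex)) filter"
  assume F: "F \<noteq> bot" "\<forall>\<^sub>F x in F. snd x \<in> kms_states (Cstar S) (dynamics S N) (fst x) \<and> 0 < fst x"
    "filterlim fst at_top F"
    and lim: "\<And>X. X \<in> carrier (Cstar S) \<Longrightarrow> ((\<lambda>x. snd x X) \<longlongrightarrow> \<phi> X) F"
  have l: "0 < ln (N s)" using N_ge_one[OF s(1)] s(2) by simp
  let ?M = "universal_norm S (p * free_gen s)"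
  have "((\<lambda>x. snd x (emb S (free_gen s * p))) \<longlongrightarrow> 0) F"
  proof (rule Lim_null_comparison)
    show "\<forall>\<^sub>F x in F. cmod (snd x (emb S (free_gen s * p))) \<le> exp (- (fst x * ln (N s))) * ?M"
      using F(2)
    proof eventually_elim
      case (elim x)
      then have st: "snd x \<in> states (Cstar S)" by (simp add: kms_states_def)
      have "cmod (snd x (emb S (free_gen s * p))) =
          cmod (exp (- of_real (fst x * ln (N s)))) * cmod (snd x (emb S (p * free_gen s)))"
        using kms_generator[of "snd x" "fst x" s p] elim s p by (simp add: norm_mult)
      also have "cmod (exp (- of_real (fst x * ln (N s)))) = exp (- (fst x * ln (N s)))" by simp
      also have "exp (- (fst x * ln (N s))) * cmod (snd x (emb S (p * free_gen s))) \<le> exp (- (fst x * ln (N s))) * ?M"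
        using states_bound[OF st, of "emb S (p * free_gen s)"] s p
        by (intro mult_left_mono) (simp_all add: anorm_emb)
      finally show ?case .
    qed
    have "filterlim (\<lambda>x. ln (N s) * fst x) at_top F"
      by (rule filterlim_tendsto_pos_mult_at_top[OF tendsto_const l F(3)])
    then have "((\<lambda>x. exp (- (ln (N s) * fst x))) \<longlongrightarrow> 0) F"
      by (intro filterlim_compose[OF exp_at_bot] filterlim_compose[OF filterlim_uminus_at_bot_at_top])
    from tendsto_mult_left_zero[OF this, of ?M]
    show "((\<lambda>x. exp (- (fst x * ln (N s))) * ?M) \<longlongrightarrow> 0) F" by (simp add: mult.commute)
  qed
  then show ?thesis using lim[of "emb S (free_gen s * p)"] s p F(1) tendsto_unique by fastforce
qed

lemma kms_infinity_monomial_zero: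
  assumes \<phi>: "\<phi> \<in> kms_infinity_states (Cstar S) (dynamics S N)"
    and st: "s \<in> carrier S" "t \<in> carrier S" and "N s \<noteq> 1 \<or> N t \<noteq> 1"
  shows "\<phi> (emb S (free_gen s * free_star (free_gen t))) = 0"
  using assms(4)
proof
  assume "N s \<noteq> 1"
  then show ?thesis using kms_infinity_zero[OF \<phi> st(1)] st by simp
next
  assume "N t \<noteq> 1"
  then have "\<phi> (emb S (free_gen t * free_star (free_gen s))) = 0"
    using kms_infinity_zero[OF \<phi> st(2)] st by simp
  then have "cnj (\<phi> (emb S (free_star (free_gen t * free_star (free_gen s))))) = 0"
    using positive_functional_star[OF free_state_positive[OF states_free_state[OF kms_infinity_states[OF \<phi>]]],
        of "free_gen t * free_star (free_gen s)"] st by simp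
  then show ?thesis by simp
qed

end

context lcm_scale
begin

text \<open>Generators of the kernel commute with everything under \<open>\<phi>\<close>; taking
  adjoints extends this to the letters \<open>Adj s\<close>, and letters are then moved one by one.
  The other factor is allowed to range over the whole free algebra of \<open>S\<close> along the
  way.\<close>

lemma kms_infinity_trace:
  assumes \<phi>: "\<phi> \<in> kms_infinity_states (Cstar S) (dynamics S N)"
    and p: "p \<in> free_carrier KS" and q: "q \<in> free_carrier KS"
  shows "\<phi> (emb S (p * q)) = \<phi> (emb S (q * p))"
proof -
  note st = states_free_state[OF kms_infinity_states[OF \<phi>]]
  note L = free_state_linear[OF st]
  note lin = linear_functional_add[OF L] linear_functional_scale[OF L] linear_functional_zero[OF L]
  have letter: "\<phi> (emb S (word [l] * p)) = \<phi> (emb S (p * word [l]))"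
    if l: "letter_base l \<in> K" and p: "p \<in> free_carrier S" for l p
  proof (cases l)
    case (Gen s)
    then show ?thesis using kms_infinity_commute[OF \<phi> _ _ p, of s] l by (simp add: word_Gen K_def)
  next
    case (Adj s)
    then have s: "s \<in> carrier S" "N s = 1" using l by (auto simp: K_def)
    have "\<phi> (emb S (free_gen s * free_star p)) = \<phi> (emb S (free_star p * free_gen s))"
      using kms_infinity_commute[OF \<phi> s, of "free_star p"] p by simp
    then have "\<phi> (emb S (free_star (free_gen s * free_star p))) = \<phi> (emb S (free_star (free_star p * free_gen s)))"
      using positive_functional_star[OF free_state_positive[OF st], of "free_gen s * free_star p"]
        positive_functional_star[OF free_state_positive[OF st], of "free_star p * free_gen s"] s p
      by simp
    then show ?thesis by (simp add: Adj word_Adj)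
  qed
  have words: "\<phi> (emb S (word u * q)) = \<phi> (emb S (q * word u))"
    if "u \<in> words KS" "q \<in> free_carrier S" for u q
    using that
  proof (induction u arbitrary: q)
    case Nil
    then show ?case by (simp add: word_Nil)
  next
    case (Cons l u)
    then have l: "letter_base l \<in> K" and u: "u \<in> words KS" by auto
    have lS: "letter_base l \<in> carrier S" and uS: "u \<in> words S" using l u K_carrier ker_words by auto
    have split: "word (l # u) = word [l] * word u" by (simp add: word_mult)
    have "\<phi> (emb S (word (l # u) * q)) = \<phi> (emb S (word [l] * (word u * q)))" by (simp add: split mult.assoc)
    also have "\<dots> = \<phi> (emb S (word u * (q * word [l])))"
      using letter[OF l, of "word u * q"] Cons.prems(2) uS by (simp add: mult.assoc)
    also have "\<dots> = \<phi> (emb S ((q * word [l]) * word u))"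
      using Cons.prems(2) lS by (intro Cons.IH[OF u]) simp
    finally show ?case by (simp add: split mult.assoc)
  qed
  have qS: "q \<in> free_carrier S" using q ker_free_carrier by blast
  from p show ?thesis
  proof (induction rule: free_carrier_induct)
    case (add p p')
    then show ?case using qS ker_free_carrier[of p] ker_free_carrier[of p'] by (simp add: ring_distribs lin)
  next
    case (scale c w)
    then show ?case using qS ker_words[OF scale] words[OF scale qS]
      by (simp add: free_scale_mult_left free_scale_mult_right lin del: free_scale_single)
  qed (simp add: lin)
qed

lemma trace_kms_infinity:
  assumes sm: "\<bar>abscissa S N\<bar> \<noteq> \<infinity>" and \<tau>: "\<tau> \<in> tracial_states (Cstar KS)"
  shows "\<exists>\<phi>\<in>kms_infinity_states (Cstar S) (dynamics S N). \<forall>s\<in>carrier S. \<forall>t\<in>carrier S.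
    \<phi> (emb S (free_gen s * free_star (free_gen t))) =
      (if s \<in> K \<and> t \<in> K then \<tau> (emb KS (free_gen s * free_star (free_gen t))) else 0)"
proof -
  define \<omega> where "\<omega> = (\<lambda>p. \<tau> (emb KS p))"
  have st: "\<tau> \<in> states (Cstar KS)" using \<tau> by (simp add: tracial_states_def)
  have \<omega>: "free_state KS \<omega>" unfolding \<omega>_def by (rule ker.states_free_state[OF st])
  have tr: "\<omega> (p * q) = \<omega> (q * p)" if "p \<in> free_carrier KS" "q \<in> free_carrier KS" for p q
    using \<tau> that ker.emb_carrier unfolding tracial_states_def \<omega>_def by (simp flip: ker.emb_simps(1))
  interpret kernel_trace S N "\<lambda>x y. \<omega> (free_gen x * free_star (free_gen y))"
    by (rule trace_kernel[OF \<omega> tr])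
  obtain \<beta>0 where \<beta>0: "weight \<beta>0 summable_on scale_classes" using weight_summable[OF sm] .
  have e: "fraction \<one> \<one> \<in> fractions" by simp
  note free = vec_free_state[OF e]
  define \<phi> where "\<phi> = state_ext S (lin (vector_state (fraction \<one> \<one>)))"
  define \<psi> where "\<psi> = (\<lambda>\<beta>. state_ext S (lin (kms_word \<beta>)))"
  have \<phi>: "\<phi> \<in> states (Cstar S)" unfolding \<phi>_def by (rule state_ext_states[OF free])
  have sm': "weight \<beta> summable_on scale_classes" if "\<beta>0 \<le> \<beta>" for \<beta>
    using weight_summable_mono[OF \<beta>0 that] .
  have kms: "\<psi> \<beta> \<in> kms_states (Cstar S) (dynamics S N) \<beta>" if "\<beta>0 \<le> \<beta>" for \<beta>
    unfolding \<psi>_def by (rule kms_word_kms_state[OF sm'[OF that]])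
  have ev: "\<forall>\<^sub>F \<beta> in at_top. \<psi> \<beta> \<in> kms_states (Cstar S) (dynamics S N) \<beta>"
    using eventually_ge_at_top[of \<beta>0] by (rule eventually_mono) (rule kms)
  have ev_st: "\<forall>\<^sub>F \<beta> in at_top. \<psi> \<beta> \<in> states (Cstar S)"
    using ev by (rule eventually_mono) (simp add: kms_states_def)
  have lim: "((\<lambda>\<beta>. \<psi> \<beta> (emb S (word w))) \<longlongrightarrow> \<phi> (emb S (word w))) at_top" if w: "w \<in> words S" for w
  proof (rule LIM_zero_cancel, rule Lim_null_comparison)
    show "((\<lambda>\<beta>. 2 * tail \<beta>) \<longlongrightarrow> 0) at_top" using tendsto_mult_right_zero[OF tail_tendsto[OF \<beta>0]] .
    show "\<forall>\<^sub>F \<beta> in at_top. cmod (\<psi> \<beta> (emb S (word w)) - \<phi> (emb S (word w))) \<le> 2 * tail \<beta>"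
      using eventually_ge_at_top[of \<beta>0]
    proof eventually_elim
      case (elim \<beta>)
      have "\<psi> \<beta> (emb S (word w)) = kms_word \<beta> w"
        unfolding \<psi>_def using state_ext_emb[OF kms_free_state[OF sm'[OF elim]], of "word w"] w by simp
      moreover have "\<phi> (emb S (word w)) = vector_state (fraction \<one> \<one>) w"
        unfolding \<phi>_def using state_ext_emb[OF free, of "word w"] w by simp
      ultimately show ?case using kms_word_ground_bound[OF sm'[OF elim] w] by simp
    qed
  qed
  \<comment> \<open>The net is \<open>\<beta> \<mapsto> (\<beta>, \<psi> \<beta>)\<close> along
    \<open>at_top\<close>; its filter on pairs is the image filter.\<close>
  have "\<phi> \<in> kms_infinity_states (Cstar S) (dynamics S N)"
    unfolding kms_infinity_states_def
  proof (intro CollectI exI[of _ "filtermap (\<lambda>\<beta>. (\<beta>, \<psi> \<beta>)) at_top"] conjI)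
    show "filtermap (\<lambda>\<beta>. (\<beta>, \<psi> \<beta>)) at_top \<noteq> bot" by (simp add: filtermap_bot_iff)
    show "\<forall>\<^sub>F (\<beta>, \<psi>) in filtermap (\<lambda>\<beta>. (\<beta>, \<psi> \<beta>)) at_top. \<psi> \<in> kms_states (Cstar S) (dynamics S N) \<beta>"
      using ev by (simp add: eventually_filtermap)
    show "filterlim fst at_top (filtermap (\<lambda>\<beta>. (\<beta>, \<psi> \<beta>)) at_top)"
      by (simp add: filterlim_def filtermap_filtermap filtermap_ident)
    show "limitin (weak_star (Cstar S)) snd \<phi> (filtermap (\<lambda>\<beta>. (\<beta>, \<psi> \<beta>)) at_top)"
      unfolding limitin_weak_star eventually_filtermap filterlim_filtermap
      using \<phi> ev_st states_tendsto[OF \<phi> ev_st lim] by simp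
  qed
  moreover have "\<phi> (emb S (free_gen s * free_star (free_gen t))) =
      (if s \<in> K \<and> t \<in> K then \<tau> (emb KS (free_gen s * free_star (free_gen t))) else 0)"
    if s: "s \<in> carrier S" and t: "t \<in> carrier S" for s t
  proof -
    have "free_gen s * free_star (free_gen t) = word [Gen s, Adj t]"
      by (simp add: free_gen_def word_mult)
    then have "\<phi> (emb S (free_gen s * free_star (free_gen t))) = vector_state (fraction \<one> \<one>) [Gen s, Adj t]"
      unfolding \<phi>_def using state_ext_emb[OF free, of "word [Gen s, Adj t]"] s t by simp
    then show ?thesis using vec_one_monomial[OF s t] by (simp add: \<omega>_def)
  qed
  ultimately show ?thesis by blast
qed

lemma states_eq_on_monomials:
  assumes \<phi>: "\<phi> \<in> states (Cstar S)" and \<psi>: "\<psi> \<in> states (Cstar S)"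
    and "\<And>s t. s \<in> carrier S \<Longrightarrow> t \<in> carrier S \<Longrightarrow>
      \<phi> (emb S (free_gen s * free_star (free_gen t))) = \<psi> (emb S (free_gen s * free_star (free_gen t)))"
  shows "\<phi> = \<psi>"
  using assms
  by (intro states_eqI free_states_eq_on_words[of "\<lambda>p. \<phi> (emb S p)" "\<lambda>p. \<psi> (emb S p)"] states_free_state)

text \<open>The inverse of \<open>\<Phi>\<close> is restriction to C*(ker N). Since monomials
  determine a state, bijectivity, continuity and affinity can all be checked on them, where the
  defining formula is explicit.\<close>

lemma kms_infinity_homeomorphism:
  assumes sm: "\<bar>abscissa S N\<bar> \<noteq> \<infinity>"
  shows "\<exists>\<Phi>. homeomorphic_map (subtopology (weak_star (Cstar KS)) (tracial_states (Cstar KS)))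
      (subtopology (weak_star (Cstar S)) (kms_infinity_states (Cstar S) (dynamics S N))) \<Phi> \<and>
    affine_on (Cstar KS) (Cstar S) (tracial_states (Cstar KS)) \<Phi> \<and>
    (\<forall>\<tau>\<in>tracial_states (Cstar KS). \<forall>s\<in>carrier S. \<forall>t\<in>carrier S.
      \<Phi> \<tau> (emb S (free_gen s * free_star (free_gen t))) =
        (if s \<in> K \<and> t \<in> K then \<tau> (emb KS (free_gen s * free_star (free_gen t))) else 0))"
proof -
  let ?T = "tracial_states (Cstar KS)" and ?I = "kms_infinity_states (Cstar S) (dynamics S N)"
  let ?X = "subtopology (weak_star (Cstar KS)) ?T" and ?Y = "subtopology (weak_star (Cstar S)) ?I"
  let ?m = "\<lambda>s t. free_gen s * free_star (free_gen t) :: 's free_alg"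
  obtain \<Phi> where \<Phi>: "\<And>\<tau>. \<tau> \<in> ?T \<Longrightarrow> \<Phi> \<tau> \<in> ?I"
    and mono: "\<And>\<tau> s t. \<tau> \<in> ?T \<Longrightarrow> s \<in> carrier S \<Longrightarrow> t \<in> carrier S \<Longrightarrow>
      \<Phi> \<tau> (emb S (?m s t)) = (if s \<in> K \<and> t \<in> K then \<tau> (emb KS (?m s t)) else 0)"
    using trace_kms_infinity[OF sm] by metis
  \<comment> \<open>Restriction along the homomorphism from C*(ker N) to C*(S): the state is read on
    the free algebra over the kernel and extended to that algebra's own completion.\<close>
  define \<Psi> where "\<Psi> = (\<lambda>\<phi>. state_ext KS (\<lambda>p. \<phi> (emb S p)))"
  have T_states: "\<tau> \<in> states (Cstar KS)" if "\<tau> \<in> ?T" for \<tau> using that by (simp add: tracial_states_def)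
  note I_states = kms_infinity_states
  have top: "topspace ?X = ?T" "topspace ?Y = ?I"
    using T_states I_states by (auto simp: topspace_subtopology ker.topspace_weak_star topspace_weak_star)
  have ker_state: "free_state KS (\<lambda>p. \<phi> (emb S p))" if "\<phi> \<in> ?I" for \<phi>
    by (rule ker_free_state[OF states_free_state[OF I_states[OF that]]])
  have \<Psi>_emb: "\<Psi> \<phi> (emb KS p) = \<phi> (emb S p)" if "\<phi> \<in> ?I" "p \<in> free_carrier KS" for \<phi> p
    unfolding \<Psi>_def by (rule ker.state_ext_emb[OF ker_state[OF that(1)] that(2)])
  have \<Psi>: "\<Psi> \<phi> \<in> ?T" if "\<phi> \<in> ?I" for \<phi>
    unfolding \<Psi>_def by (rule ker.tracial_state_ext[OF ker_state[OF that] kms_infinity_trace[OF that]])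
  have m_K: "?m s t \<in> free_carrier KS" if "s \<in> K" "t \<in> K" for s t using that by simp
  have inv1: "\<Psi> (\<Phi> \<tau>) = \<tau>" if \<tau>: "\<tau> \<in> ?T" for \<tau>
  proof (rule ker.states_eqI)
    show "\<Psi> (\<Phi> \<tau>) \<in> states (Cstar KS)" by (rule T_states[OF \<Psi>[OF \<Phi>[OF \<tau>]]])
    show st: "\<tau> \<in> states (Cstar KS)" by (rule T_states[OF \<tau>])
    fix w assume "w \<in> words KS"
    then show "\<Psi> (\<Phi> \<tau>) (emb KS (word w)) = \<tau> (emb KS (word w))"
    proof (rule ker.free_states_eq_on_words[OF ker.states_free_state[OF T_states[OF \<Psi>[OF \<Phi>[OF \<tau>]]]]
          ker.states_free_state[OF st], rotated])
      fix s t assume "s \<in> carrier KS" "t \<in> carrier KS"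
      then have "s \<in> K" "t \<in> K" by simp_all
      then show "\<Psi> (\<Phi> \<tau>) (emb KS (?m s t)) = \<tau> (emb KS (?m s t))"
        using \<Psi>_emb[OF \<Phi>[OF \<tau>] m_K] mono[OF \<tau>, of s t] K_carrier by simp
    qed
  qed
  have inv2: "\<Phi> (\<Psi> \<phi>) = \<phi>" if \<phi>: "\<phi> \<in> ?I" for \<phi>
  proof (rule states_eq_on_monomials)
    show "\<Phi> (\<Psi> \<phi>) \<in> states (Cstar S)" "\<phi> \<in> states (Cstar S)"
      using I_states \<phi> \<Phi>[OF \<Psi>[OF \<phi>]] by auto
    fix s t assume st: "s \<in> carrier S" "t \<in> carrier S"
    show "\<Phi> (\<Psi> \<phi>) (emb S (?m s t)) = \<phi> (emb S (?m s t))"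
    proof (cases "s \<in> K \<and> t \<in> K")
      case True
      then show ?thesis using mono[OF \<Psi>[OF \<phi>] st] \<Psi>_emb[OF \<phi> m_K] by simp
    next
      case False
      then have "N s \<noteq> 1 \<or> N t \<noteq> 1" using st by (auto simp: K_def)
      then show ?thesis using mono[OF \<Psi>[OF \<phi>] st] False kms_infinity_monomial_zero[OF \<phi> st] by auto
    qed
  qed
  have cont1: "continuous_map ?X ?Y \<Phi>"
  proof (rule continuous_map_weak_star)
    show "\<Phi> \<tau> \<in> ?I \<and> \<Phi> \<tau> \<in> states (Cstar S)" if "\<tau> \<in> topspace ?X" for \<tau>
      using that \<Phi> I_states unfolding top by blast
    fix w assume w: "w \<in> words S"
    note eqv = free_state_eqv[OF states_free_state[OF I_states[OF \<Phi>]]]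
    note zero = linear_functional_zero[OF free_state_linear[OF states_free_state[OF I_states[OF \<Phi>]]]]
    \<comment> \<open>As a function of \<tau> the value is identically 0 or the evaluation of \<tau>
      at one fixed element.\<close>
    from word_reduce[OF w] show "continuous_map ?X euclidean (\<lambda>\<tau>. \<Phi> \<tau> (emb S (word w)))"
    proof
      assume "eqv (word w) 0"
      then have "\<Phi> \<tau> (emb S (word w)) = 0" if "\<tau> \<in> topspace ?X" for \<tau>
        using eqv[of \<tau> "word w" 0] zero[of \<tau>] that unfolding top by simp
      then show ?thesis by (subst continuous_map_eq[where f = "\<lambda>_. 0"]) auto
    next
      assume "\<exists>s\<in>carrier S. \<exists>t\<in>carrier S. eqv (word w) (?m s t)"
      then obtain s t where st: "s \<in> carrier S" "t \<in> carrier S" "eqv (word w) (?m s t)" by blast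
      have eq: "\<Phi> \<tau> (emb S (word w)) = (if s \<in> K \<and> t \<in> K then \<tau> (emb KS (?m s t)) else 0)"
        if "\<tau> \<in> topspace ?X" for \<tau>
        using eqv[of \<tau>, OF _ st(3)] mono[OF _ st(1,2)] that unfolding top by simp
      have "continuous_map ?X euclidean (\<lambda>\<tau>. if s \<in> K \<and> t \<in> K then \<tau> (emb KS (?m s t)) else 0)"
      proof (cases "s \<in> K \<and> t \<in> K")
        case True
        then show ?thesis using ker.continuous_map_evaluation[of "emb KS (?m s t)" ?T] m_K by simp
      qed (simp only: if_False continuous_map_const, simp)
      then show ?thesis by (rule continuous_map_eq) (simp add: eq)
    qed
  qed
  have cont2: "continuous_map ?Y ?X \<Psi>"
  proof (rule ker.continuous_map_weak_star)
    show "\<Psi> \<phi> \<in> ?T \<and> \<Psi> \<phi> \<in> states (Cstar KS)" if "\<phi> \<in> topspace ?Y" for \<phi>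
      using that \<Psi> T_states unfolding top by blast
    fix w assume w: "w \<in> words KS"
    have "continuous_map ?Y euclidean (\<lambda>\<phi>. \<phi> (emb S (word w)))"
      using ker_words[OF w] by (intro continuous_map_evaluation emb_carrier) simp
    then show "continuous_map ?Y euclidean (\<lambda>\<phi>. \<Psi> \<phi> (emb KS (word w)))"
      by (rule continuous_map_eq) (use \<Psi>_emb w top in simp)
  qed
  have "homeomorphic_maps ?X ?Y \<Phi> \<Psi>"
    unfolding homeomorphic_maps_def top using cont1 cont2 inv1 inv2 by blast
  then have homeo: "homeomorphic_map ?X ?Y \<Phi>" unfolding homeomorphic_map_maps by blast
  have affine: "affine_on (Cstar KS) (Cstar S) ?T \<Phi>"
    unfolding affine_on_def
  proof (intro ballI)
    fix \<tau> \<tau>' and u :: real assume \<tau>: "\<tau> \<in> ?T" and \<tau>': "\<tau>' \<in> ?T" and u: "u \<in> {0..1}"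
    let ?c = "\<lambda>a\<in>carrier (Cstar KS). of_real (1 - u) * \<tau> a + of_real u * \<tau>' a"
    let ?d = "\<lambda>b\<in>carrier (Cstar S). of_real (1 - u) * \<Phi> \<tau> b + of_real u * \<Phi> \<tau>' b"
    have c: "?c \<in> ?T" using \<tau> \<tau>' u by (rule ker.tracial_states_convex)
    \<comment> \<open>Both sides are states, so it suffices to compare monomials, where the formula
      for \<open>\<Phi>\<close> is linear in the trace.\<close>
    show "\<Phi> ?c = ?d"
    proof (rule states_eq_on_monomials)
      show "\<Phi> ?c \<in> states (Cstar S)" by (rule I_states[OF \<Phi>[OF c]])
      show "?d \<in> states (Cstar S)" by (rule states_convex[OF I_states[OF \<Phi>[OF \<tau>]] I_states[OF \<Phi>[OF \<tau>']] u])
      fix s t assume st: "s \<in> carrier S" "t \<in> carrier S"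
      have mS: "emb S (?m s t) \<in> carrier (Cstar S)" using st by (intro emb_carrier) simp
      show "\<Phi> ?c (emb S (?m s t)) = ?d (emb S (?m s t))"
      proof (cases "s \<in> K \<and> t \<in> K")
        case True
        then have "emb KS (?m s t) \<in> carrier (Cstar KS)" using m_K by simp
        then show ?thesis using True mono[OF c st] mono[OF \<tau> st] mono[OF \<tau>' st] mS by simp
      next
        case False
        then show ?thesis unfolding restrict_apply'[OF mS] mono[OF c st] mono[OF \<tau> st] mono[OF \<tau>' st] if_not_P[OF False] by simp
      qed
    qed
  qed
  show ?thesis using homeo affine mono by blast
qed

end

theorem corollary4p8:
  fixes S :: "'s monoid" and N :: "'s \<Rightarrow> real"
  defines "A \<equiv> Cstar S"
    and "B \<equiv> Cstar (ker_scale S N)"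
    and "\<sigma> \<equiv> dynamics S N"
  assumes "right_lcm_semigroup S"
    and "countable (carrier S)"
    and "nontrivial_scale S N"
    and "directed_kernel S N"
    and "\<bar>abscissa S N\<bar> \<noteq> \<infinity>"
  shows "\<exists>\<Phi>.
     homeomorphic_map
       (subtopology (weak_star B) (tracial_states B))
       (subtopology (weak_star A) (kms_infinity_states A \<sigma>)) \<Phi> \<and>
     affine_on B A (tracial_states B) \<Phi> \<and>
     (\<forall>\<tau>\<in>tracial_states B. \<forall>s\<in>carrier S. \<forall>t\<in>carrier S.
        \<Phi> \<tau> (isom S s \<otimes>\<^bsub>A\<^esub> star A (isom S t)) =
          (if s \<in> carrier (ker_scale S N) \<and> t \<in> carrier (ker_scale S N)
           then \<tau> (isom (ker_scale S N) s \<otimes>\<^bsub>B\<^esub> star B (isom (ker_scale S N) t))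
           else 0))"
proof -
  interpret lcm_scale S N
    using assms(4,6,7)
    by (intro lcm_scale.intro lcm_scale_axioms.intro right_lcm_algebra.intro) (auto simp: nontrivial_scale_def)
  have S: "isom S s \<otimes>\<^bsub>Cstar S\<^esub> star (Cstar S) (isom S t) = emb S (free_gen s * free_star (free_gen t))"
    if "s \<in> carrier S" "t \<in> carrier S" for s t
    using that by (simp add: isom_eq_emb emb_simps)
  have K: "isom KS s \<otimes>\<^bsub>Cstar KS\<^esub> star (Cstar KS) (isom KS t) = emb KS (free_gen s * free_star (free_gen t))"
    if "s \<in> K" "t \<in> K" for s t
    using that by (simp add: isom_eq_emb ker.emb_simps)
  obtain \<Phi> where \<Phi>: "homeomorphic_map (subtopology (weak_star B) (tracial_states B))
      (subtopology (weak_star A) (kms_infinity_states A \<sigma>)) \<Phi>" "affine_on B A (tracial_states B) \<Phi>"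
    and mono: "\<forall>\<tau>\<in>tracial_states B. \<forall>s\<in>carrier S. \<forall>t\<in>carrier S.
      \<Phi> \<tau> (emb S (free_gen s * free_star (free_gen t))) =
        (if s \<in> K \<and> t \<in> K then \<tau> (emb KS (free_gen s * free_star (free_gen t))) else 0)"
    using kms_infinity_homeomorphism[OF assms(8)] unfolding A_def B_def \<sigma>_def by blast
  have "\<Phi> \<tau> (isom S s \<otimes>\<^bsub>A\<^esub> star A (isom S t)) =
      (if s \<in> carrier KS \<and> t \<in> carrier KS then \<tau> (isom KS s \<otimes>\<^bsub>B\<^esub> star B (isom KS t)) else 0)"
    if "\<tau> \<in> tracial_states B" "s \<in> carrier S" "t \<in> carrier S" for \<tau> s t
    using mono that S[OF that(2,3)] K[of s t] unfolding A_def B_def carrier_ker by simp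
  with \<Phi> show ?thesis by blast
qed

end
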